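(* Let $\mathcal{M}=\{M_t\}_{t\in(-\infty,0]}$ be an ancient, smooth, complete, non-compact curve shortening flow embedded in $\mathbb{R}^2$ with finite entropy. Then $\mathcal{M}$ has a unique tangent flow at infinity. Moreover, unless $\mathcal{M}$ is a static line, this tangent flow at infinity is a (static) straight line through the origin with multiplicity $m\ge2$, where $m=\mathrm{Ent}[\mathcal{M}]$.
   Context: CSF: smooth immersions $\gamma:\mathbb{R}\times I\to\mathbb{R}^2$ with $\gamma_t=\gamma_{ss}=\kappa\mathbf{n}$, $s$ arc length, $\mathbf{n}=J\gamma_s$, $\kappa=\langle\gamma_{ss},\mathbf{n}\rangle$. Entropy: $F_{x_0,\lambda}[\Gamma]=(4\pi\lambda)^{-1/2}\int_\Gamma e^{-|x-x_0|^2/(4\lambda)}ds$, $\mathrm{Ent}[\Gamma]=\sup_{x_0,\lambda>0}F_{x_0,\lambda}[\Gamma]$, $\mathrm{Ent}[\mathcal{M}]=\sup_t\mathrm{Ent}[M_t]$. A tangent flow at infinity is a subsequential limit (as Brakke flows / in the sense of Radon measures with multiplicity) of the parabolically rescaled flows $\{\lambda_iM_{\lambda_i^{-2}t}\}_t$ as $\lambda_i\to0$; equivalently, of the rescaled flow $\overline{M}_\tau=e^{\tau/2}M_{-e^{-\tau}}$ as $\tau\to-\infty$. Uniqueness means the limit is independent of the chosen sequence. *)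

theory Defs
  imports "HOL-Analysis.Analysis" "HOL-Probability.Probability"
begin

text \<open>A flow of plane curves is given by a map gamma :: real => real => real^2,
  gamma t u being the point with parameter u on the curve M_t, defined for t \<le> 0
  (ancient flow on (-infinity,0]) and u in the whole real line.\<close>

type_synonym pt = "real ^ 2"
type_synonym flow = "real \<Rightarrow> real \<Rightarrow> pt"

definition dT :: "(real \<times> real \<Rightarrow> pt) \<Rightarrow> real \<times> real \<Rightarrow> pt" where
  "dT g = (\<lambda>(t, u). vector_derivative (\<lambda>s. g (s, u)) (at t within {..0}))"

definition dU :: "(real \<times> real \<Rightarrow> pt) \<Rightarrow> real \<times> real \<Rightarrow> pt" where
  "dU g = (\<lambda>(t, u). vector_derivative (\<lambda>v. g (t, v)) (at u))"

fun dword :: "bool list \<Rightarrow> (real \<times> real \<Rightarrow> pt) \<Rightarrow> real \<times> real \<Rightarrow> pt" where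
  "dword [] g = g"
| "dword (b # w) g = (if b then dT (dword w g) else dU (dword w g))"

definition smooth_flow :: "flow \<Rightarrow> bool" where
  "smooth_flow \<gamma> \<longleftrightarrow>
     (\<forall>w. continuous_on ({..0} \<times> UNIV) (dword w (case_prod \<gamma>)) \<and>
          (\<forall>t u. t \<le> 0 \<longrightarrow>
             (\<lambda>s. dword w (case_prod \<gamma>) (s, u)) differentiable (at t within {..0}) \<and>
             (\<lambda>v. dword w (case_prod \<gamma>) (t, v)) differentiable (at u)))"

definition gu :: "flow \<Rightarrow> real \<Rightarrow> real \<Rightarrow> pt" where
  "gu \<gamma> t u = vector_derivative (\<gamma> t) (at u)"

definition gss :: "flow \<Rightarrow> real \<Rightarrow> real \<Rightarrow> pt" where
  "gss \<gamma> t u = (1 / norm (gu \<gamma> t u)) *\<^sub>R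
      vector_derivative (\<lambda>v. (1 / norm (gu \<gamma> t v)) *\<^sub>R gu \<gamma> t v) (at u)"

definition ancient_csf :: "flow \<Rightarrow> bool" where
  "ancient_csf \<gamma> \<longleftrightarrow> smooth_flow \<gamma> \<and>
     (\<forall>t u. t \<le> 0 \<longrightarrow> gu \<gamma> t u \<noteq> 0 \<and>
        vector_derivative (\<lambda>s. \<gamma> s u) (at t within {..0}) = gss \<gamma> t u)"

definition embedded_flow :: "flow \<Rightarrow> bool" where
  "embedded_flow \<gamma> \<longleftrightarrow> (\<forall>t\<le>0. inj (\<gamma> t) \<and> continuous_on (range (\<gamma> t)) (inv (\<gamma> t)))"

definition complete_flow :: "flow \<Rightarrow> bool" where
  "complete_flow \<gamma> \<longleftrightarrow> (\<forall>t\<le>0.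
     (\<integral>\<^sup>+ u. ennreal (norm (gu \<gamma> t u)) * indicator {0..} u \<partial>lborel) = \<infinity> \<and>
     (\<integral>\<^sup>+ u. ennreal (norm (gu \<gamma> t u)) * indicator {..0} u \<partial>lborel) = \<infinity>)"

definition noncompact_flow :: "flow \<Rightarrow> bool" where
  "noncompact_flow \<gamma> \<longleftrightarrow> (\<forall>t\<le>0. \<not> compact (range (\<gamma> t)))"

definition gauss_area :: "flow \<Rightarrow> real \<Rightarrow> pt \<Rightarrow> real \<Rightarrow> ennreal" where
  "gauss_area \<gamma> t x0 l = ennreal (1 / sqrt (4 * pi * l)) *
     (\<integral>\<^sup>+ u. ennreal (exp (- (norm (\<gamma> t u - x0))\<^sup>2 / (4 * l)) * norm (gu \<gamma> t u)) \<partial>lborel)"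

definition entropy_slice :: "flow \<Rightarrow> real \<Rightarrow> ennreal" where
  "entropy_slice \<gamma> t = (SUP p \<in> UNIV \<times> {0<..}. gauss_area \<gamma> t (fst p) (snd p))"

definition entropy :: "flow \<Rightarrow> ennreal" where
  "entropy \<gamma> = (SUP t \<in> {..0}. entropy_slice \<gamma> t)"

text \<open>Length (1-dimensional Hausdorff) measure of an injectively parametrized curve.\<close>
definition curve_measure :: "(real \<Rightarrow> pt) \<Rightarrow> pt measure" where
  "curve_measure c = distr (density lborel (\<lambda>u. ennreal (norm (vector_derivative c (at u))))) borel c"

definition rescaled_measure :: "flow \<Rightarrow> real \<Rightarrow> real \<Rightarrow> pt measure" where
  "rescaled_measure \<gamma> l t = curve_measure (\<lambda>u. l *\<^sub>R \<gamma> (t / l\<^sup>2) u)"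

definition radon_measure :: "pt measure \<Rightarrow> bool" where
  "radon_measure \<mu> \<longleftrightarrow> sets \<mu> = sets borel \<and> (\<forall>K. compact K \<longrightarrow> emeasure \<mu> K < \<infinity>)"

definition radon_converges :: "(nat \<Rightarrow> pt measure) \<Rightarrow> pt measure \<Rightarrow> bool" where
  "radon_converges \<mu>s \<mu> \<longleftrightarrow>
     (\<forall>\<phi> :: pt \<Rightarrow> real. continuous_on UNIV \<phi> \<longrightarrow> compact (closure {x. \<phi> x \<noteq> 0}) \<longrightarrow>
        (\<lambda>i. integral\<^sup>L (\<mu>s i) \<phi>) \<longlonglongrightarrow> integral\<^sup>L \<mu> \<phi>)"

definition tangent_flow_at_infinity :: "flow \<Rightarrow> (real \<Rightarrow> pt measure) \<Rightarrow> bool" where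
  "tangent_flow_at_infinity \<gamma> \<nu> \<longleftrightarrow>
     (\<forall>t<0. radon_measure (\<nu> t)) \<and>
     (\<exists>ls :: nat \<Rightarrow> real. (\<forall>i. ls i > 0) \<and> ls \<longlonglongrightarrow> 0 \<and>
        (\<forall>t<0. radon_converges (\<lambda>i. rescaled_measure \<gamma> (ls i) t) (\<nu> t)))"

text \<open>Line through the origin in direction e (|e| = 1) with multiplicity m.\<close>
definition line_measure :: "nat \<Rightarrow> pt \<Rightarrow> pt measure" where
  "line_measure m e = scale_measure (of_nat m) (distr lborel borel (\<lambda>s. s *\<^sub>R e))"

definition static_line :: "flow \<Rightarrow> bool" where
  "static_line \<gamma> \<longleftrightarrow> (\<exists>p e. e \<noteq> 0 \<and> (\<forall>t\<le>0. range (\<gamma> t) = {p + s *\<^sub>R e | s. True}))"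

end

theory Submission
 imports Defs
begin

text \<open>Identify the plane with the complex numbers. Along the flow the tangent angle solves the heat
  equation, so Huisken's monotonicity formula holds with convex weights \<open>f\<close> of the angle. An
  embedded arc which leaves a disc and comes back turns by a bounded amount; together with finite
  entropy this bounds the Gaussian variance of the angle by the curvature, and the weight
  \<open>f(x) = (x - c)\<^sup>2\<close> shows that the squared curvature has a finite integral against the backward heat
  kernel over all of space-time. Consequently the Gaussian integrals of \<open>1\<close> and of \<open>exp(2 i \<cdot> angle)\<close>
  converge as \<open>t \<rightarrow> -\<infinity>\<close>. At times of small energy the rescaled curve consists of nearly straight sheets
  through the origin, which are parallel because they would cross otherwise. So the rescaled curve is
  close to a line with an integer multiplicity \<open>m\<close>, and \<open>m\<close> and the direction are determined by these
  two limits, which do not depend on the chosen sequence. By monotonicity the entropy equals \<open>m\<close>. If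
  \<open>m = 1\<close>, then every point has Gaussian density one at every scale, the arc length parametrization is
  an isometry, and the flow is a static line.\<close>

text \<open>The obstacle is noncompactness: a time slice is an infinite curve whose tangent angle
  might turn without bound, so neither the finiteness of a weighted integral nor the vanishing of
  boundary terms is automatic, and the quadratic weight gives nothing until its integral is known to
  be bounded along times tending to minus infinity. Embeddedness first enters there, through Hopf's
  argument and inversion. The resulting constants see the flow only through the entropy bound
  \<open>E\<close>, so they survive parabolic rescaling. With weight 1 the monotonicity formula
  controls only the shrinker quantity \<open>Vel\<close> and leaves the direction free; the second
  derivative of the quadratic weight adds the curvature. The space-time integral of the squared
  curvature is scale invariant, so its tail is small, and every interval [2t, t] with t very
  negative contains a time of small rescaled energy; across such an interval a test integral hardly
  changes. The angle is doubled because sheets may be traversed in opposite directions. Since only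
  convex weights are monotone, cosine and sine of the doubled angle are treated as differences of
  two convex weights of quadratic growth.\<close>

abbreviation nn_lborel :: "(real \<Rightarrow> ennreal) \<Rightarrow> ennreal" (binder \<open>NN \<close> 60)
 where "nn_lborel f \<equiv> nn_integral lborel f"

abbreviation nn_lborel_real :: "(real \<Rightarrow> real) \<Rightarrow> ennreal" (binder \<open>NE \<close> 60)
 where "nn_lborel_real f \<equiv> nn_integral lborel (\<lambda>x. ennreal (f x))"

section \<open>Turning of embedded arcs inside and outside a disc\<close>

text \<open>By the intermediate value theorem \<open>y\<close> takes every value between its end
  values. On a range longer than pi both \<open>v\<close> and \<open>v + pi\<close> occur, where the
  cosine has opposite signs, so it would have to vanish for a whole interval of
  \<open>v\<close>.\<close>

lemma cos_nonneg_oscillation: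
 fixes y :: "real \<Rightarrow> real"
 assumes "continuous_on {a..b} y" "a \<le> b" "\<And>x. x \<in> {a..b} \<Longrightarrow> 0 \<le> cos (y x)"
 shows "\<bar>y b - y a\<bar> \<le> pi"
proof (rule ccontr)
 assume "\<not> ?thesis"
 hence gt: "\<bar>y b - y a\<bar> > pi" by simp
 define p q where "p = min (y a) (y b)" and "q = max (y a) (y b)"
 have pq: "q - p > pi" using gt by (auto simp: p_def q_def)
 have img: "\<exists>x\<in>{a..b}. y x = v" if "p \<le> v" "v \<le> q" for v
 proof (cases "y a \<le> y b")
  case True
  then show ?thesis using IVT'[of y a v b] assms that by (auto simp: p_def q_def)
 next
  case False
  then show ?thesis using IVT2'[of y b v a] assms that by (auto simp: p_def q_def)
 qed
 have nn: "0 \<le> cos v" if "p \<le> v" "v \<le> q" for v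
  using img[OF that] assms(3) by auto
 have "cos p = 0"
 proof -
  have "0 \<le> cos p" "0 \<le> cos (p + pi)" using pq nn[of p] nn[of "p+pi"] pi_gt_zero by auto
  thus ?thesis by simp
 qed
 moreover have "cos (p + (q - p - pi)) \<ge> 0" "cos (p + (q - p - pi) + pi) \<ge> 0" 
  using pq nn[of "q - pi"] nn[of q] pi_gt_zero by auto
 ultimately have qp: "cos (q - pi) = 0" by simp
 \<comment> \<open>A shift in (0, pi/2] that keeps \<open>p + d\<close> and
   \<open>p + d + pi\<close> in the range: the cosine then vanishes at both \<open>p\<close> and
   \<open>p + d\<close>, which the addition formula excludes.\<close>
 define d where "d = min (q - p - pi) (pi/2)"
 have d: "0 < d" "d \<le> pi/2" "d \<le> q - p - pi" using pq pi_gt_zero unfolding d_def by linarith+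
 have "cos (p + d) \<ge> 0" "cos (p + d + pi) \<ge> 0" using d pi_gt_zero nn[of "p+d"] nn[of "p+d+pi"] by auto
 hence "cos (p + d) = 0" by simp
 hence "sin p * sin d = 0" using \<open>cos p = 0\<close> by (simp add: cos_add)
 moreover have "sin d > 0" using d by (intro sin_gt_zero) auto
 moreover have "sin p \<noteq> 0" using \<open>cos p = 0\<close> sin_zero_abs_cos_one by fastforce
 ultimately show False by simp
qed

lemma integer_valued_constant:
 fixes f :: "real \<Rightarrow> real"
 assumes "continuous_on {a..b} f" "\<And>x. x \<in> {a..b} \<Longrightarrow> f x \<in> \<int>"
 shows "f constant_on {a..b}"
proof (rule continuous_discrete_range_constant[OF _ assms(1)])
 fix x assume x: "x \<in> {a..b}"
 have "1 \<le> norm (f y - f x)" if "y \<in> {a..b}" "f y \<noteq> f x" for y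
  using Ints_nonzero_abs_ge1[of "f y - f x"] assms(2)[OF that(1)] assms(2)[OF x] that(2) by auto
 thus "\<exists>e>0. \<forall>y. y \<in> {a..b} \<and> f y \<noteq> f x \<longrightarrow> e \<le> norm (f y - f x)"
  by (intro exI[of _ 1]) auto
qed simp

text \<open>Hopf's secant map on the triangle \<open>s \<le> t\<close>: along the two legs the secants stay in
 a half plane because both end points are farthest from the origin.\<close>
lemma arc_in_disc_turning:
 fixes w :: "real \<Rightarrow> complex" and r ag :: "real \<Rightarrow> real"
 assumes ab: "a \<le> b"
  and w': "\<And>x. x \<in> {a..b} \<Longrightarrow> (w has_vector_derivative (r x *\<^sub>R cis (ag x))) (at x within {a..b})"
  and r: "continuous_on {a..b} r" "\<And>x. x \<in> {a..b} \<Longrightarrow> r x > 0"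
  and th: "continuous_on {a..b} ag"
  and inj: "inj_on w {a..b}"
  and far: "\<And>x. x \<in> {a..b} \<Longrightarrow> norm (w x) \<le> norm (w a)" "norm (w b) = norm (w a)"
 shows "\<bar>ag b - ag a\<bar> \<le> 2 * pi"
proof -
 \<comment> \<open>\<open>D\<close> is the triangle of ordered parameter pairs. \<open>h\<close> is
   the difference quotient of \<open>w\<close>, written as an average of the derivative so that it
   is continuous up to the diagonal, where it equals the velocity.\<close>
 define D where "D = {p :: real \<times> real. a \<le> fst p \<and> fst p \<le> snd p \<and> snd p \<le> b}"
 define v where "v = (\<lambda>x. r x *\<^sub>R cis (ag x))"
 define h where "h = (\<lambda>p. integral (cbox 0 1) (\<lambda>ta. v (fst p + ta * (snd p - fst p))))"
 have contv: "continuous_on {a..b} v"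
  unfolding v_def using r th by (intro continuous_intros)
 have seg: "fst p + ta * (snd p - fst p) \<in> {a..b}" if "p \<in> D" "ta \<in> {0..1}" for p ta
 proof -
  have "0 \<le> ta * (snd p - fst p)" "ta * (snd p - fst p) \<le> 1 * (snd p - fst p)"
   using that mult_right_mono[of ta 1 "snd p - fst p"] by (auto simp: D_def)
  thus ?thesis using that by (auto simp: D_def)
 qed
 have conth: "continuous_on D h"
  unfolding h_def
  by (rule integral_continuous_on_param)
   (auto intro!: continuous_on_compose2[OF contv] continuous_intros seg simp: case_prod_unfold)
 have secant: "(t - s) *\<^sub>R h (s,t) = w t - w s" if "(s,t) \<in> D" for s t
 proof -
  have "((\<lambda>ta. (t - s) *\<^sub>R v (s + ta * (t - s))) has_integral (w (s + 1 * (t - s)) - w (s + 0 * (t - s)))) {0..1}"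
  proof (rule fundamental_theorem_of_calculus)
   fix ta :: real assume ta: "ta \<in> {0..1}"
   have "((w \<circ> (\<lambda>ta. s + ta * (t - s))) has_vector_derivative (t - s) *\<^sub>R v (s + ta * (t - s))) (at ta within {0..1})"
   proof (rule vector_diff_chain_within)
    show "((\<lambda>ta. s + ta * (t - s)) has_vector_derivative (t - s)) (at ta within {0..1})"
     by (auto intro!: derivative_eq_intros)
    show "(w has_vector_derivative v (s + ta * (t - s))) (at (s + ta * (t - s)) within (\<lambda>ta. s + ta * (t - s)) ` {0..1})"
     using seg[OF that ta] seg[OF that] unfolding v_def
     by (intro has_vector_derivative_within_subset[OF w']) auto
   qed
   thus "((\<lambda>ta. w (s + ta * (t - s))) has_vector_derivative (t - s) *\<^sub>R v (s + ta * (t - s))) (at ta within {0..1})"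
    by (simp add: o_def)
  qed simp
  hence "integral {0..1} (\<lambda>ta. (t - s) *\<^sub>R v (s + ta * (t - s))) = w t - w s"
   by (auto dest: integral_unique)
  thus ?thesis by (simp add: h_def)
 qed
 have diag: "h (s,s) = v s" for s by (simp add: h_def)
 have h0: "h p \<noteq> 0" if "p \<in> D" for p
 proof (cases "fst p = snd p")
  case True
  have "r (fst p) > 0" using that r by (auto simp: D_def)
  then show ?thesis using True diag[of "fst p"] by (cases p) (auto simp: v_def)
 next
  case False
  obtain s t where p: "p = (s,t)" by (cases p)
  have "w t \<noteq> w s" using inj_onD[OF inj, of t s] False that by (auto simp: D_def p)
  then show ?thesis using secant[of s t] that p by auto
 qed
 have "convex D"
  unfolding convex_alt D_def
 proof (clarsimp, intro conjI)
  fix p1 p2 q1 q2 u :: real assume *: "a \<le> p1" "p1 \<le> p2" "p2 \<le> b" "a \<le> q1" "q1 \<le> q2" "q2 \<le> b" "0 \<le> u" "u \<le> 1"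
  have "(1-u)*a \<le> (1-u)*p1" "u*a \<le> u*q1" "(1-u)*p1 \<le> (1-u)*p2" "u*q1 \<le> u*q2" "(1-u)*p2 \<le> (1-u)*b" "u*q2 \<le> u*b"
   using * by (auto intro!: mult_left_mono)
  thus "a \<le> (1 - u) * p1 + u * q1" "(1 - u) * p1 + u * q1 \<le> (1 - u) * p2 + u * q2" "(1 - u) * p2 + u * q2 \<le> b"
   by (auto simp: algebra_simps)
 qed
 then obtain G where G: "continuous_on D G" "\<And>p. p \<in> D \<Longrightarrow> h p = exp (G p)"
  using continuous_logarithm_on_contractible[OF conth _ h0] convex_imp_contractible by blast
 define Th where "Th = (\<lambda>p. Im (G p))"
 have contTh: "continuous_on D Th" unfolding Th_def by (intro continuous_intros G)
 \<comment> \<open>On the diagonal \<open>Th\<close> and \<open>ag\<close> are arguments of the same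
   vector, so they differ by a multiple of 2 pi, which is constant by continuity.\<close>
 have 1: "Th (b,b) - Th (a,a) = ag b - ag a"
 proof -
  have "continuous_on {a..b} (\<lambda>s. (Th (s,s) - ag s) / (2*pi))"
   using th by (intro continuous_intros continuous_on_compose2[OF contTh]) (auto simp: D_def)
  moreover have "(Th (s,s) - ag s) / (2*pi) \<in> \<int>" if "s \<in> {a..b}" for s
  proof -
   have sD: "(s,s) \<in> D" using that by (auto simp: D_def)
   have "exp (G (s,s)) = r s *\<^sub>R cis (ag s)" using G(2)[OF sD] diag[of s] by (simp add: v_def)
   moreover have "exp (G (s,s)) = of_real (exp (Re (G (s,s)))) * cis (Th (s,s))"
    by (simp add: exp_eq_polar Th_def)
   ultimately have e: "of_real (exp (Re (G (s,s)))) * cis (Th (s,s)) = of_real (r s) * cis (ag s)"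
    by (simp add: scaleR_conv_of_real)
   hence "norm (of_real (exp (Re (G (s,s)))) * cis (Th (s,s))) = norm (of_real (r s) * cis (ag s))" by simp
   hence "exp (Re (G (s,s))) = r s" using r(2)[OF that] by (simp add: norm_mult)
   with e r(2)[OF that] have "cis (Th (s,s)) = cis (ag s)" by simp
   hence "cis (Th (s,s) - ag s) = 1" by (simp add: cis_divide[symmetric])
   hence "cos (Th (s,s) - ag s) = 1" by (simp add: complex_eq_iff)
   then obtain n where "Th (s,s) - ag s = of_int n * 2 * pi" by (auto simp: cos_one_2pi_int)
   thus ?thesis by simp
  qed
  ultimately have "(\<lambda>s. (Th (s,s) - ag s) / (2*pi)) constant_on {a..b}"
   by (rule integer_valued_constant)
  then obtain k where "\<forall>s\<in>{a..b}. (Th (s,s) - ag s) / (2*pi) = k" by (auto simp: constant_on_def)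
  hence "(Th (b,b) - ag b) / (2*pi) = (Th (a,a) - ag a) / (2*pi)" using ab by auto
  thus ?thesis by simp
 qed
 \<comment> \<open>Along a leg \<open>h\<close> stays in a closed half plane, so \<open>Th\<close>
   oscillates by at most pi. The condition is assumed only on the open interval, because a secant of
   length zero says nothing at the corner; continuity supplies the end points.\<close>
 have legs: "\<bar>Th (f b) - Th (f a)\<bar> \<le> pi"
  if f: "continuous_on {a..b} f" "\<And>x. x \<in> {a..b} \<Longrightarrow> f x \<in> D" 
   and half: "\<And>x. x \<in> {a<..<b} \<Longrightarrow> Re (h (f x) * c) \<ge> 0" and c: "c \<noteq> 0" for f c
 proof (cases "a = b")
  case False
  have cont: "continuous_on {a..b} (\<lambda>x. Re (h (f x) * c))"
   by (intro continuous_intros continuous_on_compose2[OF conth f(1)]) (use f in auto)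
  have half': "Re (h (f x) * c) \<ge> 0" if "x \<in> {a..b}" for x
  proof (rule continuous_ge_on_closure[where S="{a<..<b}" and f="\<lambda>x. Re (h (f x) * c)"])
   show "continuous_on (closure {a<..<b}) (\<lambda>x. Re (h (f x) * c))" using cont False ab by simp
   show "x \<in> closure {a<..<b}" using that False ab by simp
  qed (use half in auto)
  have "\<bar>(Th (f b) + Arg c) - (Th (f a) + Arg c)\<bar> \<le> pi"
  proof (rule cos_nonneg_oscillation[where y="\<lambda>x. Th (f x) + Arg c"])
   show "continuous_on {a..b} (\<lambda>x. Th (f x) + Arg c)"
    by (intro continuous_intros continuous_on_compose2[OF contTh f(1)]) (use f in auto)
   fix x assume x: "x \<in> {a..b}"
   have "h (f x) * c = of_real (exp (Re (G (f x)))) * cis (Th (f x)) * (of_real (norm c) * cis (Arg c))"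
    using G(2)[OF f(2)[OF x]] rcis_cmod_Arg[of c] by (simp add: exp_eq_polar Th_def rcis_def)
   also have "\<dots> = of_real (exp (Re (G (f x))) * norm c) * cis (Th (f x) + Arg c)"
    by (simp add: cis_mult[symmetric])
   finally have "Re (h (f x) * c) = exp (Re (G (f x))) * norm c * cos (Th (f x) + Arg c)"
    by simp
   hence "0 \<le> exp (Re (G (f x))) * norm c * cos (Th (f x) + Arg c)" using half'[OF x] by simp
   moreover have "exp (Re (G (f x))) * norm c > 0" using c by simp
   ultimately show "0 \<le> cos (Th (f x) + Arg c)"
    using zero_le_mult_iff by (smt (verit))
  qed (use ab in auto)
  thus ?thesis by simp
 qed (simp add: pi_ge_zero)
 show ?thesis
 proof (cases "w a = 0")
  case True
  hence "w b = w a" using far by auto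
  hence "a = b" using inj_onD[OF inj, of b a] ab by auto
  thus ?thesis by simp
 next
  case False
  have prj: "Re ((w x - w y) * cnj (w y)) \<le> 0" if "norm (w x) \<le> norm (w y)" for x y
  proof -
   have "Re (w x * cnj (w y)) \<le> norm (w x * cnj (w y))" by (rule complex_Re_le_cmod)
   also have "\<dots> \<le> norm (w y) * norm (w y)" using that by (simp add: norm_mult mult_right_mono)
   also have "\<dots> = Re (w y * cnj (w y))" by (simp add: cmod_power2[symmetric] flip: power2_eq_square)
   finally show ?thesis by (simp add: algebra_simps)
  qed
  \<comment> \<open>The two legs lead from (a, a) to (b, b), the same end points as the diagonal, so
    the turning of the tangent is at most pi + pi.\<close>
  have 2: "\<bar>Th (a,b) - Th (a,a)\<bar> \<le> pi"
  proof (rule legs[of "\<lambda>x. (a,x)" "- cnj (w a)"])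
   fix x assume x: "x \<in> {a<..<b}"
   have "Re ((x - a) *\<^sub>R h (a,x) * cnj (w a)) \<le> 0"
    using secant[of a x] x prj[of x a] far(1)[of x] by (auto simp: D_def)
   hence "(x - a) * Re (h (a,x) * cnj (w a)) \<le> 0" by (simp add: algebra_simps)
   thus "0 \<le> Re (h (a, x) * - cnj (w a))" using x by (auto simp: mult_le_0_iff)
  qed (use False in \<open>auto simp: D_def intro!: continuous_intros\<close>)
  have 3: "\<bar>Th (b,b) - Th (a,b)\<bar> \<le> pi"
  proof (rule legs[of "\<lambda>x. (x,b)" "cnj (w b)"])
   fix x assume x: "x \<in> {a<..<b}"
   have "Re ((w x - w b) * cnj (w b)) \<le> 0" using prj[of x b] far(1)[of x] far(2) x by auto
   moreover have "(w x - w b) = - ((b - x) *\<^sub>R h (x,b))" using secant[of x b] x by (auto simp: D_def)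
   ultimately have "(b - x) * Re (h (x,b) * cnj (w b)) \<ge> 0" by (simp add: algebra_simps)
   thus "0 \<le> Re (h (x,b) * cnj (w b))" using x by (auto simp: zero_le_mult_iff)
  qed (use False far in \<open>auto simp: D_def intro!: continuous_intros\<close>)
  show ?thesis using 1 2 3 by linarith
 qed
qed

text \<open>In the coordinates (argument, log norm) the arc becomes a path in a half plane with both
  ends on the boundary line. If the argument grew by more than 2 pi, the ends of this path and of
  its translate by 2 pi in the argument would interlace on that line, so the two paths would cross;
  a crossing is a double point of \<open>z\<close>.\<close>

lemma arc_outside_disc_winding:
 fixes z g :: "real \<Rightarrow> complex"
 assumes ab: "a < b" and g: "continuous_on {a..b} g" "\<And>x. x \<in> {a..b} \<Longrightarrow> z x = exp (g x)"
  and inj: "inj_on z {a..b}"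
  and out: "\<And>x. x \<in> {a..b} \<Longrightarrow> norm (z a) \<le> norm (z x)" "norm (z b) = norm (z a)"
 shows "Im (g b) - Im (g a) \<le> 2 * pi"
proof (rule ccontr)
 assume "\<not> ?thesis"
 hence gt: "Im (g b) > Im (g a) + 2 * pi" by simp
 define e where "e = (\<lambda>x::real. a + x * (b - a))"
 have e: "e x \<in> {a..b}" if "x \<in> {0..1}" for x
 proof -
  have "x * (b - a) \<le> 1 * (b - a)" "0 \<le> x * (b - a)" using that ab by (auto intro: mult_right_mono mult_nonneg_nonneg simp del: mult_1)
  thus ?thesis by (auto simp: e_def)
 qed
 define f1 f2 where "f1 = (\<lambda>x. vector [Im (g (e x)), Re (g (e x))] :: real^2)"
  and "f2 = (\<lambda>x. vector [Im (g (e x)) + 2*pi, Re (g (e x))] :: real^2)"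
 have ge: "continuous_on {0..1} (\<lambda>x. g (e x))"
  by (rule continuous_on_compose2[OF g(1)]) (use e in \<open>auto simp: e_def intro!: continuous_intros\<close>)
 have vec: "continuous_on S (\<lambda>x. vector [p x, q x] :: real^2)" if "continuous_on S p" "continuous_on S q"
  for p q :: "real \<Rightarrow> real" and S
 proof -
  have "(\<lambda>x. vector [p x, q x] :: real^2) = (\<lambda>x. p x *\<^sub>R axis 1 1 + q x *\<^sub>R axis 2 1)"
   by (auto simp: fun_eq_iff vec_eq_iff forall_2 axis_def)
  thus ?thesis by (simp only:) (intro continuous_intros that)
 qed
 have p: "path f1" "path f2" unfolding path_def f1_def f2_def
  by (intro vec continuous_intros ge)+
 have "bounded (path_image f1 \<union> path_image f2)"
  using p by (simp add: bounded_path_image)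
 then obtain B where B: "\<And>v. v \<in> path_image f1 \<union> path_image f2 \<Longrightarrow> norm v \<le> B"
  unfolding bounded_iff by blast
 have lnz: "Re (g x) \<ge> Re (g a)" if "x \<in> {a..b}" for x
 proof -
  have "exp (Re (g a)) \<le> exp (Re (g x))"
   using out(1)[OF that] g(2)[OF that] g(2)[of a] ab by simp
  thus ?thesis by simp
 qed
 have "exp (Re (g b)) = exp (Re (g a))" using out(2) g(2)[of a] g(2)[of b] ab by simp
 hence Reb: "Re (g b) = Re (g a)" by simp
 \<comment> \<open>The lower side of the box is the line on which all four end points lie, as
   \<open>fashoda_interlace\<close> requires.\<close>
 define lo hi where "lo = (vector [- B, Re (g a)] :: real^2)" and "hi = (vector [B, B] :: real^2)"
 have nB: "\<bar>v$i\<bar> \<le> B" if "v \<in> path_image f1 \<union> path_image f2" for v and i :: 2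
  using B[OF that] component_le_norm_cart[of v i] by linarith
 have box: "path_image f1 \<subseteq> cbox lo hi" "path_image f2 \<subseteq> cbox lo hi"
 proof -
  have "v \<in> cbox lo hi" if v: "v \<in> path_image f1 \<union> path_image f2" for v
  proof -
   obtain x where x: "x \<in> {0..1}" "v = f1 x \<or> v = f2 x" using v by (auto simp: path_image_def)
   have "v$2 = Re (g (e x))" using x by (auto simp: f1_def f2_def)
   hence "v$2 \<ge> Re (g a)" using lnz e x by auto
   thus ?thesis using nB[OF v, of 1] nB[OF v, of 2]
    by (auto simp: mem_box_cart lo_def hi_def forall_2 abs_le_iff)
  qed
  thus "path_image f1 \<subseteq> cbox lo hi" "path_image f2 \<subseteq> cbox lo hi" by auto
 qed
 have ends: "e 0 = a" "e 1 = b" by (auto simp: e_def)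
 obtain q where q: "q \<in> path_image f1" "q \<in> path_image f2"
  by (rule fashoda_interlace[OF p box])
   (use gt in \<open>auto simp: pathstart_def pathfinish_def f1_def f2_def lo_def ends Reb\<close>)
 then obtain x y where xy: "x \<in> {0..1}" "y \<in> {0..1}" "q = f1 x" "q = f2 y" by (auto simp: path_image_def)
 hence "f1 x $ 1 = f2 y $ 1" "f1 x $ 2 = f2 y $ 2" by auto
 hence im: "Im (g (e x)) = Im (g (e y)) + 2*pi" and re: "Re (g (e x)) = Re (g (e y))"
  by (auto simp: f1_def f2_def)
 hence "g (e x) = g (e y) + 2 * of_real pi * \<i>" by (simp add: complex_eq_iff)
 hence "z (e x) = z (e y)" using g(2)[OF e[OF xy(1)]] g(2)[OF e[OF xy(2)]] by (simp add: exp_add)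
 hence "e x = e y" using inj_onD[OF inj] e xy by blast
 thus False using im pi_gt_zero by simp
qed

text \<open>Inversion maps the arc into the disc whose boundary circle contains the images of its
  ends, where the turning is at most 2 pi. The tangent angle of \<open>1/z\<close> is the angle of
  \<open>z\<close> minus twice the argument of \<open>z\<close>, plus pi, and the argument changes
  by at most 2 pi; altogether 2 pi + 2 * 2 pi.\<close>

lemma arc_outside_disc_turning:
 fixes z :: "real \<Rightarrow> complex" and r ag :: "real \<Rightarrow> real"
 assumes ab: "a \<le> b"
  and z': "\<And>x. x \<in> {a..b} \<Longrightarrow> (z has_vector_derivative (r x *\<^sub>R cis (ag x))) (at x within {a..b})"
  and r: "continuous_on {a..b} r" "\<And>x. x \<in> {a..b} \<Longrightarrow> r x > 0"
  and th: "continuous_on {a..b} ag"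
  and inj: "inj_on z {a..b}"
  and out: "\<And>x. x \<in> {a..b} \<Longrightarrow> norm (z a) \<le> norm (z x)" "norm (z b) = norm (z a)" "z a \<noteq> 0"
 shows "\<bar>ag b - ag a\<bar> \<le> 6 * pi"
proof (cases "a = b")
 case False
 hence ab': "a < b" using ab by simp
 have contz: "continuous_on {a..b} z"
  using z' by (meson continuous_on_eq_continuous_within has_vector_derivative_continuous)
 have z0: "z x \<noteq> 0" if "x \<in> {a..b}" for x using out(1)[OF that] out(3) by auto
 obtain g where g: "continuous_on {a..b} g" "\<And>x. x \<in> {a..b} \<Longrightarrow> z x = exp (g x)"
  using continuous_logarithm_on_contractible[OF contz _ z0] convex_imp_contractible by blast
 have w1: "Im (g b) - Im (g a) \<le> 2 * pi"
  by (rule arc_outside_disc_winding[OF ab' g inj]) (use out in auto)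
 \<comment> \<open>The reversed arc bounds the winding in the other direction.\<close>
 have w2: "Im (g a) - Im (g b) \<le> 2 * pi"
 proof -
  have "Im (g (a + b - b)) - Im (g (a + b - a)) \<le> 2 * pi"
  proof (rule arc_outside_disc_winding[OF ab', of "\<lambda>x. g (a + b - x)" "\<lambda>x. z (a + b - x)"])
   show "continuous_on {a..b} (\<lambda>x. g (a + b - x))"
    by (rule continuous_on_compose2[OF g(1)]) (auto intro!: continuous_intros)
   show "inj_on (\<lambda>x. z (a + b - x)) {a..b}"
   proof (rule inj_onI)
    fix x y assume "x \<in> {a..b}" "y \<in> {a..b}" "z (a + b - x) = z (a + b - y)"
    thus "x = y" using inj_onD[OF inj, of "a + b - x" "a + b - y"] by auto
   qed
   show "norm (z (a + b - a)) \<le> norm (z (a + b - x))" if "x \<in> {a..b}" for x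
    using out(1)[of "a + b - x"] out(2) that by auto
  qed (use g out in auto)
  thus ?thesis by simp
 qed
 define w where "w = (\<lambda>x. inverse (z x))"
 have "\<bar>(ag b - 2 * Im (g b) + pi) - (ag a - 2 * Im (g a) + pi)\<bar> \<le> 2 * pi"
 proof (rule arc_in_disc_turning[where w=w and r="\<lambda>x. r x / norm (z x)^2"
    and ag="\<lambda>x. ag x - 2 * Im (g x) + pi"])
  fix x assume x: "x \<in> {a..b}"
  have zx: "z x = of_real (norm (z x)) * cis (Im (g x))" using exp_eq_polar[of "g x"] g(2)[OF x] by (simp add: norm_mult)
  have "(w has_vector_derivative - (inverse (z x) * (r x *\<^sub>R cis (ag x)) * inverse (z x))) (at x within {a..b})"
   using Deriv.has_derivative_inverse[OF z0[OF x] z'[OF x, unfolded has_vector_derivative_def]]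
   unfolding has_vector_derivative_def w_def by (rule has_derivative_eq_rhs) (auto simp: fun_eq_iff)
  moreover have "- (inverse (z x) * (r x *\<^sub>R cis (ag x)) * inverse (z x))
   = (r x / norm (z x)^2) *\<^sub>R cis (ag x - 2 * Im (g x) + pi)"
  proof -
   have "cis (ag x - 2 * Im (g x) + pi) = - (cis (ag x) * inverse (cis (Im (g x)))^2)"
    by (simp add: cis_mult cis_divide power2_eq_square flip: cis_inverse cis_cnj) (simp add: cis_mult cis_cnj complex_eq_iff)
   thus ?thesis using z0[OF x]
    by (subst (1 2) zx) (simp add: scaleR_conv_of_real power2_eq_square field_simps)
  qed
  ultimately show "(w has_vector_derivative (r x / norm (z x)^2) *\<^sub>R cis (ag x - 2 * Im (g x) + pi)) (at x within {a..b})"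
   by simp
  show "r x / (cmod (z x))\<^sup>2 > 0" using r(2)[OF x] z0[OF x] by simp
  show "cmod (w x) \<le> cmod (w a)" using out(1)[OF x] out(3)
   by (auto simp: w_def norm_inverse intro!: le_imp_inverse_le)
 next
  show "continuous_on {a..b} (\<lambda>x. r x / (cmod (z x))\<^sup>2)"
   using z0 by (intro continuous_intros r contz) auto
  show "continuous_on {a..b} (\<lambda>x. ag x - 2 * Im (g x) + pi)"
   by (intro continuous_intros th g)
  show "inj_on w {a..b}" using inj by (auto simp: inj_on_def w_def)
  show "cmod (w b) = cmod (w a)" using out by (simp add: w_def norm_inverse)
 qed (rule ab)
 thus ?thesis using w1 w2 by linarith
qed simp

section \<open>Auxiliary integrals on the real line\<close>

lemma nn_integral_continuous_interval:
 fixes f :: "real \<Rightarrow> real"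
 assumes f: "continuous_on {a..b} f" "\<And>x. x \<in> {a..b} \<Longrightarrow> 0 \<le> f x"
 shows "(NN x. ennreal (f x) * indicator {a..b} x) = ennreal (integral {a..b} f)"
proof -
 have si: "set_integrable lborel {a..b} f"
  by (rule borel_integrable_atLeastAtMost') (rule f)
 have "(NN x. ennreal (f x) * indicator {a..b} x) = (NE x. indicator {a..b} x *\<^sub>R f x)"
  by (intro nn_integral_cong) (auto simp: indicator_def)
 also have "\<dots> = ennreal (LBINT x. indicator {a..b} x *\<^sub>R f x)"
  using si f(2) by (intro nn_integral_eq_integral) (auto simp: set_integrable_def indicator_def)
 also have "(LBINT x. indicator {a..b} x *\<^sub>R f x) = integral {a..b} f"
  using set_borel_integral_eq_integral(2)[OF si] by (simp add: set_lebesgue_integral_def)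
 finally show ?thesis .
qed

lemma nn_integral_gaussian:
 assumes "l > 0"
 shows "(NE x. exp (- (x - a)\<^sup>2 / (4 * l))) = ennreal (sqrt (4 * pi * l))"
proof -
 have eq: "exp (- (x - a)\<^sup>2 / (4 * l)) = sqrt (4 * pi * l) * normal_density a (sqrt (2 * l)) x" for x
  using assms by (simp add: normal_density_def field_simps)
 have "(NE x. exp (- (x - a)\<^sup>2 / (4 * l)))
   = (NN x. ennreal (sqrt (4 * pi * l)) * ennreal (normal_density a (sqrt (2 * l)) x))"
  using assms unfolding eq by (simp add: ennreal_mult normal_density_nonneg)
 also have "\<dots> = ennreal (sqrt (4 * pi * l)) * (NE x. normal_density a (sqrt (2 * l)) x)"
  by (rule nn_integral_cmult) simp
 also have "(NE x. normal_density a (sqrt (2 * l)) x) = 1"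
  using assms by (subst nn_integral_eq_integral) (auto simp: integrable_normal_density integral_normal_density)
 finally show ?thesis by simp
qed

section \<open>Unit speed curves with Gaussian length bounds\<close>

text \<open>The assumption \<open>gauss\<close> is the entropy bound at every centre and scale.
  Together with injectivity it is the only global information on the curve, and it enters all
  constants below through \<open>E\<close> alone.\<close>

locale ucurve =
 fixes c :: "real \<Rightarrow> complex" and ag k :: "real \<Rightarrow> real" and E :: real
 assumes c': "\<And>s. (c has_vector_derivative cis (ag s)) (at s)"
  and th': "\<And>s. (ag has_real_derivative k s) (at s)"
  and contk: "continuous_on UNIV k"
  and inj: "inj c"
  and E: "E > 0"
  and gauss: "\<And>x l. l > 0 \<Longrightarrow>
   (NE s. exp (- (norm (c s - x))\<^sup>2 / (4 * l))) \<le> ennreal (E * sqrt (4 * pi * l))"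
begin

lemma cont: "continuous_on S c" "continuous_on S ag" "continuous_on S k"
 using c' th' contk continuous_on_subset[OF contk]
 by (auto intro!: has_vector_derivative_continuous continuous_at_imp_continuous_on DERIV_isCont)

lemma meas [measurable]: "c \<in> borel_measurable borel" "ag \<in> borel_measurable borel" "k \<in> borel_measurable borel"
 by (rule borel_measurable_continuous_onI, rule cont)+

lemma chord_le: "norm (c s - c t) \<le> \<bar>s - t\<bar>"
proof -
 have "norm (c s - c t) \<le> 1 * norm (s - t)"
  by (rule differentiable_bound[where S=UNIV and f'="\<lambda>x h. h *\<^sub>R cis (ag x)"])
   (use c' in \<open>auto simp: has_vector_derivative_def intro!: onorm_le\<close>)
 thus ?thesis by simp
qed

text \<open>On the ball of radius \<open>R\<close> the Gaussian of scale \<open>R^2\<close> is at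
  least exp(-1/4), and exp(1/4) <= 3/2; together with sqrt(4 pi) <= 4 this gives the factor
  6.\<close>

lemma length_le:
 assumes "R > 0"
 shows "emeasure lborel {s. norm (c s) \<le> R} \<le> ennreal (6 * E * R)"
proof -
 have e: "exp (1/4) \<le> (3/2 :: real)"
 proof -
  have "exp (1/4) ^ 4 = exp (1::real)" by (simp flip: exp_of_nat_mult)
  also have "\<dots> \<le> 3" by (rule exp_le)
  also have "\<dots> \<le> (3/2)^4" by (simp add: power4_eq_xxxx)
  finally show ?thesis using power_mono_iff[of "exp (1/4)" "3/2::real" 4] by simp
 qed
 have s: "sqrt (4 * pi * R\<^sup>2) \<le> 4 * R"
  using assms pi_less_4 by (intro real_le_lsqrt) (auto simp: power_mult_distrib intro!: mult_right_mono)
 have "emeasure lborel {s. norm (c s) \<le> R} = (NN s. indicator {s. norm (c s) \<le> R} s)"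
  by (rule nn_integral_indicator[symmetric]) measurable
 also have "\<dots> \<le> (NN s. ennreal (3/2) * ennreal (exp (- (norm (c s - 0))\<^sup>2 / (4 * R\<^sup>2))))"
 proof (rule nn_integral_mono)
  fix s
  have "1 \<le> 3/2 * exp (- (norm (c s))\<^sup>2 / (4 * R\<^sup>2))" if "norm (c s) \<le> R"
  proof -
   have "(norm (c s))\<^sup>2 \<le> R\<^sup>2" using that by (intro power_mono) auto
   hence "- (norm (c s))\<^sup>2 / (4 * R\<^sup>2) \<ge> - (1/4)" using assms by (simp add: field_simps)
   hence "exp (- (1/4)) \<le> exp (- (norm (c s))\<^sup>2 / (4 * R\<^sup>2))" by simp
   moreover have "1 \<le> 3/2 * exp (- (1/4 :: real))" using e by (simp add: exp_minus field_simps)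
   ultimately show ?thesis by linarith
  qed
  thus "indicator {s. norm (c s) \<le> R} s \<le> ennreal (3/2) * ennreal (exp (- (norm (c s - 0))\<^sup>2 / (4 * R\<^sup>2)))"
   by (auto simp: indicator_def ennreal_mult[symmetric])
 qed
 also have "\<dots> = ennreal (3/2) * (NE s. exp (- (norm (c s - 0))\<^sup>2 / (4 * R\<^sup>2)))"
  by (rule nn_integral_cmult) measurable
 also have "\<dots> \<le> ennreal (3/2) * ennreal (E * sqrt (4 * pi * R\<^sup>2))"
  using gauss[of "R\<^sup>2" 0] assms by (intro mult_left_mono) auto
 also have "\<dots> = ennreal (3/2 * (E * sqrt (4 * pi * R\<^sup>2)))" by (rule ennreal_mult'[symmetric]) simp
 also have "\<dots> \<le> ennreal (3/2 * (E * (4 * R)))"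
  using s E by (intro ennreal_leI mult_left_mono) auto
 finally show ?thesis by (simp add: mult_ac)
qed

text \<open>Half-open intervals are used so that the right-hand sides of adjacent arcs add up
  exactly.\<close>

lemma turning_le_curvature:
 assumes "s \<le> t"
 shows "ennreal \<bar>ag t - ag s\<bar> \<le> (NN x. ennreal \<bar>k x\<bar> * indicator {s<..t} x)"
proof -
 have hi: "(k has_integral (ag t - ag s)) {s..t}"
  by (rule fundamental_theorem_of_calculus[OF assms])
   (use th' in \<open>auto simp: has_real_derivative_iff_has_vector_derivative[symmetric] intro: DERIV_subset\<close>)
 have ik: "(\<lambda>x. \<bar>k x\<bar>) integrable_on {s..t}"
  by (intro integrable_continuous_interval continuous_intros cont)
 have "\<bar>ag t - ag s\<bar> \<le> integral {s..t} (\<lambda>x. \<bar>k x\<bar>)"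
  using integral_norm_bound_integral[of k "{s..t}" "\<lambda>x. \<bar>k x\<bar>"] hi ik by (auto simp: has_integral_iff)
 also have "ennreal \<dots> = (NN x. ennreal \<bar>k x\<bar> * indicator {s..t} x)"
  by (rule nn_integral_continuous_interval[symmetric]) (auto intro!: continuous_intros cont)
 also have "\<dots> = (NN x. ennreal \<bar>k x\<bar> * indicator {s<..t} x)"
  by (rule nn_integral_cong_AE) (use AE_lborel_singleton[of s] in \<open>auto simp: indicator_def\<close>)
 finally show ?thesis by (simp add: ennreal_leI)
qed

lemma last_inside_before:
 assumes "s \<le> x" "norm (c s) \<le> R" "norm (c x) > R"
 obtains a where "s \<le> a" "a < x" "norm (c a) = R" "\<And>y. a < y \<Longrightarrow> y \<le> x \<Longrightarrow> R < norm (c y)"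
proof -
 have "compact ({s..x} \<inter> {y. norm (c y) \<le> R})"
  by (intro compact_Int_closed closed_Collect_le continuous_intros cont) auto
 moreover have "{s..x} \<inter> {y. norm (c y) \<le> R} \<noteq> {}" using assms by auto
 ultimately obtain a where a: "a \<in> {s..x} \<inter> {y. norm (c y) \<le> R}" "\<And>y. y \<in> {s..x} \<inter> {y. norm (c y) \<le> R} \<Longrightarrow> y \<le> a"
  by (meson compact_attains_sup)
 have "\<exists>y\<ge>a. y \<le> x \<and> norm (c y) = R"
  by (rule IVT') (use a assms in \<open>auto intro!: continuous_intros cont\<close>)
 then obtain y where y: "a \<le> y" "y \<le> x" "norm (c y) = R" by blast
 hence "y = a" using a by (intro antisym) auto
 show ?thesis
 proof (rule that[of a])
  show "R < norm (c y)" if "a < y" "y \<le> x" for y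
   using a(1) a(2)[of y] that by (cases "norm (c y) \<le> R") auto
 qed (use a y \<open>y = a\<close> assms in \<open>force+\<close>)
qed

lemma first_inside_after:
 assumes "x \<le> t" "norm (c t) \<le> R" "norm (c x) > R"
 obtains b where "b \<le> t" "x < b" "norm (c b) = R" "\<And>y. x \<le> y \<Longrightarrow> y < b \<Longrightarrow> R < norm (c y)"
proof -
 have "compact ({x..t} \<inter> {y. norm (c y) \<le> R})"
  by (intro compact_Int_closed closed_Collect_le continuous_intros cont) auto
 moreover have "{x..t} \<inter> {y. norm (c y) \<le> R} \<noteq> {}" using assms by auto
 ultimately obtain b where b: "b \<in> {x..t} \<inter> {y. norm (c y) \<le> R}" "\<And>y. y \<in> {x..t} \<inter> {y. norm (c y) \<le> R} \<Longrightarrow> b \<le> y"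
  by (meson compact_attains_inf)
 have "\<exists>y\<ge>x. y \<le> b \<and> norm (c y) = R"
  by (rule IVT2') (use b assms in \<open>auto intro!: continuous_intros cont\<close>)
 then obtain y where y: "x \<le> y" "y \<le> b" "norm (c y) = R" by blast
 hence "y = b" using b by (intro antisym) auto
 show ?thesis
 proof (rule that[of b])
  show "R < norm (c y)" if "x \<le> y" "y < b" for y
   using b(1) b(2)[of y] that by (cases "norm (c y) \<le> R") auto
 qed (use b y \<open>y = b\<close> assms in \<open>force+\<close>)
qed

text \<open>While the curve stays in the ball of radius \<open>R + 1\<close>, curvature accounts for
  the turning. An arc that leaves this ball and comes back to radius \<open>R\<close> turns by at
  most 6 pi, whatever it does outside, and it spends length at least 1 between the spheres of radius
  \<open>R\<close> and \<open>R + 1\<close>; charging 6 pi to each unit of length there pays for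
  it.\<close>

lemma turning_le:
 assumes R: "R > 0" and st: "s \<le> t" "norm (c s) \<le> R" "norm (c t) \<le> R"
 shows "ennreal \<bar>ag t - ag s\<bar> \<le> (NN x. ennreal (\<bar>k x\<bar> + 6 * pi) * indicator {x. norm (c x) \<le> R + 1} x)"
proof -
 define I where "I = (\<lambda>x. indicator {x. norm (c x) \<le> R + 1} x :: ennreal)"
 have [measurable]: "I \<in> borel_measurable borel" unfolding I_def by measurable
 \<comment> \<open>\<open>G\<close> is the claimed bound restricted to (s, t], and \<open>L\<close>
   is the length inside the larger ball; both are additive in the interval.\<close>
 define G where "G = (\<lambda>s t. NN x. ennreal (\<bar>k x\<bar> + 6 * pi) * I x * indicator {s<..t} x)"
 define L where "L = (\<lambda>s t. NN x. I x * indicator {s<..t} x)"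
 have split: "(NN x. h x * indicator {s<..t} x) = (NN x. h x * indicator {s<..a} x)
   + (NN x. h x * indicator {a<..b} x) + (NN x. h x * indicator {b<..t} x)"
  if "s \<le> a" "a \<le> b" "b \<le> t" and [measurable]: "h \<in> borel_measurable borel" for s a b t :: real and h :: "real \<Rightarrow> ennreal"
 proof -
  have "(NN x. h x * indicator {s<..a} x) + (NN x. h x * indicator {a<..b} x)
    + (NN x. h x * indicator {b<..t} x)
   = (NN x. h x * indicator {s<..a} x + h x * indicator {a<..b} x + h x * indicator {b<..t} x)"
   by (simp add: nn_integral_add)
  also have "\<dots> = (NN x. h x * indicator {s<..t} x)"
   using that by (intro nn_integral_cong) (auto simp: indicator_def)
  finally show ?thesis by simp
 qed
 \<comment> \<open>Induction on a bound \<open>n\<close> for \<open>L\<close>: cutting out one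
   excursion removes length at least 1 and leaves two arcs to which the smaller bound
   applies.\<close>
 have main: "ennreal \<bar>ag t - ag s\<bar> \<le> G s t"
  if "s \<le> t" "norm (c s) \<le> R" "norm (c t) \<le> R" "L s t < of_nat n" for s t n
  using that
 proof (induction n arbitrary: s t)
  case 0
  thus ?case by simp
 next
  case (Suc n)
  show ?case
  proof (cases "\<forall>x\<in>{s..t}. norm (c x) \<le> R + 1")
   case True
   have "ennreal \<bar>ag t - ag s\<bar> \<le> (NN x. ennreal \<bar>k x\<bar> * indicator {s<..t} x)"
    by (rule turning_le_curvature) fact
   also have "\<dots> \<le> G s t" unfolding G_def
    by (rule nn_integral_mono) (use True pi_ge_zero in \<open>auto simp: I_def indicator_def intro!: ennreal_leI\<close>)
   finally show ?thesis .
  next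
   case False
   then obtain x where x: "s \<le> x" "x \<le> t" "norm (c x) > R + 1" by force
   obtain a where a: "s \<le> a" "a < x" "norm (c a) = R" "\<And>y. a < y \<Longrightarrow> y \<le> x \<Longrightarrow> R < norm (c y)"
    using last_inside_before[of s x R] x Suc.prems by auto
   obtain b where b: "b \<le> t" "x < b" "norm (c b) = R" "\<And>y. x \<le> y \<Longrightarrow> y < b \<Longrightarrow> R < norm (c y)"
    using first_inside_after[of x t R] x Suc.prems by auto
   have "norm (c x) \<le> norm (c a) + norm (c x - c a)" by (metis norm_triangle_sub)
   hence ax: "a + 1 < x" using chord_le[of x a] a x by auto
   have turn: "\<bar>ag b - ag a\<bar> \<le> 6 * pi"
   proof (rule arc_outside_disc_turning[where z=c and r="\<lambda>_. 1" and ag=ag and a=a and b=b])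
    show "norm (c a) \<le> norm (c y)" if "y \<in> {a..b}" for y
    proof -
     consider "y = a" | "y = b" | "a < y" "y \<le> x" | "x \<le> y" "y < b" using \<open>y \<in> {a..b}\<close> by force
     thus ?thesis using a(3,4) b(3,4) by cases (auto intro: less_imp_le)
    qed
    show "inj_on c {a..b}" using inj by (meson inj_on_subset subset_UNIV)
   qed (use a b R c' in \<open>auto intro!: cont intro: has_vector_derivative_at_within\<close>)
   \<comment> \<open>The first unit of length after \<open>a\<close> cannot get beyond radius
     \<open>R + 1\<close>, so all of it counts.\<close>
   have Lab: "1 \<le> L a b"
   proof -
    have "norm (c y) \<le> R + 1" if "a < y" "y \<le> a + 1" for y
     using chord_le[of y a] norm_triangle_sub[of "c y" "c a"] a that by linarith
    hence "(NN y. indicator {a<..a+1} y) \<le> L a b"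
     unfolding L_def I_def using ax b by (intro nn_integral_mono) (auto simp: indicator_def)
    thus ?thesis by simp
   qed
   have Lsum: "L s t = L s a + L a b + L b t" unfolding L_def
    by (rule split) (use a b in auto)
   have "L s a + L b t + 1 \<le> L s t" unfolding Lsum
    using Lab by (metis add.assoc add.commute add_left_mono)
   also have "\<dots> < of_nat (Suc n)" by fact
   finally have "L s a + L b t < of_nat n"
    by (simp add: add.commute)
   hence "L s a < of_nat n" "L b t < of_nat n"
    by (meson add_increasing add_increasing2 le_less_trans order_refl zero_le)+
   hence IH: "ennreal \<bar>ag a - ag s\<bar> \<le> G s a" "ennreal \<bar>ag t - ag b\<bar> \<le> G b t"
    using Suc.IH[of s a] Suc.IH[of b t] a b Suc.prems by auto
   have "ennreal \<bar>ag b - ag a\<bar> \<le> ennreal (6 * pi) * 1" using turn by (simp add: ennreal_leI)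
   also have "\<dots> \<le> ennreal (6 * pi) * L a b" by (intro mult_left_mono Lab) auto
   also have "\<dots> = (NN x. ennreal (6 * pi) * (I x * indicator {a<..b} x))"
    unfolding L_def by (rule nn_integral_cmult[symmetric]) measurable
   also have "\<dots> \<le> G a b" unfolding G_def mult.assoc[symmetric]
    by (intro nn_integral_mono mult_right_mono ennreal_leI) auto
   finally have mid: "ennreal \<bar>ag b - ag a\<bar> \<le> G a b" .
   have "ennreal \<bar>ag t - ag s\<bar> \<le> ennreal (\<bar>ag a - ag s\<bar> + \<bar>ag b - ag a\<bar> + \<bar>ag t - ag b\<bar>)"
    by (intro ennreal_leI) linarith
   also have "\<dots> = ennreal \<bar>ag a - ag s\<bar> + ennreal \<bar>ag b - ag a\<bar> + ennreal \<bar>ag t - ag b\<bar>"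
    by simp
   also have "\<dots> \<le> G s a + G a b + G b t" by (intro add_mono IH mid)
   also have "\<dots> = G s t" unfolding G_def by (rule split[symmetric]) (use a b in auto)
   finally show ?thesis .
  qed
 qed
 have "L s t \<le> (NN x. indicator {s<..t} x)" unfolding L_def I_def
  by (intro nn_integral_mono) (auto simp: indicator_def)
 also have "\<dots> < \<infinity>" using st by simp
 finally obtain n where "L s t < of_nat n" by (metis ennreal_Ex_less_of_nat infinity_ennreal_def)
 from main[OF st this] have "ennreal \<bar>ag t - ag s\<bar> \<le> G s t" .
 also have "\<dots> \<le> (NN x. ennreal (\<bar>k x\<bar> + 6 * pi) * I x)"
  unfolding G_def by (intro nn_integral_mono) (auto simp: indicator_def)
 finally show ?thesis by (simp add: I_def)
qed

text \<open>Cauchy-Schwarz against the length in the ball; the factor exp(R^2/r) is the price of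
  inserting the Gaussian weight.\<close>

lemma curvature_in_ball_square_le:
 assumes R: "R > 0" and r: "r > 0"
 shows "(NN x. ennreal \<bar>k x\<bar> * indicator {x. norm (c x) \<le> R} x)\<^sup>2
  \<le> ennreal (6 * E * R * exp (R\<^sup>2 / r)) * (NE x. (k x)\<^sup>2 * exp (- (norm (c x))\<^sup>2 / r))"
proof -
 define I where "I = (\<lambda>x. indicator {x. norm (c x) \<le> R} x :: ennreal)"
 have [measurable]: "I \<in> borel_measurable borel" unfolding I_def by measurable
 have "(NN x. ennreal \<bar>k x\<bar> * I x)\<^sup>2 = (NN x. (ennreal \<bar>k x\<bar> * I x) * I x)\<^sup>2"
  by (intro arg_cong[where f="\<lambda>x. x\<^sup>2"] nn_integral_cong) (auto simp: I_def indicator_def)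
 also have "\<dots> \<le> (NN x. (ennreal \<bar>k x\<bar> * I x)\<^sup>2) * (NN x. (I x)\<^sup>2)"
  by (rule Cauchy_Schwarz_nn_integral) measurable
 also have "(NN x. (I x)\<^sup>2) = emeasure lborel {x. norm (c x) \<le> R}"
 proof -
  have "(\<lambda>x. (I x)\<^sup>2) = indicator {x. norm (c x) \<le> R}" by (auto simp: I_def indicator_def fun_eq_iff)
  thus ?thesis by (simp add: nn_integral_indicator)
 qed
 also have "\<dots> \<le> ennreal (6 * E * R)" by (rule length_le[OF R])
 also have "(NN x. (ennreal \<bar>k x\<bar> * I x)\<^sup>2)
   \<le> (NN x. ennreal (exp (R\<^sup>2 / r)) * ennreal ((k x)\<^sup>2 * exp (- (norm (c x))\<^sup>2 / r)))"
 proof (rule nn_integral_mono)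
  fix x
  have "1 \<le> exp (R\<^sup>2 / r) * exp (- (norm (c x))\<^sup>2 / r)" if "norm (c x) \<le> R"
  proof -
   have "(norm (c x))\<^sup>2 \<le> R\<^sup>2" using that by (intro power_mono) auto
   thus ?thesis using r by (simp add: exp_add[symmetric] field_simps)
  qed
  from mult_left_mono[OF this, of "(k x)\<^sup>2"]
  show "(ennreal \<bar>k x\<bar> * I x)\<^sup>2 \<le> ennreal (exp (R\<^sup>2 / r)) * ennreal ((k x)\<^sup>2 * exp (- (norm (c x))\<^sup>2 / r))"
   by (auto simp: I_def indicator_def ennreal_mult[symmetric] ennreal_power power_mult_distrib mult_ac intro!: ennreal_leI)
 qed
 also have "\<dots> = ennreal (exp (R\<^sup>2 / r)) * (NE x. (k x)\<^sup>2 * exp (- (norm (c x))\<^sup>2 / r))"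
  by (rule nn_integral_cmult) measurable
 finally have "(NN x. ennreal \<bar>k x\<bar> * I x)\<^sup>2 \<le> ennreal (exp (R\<^sup>2 / r)) *
  (NE x. (k x)\<^sup>2 * exp (- (norm (c x))\<^sup>2 / r)) * ennreal (6 * E * R)"
  by (simp add: mult_left_mono mult_right_mono)
 thus ?thesis using R E by (simp add: I_def ennreal_mult' ennreal_mult mult_ac)
qed

end

section \<open>Gaussian variance of the tangent angle on one curve\<close>

text \<open>The Gaussian beats the growth allowed by the turning estimate: (y + d)^2 <= 5/4 y^2 + 5
  d^2 costs 5/48 in the exponent, and 1/4 = 5/48 + 1/8 + 1/48, where 1/8 is kept and 1/48 absorbs
  the quadratic factor.\<close>

lemma gaussian_growth_bound:
 fixes y d r :: real
 assumes "y \<ge> 0" "d \<ge> 0" "r > 0"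
 shows "(y + d)\<^sup>2 * exp ((y + d)\<^sup>2 / (12 * r)) * exp (- y\<^sup>2 / (4 * r))
  \<le> (96 * r + 2 * d\<^sup>2) * exp (5 * d\<^sup>2 / (12 * r)) * exp (- y\<^sup>2 / (8 * r))"
proof -
 have 1: "(y + d)\<^sup>2 \<le> 5/4 * y\<^sup>2 + 5 * d\<^sup>2" using zero_le_power2[of "y/2 - 2 * d"] by (simp add: power2_eq_square algebra_simps)
 have 2: "(y + d)\<^sup>2 \<le> 2 * y\<^sup>2 + 2 * d\<^sup>2" using zero_le_power2[of "y - d"] by (simp add: power2_eq_square algebra_simps)
 have "(y + d)\<^sup>2 / (12 * r) + - y\<^sup>2 / (4 * r) \<le> 5 * d\<^sup>2 / (12 * r) + (- y\<^sup>2 / (8 * r)) + (- y\<^sup>2 / (48 * r))"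
 proof -
  have "(y + d)\<^sup>2 / (12 * r) \<le> (5/4 * y\<^sup>2 + 5 * d\<^sup>2) / (12 * r)" using 1 assms by (intro divide_right_mono) auto
  also have "\<dots> = 5 * d\<^sup>2 / (12 * r) + 5 * y\<^sup>2 / (48 * r)" by (simp add: add_divide_distrib)
  finally have "(y + d)\<^sup>2 / (12 * r) \<le> 5 * d\<^sup>2 / (12 * r) + 5 * y\<^sup>2 / (48 * r)" .
  moreover have "5 * y\<^sup>2 / (48 * r) + - y\<^sup>2 / (4 * r) = (- y\<^sup>2 / (8 * r)) + (- y\<^sup>2 / (48 * r))"
   using assms by (simp add: field_simps)
  ultimately show ?thesis by linarith
 qed
 hence "exp ((y + d)\<^sup>2 / (12 * r)) * exp (- y\<^sup>2 / (4 * r)) \<le> exp (5 * d\<^sup>2 / (12 * r)) * exp (- y\<^sup>2 / (8 * r)) * exp (- y\<^sup>2 / (48 * r))"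
  by (simp add: exp_add[symmetric])
 hence 3: "(y + d)\<^sup>2 * (exp ((y + d)\<^sup>2 / (12 * r)) * exp (- y\<^sup>2 / (4 * r)))
  \<le> (2 * y\<^sup>2 + 2 * d\<^sup>2) * (exp (5 * d\<^sup>2 / (12 * r)) * exp (- y\<^sup>2 / (8 * r)) * exp (- y\<^sup>2 / (48 * r)))"
  using 2 by (intro mult_mono[OF 2]) auto
 have "(2 * y\<^sup>2 + 2 * d\<^sup>2) * exp (- y\<^sup>2 / (48 * r)) \<le> 96 * r + 2 * d\<^sup>2"
 proof -
  have "y\<^sup>2 / (48 * r) \<le> exp (y\<^sup>2 / (48 * r))" using exp_ge_add_one_self[of "y\<^sup>2 / (48 * r)"] by linarith
  hence "y\<^sup>2 / (48 * r) * exp (- y\<^sup>2 / (48 * r)) \<le> exp (y\<^sup>2 / (48 * r)) * exp (- y\<^sup>2 / (48 * r))" by (intro mult_right_mono) auto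
  hence "y\<^sup>2 / (48 * r) * exp (- y\<^sup>2 / (48 * r)) \<le> 1" by (simp add: exp_add[symmetric])
  hence a: "2 * y\<^sup>2 * exp (- y\<^sup>2 / (48 * r)) \<le> 96 * r" using assms by (simp add: field_simps)
  have "exp (- y\<^sup>2 / (48 * r)) \<le> 1" using assms by simp
  hence "2 * d\<^sup>2 * exp (- y\<^sup>2 / (48 * r)) \<le> 2 * d\<^sup>2 * 1" by (intro mult_left_mono) auto
  with a show ?thesis by (simp add: algebra_simps)
 qed
 hence "(2 * y\<^sup>2 + 2 * d\<^sup>2) * exp (- y\<^sup>2 / (48 * r)) * (exp (5 * d\<^sup>2 / (12 * r)) * exp (- y\<^sup>2 / (8 * r)))
  \<le> (96 * r + 2 * d\<^sup>2) * (exp (5 * d\<^sup>2 / (12 * r)) * exp (- y\<^sup>2 / (8 * r)))"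
  by (intro mult_right_mono) auto
 thus ?thesis using 3 by (simp only: mult_ac)
qed

text \<open>For each \<open>s\<close> the turning between \<open>s0\<close> and \<open>s\<close> is
  estimated in a ball just large enough to contain both points. The square of the estimate grows at
  most like the factor treated in \<open>gaussian_growth_bound\<close>, times 1 plus the curvature
  integral. The constant is chosen before the curve, so it depends only on \<open>E\<close>,
  \<open>r\<close> and \<open>R0\<close>.\<close>

lemma gaussian_angle_variance_le:
 assumes E: "E > 0" and r: "r > 0" and R0: "R0 \<ge> 0"
 shows "\<exists>C>0. \<forall>c ag k s0. ucurve c ag k E \<longrightarrow> norm (c s0) \<le> R0 \<longrightarrow>
  (NE s. (ag s - ag s0)\<^sup>2 * exp (- (norm (c s))\<^sup>2 / (4 * r)))
  \<le> ennreal C * (1 + (NE s. (k s)\<^sup>2 * exp (- (norm (c s))\<^sup>2 / (12 * r))))"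
proof -
 \<comment> \<open>\<open>d\<close> is such that the larger ball in \<open>turning_le\<close> has
   radius \<open>norm (c s) + d\<close>. In \<open>C1\<close> the first summand comes from the
   curvature, the second from 6 pi times the length bound \<open>6 * E\<close>.\<close>
 define d where "d = R0 + 2"
 define C1 where "C1 = 12 * E + 2 * (36 * pi * E)\<^sup>2"
 define C2 where "C2 = (96 * r + 2 * d\<^sup>2) * exp (5 * d\<^sup>2 / (12 * r))"
 define C where "C = C1 * C2 * (E * sqrt (4 * pi * (2 * r)))"
 have C1: "C1 > 0" using E unfolding C1_def by (intro add_pos_nonneg) auto
 have C2: "C2 > 0" using r unfolding C2_def by (intro mult_pos_pos add_pos_nonneg) auto
 have C: "C > 0" using C1 C2 E r unfolding C_def by (intro mult_pos_pos) auto
 show ?thesis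
 proof (intro exI[of _ C] conjI allI impI C)
  fix c ag k s0 assume u: "ucurve c ag k E" and s0: "norm (c s0) \<le> R0"
  interpret ucurve c ag k E by (rule u)
  define K where "K = (NE s. (k s)\<^sup>2 * exp (- (norm (c s))\<^sup>2 / (12 * r)))"
  have pt: "ennreal ((ag s - ag s0)\<^sup>2 * exp (- (norm (c s))\<^sup>2 / (4 * r)))
    \<le> ennreal (C1 * C2) * (1 + K) * ennreal (exp (- (norm (c s - 0))\<^sup>2 / (4 * (2 * r))))" for s
  proof (cases "K = \<infinity>")
   case True
   then show ?thesis using C1 C2 by (simp add: ennreal_mult_top ennreal_top_mult)
  next
   case False
   then obtain K' where K': "K = ennreal K'" "K' \<ge> 0" by (cases K) auto
   define R where "R = norm (c s) + R0 + 1"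
   define y where "y = norm (c s)"
   have R: "R > 0" using R0 unfolding R_def by (smt (verit) norm_ge_zero)
   have Ry: "R + 1 = y + d" by (simp add: R_def y_def d_def)
   define P where "P = (NN x. ennreal \<bar>k x\<bar> * indicator {x. norm (c x) \<le> R + 1} x)"
   have P2: "P\<^sup>2 \<le> ennreal (6 * E * (R + 1) * exp ((R + 1)\<^sup>2 / (12 * r)) * K')"
    using curvature_in_ball_square_le[of "R + 1" "12 * r"] R r E K' unfolding P_def K_def[symmetric]
    by (simp add: ennreal_mult)
   hence "P\<^sup>2 < \<infinity>" by (metis ennreal_less_top infinity_ennreal_def le_less_trans)
   hence "P \<noteq> \<infinity>" by (auto simp: power2_eq_square)
   then obtain p where p: "P = ennreal p" "p \<ge> 0" by (cases P) auto
   have p2: "p\<^sup>2 \<le> 6 * E * (R + 1) * exp ((R + 1)\<^sup>2 / (12 * r)) * K'"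
    using P2 p R E K' by (simp add: ennreal_power ennreal_le_iff)
   have "ennreal \<bar>ag s - ag s0\<bar> \<le> (NN x. ennreal (\<bar>k x\<bar> + 6 * pi) * indicator {x. norm (c x) \<le> R + 1} x)"
   proof (cases "s0 \<le> s")
    case True
    show ?thesis by (rule turning_le[OF R True]) (use s0 R0 norm_ge_zero[of "c s"] in \<open>unfold R_def, linarith+\<close>)
   next
    case False
    hence "s \<le> s0" by simp
    show ?thesis by (subst abs_minus_commute, rule turning_le[OF R \<open>s \<le> s0\<close>])
      (use s0 R0 norm_ge_zero[of "c s"] in \<open>unfold R_def, linarith+\<close>)
   qed
   also have "\<dots> = (NN x. ennreal \<bar>k x\<bar> * indicator {x. norm (c x) \<le> R + 1} x
     + ennreal (6 * pi) * indicator {x. norm (c x) \<le> R + 1} x)"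
    by (intro nn_integral_cong) (auto simp: distrib_right ennreal_plus)
   also have "\<dots> = P + ennreal (6 * pi) * emeasure lborel {x. norm (c x) \<le> R + 1}"
    unfolding P_def by (subst nn_integral_add) (auto simp: nn_integral_cmult)
   also have "\<dots> \<le> ennreal p + ennreal (6 * pi) * ennreal (6 * E * (R + 1))"
    unfolding p using R by (intro add_left_mono mult_left_mono length_le) auto
   also have "\<dots> = ennreal (p + 36 * pi * E * (R + 1))"
    using p R E by (subst ennreal_mult[symmetric]) (auto simp: ennreal_plus[symmetric] mult_ac simp del: ennreal_plus)
   finally have th: "\<bar>ag s - ag s0\<bar> \<le> p + 36 * pi * E * (R + 1)"
    using p R E by (subst (asm) ennreal_le_iff) auto
   have "(ag s - ag s0)\<^sup>2 \<le> (p + 36 * pi * E * (R + 1))\<^sup>2"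
    using power_mono[OF th, of 2] by simp
   also have "\<dots> \<le> 2 * p\<^sup>2 + 2 * (36 * pi * E * (R + 1))\<^sup>2"
    using zero_le_power2[of "p - 36 * pi * E * (R + 1)"] by (simp add: power2_eq_square algebra_simps)
   also have "\<dots> \<le> C1 * (1 + K') * ((y + d)\<^sup>2 * exp ((y + d)\<^sup>2 / (12 * r)))"
   proof -
    define X where "X = (y + d)\<^sup>2 * exp ((y + d)\<^sup>2 / (12 * r))"
    have e1: "1 \<le> exp ((y + d)\<^sup>2 / (12 * r))" using r by simp
    have yd: "y + d \<ge> 1" using R0 by (simp add: y_def d_def)
    hence "y + d \<le> (y + d)\<^sup>2" by (simp add: self_le_power)
    hence "(y + d) * exp ((y + d)\<^sup>2 / (12 * r)) \<le> X" unfolding X_def by (intro mult_right_mono) auto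
    hence "6 * E * K' * ((y + d) * exp ((y + d)\<^sup>2 / (12 * r))) \<le> 6 * E * K' * X"
     using E K' by (intro mult_left_mono) auto
    hence a: "2 * p\<^sup>2 \<le> 12 * E * K' * X" using p2 unfolding Ry by (simp add: algebra_simps)
    have "(y + d)\<^sup>2 * 1 \<le> X" unfolding X_def by (intro mult_left_mono e1) auto
    hence "2 * (36 * pi * E)\<^sup>2 * (y + d)\<^sup>2 \<le> 2 * (36 * pi * E)\<^sup>2 * X" by (intro mult_left_mono) auto
    hence b: "2 * (36 * pi * E * (R + 1))\<^sup>2 \<le> 2 * (36 * pi * E)\<^sup>2 * X" unfolding Ry power_mult_distrib by simp
    have X0: "X \<ge> 0" by (simp add: X_def)
    have "12 * E * K' * X \<le> 12 * E * (1 + K') * X" using E K' X0 by (intro mult_right_mono mult_left_mono) auto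
    moreover have "2 * (36 * pi * E)\<^sup>2 * X * 1 \<le> 2 * (36 * pi * E)\<^sup>2 * X * (1 + K')"
     using K' X0 by (intro mult_left_mono) auto
    ultimately show ?thesis using a b unfolding C1_def X_def[symmetric] by (simp add: algebra_simps)
   qed
   finally have "(ag s - ag s0)\<^sup>2 * exp (- y\<^sup>2 / (4 * r))
     \<le> C1 * (1 + K') * ((y + d)\<^sup>2 * exp ((y + d)\<^sup>2 / (12 * r))) * exp (- y\<^sup>2 / (4 * r))"
    by (intro mult_right_mono) auto
   also have "\<dots> = C1 * (1 + K') * ((y + d)\<^sup>2 * exp ((y + d)\<^sup>2 / (12 * r)) * exp (- y\<^sup>2 / (4 * r)))"
    by simp
   also have "\<dots> \<le> C1 * (1 + K') * (C2 * exp (- y\<^sup>2 / (8 * r)))"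
    unfolding C2_def using gaussian_growth_bound[of y d r] R0 r C1 K'
    by (intro mult_left_mono) (auto simp: y_def d_def)
   finally have "ennreal ((ag s - ag s0)\<^sup>2 * exp (- y\<^sup>2 / (4 * r))) \<le> ennreal (C1 * (1 + K') * (C2 * exp (- y\<^sup>2 / (8 * r))))"
    by (rule ennreal_leI)
   also have "\<dots> = ennreal (C1 * C2) * (1 + K) * ennreal (exp (- (norm (c s - 0))\<^sup>2 / (4 * (2 * r))))"
   proof -
    have "1 + K = ennreal (1 + K')" using K' by (simp add: ennreal_plus)
    moreover have "C1 * (1 + K') * (C2 * exp (- y\<^sup>2 / (8 * r))) = C1 * C2 * (1 + K') * exp (- (norm (c s - 0))\<^sup>2 / (4 * (2 * r)))"
     by (simp add: y_def)
    ultimately show ?thesis using C1 C2 K' by (simp only: ennreal_mult mult_nonneg_nonneg less_imp_le exp_ge_zero add_nonneg_nonneg zero_le_one)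
   qed
   finally show ?thesis by (simp add: y_def)
  qed
  have "(NE s. (ag s - ag s0)\<^sup>2 * exp (- (norm (c s))\<^sup>2 / (4 * r)))
   \<le> (NN s. ennreal (C1 * C2) * (1 + K) * ennreal (exp (- (norm (c s - 0))\<^sup>2 / (4 * (2 * r)))))"
   by (intro nn_integral_mono pt)
  also have "\<dots> = ennreal (C1 * C2) * (1 + K) * (NE s. exp (- (norm (c s - 0))\<^sup>2 / (4 * (2 * r))))"
   by (rule nn_integral_cmult) measurable
  also have "\<dots> \<le> ennreal (C1 * C2) * (1 + K) * ennreal (E * sqrt (4 * pi * (2 * r)))"
   using r by (intro mult_left_mono gauss) auto
  also have "\<dots> = ennreal C * (1 + K)"
   unfolding C_def using C1 C2 E r by (simp add: ennreal_mult mult_ac)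
  finally show "(NE s. (ag s - ag s0)\<^sup>2 * exp (- (norm (c s))\<^sup>2 / (4 * r)))
  \<le> ennreal C * (1 + (NE s. (k s)\<^sup>2 * exp (- (norm (c s))\<^sup>2 / (12 * r))))"
   unfolding K_def .
 qed
qed

section \<open>Sheets of a curve in a large ball\<close>

text \<open>Parameter intervals of the components of the curve in the open ball that reach depth 1
  below the sphere. The depth condition discards arcs that merely graze the boundary and forces
  length at least 2, which makes the set finite.\<close>

definition sheets :: "(real \<Rightarrow> complex) \<Rightarrow> real \<Rightarrow> (real \<times> real) set" where
 "sheets c R = {(a,b). a < b \<and> norm (c a) = R \<and> norm (c b) = R \<and> (\<forall>x\<in>{a<..<b}. norm (c x) < R)
  \<and> (\<exists>x\<in>{a<..<b}. norm (c x) < R - 1)}"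

text \<open>\<open>q\<close> consists of the parameter matched with the origin of the approximating
  line and of the angle of that line. The last two conditions say that the sheet traverses almost
  the whole diameter.\<close>

definition straight_sheet :: "(real \<Rightarrow> complex) \<Rightarrow> (real \<Rightarrow> real) \<Rightarrow> real \<Rightarrow> real \<Rightarrow> real \<times> real \<Rightarrow> real \<times> real \<Rightarrow> bool" where
 "straight_sheet c ag R et p q \<longleftrightarrow> (\<forall>s\<in>{fst p..snd p}. norm (c s - of_real (s - fst q) * cis (snd q)) \<le> et \<and> \<bar>ag s - snd q\<bar> \<le> et)
  \<and> fst p \<le> fst q - R + et \<and> fst q + R - et \<le> snd p"

context ucurve
begin

text \<open>Finite length in the ball forces the curve out of it on both sides of \<open>s\<close>,
  within parameter distance \<open>L\<close>; the nearest exits bound the sheet.\<close>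

lemma sheets_cover:
 assumes R: "R > 0" and s: "norm (c s) < R - 1"
 shows "\<exists>p\<in>sheets c R. s \<in> {fst p<..<snd p}"
proof -
 define L where "L = 6 * E * R + 1"
 have L: "L > 0" using R E by (simp add: L_def add_pos_pos)
 have exit: "\<exists>x\<in>{u..u+L}. R \<le> norm (c x)" for u
 proof (rule ccontr)
  assume "\<not> ?thesis"
  hence "{u..u+L} \<subseteq> {x. norm (c x) \<le> R}" by force
  hence "emeasure lborel {u..u+L} \<le> emeasure lborel {x. norm (c x) \<le> R}"
   by (intro emeasure_mono) measurable
  also have "\<dots> \<le> ennreal (6 * E * R)" by (rule length_le[OF R])
  finally show False using L E R by (simp add: ennreal_le_iff L_def)
 qed
 obtain x where x: "x \<in> {s-L..s}" "R \<le> norm (c x)" using exit[of "s - L"] by auto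
 obtain y where y: "y \<in> {s..s+L}" "R \<le> norm (c y)" using exit[of s] by auto
 have "compact ({x..s} \<inter> {z. R \<le> norm (c z)})" "compact ({s..y} \<inter> {z. R \<le> norm (c z)})"
  by (intro compact_Int_closed closed_Collect_le continuous_intros cont; simp)+
 moreover have "{x..s} \<inter> {z. R \<le> norm (c z)} \<noteq> {}" "{s..y} \<inter> {z. R \<le> norm (c z)} \<noteq> {}" using x y by auto
 ultimately obtain a b where
  a: "a \<in> {x..s} \<inter> {z. R \<le> norm (c z)}" "\<And>z. z \<in> {x..s} \<inter> {z. R \<le> norm (c z)} \<Longrightarrow> z \<le> a" and
  b: "b \<in> {s..y} \<inter> {z. R \<le> norm (c z)}" "\<And>z. z \<in> {s..y} \<inter> {z. R \<le> norm (c z)} \<Longrightarrow> b \<le> z"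
  by (meson compact_attains_sup compact_attains_inf)
 have "a \<noteq> s" "s \<noteq> b" using a(1) b(1) s by auto
 hence as: "a < s" "s < b" using a(1) b(1) by auto
 have lt: "norm (c z) < R" if "z \<in> {a<..<b}" for z
 proof (rule ccontr)
  assume "\<not> ?thesis"
  thus False using a(2)[of z] b(2)[of z] a(1) b(1) that as by (cases "z \<le> s") auto
 qed
 have cl: "norm (c z) \<le> R" if "z \<in> {a..b}" for z
 proof (rule continuous_le_on_closure[where S="{a<..<b}" and f="\<lambda>z. norm (c z)"])
  show "continuous_on (closure {a<..<b}) (\<lambda>z. norm (c z))" by (intro continuous_intros cont)
  show "z \<in> closure {a<..<b}" using that as by simp
 qed (use lt in force)
 have "norm (c a) = R" "norm (c b) = R" using cl[of a] cl[of b] a(1) b(1) as by auto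
 hence "(a,b) \<in> sheets c R" using as lt s by (auto simp: sheets_def)
 thus ?thesis using as by force
qed

text \<open>An end point of one sheet in the interior of another would have norm \<open>R\<close>
  where the norm is below \<open>R\<close>.\<close>

lemma sheets_disjoint:
 assumes "p \<in> sheets c R" "q \<in> sheets c R" "x \<in> {fst p<..<snd p}" "x \<in> {fst q<..<snd q}"
 shows "p = q"
proof -
 have "\<not> fst p < fst q" if "p \<in> sheets c R" "q \<in> sheets c R" "x \<in> {fst p<..<snd p}" "x \<in> {fst q<..<snd q}" for p q
 proof
  assume "fst p < fst q"
  hence "fst q \<in> {fst p<..<snd p}" using that by auto
  moreover have "norm (c (fst q)) = R" "\<forall>x\<in>{fst p<..<snd p}. norm (c x) < R" using that by (auto simp: sheets_def)
  ultimately show False by force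
 qed
 moreover have "\<not> snd p < snd q" if "p \<in> sheets c R" "q \<in> sheets c R" "x \<in> {fst p<..<snd p}" "x \<in> {fst q<..<snd q}" for p q
 proof
  assume "snd p < snd q"
  hence "snd p \<in> {fst q<..<snd q}" using that by auto
  moreover have "norm (c (snd p)) = R" "\<forall>x\<in>{fst q<..<snd q}. norm (c x) < R" using that by (auto simp: sheets_def)
  ultimately show False by force
 qed
 ultimately have "fst p = fst q" "snd p = snd q" using assms by (meson linorder_less_linear)+
 thus ?thesis by (rule prod_eqI)
qed

lemma sheets_length:
 assumes "p \<in> sheets c R"
 shows "snd p - fst p \<ge> 2"
proof -
 obtain x where x: "x \<in> {fst p<..<snd p}" "norm (c x) < R - 1" "norm (c (fst p)) = R" "norm (c (snd p)) = R"
  using assms by (auto simp: sheets_def)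
 have "norm (c (fst p)) - norm (c x) \<le> \<bar>fst p - x\<bar>" "norm (c (snd p)) - norm (c x) \<le> \<bar>snd p - x\<bar>"
  using chord_le norm_triangle_ineq2 order_trans by blast+
 thus ?thesis using x by auto
qed

lemma sheets_inside:
 assumes "p \<in> sheets c R" "x \<in> {fst p..snd p}"
 shows "norm (c x) \<le> R"
proof (cases "x = fst p \<or> x = snd p")
 case False
 hence "x \<in> {fst p<..<snd p}" using assms by auto
 moreover have "\<forall>x\<in>{fst p<..<snd p}. norm (c x) < R" using assms by (auto simp: sheets_def)
 ultimately show ?thesis by force
qed (use assms in \<open>auto simp: sheets_def\<close>)

text \<open>The parameter intervals are disjoint, their total length is bounded by
  \<open>length_le\<close>, and each contributes at least 1.\<close>

lemma sheets_finite:
 assumes R: "R > 0"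
 shows "finite (sheets c R)" "real (card (sheets c R)) \<le> 6 * E * R"
  "p \<in> sheets c R \<Longrightarrow> snd p - fst p \<le> 6 * E * R"
proof -
 have G: "(\<Sum>p\<in>G. snd p - fst p) \<le> 6 * E * R" if "G \<subseteq> sheets c R" "finite G" for G
 proof -
  have "ennreal (\<Sum>p\<in>G. snd p - fst p) = (\<Sum>p\<in>G. emeasure lborel {fst p<..<snd p})"
   using that by (subst sum_ennreal[symmetric]) (auto simp: sheets_def intro!: sum.cong)
  also have "\<dots> = emeasure lborel (\<Union>p\<in>G. {fst p<..<snd p})"
  proof (rule sum_emeasure)
   show "disjoint_family_on (\<lambda>p. {fst p<..<snd p}) G"
    unfolding disjoint_family_on_def
   proof (intro ballI impI, rule ccontr)
    fix p q assume *: "p \<in> G" "q \<in> G" "p \<noteq> q" "{fst p<..<snd p} \<inter> {fst q<..<snd q} \<noteq> {}"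
    then obtain x where "x \<in> {fst p<..<snd p}" "x \<in> {fst q<..<snd q}" by blast
    thus False using sheets_disjoint[of p R q x] * \<open>G \<subseteq> sheets c R\<close> by blast
   qed
  qed (use that in auto)
  also have "\<dots> \<le> emeasure lborel {x. norm (c x) \<le> R}"
   using that sheets_inside by (intro emeasure_mono) (force, measurable)
  also have "\<dots> \<le> ennreal (6 * E * R)" by (rule length_le[OF R])
  finally show ?thesis using E R by (subst (asm) ennreal_le_iff) auto
 qed
 have "card G \<le> nat \<lfloor>6 * E * R\<rfloor>" if "G \<subseteq> sheets c R" "finite G" for G
 proof -
  have "real (card G) = (\<Sum>p\<in>G. 1)" by simp
  also have "\<dots> \<le> (\<Sum>p\<in>G. snd p - fst p)" using sheets_length that by (intro sum_mono) force
  also have "\<dots> \<le> 6 * E * R" by (rule G[OF that])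
  finally show ?thesis by (simp add: le_nat_floor)
 qed
 from finite_if_finite_subsets_card_bdd[of "sheets c R", OF this]
 have f: "finite (sheets c R)" "card (sheets c R) \<le> nat \<lfloor>6 * E * R\<rfloor>" by auto
 show "finite (sheets c R)" by fact
 have "0 \<le> 6 * E * R" using E R by simp
 thus "real (card (sheets c R)) \<le> 6 * E * R" using f(2) by linarith
 show "snd p - fst p \<le> 6 * E * R" if "p \<in> sheets c R" using G[of "{p}"] that by simp
qed

lemma turning_le_total_curvature:
 assumes "(NN x. ennreal \<bar>k x\<bar> * indicator {x. norm (c x) \<le> R} x) \<le> ennreal be"
  and "be \<ge> 0" and in_ball: "\<And>x. x \<in> {a..b} \<Longrightarrow> norm (c x) \<le> R" and "s \<in> {a..b}" "t \<in> {a..b}"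
 shows "\<bar>ag s - ag t\<bar> \<le> be"
proof -
 have *: "\<bar>ag t - ag s\<bar> \<le> be" if "s \<le> t" "s \<in> {a..b}" "t \<in> {a..b}" for s t
 proof -
  have "ennreal \<bar>ag t - ag s\<bar> \<le> (NN x. ennreal \<bar>k x\<bar> * indicator {s<..t} x)"
   by (rule turning_le_curvature) fact
  also have "\<dots> \<le> (NN x. ennreal \<bar>k x\<bar> * indicator {x. norm (c x) \<le> R} x)"
   using that in_ball by (intro nn_integral_mono) (auto simp: indicator_def)
  also have "\<dots> \<le> ennreal be" by fact
  finally show ?thesis using \<open>be \<ge> 0\<close> by simp
 qed
 show ?thesis using *[of s t] *[of t s] assms by (cases "s \<le> t") auto
qed

text \<open>The integral of the squared normal component of the position is at most
  \<open>de\<close>, and the sheet has length at least 2, so at some point the tangent line passes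
  close to the origin. Since the tangent turns by at most \<open>be\<close> on the sheet, the whole
  sheet stays near that line.\<close>

lemma sheet_is_straight:
 assumes R: "R > 2" and et: "et > 0" "et < 1/4"
  and be: "be \<ge> 0" "(NN x. ennreal \<bar>k x\<bar> * indicator {x. norm (c x) \<le> R} x) \<le> ennreal be"
  and de: "de > 0" "(NE x. (Im (c x * cis (- ag x)))\<^sup>2 * exp (- (norm (c x))\<^sup>2 / 4)) \<le> ennreal de"
  and small: "6 * E * R * be + exp (R\<^sup>2 / 8) * sqrt de \<le> et" "be \<le> et"
  and p: "p \<in> sheets c R"
 shows "\<exists>q. straight_sheet c ag R et p q"
proof -
 define a b where "a = fst p" and "b = snd p"
 have ab: "b - a \<ge> 2" "b - a \<le> 6 * E * R" "\<And>x. x \<in> {a..b} \<Longrightarrow> norm (c x) \<le> R"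
  using sheets_length[OF p] sheets_finite(3)[OF _ p] sheets_inside[OF p] R by (auto simp: a_def b_def)
 have turn: "\<bar>ag s - ag t\<bar> \<le> be" if "s \<in> {a..b}" "t \<in> {a..b}" for s t
  by (rule turning_le_total_curvature[OF be(2,1) ab(3) that])
 have "\<exists>x\<in>{a..b}. \<bar>Im (c x * cis (- ag x))\<bar> \<le> exp (R\<^sup>2 / 8) * sqrt de"
 proof (rule ccontr)
  assume "\<not> ?thesis"
  hence big: "exp (R\<^sup>2 / 8) * sqrt de < \<bar>Im (c x * cis (- ag x))\<bar>" if "x \<in> {a..b}" for x using that by force
  have ge: "de \<le> (Im (c x * cis (- ag x)))\<^sup>2 * exp (- (norm (c x))\<^sup>2 / 4)" if x: "x \<in> {a..b}" for x
  proof -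
   have "(exp (R\<^sup>2 / 8) * sqrt de)\<^sup>2 \<le> \<bar>Im (c x * cis (- ag x))\<bar>\<^sup>2"
    using big[OF x] de by (intro power_mono) auto
   moreover have "(exp (R\<^sup>2 / 8) * sqrt de)\<^sup>2 = exp (R\<^sup>2 / 4) * de"
    using de by (simp add: power_mult_distrib flip: exp_double)
   ultimately have 1: "exp (R\<^sup>2 / 4) * de \<le> (Im (c x * cis (- ag x)))\<^sup>2" by simp
   have "(norm (c x))\<^sup>2 \<le> R\<^sup>2" using ab(3)[OF x] by (intro power_mono) auto
   hence 2: "exp (- R\<^sup>2 / 4) \<le> exp (- (norm (c x))\<^sup>2 / 4)" by simp
   have "de = (exp (R\<^sup>2 / 4) * de) * exp (- R\<^sup>2 / 4)" by (simp add: exp_minus field_simps)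
   also have "\<dots> \<le> (Im (c x * cis (- ag x)))\<^sup>2 * exp (- (norm (c x))\<^sup>2 / 4)"
    using 1 2 de by (intro mult_mono) auto
   finally show ?thesis .
  qed
  have "ennreal (2 * de) \<le> ennreal de * ennreal (b - a)"
   using ab(1) de by (simp flip: ennreal_mult)
  also have "\<dots> = (NN x. ennreal de * indicator {a..b} x)"
   using ab by (subst nn_integral_cmult_indicator) auto
  also have "\<dots> \<le> (NE x. (Im (c x * cis (- ag x)))\<^sup>2 * exp (- (norm (c x))\<^sup>2 / 4))"
   using ge by (intro nn_integral_mono) (auto simp: indicator_def intro!: ennreal_leI)
  also have "\<dots> \<le> ennreal de" by fact
  finally show False using de by (simp add: ennreal_le_iff)
 qed
 then obtain x where x: "x \<in> {a..b}" "\<bar>Im (c x * cis (- ag x))\<bar> \<le> exp (R\<^sup>2 / 8) * sqrt de" by blast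
 \<comment> \<open>\<open>al\<close> is the tangent angle at \<open>x\<close>, and \<open>sg\<close>
   shifts the parameter so that \<open>x - sg\<close> is the tangential component of
   \<open>c x\<close>; what remains of \<open>c x\<close> is its normal component.\<close>
 define al sg where "al = ag x" and "sg = x - Re (c x * cis (- ag x))"
 have cx: "norm (c x - of_real (x - sg) * cis al) \<le> exp (R\<^sup>2 / 8) * sqrt de"
 proof -
  have "(c x - of_real (x - sg) * cis al) * cis (- al) = c x * cis (- al) - of_real (x - sg)"
   by (simp add: left_diff_distrib mult.assoc cis_mult)
  also have "\<dots> = \<i> * of_real (Im (c x * cis (- al)))"
   by (simp add: complex_eq_iff sg_def al_def)
  finally have "norm ((c x - of_real (x - sg) * cis al) * cis (- al)) = \<bar>Im (c x * cis (- al))\<bar>"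
   by (simp only: norm_mult norm_ii norm_of_real mult_1)
  thus ?thesis using x(2) by (simp add: norm_mult al_def)
 qed
 have close: "norm (c s - of_real (s - sg) * cis al) \<le> et" if s: "s \<in> {a..b}" for s
 proof -
  have "norm ((c s - of_real s * cis al) - (c x - of_real x * cis al)) \<le> be * norm (s - x)"
  proof (rule differentiable_bound[where S="{a..b}" and f'="\<lambda>y h. h *\<^sub>R cis (ag y) - h *\<^sub>R cis al"])
   fix y assume y: "y \<in> {a..b}"
   have "(c has_derivative (\<lambda>h. h *\<^sub>R cis (ag y))) (at y within {a..b})"
    using c'[of y] by (simp add: has_vector_derivative_def has_derivative_at_withinI)
   thus "((\<lambda>s. c s - of_real s * cis al) has_derivative (\<lambda>h. h *\<^sub>R cis (ag y) - h *\<^sub>R cis al)) (at y within {a..b})"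
    by (auto intro!: derivative_eq_intros simp: scaleR_conv_of_real)
   have "norm (cis (ag y) - cis al) \<le> \<bar>ag y - al\<bar>"
   proof -
    have "norm (cis (ag y) - cis al) \<le> 1 * norm (ag y - al)"
     by (rule differentiable_bound[where S=UNIV and f'="\<lambda>x h. of_real h * (\<i> * cis x)"])
      (auto intro!: derivative_eq_intros onorm_le simp: norm_mult scaleR_conv_of_real)
    thus ?thesis by simp
   qed
   also have "\<dots> \<le> be" unfolding al_def using turn[OF y x(1)] .
   finally show "onorm (\<lambda>h. h *\<^sub>R cis (ag y) - h *\<^sub>R cis al) \<le> be"
    by (intro onorm_le) (auto simp: scaleR_diff_right[symmetric] mult.commute[of be] intro!: mult_left_mono)
  qed (use s x in auto)
  also have "\<dots> \<le> be * (6 * E * R)" using ab s x be by (intro mult_left_mono) auto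
  finally have 1: "norm ((c s - of_real s * cis al) - (c x - of_real x * cis al)) \<le> be * (6 * E * R)" .
  have "c s - of_real (s - sg) * cis al = ((c s - of_real s * cis al) - (c x - of_real x * cis al)) + (c x - of_real (x - sg) * cis al)"
   by (simp add: algebra_simps)
  hence "norm (c s - of_real (s - sg) * cis al) \<le> be * (6 * E * R) + exp (R\<^sup>2 / 8) * sqrt de"
   using norm_triangle_mono[OF 1 cx] by (simp only:)
  thus ?thesis using small by (simp add: mult_ac)
 qed
 have dist: "\<bar>norm (c s) - \<bar>s - sg\<bar>\<bar> \<le> et" if "s \<in> {a..b}" for s
  using close[OF that] norm_triangle_ineq3[of "c s" "of_real (s - sg) * cis al"] by (simp add: norm_mult del: of_real_diff)
 obtain s0 where s0: "a < s0" "s0 < b" "norm (c s0) < R - 1" "norm (c a) = R" "norm (c b) = R"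
  using p by (auto simp: sheets_def a_def b_def)
 \<comment> \<open>Up to \<open>et\<close>, the norm is the distance of the parameter from
   \<open>sg\<close>. It is \<open>R\<close> at both ends and below \<open>R - 1\<close> in between,
   so the ends lie on opposite sides of \<open>sg\<close>.\<close>
 have "a \<le> sg - R + et" "sg + R - et \<le> b"
  using dist[of a] dist[of b] dist[of s0] s0 et R by (auto simp: abs_if split: if_splits)
 moreover have "\<bar>ag s - al\<bar> \<le> et" if "s \<in> {a..b}" for s
  using turn[OF that x(1)] small(2) by (simp add: al_def)
 ultimately show ?thesis unfolding straight_sheet_def using close
  by (intro exI[of _ "(sg,al)"]) (auto simp: a_def b_def)
qed

end

section \<open>Integrals over nearly straight sheets\<close>

lemma ennreal_le_of_power2_le:
 fixes a :: ennreal
 assumes "a\<^sup>2 \<le> (ennreal b)\<^sup>2" "b \<ge> 0"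
 shows "a \<le> ennreal b"
 using assms by (cases a) (auto simp: ennreal_power top_unique ennreal_le_iff intro: power2_le_imp_le ennreal_leI)

lemma abs_integral_diff_le:
 fixes f g h :: "real \<Rightarrow> real"
 assumes "integrable lborel f" "integrable lborel g" "integrable lborel h" "\<And>x. \<bar>f x - g x\<bar> \<le> h x"
 shows "\<bar>(LBINT x. f x) - (LBINT x. g x)\<bar> \<le> (LBINT x. h x)"
proof -
 have "\<bar>(LBINT x. f x) - (LBINT x. g x)\<bar> = \<bar>LBINT x. f x - g x\<bar>"
  using assms by simp
 also have "\<dots> \<le> (LBINT x. \<bar>f x - g x\<bar>)" by (rule integral_abs_bound)
 also have "\<dots> \<le> (LBINT x. h x)" using assms by (intro integral_mono) auto
 finally show ?thesis .
qed

lemma integrable_compact_support: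
 fixes f :: "real \<Rightarrow> real"
 assumes "continuous_on UNIV f" "\<And>x. x \<notin> {a..b} \<Longrightarrow> f x = 0"
 shows "integrable lborel f"
proof -
 have "integrable lborel (\<lambda>x. indicator {a..b} x *\<^sub>R f x)"
  by (rule borel_integrable_compact[OF _ continuous_on_subset[OF assms(1)]]) auto
 moreover have "(\<lambda>x. indicator {a..b} x *\<^sub>R f x) = f"
  using assms(2) by (auto simp: fun_eq_iff indicator_def)
 ultimately show ?thesis by simp
qed

lemma gaussian_integral:
 assumes "l > 0"
 shows "integrable lborel (\<lambda>x::real. exp (- x\<^sup>2 / (4 * l)))" "(LBINT x. exp (- (x::real)\<^sup>2 / (4 * l))) = sqrt (4 * pi * l)"
proof -
 have n: "(NE x. exp (- (x::real)\<^sup>2 / (4 * l))) = ennreal (sqrt (4 * pi * l))"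
  using nn_integral_gaussian[OF assms, of 0] by simp
 show "integrable lborel (\<lambda>x::real. exp (- x\<^sup>2 / (4 * l)))"
  by (rule integrableI_nonneg) (use n in auto)
 show "(LBINT x. exp (- (x::real)\<^sup>2 / (4 * l))) = sqrt (4 * pi * l)"
  using assms n by (subst integral_eq_nn_integral) auto
qed

lemma uniform_modulus_compact_support:
 fixes ph :: "'a::euclidean_space \<Rightarrow> real"
 assumes "continuous_on UNIV ph" "\<And>x. norm x \<ge> R \<Longrightarrow> ph x = 0" "e > 0"
 shows "\<exists>d>0. \<forall>x y. norm (x - y) \<le> d \<longrightarrow> \<bar>ph x - ph y\<bar> \<le> e"
proof -
 have "uniformly_continuous_on (cball 0 (R + 1)) ph"
  by (rule compact_uniformly_continuous[OF continuous_on_subset[OF assms(1)]]) auto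
 then obtain d where d: "d > 0" "\<And>x y. x \<in> cball 0 (R+1) \<Longrightarrow> y \<in> cball 0 (R+1) \<Longrightarrow> dist y x < d \<Longrightarrow> dist (ph y) (ph x) < e"
  using assms(3) unfolding uniformly_continuous_on_def by metis
 have "\<bar>ph x - ph y\<bar> \<le> e" if "norm (x - y) \<le> min (d/2) 1" for x y
 proof (cases "norm x \<le> R + 1 \<and> norm y \<le> R + 1")
  case True
  have "dist x y < d" using that d(1) by (simp add: dist_norm)
  thus ?thesis using d(2)[of y x] True by (auto simp: dist_real_def)
 next
  case False
  have "norm x \<le> norm y + norm (x - y)" "norm y \<le> norm x + norm (x - y)"
   using norm_triangle_sub[of x y] norm_triangle_sub[of y x] by (auto simp: norm_minus_commute)
  hence "norm x \<ge> R" "norm y \<ge> R" using False that by auto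
  thus ?thesis using assms by simp
 qed
 thus ?thesis using d(1) by (intro exI[of _ "min (d/2) 1"]) auto
qed

context ucurve
begin

lemma gauss_integral:
 assumes "l > 0"
 shows "integrable lborel (\<lambda>s. exp (- (norm (c s))\<^sup>2 / (4 * l)))"
  "(LBINT s. exp (- (norm (c s))\<^sup>2 / (4 * l))) \<le> E * sqrt (4 * pi * l)"
proof -
 have n: "(NE s. exp (- (norm (c s))\<^sup>2 / (4 * l))) \<le> ennreal (E * sqrt (4 * pi * l))"
  using gauss[OF assms, of 0] by simp
 show "integrable lborel (\<lambda>s. exp (- (norm (c s))\<^sup>2 / (4 * l)))"
  by (rule integrableI_nonneg) (use n in \<open>auto intro: le_less_trans\<close>)
 show "(LBINT s. exp (- (norm (c s))\<^sup>2 / (4 * l))) \<le> E * sqrt (4 * pi * l)"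
  by (rule integral_real_bounded) (use n E assms in auto)
qed

text \<open>Two nearly straight sheets through the origin in different directions meet, by Brouwer's theorem.\<close>
lemma sheets_parallel:
 assumes R: "R > 2" and et: "et > 0" "et < 1/4"
  and pq: "p \<in> sheets c R" "q \<in> sheets c R" "p \<noteq> q"
  and P: "straight_sheet c ag R et p P" and Q: "straight_sheet c ag R et q Q"
 shows "\<bar>sin (snd P - snd Q)\<bar> \<le> 2 * et"
proof (rule ccontr)
 define S where "S = sin (snd P - snd Q)"
 assume "\<not> ?thesis"
 hence S: "\<bar>S\<bar> > 2 * et" by (simp add: S_def)
 define w where "w = (\<lambda>xy. c (fst P + fst xy) - c (fst Q + snd xy))"
 \<comment> \<open>For two exact lines \<open>w\<close> would be x cis(P) - y cis(Q) and the two
   quotients would be x and y, so \<open>F\<close> would vanish; the errors of the sheets keep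
   \<open>F\<close> inside the square. At a fixed point both quotients are zero, and as the two
   directions are independent this means that \<open>w\<close> is zero.\<close>
 define F where "F = (\<lambda>xy. (fst xy - Im (w xy * cis (- snd Q)) / S, snd xy - Im (w xy * cis (- snd P)) / S))"
 define K where "K = {-1..1::real} \<times> {-1..1::real}"
 have Pc: "norm (c (fst P + x) - of_real x * cis (snd P)) \<le> et" "fst P + x \<in> {fst p<..<snd p}" if "x \<in> {-1..1}" for x
 proof -
  show "fst P + x \<in> {fst p<..<snd p}" using P that R et by (auto simp: straight_sheet_def)
  hence "norm (c (fst P + x) - of_real (fst P + x - fst P) * cis (snd P)) \<le> et" using P unfolding straight_sheet_def by (meson atLeastAtMost_iff greaterThanLessThan_iff less_imp_le)
  thus "norm (c (fst P + x) - of_real x * cis (snd P)) \<le> et" by simp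
 qed
 have Qc: "norm (c (fst Q + x) - of_real x * cis (snd Q)) \<le> et" "fst Q + x \<in> {fst q<..<snd q}" if "x \<in> {-1..1}" for x
 proof -
  show "fst Q + x \<in> {fst q<..<snd q}" using Q that R et by (auto simp: straight_sheet_def)
  hence "norm (c (fst Q + x) - of_real (fst Q + x - fst Q) * cis (snd Q)) \<le> et" using Q unfolding straight_sheet_def by (meson atLeastAtMost_iff greaterThanLessThan_iff less_imp_le)
  thus "norm (c (fst Q + x) - of_real x * cis (snd Q)) \<le> et" by simp
 qed
 have FK: "F xy \<in> K" if xyK: "xy \<in> K" for xy
 proof -
  obtain x y where xy: "xy = (x,y)" "x \<in> {-1..1}" "y \<in> {-1..1}" using xyK unfolding K_def by blast
  define err where "err = w xy - (of_real x * cis (snd P) - of_real y * cis (snd Q))"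
  have err: "norm err \<le> 2 * et"
   using norm_triangle_ineq4[of "c (fst P + x) - of_real x * cis (snd P)" "c (fst Q + y) - of_real y * cis (snd Q)"] 
    Pc(1)[OF xy(2)] Qc(1)[OF xy(3)] by (simp add: err_def w_def xy algebra_simps)
  have w: "w xy = of_real x * cis (snd P) - of_real y * cis (snd Q) + err" by (simp add: err_def)
  have 1: "Im (w xy * cis (- snd Q)) = x * S + Im (err * cis (- snd Q))"
   unfolding w S_def by (simp add: algebra_simps sin_diff)
  have 2: "Im (w xy * cis (- snd P)) = y * S + Im (err * cis (- snd P))"
   unfolding w S_def by (simp add: algebra_simps sin_diff)
  have "\<bar>Im (err * cis a) / S\<bar> \<le> 1" for a
  proof -
   have "\<bar>Im (err * cis a)\<bar> \<le> norm (err * cis a)" by (rule abs_Im_le_cmod)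
   also have "\<dots> \<le> \<bar>S\<bar>" using err S by (simp add: norm_mult)
   finally show ?thesis using S et by (simp add: divide_le_eq_1)
  qed
  note b = this[of "- snd Q"] this[of "- snd P"]
  have "S \<noteq> 0" using S et by auto
  hence Fxy: "F xy = (- (Im (err * cis (- snd Q)) / S), - (Im (err * cis (- snd P)) / S))"
   unfolding F_def 1 2 by (simp only: xy fst_conv snd_conv add_divide_distrib nonzero_mult_div_cancel_right) simp
  have "- u \<in> {-1..1}" if "\<bar>u\<bar> \<le> 1" for u :: real using that by auto
  thus ?thesis unfolding Fxy K_def using b by blast
 qed
 have "continuous_on K F" unfolding F_def w_def
  by (intro continuous_intros continuous_on_compose2[OF cont(1)[of UNIV]]) (use S et in auto)
 then obtain xy where fx: "xy \<in> K" "F xy = xy"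
  using brouwer[of K F] FK by (auto simp: K_def compact_Times convex_Times)
 have z: "Im (w xy * cis (- snd Q)) = 0" "Im (w xy * cis (- snd P)) = 0"
  using fx(2) S et by (auto simp: F_def prod_eq_iff)
 have "Re (w xy) * S = 0" "Im (w xy) * S = 0"
 proof -
  have a: "Im (w xy) * cos (snd Q) = Re (w xy) * sin (snd Q)" "Im (w xy) * cos (snd P) = Re (w xy) * sin (snd P)"
   using z by (auto simp: algebra_simps)
  have "Re (w xy) * S = (Re (w xy) * sin (snd P)) * cos (snd Q) - (Re (w xy) * sin (snd Q)) * cos (snd P)"
   by (simp add: S_def sin_diff algebra_simps)
  also have "\<dots> = 0" unfolding a[symmetric] by simp
  finally show "Re (w xy) * S = 0" .
  have "Im (w xy) * S = sin (snd P) * (Im (w xy) * cos (snd Q)) - sin (snd Q) * (Im (w xy) * cos (snd P))"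
   by (simp add: S_def sin_diff algebra_simps)
  also have "\<dots> = 0" unfolding a by simp
  finally show "Im (w xy) * S = 0" .
 qed
 hence "w xy = 0" using S et by (auto simp: complex_eq_iff)
 \<comment> \<open>By injectivity the two parameters coincide, but they belong to disjoint
   sheets.\<close>
 hence "fst P + fst xy = fst Q + snd xy" using inj by (auto simp: w_def inj_def)
 moreover have "fst xy \<in> {-1..1}" "snd xy \<in> {-1..1}" using fx by (auto simp: K_def)
 ultimately show False using sheets_disjoint[OF pq(1,2)] Pc(2) Qc(2) pq(3) by metis
qed

text \<open>The integrand may depend on the position and on the tangent angle, which covers test
  functions as well as Gaussian integrals of the doubled angle. A support in the ball of radius
  \<open>R - 2\<close> leaves the room needed: a curve point there lies on a sheet, at distance less
  than \<open>R - 1\<close> along its line.\<close>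

lemma sheet_integral:
 assumes R: "R > 2" and et: "et > 0" "et < 1/4"
  and Q: "\<And>p. p \<in> sheets c R \<Longrightarrow> straight_sheet c ag R et p (Q p)"
  and ps: "continuous_on UNIV (\<lambda>(x,t). ps x t)" "\<And>x t. norm x \<ge> R - 2 \<Longrightarrow> ps x t = 0"
  and om: "om \<ge> 0" "\<And>x y s t. norm (x - y) \<le> et \<Longrightarrow> \<bar>s - t\<bar> \<le> et \<Longrightarrow> \<bar>ps x s - ps y t\<bar> \<le> om"
 shows "integrable lborel (\<lambda>s. ps (c s) (ag s))"
  "\<bar>(LBINT s. ps (c s) (ag s)) - (\<Sum>p\<in>sheets c R. LBINT r. ps (of_real r * cis (snd (Q p))) (snd (Q p)))\<bar> \<le> 12 * E * R\<^sup>2 * om"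
proof -
 define h where "h = (\<lambda>s. ps (c s) (ag s))"
 define I where "I = (\<lambda>p. {fst (Q p) - (R - 1)..fst (Q p) + (R - 1)})"
 have fin: "finite (sheets c R)" "real (card (sheets c R)) \<le> 6 * E * R" using sheets_finite(1,2) R by auto
 have conth: "continuous_on S h" for S
  unfolding h_def using continuous_on_compose2[OF ps(1), of S "\<lambda>s. (c s, ag s)"] by (auto intro!: continuous_intros cont)
 have Isub: "I p \<subseteq> {fst p<..<snd p}" if "p \<in> sheets c R" for p
  using Q[OF that] R et by (auto simp: straight_sheet_def I_def)
 \<comment> \<open>A parameter lies in at most one \<open>I p\<close>; one that lies in none has
   norm at least \<open>R - 2\<close>, where the integrand vanishes.\<close>
 have hsum: "h s = (\<Sum>p\<in>sheets c R. indicator (I p) s *\<^sub>R h s)" for s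
 proof (cases "\<exists>p\<in>sheets c R. s \<in> I p")
  case True
  then obtain p where p: "p \<in> sheets c R" "s \<in> I p" by blast
  have "s \<notin> I q" if "q \<in> sheets c R - {p}" for q
   using sheets_disjoint[of p R q s] Isub[OF p(1)] Isub[of q] p that by blast
  hence "(\<Sum>p\<in>sheets c R. indicator (I p) s *\<^sub>R h s) = (\<Sum>q\<in>{p}. indicator (I q) s *\<^sub>R h s)"
   using p by (intro sum.mono_neutral_right fin) (auto simp: indicator_def)
  thus ?thesis using p by simp
 next
  case False
  have "norm (c s) \<ge> R - 2"
  proof (rule ccontr)
   assume a: "\<not> ?thesis"
   hence "norm (c s) < R - 1" by simp
   then obtain p where p: "p \<in> sheets c R" "s \<in> {fst p<..<snd p}" using sheets_cover[of R s] R by auto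
   hence "norm (c s - of_real (s - fst (Q p)) * cis (snd (Q p))) \<le> et" using Q[OF p(1)] by (auto simp: straight_sheet_def)
   hence "\<bar>s - fst (Q p)\<bar> \<le> norm (c s) + et"
    using norm_triangle_ineq3[of "c s" "of_real (s - fst (Q p)) * cis (snd (Q p))"] by (simp add: norm_mult del: of_real_diff)
   hence "s \<in> I p" using a et by (auto simp: I_def)
   thus False using False p by blast
  qed
  thus ?thesis using ps(2) by (simp add: h_def)
 qed
 have int: "integrable lborel (\<lambda>s. indicator (I p) s *\<^sub>R h s)" for p
  unfolding I_def by (intro borel_integrable_compact conth) auto
 have "integrable lborel (\<lambda>s. \<Sum>p\<in>sheets c R. indicator (I p) s *\<^sub>R h s)" using int by auto
 moreover have "(\<lambda>s. \<Sum>p\<in>sheets c R. indicator (I p) s *\<^sub>R h s) = h" using hsum by (simp add: fun_eq_iff)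
 ultimately have "integrable lborel h" by simp
 thus "integrable lborel (\<lambda>s. ps (c s) (ag s))" by (simp add: h_def)
 have inth: "(LBINT s. h s) = (\<Sum>p\<in>sheets c R. LBINT s. indicator (I p) s *\<^sub>R h s)"
  by (subst hsum) (use int in simp)
 have each: "\<bar>(LBINT s. indicator (I p) s *\<^sub>R h s) - (LBINT r. ps (of_real r * cis (snd (Q p))) (snd (Q p)))\<bar> \<le> 2 * R * om"
  if p: "p \<in> sheets c R" for p
 proof -
  define l where "l = (\<lambda>r. ps (of_real r * cis (snd (Q p))) (snd (Q p)))"
  have contl: "continuous_on UNIV l"
  proof -
   have "continuous_on UNIV ((\<lambda>(x,t). ps x t) \<circ> (\<lambda>r. (of_real r * cis (snd (Q p)), snd (Q p))))"
    by (intro continuous_on_compose continuous_on_subset[OF ps(1)] continuous_intros) auto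
   thus ?thesis by (simp add: l_def o_def)
  qed
  have l0: "l r = 0" if "\<bar>r\<bar> \<ge> R - 2" for r unfolding l_def using ps(2) that by (simp add: norm_mult)
  have "(LBINT r. l r) = (LBINT s. l (s - fst (Q p)))"
   using lborel_integral_real_affine[of 1 l "- fst (Q p)"] by simp
  moreover have "\<bar>(LBINT s. indicator (I p) s *\<^sub>R h s) - (LBINT s. l (s - fst (Q p)))\<bar> \<le> (LBINT s. indicator (I p) s *\<^sub>R om)"
  proof (rule abs_integral_diff_le[OF int])
   show "integrable lborel (\<lambda>s. l (s - fst (Q p)))"
    by (rule integrable_compact_support[of _ "fst (Q p) - R" "fst (Q p) + R"])
     (use l0 in \<open>auto intro!: continuous_on_compose2[OF contl] continuous_intros\<close>)
   show "integrable lborel (\<lambda>s. indicator (I p) s *\<^sub>R om)" unfolding I_def by (intro borel_integrable_compact) auto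
   show "\<bar>indicator (I p) s *\<^sub>R h s - l (s - fst (Q p))\<bar> \<le> indicator (I p) s *\<^sub>R om" for s
   proof (cases "s \<in> I p")
    case True
    hence "s \<in> {fst p..snd p}" using Isub[OF p] by force
    hence "norm (c s - of_real (s - fst (Q p)) * cis (snd (Q p))) \<le> et" "\<bar>ag s - snd (Q p)\<bar> \<le> et"
     using Q[OF p] by (auto simp: straight_sheet_def)
    thus ?thesis using om(2) True by (simp add: h_def l_def)
   next
    case False
    hence "\<bar>s - fst (Q p)\<bar> \<ge> R - 2" by (auto simp: I_def)
    thus ?thesis using l0 False by simp
   qed
  qed
  moreover have "(LBINT s. indicator (I p) s *\<^sub>R om) = 2 * (R - 1) * om"
   using R by (simp add: I_def algebra_simps)
  moreover have "2 * (R - 1) * om \<le> 2 * R * om" using om(1) by (intro mult_right_mono) auto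
  ultimately show ?thesis unfolding l_def by linarith
 qed
 have "\<bar>(LBINT s. h s) - (\<Sum>p\<in>sheets c R. LBINT r. ps (of_real r * cis (snd (Q p))) (snd (Q p)))\<bar>
  \<le> (\<Sum>p\<in>sheets c R. 2 * R * om)"
  unfolding inth sum_subtractf[symmetric] by (rule order_trans[OF sum_abs sum_mono]) (rule each)
 also have "\<dots> = real (card (sheets c R)) * (2 * R * om)" by simp
 also have "\<dots> \<le> 6 * E * R * (2 * R * om)" using fin(2) R om(1) by (intro mult_right_mono) auto
 finally show "\<bar>(LBINT s. ps (c s) (ag s)) - (\<Sum>p\<in>sheets c R. LBINT r. ps (of_real r * cis (snd (Q p))) (snd (Q p)))\<bar> \<le> 12 * E * R\<^sup>2 * om"
  by (simp add: h_def power2_eq_square mult_ac)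
qed

text \<open>\<open>M\<close> adds up the constants with which the square root of the energy enters
  the two smallness conditions of \<open>sheet_is_straight\<close>, so that the single threshold et
  / M serves both.\<close>

lemma straight_sheets_of_energy:
 assumes R: "R > 2" and et: "et > 0" "et < 1/4"
  and M: "M = (6 * E * R + 1) * sqrt (6 * E * R * exp (R\<^sup>2 / 4)) + exp (R\<^sup>2 / 8)"
  and en: "(NE s. ((k s)\<^sup>2 + (Im (c s * cis (- ag s)))\<^sup>2) * exp (- (norm (c s))\<^sup>2 / 4)) \<le> ennreal ((et / M)\<^sup>2)"
  and p: "p \<in> sheets c R"
 shows "\<exists>q. straight_sheet c ag R et p q"
proof -
 define A where "A = sqrt (6 * E * R * exp (R\<^sup>2 / 4))"
 define x where "x = et / M"
 have A: "A \<ge> 0" using E R by (simp add: A_def)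
 have "M > 0" unfolding M using E R by (intro add_nonneg_pos) auto
 hence x: "x > 0" "x * M = et" using et by (auto simp: x_def)
 have e1: "(NE s. (k s)\<^sup>2 * exp (- (norm (c s))\<^sup>2 / 4)) \<le> ennreal (x\<^sup>2)"
  unfolding x_def by (rule order_trans[OF nn_integral_mono en]) (auto intro!: ennreal_leI mult_right_mono)
 have e2: "(NE s. (Im (c s * cis (- ag s)))\<^sup>2 * exp (- (norm (c s))\<^sup>2 / 4)) \<le> ennreal (x\<^sup>2)"
  unfolding x_def by (rule order_trans[OF nn_integral_mono en]) (intro ennreal_leI mult_right_mono; simp)
 have be: "(NN s. ennreal \<bar>k s\<bar> * indicator {s. norm (c s) \<le> R} s) \<le> ennreal (A * x)" (is "?L \<le> _")
 proof -
  have "?L\<^sup>2 \<le> ennreal (6 * E * R * exp (R\<^sup>2 / 4)) * (NE s. (k s)\<^sup>2 * exp (- (norm (c s))\<^sup>2 / 4))"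
   using curvature_in_ball_square_le[of R 4] R by simp
  also have "\<dots> \<le> ennreal (6 * E * R * exp (R\<^sup>2 / 4)) * ennreal (x\<^sup>2)" by (intro mult_left_mono e1) auto
  also have "\<dots> = ennreal ((A * x)\<^sup>2)" using E R by (simp add: ennreal_mult'[symmetric] power_mult_distrib A_def)
  also have "\<dots> = (ennreal (A * x))\<^sup>2" using A x by (simp add: ennreal_power)
  finally show ?thesis using A x by (intro ennreal_le_of_power2_le) auto
 qed
 have Ax: "A * x \<le> et" "6 * E * R * (A * x) + exp (R\<^sup>2 / 8) * sqrt (x\<^sup>2) \<le> et"
 proof -
  have "et = 6 * E * R * (A * x) + A * x + exp (R\<^sup>2 / 8) * x" using x(2) unfolding M A_def[symmetric] by (simp add: algebra_simps)
  moreover have "0 \<le> 6 * E * R * (A * x)" "0 \<le> A * x" "0 \<le> exp (R\<^sup>2 / 8) * x" using A x E R by auto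
  ultimately show "A * x \<le> et" "6 * E * R * (A * x) + exp (R\<^sup>2 / 8) * sqrt (x\<^sup>2) \<le> et" using x by auto
 qed
 show ?thesis
  by (rule sheet_is_straight[OF R et _ be _ e2 Ax(2,1) p]) (use A x in auto)
qed

end

section \<open>Small energy: closeness to a line with multiplicity\<close>

text \<open>With R = x + 3 the crude bounds exp(-x^2/8) <= 8/x^2 and 1 + 6 R <= 25 x suffice; hence
  the 200.\<close>

lemma gaussian_tail_small:
 assumes "A > 0" "e > 0"
 shows "\<exists>R\<ge>r0. R \<ge> 4 \<and> A * (1 + 6 * R) * exp (- (R - 3)\<^sup>2 / 8) \<le> (e::real)"
proof -
 define x where "x = max (max 1 r0) (200 * A / e)"
 have x: "x \<ge> 1" "x \<ge> r0" "x \<ge> 200 * A / e" by (auto simp: x_def)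
 have "exp (- x\<^sup>2 / 8) \<le> 8 / x\<^sup>2"
 proof -
  have "x\<^sup>2 / 8 \<le> exp (x\<^sup>2 / 8)" using exp_ge_add_one_self[of "x\<^sup>2 / 8"] by linarith
  thus ?thesis using x(1) by (simp add: exp_minus field_simps)
 qed
 hence "A * (1 + 6 * (x + 3)) * exp (- x\<^sup>2 / 8) \<le> A * (25 * x) * (8 / x\<^sup>2)"
  using assms x(1) by (intro mult_mono mult_left_mono mult_nonneg_nonneg) auto
 also have "\<dots> = 200 * A / x" using x(1) by (simp add: power2_eq_square)
 also have "\<dots> \<le> e" using x assms by (simp add: field_simps)
 finally show ?thesis using x by (intro exI[of _ "x + 3"]) auto
qed

text \<open>A small sine determines the angle only modulo pi, hence the sign: lines carry no
  orientation.\<close>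

lemma cis_sign_close:
 assumes "\<bar>sin (a - b)\<bar> \<le> 2 * et"
 shows "\<exists>g\<in>{1,-1::real}. norm (cis a - of_real g * cis b) \<le> 3 * et"
proof -
 define g where "g = (if cos (a - b) \<ge> 0 then 1 else - 1 :: real)"
 have gc: "g * cos (a - b) = \<bar>cos (a - b)\<bar>" "g\<^sup>2 = 1" by (auto simp: g_def)
 have "norm (cis a - of_real g * cis b) = norm ((cis a - of_real g * cis b) * cis (- b))" by (simp add: norm_mult)
 also have "(cis a - of_real g * cis b) * cis (- b) = cis (a - b) - of_real g" by (simp add: left_diff_distrib cis_mult mult.assoc)
 finally have n: "norm (cis a - of_real g * cis b) = norm (cis (a - b) - of_real g)" .
 have "(norm (cis (a - b) - of_real g))\<^sup>2 = (cos (a - b) - g)\<^sup>2 + (sin (a - b))\<^sup>2"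
  by (simp add: cmod_power2)
 also have "\<dots> = 2 - 2 * \<bar>cos (a - b)\<bar>"
  using sin_squared_eq[of "a - b"] gc by (simp add: power2_diff mult.commute)
 also have "\<dots> \<le> 2 - 2 * (cos (a - b))\<^sup>2"
 proof -
  have "\<bar>cos (a - b)\<bar> * \<bar>cos (a - b)\<bar> \<le> \<bar>cos (a - b)\<bar> * 1" by (intro mult_left_mono) auto
  thus ?thesis by (simp add: power2_eq_square)
 qed
 also have "\<dots> = 2 * \<bar>sin (a - b)\<bar>\<^sup>2" by (simp add: sin_squared_eq)
 also have "\<dots> \<le> 2 * (2 * et)\<^sup>2" using assms by (intro mult_left_mono power_mono) auto
 also have "\<dots> \<le> (3 * et)\<^sup>2" by (simp add: power_mult_distrib)
 finally have sq: "(norm (cis (a - b) - of_real g))\<^sup>2 \<le> (3 * et)\<^sup>2" .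
 have "0 \<le> 3 * et" using assms abs_ge_zero[of "sin (a - b)"] by linarith
 with sq have "norm (cis (a - b) - of_real g) \<le> 3 * et" by (rule power2_le_imp_le)
 thus ?thesis using n by (intro bexI[of _ g]) (auto simp: g_def)
qed

lemma abs_cos_sin_double_diff_le:
 fixes a b :: real
 shows "\<bar>cos (2 * a) - cos (2 * b)\<bar> \<le> 2 * \<bar>sin (a - b)\<bar>" "\<bar>sin (2 * a) - sin (2 * b)\<bar> \<le> 2 * \<bar>sin (a - b)\<bar>"
proof -
 have "cos (2 * a) - cos (2 * b) = 2 * sin (a + b) * sin (b - a)"
  using cos_diff_cos[of "2 * a" "2 * b"] by (simp add: add_divide_distrib diff_divide_distrib)
 hence "\<bar>cos (2 * a) - cos (2 * b)\<bar> = 2 * \<bar>sin (a + b)\<bar> * \<bar>sin (a - b)\<bar>"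
  using sin_minus[of "a - b"] by (simp add: abs_mult)
 also have "\<dots> \<le> 2 * 1 * \<bar>sin (a - b)\<bar>" by (intro mult_mono) auto
 finally show "\<bar>cos (2 * a) - cos (2 * b)\<bar> \<le> 2 * \<bar>sin (a - b)\<bar>" by simp
 have "sin (2 * a) - sin (2 * b) = 2 * sin (a - b) * cos (a + b)"
  using sin_diff_sin[of "2 * a" "2 * b"] by (simp add: add_divide_distrib diff_divide_distrib)
 hence "\<bar>sin (2 * a) - sin (2 * b)\<bar> = 2 * \<bar>cos (a + b)\<bar> * \<bar>sin (a - b)\<bar>"
  by (simp add: abs_mult)
 also have "\<dots> \<le> 2 * 1 * \<bar>sin (a - b)\<bar>" by (intro mult_mono) auto
 finally show "\<bar>sin (2 * a) - sin (2 * b)\<bar> \<le> 2 * \<bar>sin (a - b)\<bar>" by simp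
qed

text \<open>\<open>N\<close> counts the sheets and \<open>al\<close> is the angle of one of them.
  That the same \<open>N\<close> and \<open>al\<close> serve all four integrals is the point: it
  lets the limits of the three Gaussian integrals determine the limit of the test integral. The
  radius is dictated by the Gaussian tail, the accuracy \<open>et\<close> of the sheets by moduli of
  continuity at that radius, and the energy threshold by both.\<close>

lemma straight_approx:
 fixes ph :: "complex \<Rightarrow> real"
 assumes E: "E > 0" and ph: "continuous_on UNIV ph" "\<And>x. norm x \<ge> R0 \<Longrightarrow> ph x = 0" and ep: "ep > 0"
 shows "\<exists>de>0. \<forall>c ag k. ucurve c ag k E \<longrightarrow>
  (NE s. ((k s)\<^sup>2 + (Im (c s * cis (- ag s)))\<^sup>2) * exp (- (norm (c s))\<^sup>2 / 4)) \<le> ennreal de \<longrightarrow>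
  (\<exists>(N::nat) al. \<bar>(LBINT s. ph (c s)) - N * (LBINT r. ph (of_real r * cis al))\<bar> \<le> ep
   \<and> \<bar>(LBINT s. exp (- (norm (c s))\<^sup>2 / 4)) - N * sqrt (4 * pi)\<bar> \<le> ep
   \<and> \<bar>(LBINT s. cos (2 * ag s) * exp (- (norm (c s))\<^sup>2 / 4)) - N * cos (2 * al) * sqrt (4 * pi)\<bar> \<le> ep
   \<and> \<bar>(LBINT s. sin (2 * ag s) * exp (- (norm (c s))\<^sup>2 / 4)) - N * sin (2 * al) * sqrt (4 * pi)\<bar> \<le> ep)"
proof -
 have "E * sqrt (4 * pi * 2) > 0" "ep / 2 > 0" using E ep by auto
 from gaussian_tail_small[OF this, of "R0 + 2"] obtain R where
  R: "R \<ge> R0 + 2" "R \<ge> 4" and tail: "E * sqrt (4 * pi * 2) * (1 + 6 * R) * exp (- (R - 3)\<^sup>2 / 8) \<le> ep / 2" by blast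
 define B where "B = exp (- (R - 3)\<^sup>2 / 8)"
 \<comment> \<open>The cutoff vanishes from radius \<open>R - 2\<close> on, as
   \<open>sheet_integral\<close> requires, and is 1 up to \<open>R - 3\<close>; the part removed is
   at most \<open>B\<close> times a Gaussian of twice the scale, which the entropy bound controls on
   the noncompact curve.\<close>
 define cut where "cut = (\<lambda>x::complex. max 0 (min 1 (R - 2 - norm x)))"
 define G where "G = (\<lambda>x::complex. exp (- (norm x)\<^sup>2 / 4) * cut x)"
 have contcut: "continuous_on UNIV cut" unfolding cut_def by (intro continuous_intros)
 have contG: "continuous_on UNIV G" unfolding G_def by (intro continuous_intros contcut) auto
 have cut01: "0 \<le> cut x" "cut x \<le> 1" for x by (auto simp: cut_def)
 have G01: "0 \<le> G x" "G x \<le> 1" for x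
  using cut01[of x] mult_mono[of "exp (- (norm x)\<^sup>2 / 4)" 1 "cut x" 1] by (auto simp: G_def)
 have G0: "G x = 0" if "norm x \<ge> R - 2" for x using that by (simp add: G_def cut_def)
 have Gtail: "\<bar>exp (- y\<^sup>2 / 4) - exp (- y\<^sup>2 / 4) * cut x\<bar> \<le> B * exp (- y\<^sup>2 / (4 * 2))" if y: "y = norm x" for x y
 proof (cases "y \<le> R - 3")
  case True
  hence "cut x = 1" using y by (simp add: cut_def)
  thus ?thesis by (simp add: B_def)
 next
  case False
  have "(R - 3)\<^sup>2 \<le> y\<^sup>2" using False R by (intro power_mono) auto
  hence "exp (- y\<^sup>2 / 8) \<le> B" by (simp add: B_def)
  hence "exp (- y\<^sup>2 / 8) * exp (- y\<^sup>2 / 8) \<le> B * exp (- y\<^sup>2 / 8)" by (intro mult_right_mono) auto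
  moreover have "exp (- y\<^sup>2 / 8) * exp (- y\<^sup>2 / 8) = exp (- y\<^sup>2 / 4)" by (simp flip: exp_add)
  moreover have "\<bar>exp (- y\<^sup>2 / 4) - exp (- y\<^sup>2 / 4) * cut x\<bar> \<le> exp (- y\<^sup>2 / 4)"
   using cut01[of x] mult_left_mono[of "cut x" 1 "exp (- y\<^sup>2 / 4)"] mult_nonneg_nonneg[of "exp (- y\<^sup>2 / 4)" "cut x"]
   by (auto simp: abs_if)
  ultimately have "\<bar>exp (- y\<^sup>2 / 4) - exp (- y\<^sup>2 / 4) * cut x\<bar> \<le> B * exp (- y\<^sup>2 / 8)" by linarith
  thus ?thesis by simp
 qed
 define g where "g = (LBINT r. G (of_real r))"
 have Gr: "G (of_real r * cis al) = G (of_real r)" for r al by (simp add: G_def cut_def norm_mult)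
 have intGr: "integrable lborel (\<lambda>r. G (of_real r))"
  by (rule integrable_compact_support[of _ "-R" R])
   (use G0 in \<open>auto intro!: continuous_on_compose2[OF contG] continuous_intros\<close>)
 have g: "\<bar>sqrt (4 * pi) - g\<bar> \<le> B * sqrt (4 * pi * 2)" "g \<ge> 0" "g \<le> sqrt (4 * pi)"
 proof -
  note gi = gaussian_integral[of 1] gaussian_integral[of 2]
  have "\<bar>(LBINT r. exp (- (r::real)\<^sup>2 / (4 * 1))) - (LBINT r. G (of_real r))\<bar> \<le> (LBINT r. B * exp (- (r::real)\<^sup>2 / (4 * 2)))"
  proof (rule abs_integral_diff_le[OF gi(1) intGr])
   show "\<bar>exp (- r\<^sup>2 / (4 * 1)) - G (of_real r)\<bar> \<le> B * exp (- r\<^sup>2 / (4 * 2))" for r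
    using Gtail[of "\<bar>r\<bar>" "of_real r"] by (simp add: G_def)
  qed (use gi(3) in auto)
  thus "\<bar>sqrt (4 * pi) - g\<bar> \<le> B * sqrt (4 * pi * 2)"
   using gi by (simp add: g_def)
  show "g \<ge> 0" unfolding g_def by (intro integral_nonneg_AE AE_I2 G01)
  have "g \<le> (LBINT r. exp (- (r::real)\<^sup>2 / (4 * 1)))" unfolding g_def
   using cut01 by (intro integral_mono gi(1) intGr) (auto simp: G_def mult_le_cancel_left1)
  thus "g \<le> sqrt (4 * pi)" using gi(2) by simp
 qed
 define M0 where "M0 = 12 * E * R\<^sup>2"
 have M0: "M0 > 0" using E R by (simp add: M0_def)
 define om where "om = ep / (8 * M0)"
 have om: "om > 0" "M0 * om = ep / 8" using ep M0 by (auto simp: om_def)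
 obtain d1 where d1: "d1 > 0" "\<And>x y. norm (x - y) \<le> d1 \<Longrightarrow> \<bar>ph x - ph y\<bar> \<le> om"
  using uniform_modulus_compact_support[OF ph om(1)] by blast
 have "om / 2 > 0" using om by simp
 from uniform_modulus_compact_support[OF contG G0 this]
 obtain d2 where d2: "d2 > 0" "\<And>x y. norm (x - y) \<le> d2 \<Longrightarrow> \<bar>G x - G y\<bar> \<le> om / 2" by blast
 \<comment> \<open>Directions of sheets agree within \<open>3 * et\<close> up to sign, so points at
   distance at most \<open>R\<close> on the corresponding lines are within
   \<open>3 * R * et\<close>, which must not exceed the modulus \<open>d1\<close>.\<close>
 define et where "et = min (min (d1 / (3 * R)) d2) (min (min (om / 4) (1/5)) (ep / (8 * (24 * E * R * sqrt (4 * pi)))))"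
 have X: "24 * E * R * sqrt (4 * pi) > 0" using E R by simp
 have et: "et > 0" "et < 1/4" "et \<le> d1 / (3 * R)" "et \<le> d2" "et \<le> om / 4" "et \<le> ep / (8 * (24 * E * R * sqrt (4 * pi)))"
  using d1 d2 om ep R X unfolding et_def by (auto simp del: mult_pos_pos)
 have et2: "3 * R * et \<le> d1" "24 * E * R * sqrt (4 * pi) * et \<le> ep / 8"
  using et(3,6) R X by (auto simp: field_simps)
 have "1 * et \<le> 3 * R * et" using et(1) R by (intro mult_right_mono) auto
 hence et3: "et \<le> d1" using et2(1) by simp
 define M where "M = (6 * E * R + 1) * sqrt (6 * E * R * exp (R\<^sup>2 / 4)) + exp (R\<^sup>2 / 8)"
 have "M > 0" unfolding M_def using E R by (intro add_nonneg_pos) auto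
 \<comment> \<open>Half of \<open>om\<close> is spent on the position and half on the angle, where
   the doubling costs a factor 2.\<close>
 have psmod: "\<bar>G x * f (2 * s) - G y * f (2 * t)\<bar> \<le> om"
  if "norm (x - y) \<le> et" "\<bar>s - t\<bar> \<le> et" "\<And>a b. \<bar>f a - f b\<bar> \<le> \<bar>a - b\<bar>" "\<And>a. \<bar>f a\<bar> \<le> 1" for x y s t and f :: "real \<Rightarrow> real"
 proof -
  have "\<bar>G x * f (2 * s) - G y * f (2 * t)\<bar> = \<bar>(G x - G y) * f (2 * s) + G y * (f (2 * s) - f (2 * t))\<bar>" by (simp add: algebra_simps)
  also have "\<dots> \<le> \<bar>G x - G y\<bar> * \<bar>f (2 * s)\<bar> + \<bar>G y\<bar> * \<bar>f (2 * s) - f (2 * t)\<bar>" by (simp add: abs_mult[symmetric] abs_triangle_ineq)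
  also have "\<dots> \<le> om / 2 * 1 + 1 * \<bar>2 * s - 2 * t\<bar>"
   using that d2(2)[of x y] et(4) G01[of y] om(1) by (intro add_mono mult_mono) auto
  also have "\<dots> \<le> om" using that(2) et(5) by simp
  finally show ?thesis .
 qed
 have coslip: "\<bar>cos a - cos b\<bar> \<le> \<bar>a - b\<bar>" "\<bar>sin a - sin b\<bar> \<le> \<bar>a - b\<bar>" for a b :: real
 proof -
  have "norm (cos a - cos b) \<le> 1 * norm (a - b)"
   by (rule field_differentiable_bound[where S=UNIV and f'="\<lambda>x. - sin x"]) (auto intro!: derivative_eq_intros)
  thus "\<bar>cos a - cos b\<bar> \<le> \<bar>a - b\<bar>" by simp
  have "norm (sin a - sin b) \<le> 1 * norm (a - b)"
   by (rule field_differentiable_bound[where S=UNIV and f'="\<lambda>x. cos x"]) (auto intro!: derivative_eq_intros)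
  thus "\<bar>sin a - sin b\<bar> \<le> \<bar>a - b\<bar>" by simp
 qed
 show ?thesis
 proof (intro exI[of _ "(et / M)\<^sup>2"] conjI allI impI)
  show "(et / M)\<^sup>2 > 0" using et(1) \<open>M > 0\<close> by simp
  fix c ag k
  assume u: "ucurve c ag k E" and en: "(NE s. ((k s)\<^sup>2 + (Im (c s * cis (- ag s)))\<^sup>2) * exp (- (norm (c s))\<^sup>2 / 4)) \<le> ennreal ((et / M)\<^sup>2)"
  interpret ucurve c ag k E by (rule u)
  have R2: "R > 2" using R by simp
  have "\<exists>Q. \<forall>p\<in>sheets c R. straight_sheet c ag R et p (Q p)"
   using straight_sheets_of_energy[OF R2 et(1,2) M_def en] by metis
  then obtain Q where Q: "\<And>p. p \<in> sheets c R \<Longrightarrow> straight_sheet c ag R et p (Q p)" by blast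
  define N where "N = card (sheets c R)"
  have fin: "finite (sheets c R)" "real N \<le> 6 * E * R" using sheets_finite(1,2) R by (auto simp: N_def)
  \<comment> \<open>Any sheet may supply the angle; without sheets every angle works.\<close>
  obtain al where al: "\<And>p. p \<in> sheets c R \<Longrightarrow> \<bar>sin (snd (Q p) - al)\<bar> \<le> 2 * et"
  proof (cases "sheets c R = {}")
   case False
   then obtain q where q: "q \<in> sheets c R" by blast
   have "\<bar>sin (snd (Q p) - snd (Q q))\<bar> \<le> 2 * et" if "p \<in> sheets c R" for p
    using sheets_parallel[OF R2 et(1,2) that q _ Q[OF that] Q[OF q]] et(1) by (cases "p = q") auto
   thus ?thesis using that by blast
  qed (use that in blast)
  have sumN: "\<bar>(\<Sum>p\<in>sheets c R. F p) - N * a\<bar> \<le> 6 * E * R * e" if "\<And>p. p \<in> sheets c R \<Longrightarrow> \<bar>F p - a\<bar> \<le> e" "e \<ge> 0" for F :: "real \<times> real \<Rightarrow> real" and a e :: real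
  proof -
   have "(\<Sum>p\<in>sheets c R. F p) - N * a = (\<Sum>p\<in>sheets c R. F p - a)" by (simp add: sum_subtractf N_def)
   also have "\<bar>\<dots>\<bar> \<le> (\<Sum>p\<in>sheets c R. e)" by (rule order_trans[OF sum_abs sum_mono]) (rule that)
   also have "\<dots> \<le> 6 * E * R * e" using fin(2) that(2) by (simp add: N_def mult_right_mono)
   finally show ?thesis .
  qed
  have 1: "\<bar>(LBINT s. ph (c s)) - N * (LBINT r. ph (of_real r * cis al))\<bar> \<le> ep"
  proof -
   have "\<bar>(LBINT s. ph (c s)) - (\<Sum>p\<in>sheets c R. LBINT r. ph (of_real r * cis (snd (Q p))))\<bar> \<le> 12 * E * R\<^sup>2 * om"
   proof (rule sheet_integral(2)[OF R2 et(1,2) Q, where ps="\<lambda>x t. ph x"])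
    show "continuous_on UNIV (\<lambda>(x, t). ph x)"
     unfolding case_prod_unfold by (intro continuous_on_compose2[OF ph(1)] continuous_intros) auto
   qed (use ph(2) R om(1) d1(2) et3 in auto)
   moreover have "\<bar>(\<Sum>p\<in>sheets c R. LBINT r. ph (of_real r * cis (snd (Q p)))) - N * (LBINT r. ph (of_real r * cis al))\<bar> \<le> 6 * E * R * (2 * R * om)"
   proof (rule sumN)
    fix p assume p: "p \<in> sheets c R"
    obtain gg where gg: "gg \<in> {1,-1::real}" "norm (cis (snd (Q p)) - of_real gg * cis al) \<le> 3 * et"
     using cis_sign_close[OF al[OF p]] by blast
    have il: "integrable lborel (\<lambda>r. ph (of_real r * z))" if "norm z = 1" for z
     by (rule integrable_compact_support[of _ "-R" R])
      (use ph(2) R that in \<open>auto intro!: continuous_on_compose2[OF ph(1)] continuous_intros simp: norm_mult\<close>)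
    \<comment> \<open>Reversing a line does not change its integral, so the sign \<open>gg\<close>
      is harmless.\<close>
    have "(LBINT r. ph (of_real r * cis al)) = (LBINT r. ph (of_real r * (of_real gg * cis al)))"
     using lborel_integral_real_affine[of "-1" "\<lambda>r. ph (of_real r * cis al)" 0] gg(1) by auto
    moreover have "\<bar>(LBINT r. ph (of_real r * cis (snd (Q p)))) - (LBINT r. ph (of_real r * (of_real gg * cis al)))\<bar>
      \<le> (LBINT r. indicator {-R..R} r *\<^sub>R om)"
    proof (rule abs_integral_diff_le)
     show "integrable lborel (\<lambda>r. indicator {-R..R} r *\<^sub>R om)" by (intro borel_integrable_compact) auto
     show "\<bar>ph (of_real r * cis (snd (Q p))) - ph (of_real r * (of_real gg * cis al))\<bar> \<le> indicator {-R..R} r *\<^sub>R om" for r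
     proof (cases "r \<in> {-R..R}")
      case True
      have "norm (of_real r * cis (snd (Q p)) - of_real r * (of_real gg * cis al)) = \<bar>r\<bar> * norm (cis (snd (Q p)) - of_real gg * cis al)"
       by (simp add: norm_mult flip: right_diff_distrib)
      also have "\<dots> \<le> R * (3 * et)" using True gg(2) R by (intro mult_mono) auto
      also have "\<dots> \<le> d1" using et2(1) by (simp add: mult_ac)
      finally show ?thesis using True d1(2) by simp
     next
      case False
      thus ?thesis using ph(2)[of "of_real r * cis (snd (Q p))"] ph(2)[of "of_real r * (of_real gg * cis al)"] R gg(1)
       by (auto simp: norm_mult)
     qed
    qed (rule il; use gg(1) in \<open>auto simp: norm_mult\<close>)+
    moreover have "(LBINT r. indicator {-R..R} r *\<^sub>R om) = 2 * R * om" using R by simp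
    ultimately show "\<bar>(LBINT r. ph (of_real r * cis (snd (Q p)))) - (LBINT r. ph (of_real r * cis al))\<bar> \<le> 2 * R * om"
     by linarith
   qed (use R om in auto)
   moreover have "6 * E * R * (2 * R * om) = M0 * om" "12 * E * R\<^sup>2 * om = M0 * om" by (auto simp: M0_def power2_eq_square)
   ultimately show ?thesis using om(2) ep by linarith
  qed
  \<comment> \<open>One argument for the weights 1, cosine and sine. Four errors are added:
    replacing sheets by lines, aligning the directions, and cutting off the Gaussian on the lines
    and on the curve.\<close>
  have F: "\<bar>(LBINT s. f (2 * ag s) * exp (- (norm (c s))\<^sup>2 / 4)) - N * f (2 * al) * sqrt (4 * pi)\<bar> \<le> ep"
   if f: "\<And>a b. \<bar>f a - f b\<bar> \<le> \<bar>a - b\<bar>" "\<And>a. \<bar>f a\<bar> \<le> 1" "\<And>a b. \<bar>f (2 * a) - f (2 * b)\<bar> \<le> 2 * \<bar>sin (a - b)\<bar>" "continuous_on UNIV f"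
   for f :: "real \<Rightarrow> real"
  proof -
   have Qf: "\<bar>(LBINT s. G (c s) * f (2 * ag s)) - (\<Sum>p\<in>sheets c R. LBINT r. G (of_real r * cis (snd (Q p))) * f (2 * snd (Q p)))\<bar> \<le> 12 * E * R\<^sup>2 * om"
    and iG: "integrable lborel (\<lambda>s. G (c s) * f (2 * ag s))"
   proof (rule sheet_integral(2)[OF R2 et(1,2) Q, where ps="\<lambda>x t. G x * f (2 * t)"])
    show cG: "continuous_on UNIV (\<lambda>(x, t). G x * f (2 * t))"
     unfolding case_prod_unfold by (intro continuous_intros continuous_on_compose2[OF contG] continuous_on_compose2[OF f(4)]) auto
    show "integrable lborel (\<lambda>s. G (c s) * f (2 * ag s))"
     by (rule sheet_integral(1)[OF R2 et(1,2) Q cG, of om]) (use G0 om(1) psmod[OF _ _ f(1,2)] in auto)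
   qed (use G0 om(1) psmod[OF _ _ f(1,2)] in auto)
   have "(\<Sum>p\<in>sheets c R. LBINT r. G (of_real r * cis (snd (Q p))) * f (2 * snd (Q p))) = (\<Sum>p\<in>sheets c R. g * f (2 * snd (Q p)))"
    using intGr by (intro sum.cong) (auto simp: Gr g_def)
   moreover have "\<bar>(\<Sum>p\<in>sheets c R. g * f (2 * snd (Q p))) - N * (g * f (2 * al))\<bar> \<le> 6 * E * R * (sqrt (4 * pi) * (4 * et))"
   proof (rule sumN)
    fix p assume p: "p \<in> sheets c R"
    have "\<bar>g * f (2 * snd (Q p)) - g * f (2 * al)\<bar> = g * \<bar>f (2 * snd (Q p)) - f (2 * al)\<bar>"
     using g(2) by (simp add: abs_mult flip: right_diff_distrib)
    also have "\<dots> \<le> sqrt (4 * pi) * (4 * et)"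
     using f(3)[of "snd (Q p)" al] al[OF p] g by (intro mult_mono) auto
    finally show "\<bar>g * f (2 * snd (Q p)) - g * f (2 * al)\<bar> \<le> sqrt (4 * pi) * (4 * et)" .
   qed (use et in auto)
   moreover have "\<bar>N * (g * f (2 * al)) - N * f (2 * al) * sqrt (4 * pi)\<bar> \<le> 6 * E * R * (B * sqrt (4 * pi * 2))"
   proof -
    have "N * (g * f (2 * al)) - N * f (2 * al) * sqrt (4 * pi) = N * (f (2 * al) * (g - sqrt (4 * pi)))" by (simp add: algebra_simps)
    also have "\<bar>\<dots>\<bar> = N * (\<bar>f (2 * al)\<bar> * \<bar>sqrt (4 * pi) - g\<bar>)" by (simp add: abs_mult abs_minus_commute)
    also have "\<dots> \<le> 6 * E * R * (1 * (B * sqrt (4 * pi * 2)))"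
     using fin(2) g(1) f(2)[of "2 * al"] E R by (intro mult_mono) auto
    finally show ?thesis by simp
   qed
   moreover have "\<bar>(LBINT s. f (2 * ag s) * exp (- (norm (c s))\<^sup>2 / 4)) - (LBINT s. G (c s) * f (2 * ag s))\<bar> \<le> B * (E * sqrt (4 * pi * 2))"
   proof -
    have "\<bar>(LBINT s. f (2 * ag s) * exp (- (norm (c s))\<^sup>2 / 4)) - (LBINT s. G (c s) * f (2 * ag s))\<bar>
      \<le> (LBINT s. B * exp (- (norm (c s))\<^sup>2 / (4 * 2)))"
    proof (rule abs_integral_diff_le[OF _ iG])
     have [measurable]: "f \<in> borel_measurable borel" using f(4) by (rule borel_measurable_continuous_onI)
     show "integrable lborel (\<lambda>s. f (2 * ag s) * exp (- (norm (c s))\<^sup>2 / 4))"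
      by (rule Bochner_Integration.integrable_bound[OF gauss_integral(1)[of 1]])
       (use f(2) in \<open>auto simp: abs_mult mult_le_cancel_right1 intro!: AE_I2\<close>)
     show "integrable lborel (\<lambda>s. B * exp (- (norm (c s))\<^sup>2 / (4 * 2)))" using gauss_integral(1)[of 2] by simp
     show "\<bar>f (2 * ag s) * exp (- (norm (c s))\<^sup>2 / 4) - G (c s) * f (2 * ag s)\<bar> \<le> B * exp (- (norm (c s))\<^sup>2 / (4 * 2))" for s
     proof -
      have "\<bar>f (2 * ag s) * exp (- (norm (c s))\<^sup>2 / 4) - G (c s) * f (2 * ag s)\<bar>
       = \<bar>f (2 * ag s)\<bar> * \<bar>exp (- (norm (c s))\<^sup>2 / 4) - exp (- (norm (c s))\<^sup>2 / 4) * cut (c s)\<bar>"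
       by (simp add: G_def algebra_simps flip: abs_mult)
      also have "\<dots> \<le> 1 * (B * exp (- (norm (c s))\<^sup>2 / (4 * 2)))" using f(2) Gtail[OF refl] by (intro mult_mono) auto
      finally show ?thesis by simp
     qed
    qed
    also have "\<dots> = B * (LBINT s. exp (- (norm (c s))\<^sup>2 / (4 * 2)))" by simp
    also have "\<dots> \<le> B * (E * sqrt (4 * pi * 2))" by (intro mult_left_mono gauss_integral) (auto simp: B_def)
    finally show ?thesis .
   qed
   moreover have "B * (E * sqrt (4 * pi * 2)) + 6 * E * R * (B * sqrt (4 * pi * 2)) \<le> ep / 2"
    using tail unfolding B_def[symmetric] by (simp add: algebra_simps)
   moreover have "6 * E * R * (sqrt (4 * pi) * (4 * et)) \<le> ep / 8" using et2(2) by (simp add: mult_ac)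
   moreover have "12 * E * R\<^sup>2 * om = ep / 8" using om(2) by (simp add: M0_def)
   ultimately show ?thesis using Qf ep by linarith
  qed
  show "\<exists>(N::nat) al. \<bar>(LBINT s. ph (c s)) - N * (LBINT r. ph (of_real r * cis al))\<bar> \<le> ep
   \<and> \<bar>(LBINT s. exp (- (norm (c s))\<^sup>2 / 4)) - N * sqrt (4 * pi)\<bar> \<le> ep
   \<and> \<bar>(LBINT s. cos (2 * ag s) * exp (- (norm (c s))\<^sup>2 / 4)) - N * cos (2 * al) * sqrt (4 * pi)\<bar> \<le> ep
   \<and> \<bar>(LBINT s. sin (2 * ag s) * exp (- (norm (c s))\<^sup>2 / 4)) - N * sin (2 * al) * sqrt (4 * pi)\<bar> \<le> ep"
   using 1 F[of "\<lambda>_. 1"] F[of cos] F[of sin] coslip abs_cos_sin_double_diff_le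
    continuous_on_cos[OF continuous_on_id[of "UNIV :: real set"]] continuous_on_sin[OF continuous_on_id[of "UNIV :: real set"]]
   by (intro exI[of _ N] exI[of _ al] conjI) auto
 qed
qed

section \<open>Curve shortening flow in complex notation\<close>

text \<open>\<open>J\<close> is the speed, \<open>ag\<close> the tangent angle, \<open>kp\<close> the curvature and \<open>kps\<close> its arc length derivative.
  The flow lives on \<open>t \<le> 0\<close>; only for convenience all functions are continuous for positive times too.\<close>
locale csf =
 fixes z :: "real \<Rightarrow> real \<Rightarrow> complex" and J ag kp kps :: "real \<Rightarrow> real \<Rightarrow> real" and E :: real
 assumes J_pos: "\<And>t u. t \<le> 0 \<Longrightarrow> J t u > 0"
  and z_u: "\<And>t u. t \<le> 0 \<Longrightarrow> (z t has_vector_derivative (J t u *\<^sub>R cis (ag t u))) (at u)"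
  and z_t: "\<And>t u. t \<le> 0 \<Longrightarrow> ((\<lambda>s. z s u) has_vector_derivative (kp t u *\<^sub>R (\<i> * cis (ag t u)))) (at t within {..0})"
  and th_u: "\<And>t u. t \<le> 0 \<Longrightarrow> (ag t has_real_derivative kp t u * J t u) (at u)"
  and th_t: "\<And>t u. t \<le> 0 \<Longrightarrow> ((\<lambda>s. ag s u) has_real_derivative kps t u) (at t within {..0})"
  and kap_u: "\<And>t u. t \<le> 0 \<Longrightarrow> (kp t has_real_derivative kps t u * J t u) (at u)"
  and J_t: "\<And>t u. t \<le> 0 \<Longrightarrow> ((\<lambda>s. J s u) has_real_derivative - (kp t u)\<^sup>2 * J t u) (at t within {..0})"
  and contz: "continuous_on UNIV (\<lambda>p. z (fst p) (snd p))"
  and contJ: "continuous_on UNIV (\<lambda>p. J (fst p) (snd p))"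
  and contth: "continuous_on UNIV (\<lambda>p. ag (fst p) (snd p))"
  and contk: "continuous_on UNIV (\<lambda>p. kp (fst p) (snd p))"
  and contks: "continuous_on UNIV (\<lambda>p. kps (fst p) (snd p))"
  and inj: "\<And>t. t \<le> 0 \<Longrightarrow> inj (z t)"
  and len_right: "\<And>t u l. t \<le> 0 \<Longrightarrow> \<exists>v\<ge>u. l \<le> integral {u..v} (J t)"
  and len_left: "\<And>t u l. t \<le> 0 \<Longrightarrow> \<exists>v\<le>u. l \<le> integral {v..u} (J t)"
  and E: "E > 0"
  and gauss: "\<And>t x l. t \<le> 0 \<Longrightarrow> l > 0 \<Longrightarrow>
   (NE u. exp (- (norm (z t u - x))\<^sup>2 / (4 * l)) * J t u) \<le> ennreal (E * sqrt (4 * pi * l))"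
begin

lemma cont2:
 assumes "continuous_on S f" "continuous_on S g"
 shows "continuous_on S (\<lambda>x. z (f x) (g x))" "continuous_on S (\<lambda>x. J (f x) (g x))"
  "continuous_on S (\<lambda>x. ag (f x) (g x))" "continuous_on S (\<lambda>x. kp (f x) (g x))" "continuous_on S (\<lambda>x. kps (f x) (g x))"
 using continuous_on_compose2[OF contz, of S "\<lambda>x. (f x, g x)"] continuous_on_compose2[OF contJ, of S "\<lambda>x. (f x, g x)"]
  continuous_on_compose2[OF contth, of S "\<lambda>x. (f x, g x)"] continuous_on_compose2[OF contk, of S "\<lambda>x. (f x, g x)"]
  continuous_on_compose2[OF contks, of S "\<lambda>x. (f x, g x)"] assms
 by (auto intro!: continuous_intros)

lemma meas2 [measurable]:
 assumes [measurable]: "f \<in> borel_measurable M" "g \<in> borel_measurable M"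
 shows "(\<lambda>x. z (f x) (g x)) \<in> borel_measurable M" "(\<lambda>x. J (f x) (g x)) \<in> borel_measurable M"
  "(\<lambda>x. ag (f x) (g x)) \<in> borel_measurable M" "(\<lambda>x. kp (f x) (g x)) \<in> borel_measurable M"
proof -
 have p: "(\<lambda>x. (f x, g x)) \<in> M \<rightarrow>\<^sub>M borel" by (simp add: borel_prod[symmetric])
 show "(\<lambda>x. z (f x) (g x)) \<in> borel_measurable M"
  using measurable_compose[OF p borel_measurable_continuous_onI[OF contz]] by simp
 show "(\<lambda>x. J (f x) (g x)) \<in> borel_measurable M"
  using measurable_compose[OF p borel_measurable_continuous_onI[OF contJ]] by simp
 show "(\<lambda>x. ag (f x) (g x)) \<in> borel_measurable M"
  using measurable_compose[OF p borel_measurable_continuous_onI[OF contth]] by simp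
 show "(\<lambda>x. kp (f x) (g x)) \<in> borel_measurable M"
  using measurable_compose[OF p borel_measurable_continuous_onI[OF contk]] by simp
qed

section \<open>Arc length, Gaussian mass and properness of time slices\<close>

text \<open>\<open>sg\<close> inverts the arc length function \<open>S\<close>, which is onto
  because both ends have infinite length. This makes every time slice an instance of
  \<open>ucurve\<close> and converts integrals between the two parameters.\<close>

lemma arclength:
 assumes t: "t \<le> 0"
 obtains sg where "strict_mono sg" "surj sg" "continuous_on UNIV sg"
  "ucurve (\<lambda>s. z t (sg s)) (\<lambda>s. ag t (sg s)) (\<lambda>s. kp t (sg s)) E"
  "\<And>F. F \<in> borel_measurable borel \<Longrightarrow> (NN s. F (sg s)) = (NN u. F u * ennreal (J t u))"
  "\<And>F::real \<Rightarrow> real. F \<in> borel_measurable borel \<Longrightarrow> (LBINT s. F (sg s)) = (LBINT u. F u * J t u)"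
proof -
 have cJ: "continuous_on S (J t)" for S using cont2(2)[of S "\<lambda>_. t" "\<lambda>x. x"] by (simp add: continuous_on_id)
 have "\<exists>F. \<forall>x. (-\<infinity>::ereal) < ereal x \<longrightarrow> ereal x < \<infinity> \<longrightarrow> (F has_vector_derivative J t x) (at x)"
  by (rule einterval_antiderivative) (use cJ[of UNIV] in \<open>auto simp: continuous_on_eq_continuous_at\<close>)
 then obtain S where S': "\<And>x. (S has_vector_derivative J t x) (at x)" by auto
 have S: "(S has_real_derivative J t x) (at x)" for x using S' by (simp add: has_real_derivative_iff_has_vector_derivative)
 have mono: "strict_mono S"
  by (rule strict_monoI, rule DERIV_pos_imp_increasing) (use S J_pos[OF t] in blast)+
 have Sint: "(J t has_integral (S v - S u)) {u..v}" if "u \<le> v" for u v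
  by (rule fundamental_theorem_of_calculus[OF that]) (use S' in \<open>auto intro: has_vector_derivative_at_within\<close>)
 have contS: "continuous_on UNIV S" using S by (auto intro: DERIV_isCont continuous_at_imp_continuous_on)
 have surj: "\<exists>u. S u = y" for y
 proof -
  obtain v where v: "v \<ge> 0" "\<bar>y - S 0\<bar> \<le> integral {0..v} (J t)" using len_right[OF t] by blast
  obtain w where w: "w \<le> 0" "\<bar>y - S 0\<bar> \<le> integral {w..0} (J t)" using len_left[OF t] by blast
  have "S w \<le> y" "y \<le> S v" using v w Sint[of 0 v] Sint[of w 0] by (auto simp: has_integral_iff)
  thus ?thesis using IVT'[of S w y v] v w continuous_on_subset[OF contS] by auto
 qed
 define sg where "sg = inv S"
 have Ssg: "S (sg s) = s" for s unfolding sg_def using surj by (meson f_inv_into_f rangeI surjI surj_f_inv_f)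
 have sgS: "sg (S u) = u" for u unfolding sg_def using mono by (simp add: strict_mono_imp_inj_on)
 have monosg: "strict_mono sg" by (rule strict_monoI) (metis Ssg mono strict_mono_less)
 have contsg: "isCont sg s" for s
  using isCont_inverse_function[of 1 "sg s" sg S] sgS DERIV_isCont[OF S] Ssg by auto
 hence contsg': "continuous_on UNIV sg" by (simp add: continuous_at_imp_continuous_on)
 have [measurable]: "sg \<in> borel_measurable borel" "S \<in> borel_measurable borel"
  using contsg' contS by (auto intro: borel_measurable_continuous_onI)
 have dsg: "(sg has_real_derivative inverse (J t (sg s))) (at s)" for s
  by (rule DERIV_inverse_function[of S _ _ _ "s - 1" "s + 1"]) (use S J_pos[OF t] Ssg contsg in \<open>auto simp: less_imp_neq[symmetric]\<close>)
 \<comment> \<open>Checked on boxes: the arc length of a parameter interval is the integral of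
   \<open>J\<close> over it.\<close>
 have lb: "lborel = distr (density lborel (\<lambda>u. ennreal (J t u))) borel S"
 proof (rule lborel_eqI)
  fix l u :: real assume lu: "\<And>b. b \<in> Basis \<Longrightarrow> l \<bullet> b \<le> u \<bullet> b"
  hence lu: "l \<le> u" by simp
  have le: "sg l \<le> sg u" using monosg lu by (simp add: strict_mono_less_eq)
  have "S -` {l<..<u} = {sg l<..<sg u}"
   using mono Ssg by (auto simp: set_eq_iff) (metis Ssg strict_mono_less)+
  hence "emeasure (distr (density lborel (\<lambda>u. ennreal (J t u))) borel S) (box l u)
    = (NN x. ennreal (J t x) * indicator {sg l<..<sg u} x)"
   by (simp add: emeasure_distr emeasure_density box_real)
  also have "\<dots> = (NN x. ennreal (J t x) * indicator {sg l..sg u} x)"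
   by (rule nn_integral_cong_AE)
    (use AE_lborel_singleton[of "sg l"] AE_lborel_singleton[of "sg u"] in \<open>eventually_elim, auto simp: indicator_def\<close>)
  also have "\<dots> = ennreal (integral {sg l..sg u} (J t))"
   by (rule nn_integral_continuous_interval[OF cJ]) (use J_pos[OF t] in \<open>auto intro: less_imp_le\<close>)
  also have "integral {sg l..sg u} (J t) = u - l" using Sint[OF le] Ssg by (simp add: has_integral_iff)
  finally show "emeasure (distr (density lborel (\<lambda>u. ennreal (J t u))) borel S) (box l u) = ennreal (\<Prod>b\<in>Basis. (u - l) \<bullet> b)"
   by simp
 qed simp
 have nn: "(NN s. F (sg s)) = (NN u. F u * ennreal (J t u))" if [measurable]: "F \<in> borel_measurable borel" for F
  by (subst lb) (simp add: nn_integral_distr nn_integral_density sgS mult.commute)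
 have bo: "(LBINT s. F (sg s)) = (LBINT u. F u * J t u)" if [measurable]: "F \<in> borel_measurable borel" for F :: "real \<Rightarrow> real"
  by (subst lb) (use J_pos[OF t] in \<open>simp add: integral_distr integral_density sgS mult.commute less_imp_le\<close>)
 have "ucurve (\<lambda>s. z t (sg s)) (\<lambda>s. ag t (sg s)) (\<lambda>s. kp t (sg s)) E"
 proof
  fix s
  have "((z t \<circ> sg) has_vector_derivative inverse (J t (sg s)) *\<^sub>R (J t (sg s) *\<^sub>R cis (ag t (sg s)))) (at s)"
   by (rule vector_diff_chain_at) (use dsg z_u[OF t] in \<open>auto simp: has_real_derivative_iff_has_vector_derivative\<close>)
  thus "((\<lambda>s. z t (sg s)) has_vector_derivative cis (ag t (sg s))) (at s)"
   using J_pos[OF t, of "sg s"] by (simp add: o_def)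
  show "((\<lambda>s. ag t (sg s)) has_real_derivative kp t (sg s)) (at s)"
   using DERIV_chain2[OF th_u[OF t] dsg, of s] J_pos[OF t, of "sg s"] by (simp add: mult.assoc)
 next
  show "continuous_on UNIV (\<lambda>s. kp t (sg s))" by (intro cont2 continuous_intros contsg')
  show "inj (\<lambda>s. z t (sg s))" using inj_compose[OF inj[OF t] strict_mono_imp_inj_on[OF monosg]] by (simp add: o_def)
  fix x and l :: real assume l: "l > 0"
  have [measurable]: "(\<lambda>u. z t u) \<in> borel_measurable borel" "J t \<in> borel_measurable borel" by measurable
  have "(NE s. exp (- (norm (z t (sg s) - x))\<^sup>2 / (4 * l)))
    = (NN u. ennreal (exp (- (norm (z t u - x))\<^sup>2 / (4 * l))) * ennreal (J t u))"
   by (rule nn) measurable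
  also have "\<dots> = (NE u. exp (- (norm (z t u - x))\<^sup>2 / (4 * l)) * J t u)"
   by (intro nn_integral_cong) (simp add: ennreal_mult')
  also have "\<dots> \<le> ennreal (E * sqrt (4 * pi * l))" by (rule gauss[OF t l])
  finally show "(NE s. exp (- (norm (z t (sg s) - x))\<^sup>2 / (4 * l))) \<le> ennreal (E * sqrt (4 * pi * l))" .
 qed (rule E)
 moreover have "surj sg" using sgS by (metis surjI)
 ultimately show ?thesis using that[of sg] monosg contsg' nn bo by blast
qed

text \<open>A chord is no longer than its arc, so a Gaussian centred at a curve point is at least
  the Gaussian of a straight line in arc length.\<close>

lemma gauss_at_point_ge:
 assumes t: "t \<le> 0" and l: "l > 0"
 shows "ennreal (sqrt (4 * pi * l)) \<le> (NE u. exp (- (norm (z t u - z t u0))\<^sup>2 / (4 * l)) * J t u)"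
proof -
 obtain sg where sg: "strict_mono sg" "surj sg" "ucurve (\<lambda>s. z t (sg s)) (\<lambda>s. ag t (sg s)) (\<lambda>s. kp t (sg s)) E"
  "\<And>F. F \<in> borel_measurable borel \<Longrightarrow> (NN s. F (sg s)) = (NN u. F u * ennreal (J t u))"
  by (rule arclength[OF t]) blast
 interpret u: ucurve "\<lambda>s. z t (sg s)" "\<lambda>s. ag t (sg s)" "\<lambda>s. kp t (sg s)" E by (rule sg(3))
 obtain s0 where s0: "u0 = sg s0" using sg(2) by (metis surjD)
 have "ennreal (sqrt (4 * pi * l)) = (NE s. exp (- (s - s0)\<^sup>2 / (4 * l)))"
  by (rule nn_integral_gaussian[OF l, symmetric])
 also have "\<dots> \<le> (NE s. exp (- (norm (z t (sg s) - z t u0))\<^sup>2 / (4 * l)))"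
 proof (intro nn_integral_mono ennreal_leI)
  fix s
  have "(norm (z t (sg s) - z t u0))\<^sup>2 \<le> \<bar>s - s0\<bar>\<^sup>2" unfolding s0 by (intro power_mono u.chord_le) auto
  thus "exp (- (s - s0)\<^sup>2 / (4 * l)) \<le> exp (- (norm (z t (sg s) - z t u0))\<^sup>2 / (4 * l))"
   using l by (simp add: divide_right_mono)
 qed
 also have "\<dots> = (NN u. ennreal (exp (- (norm (z t u - z t u0))\<^sup>2 / (4 * l))) * ennreal (J t u))"
  by (rule sg(4)) measurable
 also have "\<dots> = (NE u. exp (- (norm (z t u - z t u0))\<^sup>2 / (4 * l)) * J t u)"
  by (intro nn_integral_cong) (simp add: ennreal_mult')
 finally show ?thesis .
qed

text \<open>Each particle separately satisfies this monotonicity, because the width of the Gaussian shrinks at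
 rate \<open>1/4\<close>; it yields a domination that is uniform in time although the curves are noncompact.\<close>
lemma gauss_particle_antimono:
 assumes t: "t1 \<le> t" "t \<le> 0" and l: "l - (t - t1) / 4 > 0"
 shows "exp (- (norm (z t u))\<^sup>2 / (4 * (l - (t - t1) / 4))) * J t u \<le> exp (- (norm (z t1 u))\<^sup>2 / (4 * l)) * J t1 u"
proof (cases "t1 = t")
 case False
 hence lt: "t1 < t" using t by simp
 define L where "L = (\<lambda>s. l - (s - t1) / 4)"
 define h where "h = (\<lambda>s. exp (- (norm (z s u))\<^sup>2 / (4 * L s)) * J s u)"
 define n where "n = (\<lambda>s. inner (z s u) (\<i> * cis (ag s u)))"
 \<comment> \<open>The bracket is at least (kp + n / (4 L))^2, because \<open>n^2\<close> is at most
   the squared norm of the position; the term with 16 comes from \<open>L\<close> decreasing at rate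
   1/4.\<close>
 define h' where "h' = (\<lambda>s. - h s * ((kp s u)\<^sup>2 + kp s u * n s / (2 * L s) + (norm (z s u))\<^sup>2 / (16 * (L s)\<^sup>2)))"
 have L: "L s > 0" if "s \<in> {t1..t}" for s using l that by (auto simp: L_def)
 have dh: "(h has_real_derivative h' s) (at s within {t1..t})" if s: "s \<in> {t1..t}" for s
 proof -
  have s0: "s \<le> 0" "{t1..t} \<subseteq> {..0}" using s t by auto
  have zt: "((\<lambda>s. z s u) has_vector_derivative (kp s u *\<^sub>R (\<i> * cis (ag s u)))) (at s within {t1..t})"
   using has_vector_derivative_within_subset[OF z_t[OF s0(1)] s0(2)] .
  have q: "((\<lambda>s. inner (z s u) (z s u)) has_real_derivative 2 * kp s u * n s) (at s within {t1..t})"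
   using bounded_bilinear.has_vector_derivative[OF bounded_bilinear_inner zt zt]
   by (simp add: has_real_derivative_iff_has_vector_derivative n_def inner_commute mult.assoc)
  have Jt: "((\<lambda>s. J s u) has_real_derivative - (kp s u)\<^sup>2 * J s u) (at s within {t1..t})"
   using DERIV_subset[OF J_t[OF s0(1)] s0(2)] .
  have h_eq: "h = (\<lambda>s. exp (- inner (z s u) (z s u) / (4 * L s)) * J s u)" by (simp add: h_def power2_norm_eq_inner)
  have Ld: "(L has_real_derivative - (1/4)) (at s within {t1..t})"
   unfolding L_def by (auto intro!: derivative_eq_intros)
  have "4 * L s \<noteq> 0" using L[OF s] by simp
  from DERIV_mult'[OF DERIV_chain2[OF DERIV_exp DERIV_divide[OF DERIV_minus[OF q] DERIV_cmult[OF Ld, of 4] this]] Jt]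
  show ?thesis unfolding h_eq
  proof (rule DERIV_cong)
   show "exp (- inner (z s u) (z s u) / (4 * L s)) * (- (kp s u)\<^sup>2 * J s u) +
    exp (- inner (z s u) (z s u) / (4 * L s)) * ((- (2 * kp s u * n s) * (4 * L s) - - inner (z s u) (z s u) * (4 * - (1 / 4))) / (4 * L s * (4 * L s))) * J s u = h' s"
    unfolding h'_def h_eq power2_norm_eq_inner using L[OF s] by (simp add: field_simps power2_eq_square)
  qed
 qed
 have neg: "h' s \<le> 0" if s: "s \<in> {t1..t}" for s
 proof -
  have "(n s)\<^sup>2 \<le> (norm (z s u))\<^sup>2"
  proof -
   have "\<bar>n s\<bar> \<le> norm (z s u) * norm (\<i> * cis (ag s u))" unfolding n_def by (rule Cauchy_Schwarz_ineq2)
   hence "\<bar>n s\<bar> \<le> norm (z s u)" by (simp add: norm_mult)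
   thus ?thesis by (metis abs_ge_zero power2_abs power_mono)
  qed
  hence "(n s)\<^sup>2 / (16 * (L s)\<^sup>2) \<le> (norm (z s u))\<^sup>2 / (16 * (L s)\<^sup>2)" by (simp add: divide_right_mono)
  moreover have "(kp s u + n s / (4 * L s))\<^sup>2 = (kp s u)\<^sup>2 + kp s u * n s / (2 * L s) + (n s)\<^sup>2 / (16 * (L s)\<^sup>2)"
   using L[OF s] by (simp add: power2_eq_square field_simps)
  ultimately have "0 \<le> (kp s u)\<^sup>2 + kp s u * n s / (2 * L s) + (norm (z s u))\<^sup>2 / (16 * (L s)\<^sup>2)"
   using zero_le_power2[of "kp s u + n s / (4 * L s)"] by linarith
  moreover have "h s \<ge> 0" using J_pos[of s u] s t by (simp add: h_def less_imp_le)
  ultimately show ?thesis unfolding h'_def by (simp add: mult_nonneg_nonneg)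
 qed
 have "\<exists>x\<in>{t1<..<t}. h t - h t1 = (\<lambda>d. d * h' x) (t - t1)"
  by (rule mvt_simple[OF lt]) (use dh in \<open>auto simp: has_real_derivative_iff_has_vector_derivative has_vector_derivative_def\<close>)
 then obtain x where x: "x \<in> {t1<..<t}" "h t - h t1 = (t - t1) * h' x" by blast
 have "(t - t1) * h' x \<le> 0" using neg[of x] x lt by (intro mult_nonneg_nonpos) auto
 thus ?thesis using x by (simp add: h_def L_def)
qed (use l in simp)

text \<open>A point of small norm with parameter beyond \<open>n\<close> brings along a unit of
  length whose parameters also lie beyond \<open>n\<close> and whose Gaussian weight is bounded
  below. By \<open>gauss_particle_antimono\<close> this weight is at most a tail of the convergent
  integral at time \<open>t1\<close>, which is small independently of the time considered.\<close>

lemma proper: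
 assumes t: "t1 \<le> t2" "t2 \<le> 0"
 obtains U where "U > 0" "\<And>t u. t \<in> {t1..t2} \<Longrightarrow> \<bar>u\<bar> \<ge> U \<Longrightarrow> norm (z t u) \<ge> R"
proof -
 define l where "l = t2 - t1 + 1"
 define h where "h = (\<lambda>u. exp (- (norm (z t1 u))\<^sup>2 / (4 * l)) * J t1 u)"
 have l: "l > 0" using t by (simp add: l_def)
 have [measurable]: "h \<in> borel_measurable borel" unfolding h_def by measurable
 have hfin: "(NE u. h u) < \<infinity>"
  using gauss[of t1 l 0] t l unfolding h_def by (auto intro: le_less_trans)
 have "(\<lambda>n. NN u. ennreal (h u) * indicator {u. \<bar>u\<bar> > real n} u) \<longlonglongrightarrow> (\<integral>\<^sup>+ u. 0 \<partial>(lborel :: real measure))"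
 proof (rule nn_integral_dominated_convergence[where w="\<lambda>u. ennreal (h u)" and u'="\<lambda>_. 0"])
  show "AE u in lborel. (\<lambda>n. ennreal (h u) * indicator {u. \<bar>u\<bar> > real n} u) \<longlonglongrightarrow> 0"
  proof (rule AE_I2)
   fix u :: real
   have "eventually (\<lambda>n. ennreal (h u) * indicator {u. \<bar>u\<bar> > real n} u = 0) sequentially"
    using eventually_ge_at_top[of "nat \<lceil>\<bar>u\<bar>\<rceil>"] by eventually_elim (auto simp: indicator_def)
   thus "(\<lambda>n. ennreal (h u) * indicator {u. \<bar>u\<bar> > real n} u) \<longlonglongrightarrow> 0" by (rule tendsto_eventually)
  qed
 qed (use hfin in \<open>auto simp: indicator_def intro!: AE_I2\<close>)
 moreover have "(0::ennreal) < ennreal (exp (- (R + 1)\<^sup>2 / 4))" by simp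
 ultimately have "eventually (\<lambda>n. (NN u. ennreal (h u) * indicator {u. \<bar>u\<bar> > real n} u) < ennreal (exp (- (R + 1)\<^sup>2 / 4))) sequentially"
  by (intro order_tendstoD(2)) auto
 then obtain n where n: "(NN u. ennreal (h u) * indicator {u. \<bar>u\<bar> > real n} u) < ennreal (exp (- (R + 1)\<^sup>2 / 4))"
  by (auto simp: eventually_sequentially)
 show ?thesis
 proof (rule that[of "real n + 1"])
  fix t u assume tu: "t \<in> {t1..t2}" "\<bar>u\<bar> \<ge> real n + 1"
  have t0: "t \<le> 0" using tu t by simp
  show "norm (z t u) \<ge> R"
  proof (rule ccontr)
   assume "\<not> ?thesis"
   hence zR: "norm (z t u) < R" by simp
   obtain sg where sg: "strict_mono sg" "surj sg" "ucurve (\<lambda>s. z t (sg s)) (\<lambda>s. ag t (sg s)) (\<lambda>s. kp t (sg s)) E"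
    "\<And>F. F \<in> borel_measurable borel \<Longrightarrow> (NN s. F (sg s)) = (NN u. F u * ennreal (J t u))"
    by (rule arclength[OF t0]) blast
   interpret u: ucurve "\<lambda>s. z t (sg s)" "\<lambda>s. ag t (sg s)" "\<lambda>s. kp t (sg s)" E by (rule sg(3))
   obtain s0 where s0: "u = sg s0" using sg(2) by (metis surjD)
   \<comment> \<open>The unit of arc length is taken on the side on which the parameter moves away
     from 0.\<close>
   define I where "I = (if u > 0 then {s0..s0+1} else {s0-1..s0})"
   define La where "La = l - (t - t1) / 4"
   have La: "La \<ge> 1" using tu by (simp add: La_def l_def field_simps)
   have I: "\<bar>sg s\<bar> > real n \<and> exp (- (R + 1)\<^sup>2 / 4) \<le> exp (- (norm (z t (sg s)))\<^sup>2 / (4 * La))" if "s \<in> I" for s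
   proof
    show "\<bar>sg s\<bar> > real n"
    proof (cases "u > 0")
     case True
     hence "sg s0 \<le> sg s" using that sg(1) by (auto simp: I_def strict_mono_less_eq)
     thus ?thesis using tu True s0 by auto
    next
     case False
     hence "sg s \<le> sg s0" using that sg(1) by (auto simp: I_def strict_mono_less_eq)
     thus ?thesis using tu False s0 by auto
    qed
    have "norm (z t (sg s) - z t u) \<le> 1" using u.chord_le[of s s0] that unfolding s0 by (auto simp: I_def split: if_splits)
    hence nz: "norm (z t (sg s)) \<le> R + 1" using norm_triangle_sub[of "z t (sg s)" "z t u"] zR by linarith
    have "(norm (z t (sg s)))\<^sup>2 / (4 * La) \<le> (norm (z t (sg s)))\<^sup>2 / 4" using La by (intro divide_left_mono) auto
    also have "\<dots> \<le> (R + 1)\<^sup>2 / 4" using nz by (intro divide_right_mono power_mono) auto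
    finally show "exp (- (R + 1)\<^sup>2 / 4) \<le> exp (- (norm (z t (sg s)))\<^sup>2 / (4 * La))" by simp
   qed
   have "ennreal (exp (- (R + 1)\<^sup>2 / 4)) = (NN s. ennreal (exp (- (R + 1)\<^sup>2 / 4)) * indicator I s)"
    by (subst nn_integral_cmult_indicator) (auto simp: I_def)
   also have "\<dots> \<le> (NN s. ennreal (exp (- (norm (z t (sg s)))\<^sup>2 / (4 * La))) * indicator {u. \<bar>u\<bar> > real n} (sg s))"
    using I by (intro nn_integral_mono) (auto simp: indicator_def intro!: ennreal_leI)
   also have "\<dots> = (NN u. ennreal (exp (- (norm (z t u))\<^sup>2 / (4 * La))) * indicator {u. \<bar>u\<bar> > real n} u * ennreal (J t u))"
    by (rule sg(4)) measurable
   also have "\<dots> \<le> (NN u. ennreal (h u) * indicator {u. \<bar>u\<bar> > real n} u)"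
   proof (rule nn_integral_mono)
    fix u
    have "exp (- (norm (z t u))\<^sup>2 / (4 * La)) * J t u \<le> h u"
     unfolding h_def La_def by (rule gauss_particle_antimono) (use tu t0 La in \<open>auto simp: La_def field_simps\<close>)
    thus "ennreal (exp (- (norm (z t u))\<^sup>2 / (4 * La))) * indicator {u. \<bar>u\<bar> > real n} u * ennreal (J t u)
      \<le> ennreal (h u) * indicator {u. \<bar>u\<bar> > real n} u"
     by (auto simp: indicator_def ennreal_mult'[symmetric] intro!: ennreal_leI)
   qed
   also have "\<dots> < ennreal (exp (- (R + 1)\<^sup>2 / 4))" by (rule n)
   finally show False by simp
  qed
 qed simp
qed

end

section \<open>Evolution of weighted integrals and backward heat kernels\<close>

text \<open>Only the origin needs an argument: there the difference quotient is bounded by the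
  absolute value of the increment, since \<open>n\<close> is at least 2.\<close>

lemma pos_part_power_deriv:
 assumes "n \<ge> 2"
 shows "((\<lambda>y::real. max 0 y ^ n) has_real_derivative real n * max 0 y ^ (n - 1)) (at y)"
proof -
 consider "y > 0" | "y < 0" | "y = 0" by linarith
 thus ?thesis
 proof cases
  case 1
  have "((\<lambda>y::real. y ^ n) has_real_derivative real n * max 0 y ^ (n - 1)) (at y)"
   using 1 by (auto intro!: derivative_eq_intros simp: max_def)
  thus ?thesis by (rule has_field_derivative_transform_within_open[where S="{0<..}"]) (use 1 in \<open>auto simp: max_def\<close>)
 next
  case 2
  have "((\<lambda>y::real. 0) has_real_derivative real n * max 0 y ^ (n - 1)) (at y)"
   using 2 assms by (auto simp: max_def power_0_left)
  thus ?thesis by (rule has_field_derivative_transform_within_open[where S="{..<0}"]) (use 2 assms in \<open>auto simp: max_def power_0_left\<close>)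
 next
  case 3
  have "((\<lambda>h::real. (max 0 (0 + h) ^ n - max 0 0 ^ n) / h) \<longlongrightarrow> 0) (at 0)"
  proof (rule Lim_null_comparison[where g="\<lambda>h. \<bar>h\<bar>"])
   show "eventually (\<lambda>h::real. norm ((max 0 (0 + h) ^ n - max 0 0 ^ n) / h) \<le> \<bar>h\<bar>) (at 0)"
    unfolding eventually_at
   proof (intro exI[of _ 1] conjI ballI impI)
    fix h :: real assume h: "h \<noteq> 0 \<and> dist h 0 < 1"
    obtain k where k: "n = Suc (Suc k)" using assms by (metis One_nat_def Suc_1 Suc_le_D Suc_le_mono)
    have "\<bar>h\<bar> ^ k \<le> 1" using h by (intro power_le_one) auto
    hence "\<bar>h\<bar> * \<bar>h\<bar> ^ k \<le> \<bar>h\<bar> * 1" by (intro mult_left_mono) auto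
    thus "norm ((max 0 (0 + h) ^ n - max 0 0 ^ n) / h) \<le> \<bar>h\<bar>"
     using h by (auto simp: k max_def abs_mult power_abs)
   qed simp
   show "((\<lambda>h::real. \<bar>h\<bar>) \<longlongrightarrow> 0) (at 0)" by (intro tendsto_eq_intros) auto
  qed
  thus ?thesis using 3 assms by (simp add: DERIV_def power_0_left)
 qed
qed

lemma continuous_on_slice:
 assumes "continuous_on (S \<times> T) (\<lambda>p. g (fst p) (snd p))" "s \<in> S"
 shows "continuous_on T (g s)"
proof -
 have "continuous_on T ((\<lambda>p. g (fst p) (snd p)) \<circ> (\<lambda>u. (s, u)))"
  by (intro continuous_on_compose continuous_on_subset[OF assms(1)] continuous_on_Pair continuous_on_const continuous_on_id)
   (use assms(2) in auto)
 thus ?thesis by (simp add: o_def)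
qed

lemma nn_integral_continuous_rectangle:
 fixes g :: "real \<Rightarrow> real \<Rightarrow> real"
 assumes g: "continuous_on ({a..b} \<times> {c..d}) (\<lambda>p. g (fst p) (snd p))"
  and pos: "\<And>t u. t \<in> {a..b} \<Longrightarrow> u \<in> {c..d} \<Longrightarrow> 0 \<le> g t u"
 shows "(NN t. (NN u. ennreal (g t u) * indicator {c..d} u) * indicator {a..b} t)
   = ennreal (integral {a..b} (\<lambda>t. integral {c..d} (g t)))"
  and "continuous_on {a..b} (\<lambda>t. integral {c..d} (g t))"
proof -
 show c: "continuous_on {a..b} (\<lambda>t. integral {c..d} (g t))"
  using integral_continuous_on_param[of "{a..b}" c d g] g by (simp add: case_prod_unfold)
 have ct: "continuous_on {c..d} (g t)" if "t \<in> {a..b}" for t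
  by (rule continuous_on_slice[OF g that])
 have "(NN t. (NN u. ennreal (g t u) * indicator {c..d} u) * indicator {a..b} t)
  = (NN t. ennreal (integral {c..d} (g t)) * indicator {a..b} t)"
 proof (rule nn_integral_cong)
  fix t
  show "(NN u. ennreal (g t u) * indicator {c..d} u) * indicator {a..b} t = ennreal (integral {c..d} (g t)) * indicator {a..b} t"
   using nn_integral_continuous_interval[OF ct pos, of t] by (cases "t \<in> {a..b}") auto
 qed
 also have "\<dots> = ennreal (integral {a..b} (\<lambda>t. integral {c..d} (g t)))"
  by (rule nn_integral_continuous_interval[OF c]) (auto intro!: integral_nonneg integrable_continuous_interval ct pos)
 finally show "(NN t. (NN u. ennreal (g t u) * indicator {c..d} u) * indicator {a..b} t)
   = ennreal (integral {a..b} (\<lambda>t. integral {c..d} (g t)))" .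
qed

context csf
begin

text \<open>\<open>dq\<close> is the time derivative of the integrand, and \<open>dq - Err\<close>
  is the derivative in \<open>u\<close> of the flux \<open>P\<close>, which vanishes at both ends;
  so \<open>dq\<close> may be traded for \<open>Err\<close>. The function \<open>B\<close> is free:
  it allows any tangential divergence to be added, which is how squares are completed in both
  applications.\<close>

lemma weighted_integral_evolution:
 fixes f f' f'' :: "real \<Rightarrow> real" and A At Au B Bu :: "real \<Rightarrow> real \<Rightarrow> real"
 assumes t: "t1 \<le> t2" "t2 \<le> 0" and U: "U > 0"
  and f: "\<And>x. (f has_real_derivative f' x) (at x)" "\<And>x. (f' has_real_derivative f'' x) (at x)" "continuous_on UNIV f''"
  and A_t: "\<And>t u. t \<in> {t1..t2} \<Longrightarrow> ((\<lambda>s. A s u) has_real_derivative At t u) (at t within {t1..t2})"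
  and A_u: "\<And>t u. t \<in> {t1..t2} \<Longrightarrow> (A t has_real_derivative Au t u) (at u)"
  and B_u: "\<And>t u. t \<in> {t1..t2} \<Longrightarrow> (B t has_real_derivative Bu t u) (at u)"
  and cont: "continuous_on ({t1..t2} \<times> UNIV) (\<lambda>p. A (fst p) (snd p))" "continuous_on ({t1..t2} \<times> UNIV) (\<lambda>p. At (fst p) (snd p))"
  and zero: "\<And>t u. t \<in> {t1..t2} \<Longrightarrow> \<bar>u\<bar> = U \<Longrightarrow> A t u = 0 \<and> B t u = 0"
 defines "q \<equiv> \<lambda>t u. f (ag t u) * A t u * J t u"
  and "Err \<equiv> \<lambda>t u. f (ag t u) * At t u * J t u - f (ag t u) * (kp t u)\<^sup>2 * A t u * J t u - f'' (ag t u) * (kp t u)\<^sup>2 * A t u * J t u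
    - f' (ag t u) * kp t u * Au t u + f' (ag t u) * kp t u * J t u * B t u + f (ag t u) * Bu t u"
 shows "((\<lambda>t. integral {-U..U} (Err t)) has_integral (integral {-U..U} (q t2) - integral {-U..U} (q t1))) {t1..t2}"
proof -
 have cf: "continuous_on UNIV f" "continuous_on UNIV f'"
  using f by (auto intro: DERIV_isCont continuous_at_imp_continuous_on)
 define dq where "dq = (\<lambda>t u. (f' (ag t u) * kps t u * A t u + f (ag t u) * At t u - f (ag t u) * (kp t u)\<^sup>2 * A t u) * J t u)"
 note ci = continuous_on_compose2[OF cf(1)] continuous_on_compose2[OF cf(2)] continuous_on_compose2[OF f(3)] cont2
 have sub: "continuous_on ({t1..t2} \<times> {-U..U}) (\<lambda>p. A (fst p) (snd p))" "continuous_on ({t1..t2} \<times> {-U..U}) (\<lambda>p. At (fst p) (snd p))"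
  by (rule continuous_on_subset[OF cont(1)]; auto) (rule continuous_on_subset[OF cont(2)]; auto)
 have contdq: "continuous_on ({t1..t2} \<times> {-U..U}) (\<lambda>p. dq (fst p) (snd p))"
  unfolding dq_def by (intro continuous_intros ci sub) auto
 have contq: "continuous_on ({t1..t2} \<times> {-U..U}) (\<lambda>p. q (fst p) (snd p))"
  unfolding q_def by (intro continuous_intros ci sub) auto
 have slice: "continuous_on {-U..U} (g s)" if "continuous_on ({t1..t2} \<times> {-U..U}) (\<lambda>p. g (fst p) (snd p))" "s \<in> {t1..t2}" for g :: "real \<Rightarrow> real \<Rightarrow> real" and s
  by (rule continuous_on_slice[OF that])
 have dI: "((\<lambda>t. integral {-U..U} (q t)) has_vector_derivative integral {-U..U} (dq s)) (at s within {t1..t2})" if s: "s \<in> {t1..t2}" for s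
 proof -
  have "((\<lambda>t. integral (cbox (-U) U) (q t)) has_vector_derivative integral (cbox (-U) U) (dq s)) (at s within {t1..t2})"
  proof (rule leibniz_rule_vector_derivative)
   fix t u assume t': "t \<in> {t1..t2}" "u \<in> cbox (-U) U"
   have s0: "t \<le> 0" "{t1..t2} \<subseteq> {..0}" using t' t by auto
   have th: "((\<lambda>s. ag s u) has_real_derivative kps t u) (at t within {t1..t2})"
    and J: "((\<lambda>s. J s u) has_real_derivative - (kp t u)\<^sup>2 * J t u) (at t within {t1..t2})"
    using DERIV_subset[OF th_t[OF s0(1)] s0(2)] DERIV_subset[OF J_t[OF s0(1)] s0(2)] .
   have "((\<lambda>s. q s u) has_real_derivative dq t u) (at t within {t1..t2})"
    unfolding q_def
    by (rule DERIV_cong[OF DERIV_mult'[OF DERIV_mult'[OF DERIV_chain2[OF f(1) th] A_t[OF t'(1)]] J]])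
     (simp add: dq_def algebra_simps power2_eq_square)
   thus "((\<lambda>s. q s u) has_vector_derivative dq t u) (at t within {t1..t2})"
    by (simp add: has_real_derivative_iff_has_vector_derivative)
  next
   show "q t integrable_on cbox (- U) U" if "t \<in> {t1..t2}" for t
    using slice[OF contq that] by (simp add: integrable_continuous_interval)
  qed (use s contdq in \<open>auto simp: case_prod_unfold\<close>)
  thus ?thesis by simp
 qed
 have eq: "integral {-U..U} (Err s) = integral {-U..U} (dq s)" if s: "s \<in> {t1..t2}" for s
 proof -
  have s0: "s \<le> 0" using s t by simp
  define P where "P = (\<lambda>u. f' (ag s u) * kp s u * A s u - f (ag s u) * B s u)"
  have "(P has_real_derivative dq s u - Err s u) (at u)" for u
   unfolding P_def
   by (rule DERIV_cong[OF DERIV_diff[OF DERIV_mult'[OF DERIV_mult'[OF DERIV_chain2[OF f(2) th_u[OF s0]] kap_u[OF s0]] A_u[OF s]]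
       DERIV_mult'[OF DERIV_chain2[OF f(1) th_u[OF s0]] B_u[OF s]]]])
    (simp add: dq_def Err_def algebra_simps power2_eq_square)
  hence "((\<lambda>u. dq s u - Err s u) has_integral (P U - P (- U))) {-U..U}"
   using U by (intro fundamental_theorem_of_calculus)
    (auto simp: has_real_derivative_iff_has_vector_derivative[symmetric] intro: DERIV_subset)
  moreover have "P U = 0" "P (- U) = 0" using zero[OF s, of U] zero[OF s, of "-U"] U by (auto simp: P_def)
  ultimately have 0: "((\<lambda>u. dq s u - Err s u) has_integral 0) {-U..U}" by simp
  have "(dq s has_integral integral {-U..U} (dq s)) {-U..U}"
   using slice[OF contdq s] by (intro integrable_integral integrable_continuous_interval)
  from has_integral_diff[OF this 0] show ?thesis by (simp add: has_integral_iff)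
 qed
 have "((\<lambda>t. integral {-U..U} (dq t)) has_integral (integral {-U..U} (q t2) - integral {-U..U} (q t1))) {t1..t2}"
  by (rule fundamental_theorem_of_calculus[OF t(1) dI])
 thus ?thesis by (rule has_integral_eq[rotated]) (simp add: eq)
qed

text \<open>The one-dimensional backward heat kernel with singular point \<open>x0\<close> at time
  \<open>T\<close>, evaluated along the flow.\<close>

definition rho :: "complex \<Rightarrow> real \<Rightarrow> real \<Rightarrow> real \<Rightarrow> real" where
 "rho x0 T t u = exp (- (norm (z t u - x0))\<^sup>2 / (4 * (T - t))) / sqrt (4 * pi * (T - t))"

text \<open>Vanishes on curves that shrink homothetically to \<open>x0\<close> at time
  \<open>T\<close>; its square is the dissipation in Huisken's formula.\<close>

definition Vel :: "complex \<Rightarrow> real \<Rightarrow> real \<Rightarrow> real \<Rightarrow> real" where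
 "Vel x0 T t u = kp t u + inner (z t u - x0) (\<i> * cis (ag t u)) / (2 * (T - t))"

abbreviation "gmass x0 T t \<equiv> NE u. rho x0 T t u * J t u"
abbreviation "mass t \<equiv> LBINT u. rho 0 0 t u * J t u"
abbreviation "cmass t \<equiv> LBINT u. cos (2 * ag t u) * rho 0 0 t u * J t u"
abbreviation "smass t \<equiv> LBINT u. sin (2 * ag t u) * rho 0 0 t u * J t u"
abbreviation "energy t \<equiv> NE u. ((kp t u)\<^sup>2 + (Vel 0 0 t u)\<^sup>2) * rho 0 0 t u * J t u"

lemma rho_meas [measurable]:
 assumes [measurable]: "f \<in> borel_measurable M" "g \<in> borel_measurable M"
 shows "(\<lambda>x. rho x0 T (f x) (g x)) \<in> borel_measurable M" "(\<lambda>x. Vel x0 T (f x) (g x)) \<in> borel_measurable M"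
 unfolding rho_def Vel_def cis_conv_exp by measurable

lemma rho_nonneg: "t < T \<Longrightarrow> 0 \<le> rho x0 T t u" by (simp add: rho_def)

lemma sq_dist_deriv:
 assumes t: "t \<le> 0"
 shows "((\<lambda>s. (norm (z s u - x0))\<^sup>2) has_real_derivative 2 * kp t u * inner (z t u - x0) (\<i> * cis (ag t u))) (at t within {..0})"
  "((\<lambda>v. (norm (z t v - x0))\<^sup>2) has_real_derivative 2 * inner (z t u - x0) (cis (ag t u)) * J t u) (at u)"
  "((\<lambda>v. inner (z t v - x0) (cis (ag t v))) has_real_derivative (1 + kp t u * inner (z t u - x0) (\<i> * cis (ag t u))) * J t u) (at u)"
proof -
 have zt: "((\<lambda>s. z s u - x0) has_vector_derivative (kp t u *\<^sub>R (\<i> * cis (ag t u)))) (at t within {..0})"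
  using has_vector_derivative_diff[OF z_t[OF t] has_vector_derivative_const[of x0]] by simp
 have zu: "((\<lambda>v. z t v - x0) has_vector_derivative (J t u *\<^sub>R cis (ag t u))) (at u)"
  using has_vector_derivative_diff[OF z_u[OF t] has_vector_derivative_const[of x0]] by simp
 have tau: "((\<lambda>v. cis (ag t v)) has_vector_derivative ((kp t u * J t u) *\<^sub>R (\<i> * cis (ag t u)))) (at u)"
 proof -
  have "(cis has_vector_derivative (\<i> * cis (ag t u))) (at (ag t u))"
   unfolding has_vector_derivative_def by (auto intro!: derivative_eq_intros simp: scaleR_conv_of_real)
  hence "((cis \<circ> ag t) has_vector_derivative ((kp t u * J t u) *\<^sub>R (\<i> * cis (ag t u)))) (at u)"
   using th_u[OF t] by (intro vector_diff_chain_at) (auto simp: has_real_derivative_iff_has_vector_derivative)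
  thus ?thesis by (simp add: o_def)
 qed
 show "((\<lambda>s. (norm (z s u - x0))\<^sup>2) has_real_derivative 2 * kp t u * inner (z t u - x0) (\<i> * cis (ag t u))) (at t within {..0})"
  using bounded_bilinear.has_vector_derivative[OF bounded_bilinear_inner zt zt]
  by (simp add: has_real_derivative_iff_has_vector_derivative power2_norm_eq_inner inner_commute mult.assoc)
 show "((\<lambda>v. (norm (z t v - x0))\<^sup>2) has_real_derivative 2 * inner (z t u - x0) (cis (ag t u)) * J t u) (at u)"
  using bounded_bilinear.has_vector_derivative[OF bounded_bilinear_inner zu zu]
  by (simp add: has_real_derivative_iff_has_vector_derivative power2_norm_eq_inner inner_commute mult_ac)
 have "inner (cis (ag t u)) (cis (ag t u)) = 1" by (simp add: power2_norm_eq_inner[symmetric])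
 thus "((\<lambda>v. inner (z t v - x0) (cis (ag t v))) has_real_derivative (1 + kp t u * inner (z t u - x0) (\<i> * cis (ag t u))) * J t u) (at u)"
  using bounded_bilinear.has_vector_derivative[OF bounded_bilinear_inner zu tau]
  by (simp add: has_real_derivative_iff_has_vector_derivative algebra_simps)
qed

lemma sq_dist_split: "(norm (y::complex))\<^sup>2 = (inner y (cis a))\<^sup>2 + (inner y (\<i> * cis a))\<^sup>2"
proof -
 have "(Re y * cos a + Im y * sin a)\<^sup>2 + (Im y * cos a - Re y * sin a)\<^sup>2 = ((Re y)\<^sup>2 + (Im y)\<^sup>2) * ((sin a)\<^sup>2 + (cos a)\<^sup>2)"
  by algebra
 thus ?thesis by (simp add: cmod_power2 inner_complex_def)
qed

end

section \<open>The weighted monotonicity formula\<close>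

text \<open>The algebraic core of the monotonicity computation, where the square of
  \<open>k + m * a\<close> appears. \<open>F\<close>, \<open>F1\<close>, \<open>F2\<close> are the
  weight and its derivatives, \<open>k\<close> the curvature, \<open>p\<close> and \<open>m\<close>
  the tangential and normal components of the position and \<open>Q\<close> its squared norm,
  \<open>h\<close>, \<open>c1\<close>, \<open>c2\<close> the cutoff and its derivatives with respect
  to \<open>Q * b\<close>, \<open>r\<close> the kernel, \<open>j\<close> the speed; \<open>a\<close>
  stands for 1/(2(T - t)) and \<open>b\<close> for 1/R^2.\<close>

lemma monotonicity_error_identity:
 fixes F F1 F2 k m p r j h c1 c2 a b Q :: real
 assumes "Q = p\<^sup>2 + m\<^sup>2"
 shows "F * (h * (r * (a - Q * a\<^sup>2 - k * m * a)) + r * (c1 * (2 * k * m * b))) * j - F * k\<^sup>2 * (h * r) * j - F2 * k\<^sup>2 * (h * r) * j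
  - F1 * k * (r * p * j * (2 * c1 * b - h * a)) + F1 * k * j * (- (r * p) * (h * a + 2 * c1 * b))
  + F * ((r * p\<^sup>2 * a * (h * a + 2 * c1 * b) - r * (1 + k * m) * (h * a + 2 * c1 * b) - r * p * (2 * c1 * p * b * a + 4 * c2 * p * b\<^sup>2)) * j)
 = r * j * (- F * (k + m * a)\<^sup>2 * h - F2 * k\<^sup>2 * h - F * (2 * c1 * b + 4 * p\<^sup>2 * c2 * b\<^sup>2) - 4 * F1 * k * p * c1 * b)"
proof -
 \<comment> \<open>The inner factors are named so that the expansion takes place in two stages:
   linearly in the names, and only afterwards in their contents.\<close>
 define x1 y1 w1 w2 w3 v where d: "x1 = a - Q * a\<^sup>2 - k * m * a" "y1 = 2 * k * m * b" "w1 = 2 * c1 * b - h * a"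
  "w2 = h * a + 2 * c1 * b" "w3 = 2 * c1 * p * b * a + 4 * c2 * p * b\<^sup>2" "v = 1 + k * m"
 have 1: "F * (h * (r * x1) + r * (c1 * y1)) * j - F * k\<^sup>2 * (h * r) * j - F2 * k\<^sup>2 * (h * r) * j
  - F1 * k * (r * p * j * w1) + F1 * k * j * (- (r * p) * w2) + F * ((r * p\<^sup>2 * a * w2 - r * v * w2 - r * p * w3) * j)
  = r * j * (F * (h * x1 + c1 * y1 - k\<^sup>2 * h + (p\<^sup>2 * a * w2 - v * w2 - p * w3)) - F2 * k\<^sup>2 * h - F1 * (k * p * (w1 + w2)))"
  by (simp add: algebra_simps)
 have 2: "h * x1 + c1 * y1 - k\<^sup>2 * h + (p\<^sup>2 * a * w2 - v * w2 - p * w3) = - (k + m * a)\<^sup>2 * h - (2 * c1 * b + 4 * p\<^sup>2 * c2 * b\<^sup>2)"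
  unfolding d assms by (simp add: power2_eq_square algebra_simps)
 have 3: "k * p * (w1 + w2) = 4 * k * p * c1 * b" by (simp add: d)
 have 4: "F * (- (k + m * a)\<^sup>2 * h - x) - F2 * k\<^sup>2 * h - F1 * (4 * k * p * c1 * b)
  = - F * (k + m * a)\<^sup>2 * h - F2 * k\<^sup>2 * h - F * x - 4 * F1 * k * p * c1 * b" for x
  by (simp add: right_diff_distrib)
 show ?thesis using 1[unfolded 2 3 4] unfolding d .
qed

text \<open>The mixed term \<open>x\<close> from the gradient of the cutoff satisfies x^2 <= 4 (F2/2
  k^2 w^3) (576 b F), because F1^2 <= 8 F F2, p^2 b <= 1 on the support of the cutoff, and w^4 <=
  w^3. Hence half of the curvature term absorbs it up to 576 b F, and a further 6 b F comes from the
  first derivative of the cutoff: 582 in all.\<close>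

lemma monotonicity_error_bound:
 fixes F F1 F2 k p w b V r j :: real
 assumes "F \<ge> 0" "F2 \<ge> 0" "F1\<^sup>2 \<le> 8 * F * F2" "0 \<le> w" "w \<le> 1" "b > 0" "w > 0 \<Longrightarrow> p\<^sup>2 * b \<le> 1" "r \<ge> 0" "j \<ge> 0"
 shows "r * j * (- F * V\<^sup>2 * w^3 - F2 * k\<^sup>2 * w^3 - F * (2 * (- 3 * w\<^sup>2) * b + 4 * p\<^sup>2 * (6 * w) * b\<^sup>2) - 4 * F1 * k * p * (- 3 * w\<^sup>2) * b)
  \<le> 582 * b * (F * r * j) - (F2 / 2 * k\<^sup>2 + F * V\<^sup>2) * w^3 * r * j"
proof -
 define x where "x = 12 * F1 * k * p * w\<^sup>2 * b"
 have x: "x \<le> F2 / 2 * k\<^sup>2 * w^3 + 576 * b * F"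
 proof (cases "w = 0")
  case False
  hence pb: "p\<^sup>2 * b \<le> 1" using assms by auto
  have "x\<^sup>2 = 144 * F1\<^sup>2 * (k\<^sup>2 * w^4 * b) * (p\<^sup>2 * b)" by (simp add: x_def power2_eq_square power4_eq_xxxx)
  also have "\<dots> \<le> 144 * F1\<^sup>2 * (k\<^sup>2 * w^4 * b) * 1" using pb assms by (intro mult_left_mono) auto
  also have "\<dots> \<le> 144 * (8 * F * F2) * (k\<^sup>2 * w^4 * b)" using assms by (simp add: mult_right_mono)
  also have "\<dots> \<le> 144 * (8 * F * F2) * (k\<^sup>2 * w^3 * b)"
   using assms power_decreasing[of 3 4 w] by (intro mult_left_mono mult_right_mono) auto
  also have "\<dots> = 4 * (F2 / 2 * k\<^sup>2 * w^3) * (576 * b * F)" by simp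
  also have "\<dots> \<le> (F2 / 2 * k\<^sup>2 * w^3 + 576 * b * F)\<^sup>2"
   using zero_le_power2[of "F2 / 2 * k\<^sup>2 * w^3 - 576 * b * F"] by (simp add: power2_eq_square algebra_simps)
  finally have "\<bar>x\<bar> \<le> \<bar>F2 / 2 * k\<^sup>2 * w^3 + 576 * b * F\<bar>" by (simp only: abs_le_square_iff)
  moreover have "0 \<le> F2 / 2 * k\<^sup>2 * w^3 + 576 * b * F" using assms by (intro add_nonneg_nonneg mult_nonneg_nonneg) auto
  ultimately show ?thesis by linarith
 qed (use assms in \<open>simp add: x_def\<close>)
 have 1: "6 * w\<^sup>2 * b * F \<le> 6 * b * F"
  using assms power_le_one[of w 2] mult_right_mono[of "w\<^sup>2" 1 "6 * b * F"] by (simp add: mult_ac)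
 have 2: "0 \<le> F * (4 * p\<^sup>2 * (6 * w) * b\<^sup>2)" using assms by auto
 have "- F * V\<^sup>2 * w^3 - F2 * k\<^sup>2 * w^3 - F * (2 * (- 3 * w\<^sup>2) * b + 4 * p\<^sup>2 * (6 * w) * b\<^sup>2) - 4 * F1 * k * p * (- 3 * w\<^sup>2) * b
   = - F * V\<^sup>2 * w^3 - F2 * k\<^sup>2 * w^3 + 6 * w\<^sup>2 * b * F - F * (4 * p\<^sup>2 * (6 * w) * b\<^sup>2) + x"
  by (simp add: x_def algebra_simps)
 also have "\<dots> \<le> 582 * b * F - (F2 / 2 * k\<^sup>2 + F * V\<^sup>2) * w^3"
  using x 1 2 by (simp add: algebra_simps)
 finally have "r * j * (- F * V\<^sup>2 * w^3 - F2 * k\<^sup>2 * w^3 - F * (2 * (- 3 * w\<^sup>2) * b + 4 * p\<^sup>2 * (6 * w) * b\<^sup>2) - 4 * F1 * k * p * (- 3 * w\<^sup>2) * b)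
  \<le> r * j * (582 * b * F - (F2 / 2 * k\<^sup>2 + F * V\<^sup>2) * w^3)"
  using assms by (intro mult_left_mono) auto
 thus ?thesis by (simp add: algebra_simps)
qed

context csf
begin

lemma rho_deriv:
 assumes t: "t \<le> 0" "t < T"
 shows "((\<lambda>s. rho x0 T s u) has_real_derivative rho x0 T t u * (1 / (2 * (T - t)) - (norm (z t u - x0))\<^sup>2 * (1 / (2 * (T - t)))\<^sup>2
   - kp t u * inner (z t u - x0) (\<i> * cis (ag t u)) * (1 / (2 * (T - t))))) (at t within {..0})"
  "(rho x0 T t has_real_derivative - rho x0 T t u * inner (z t u - x0) (cis (ag t u)) * (1 / (2 * (T - t))) * J t u) (at u)"
proof -
 define S where "S = sqrt (4 * pi * (T - t))"
 have S: "S > 0" "S * S = 4 * pi * (T - t)" using t by (auto simp: S_def)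
 define Q where "Q = (norm (z t u - x0))\<^sup>2"
 define M where "M = inner (z t u - x0) (\<i> * cis (ag t u))"
 have ne: "4 * (T - t) \<noteq> 0" using t by simp
 have d4: "((\<lambda>s. 4 * (T - s)) has_real_derivative - 4) (at t within {..0})" by (auto intro!: derivative_eq_intros)
 have dS: "((\<lambda>s. sqrt (4 * pi * (T - s))) has_real_derivative inverse S / 2 * (- 4 * pi)) (at t within {..0})"
  unfolding S_def by (rule DERIV_chain2[OF DERIV_real_sqrt]) (use t in \<open>auto intro!: derivative_eq_intros\<close>)
 have "((\<lambda>s. rho x0 T s u) has_real_derivative
  (exp (- Q / (4 * (T - t))) * ((- (2 * kp t u * M) * (4 * (T - t)) - - Q * - 4) / (4 * (T - t) * (4 * (T - t)))) * S
   - exp (- Q / (4 * (T - t))) * (inverse S / 2 * (- 4 * pi))) / (S * S)) (at t within {..0})"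
 proof -
  have "sqrt (4 * pi * (T - t)) \<noteq> 0" using t by simp
  from DERIV_divide[OF DERIV_chain2[OF DERIV_exp DERIV_divide[OF DERIV_minus[OF sq_dist_deriv(1)[OF t(1), of u x0]] d4 ne]] dS this]
  show ?thesis unfolding rho_def Q_def M_def S_def .
 qed
 also have "(exp (- Q / (4 * (T - t))) * ((- (2 * kp t u * M) * (4 * (T - t)) - - Q * - 4) / (4 * (T - t) * (4 * (T - t)))) * S
   - exp (- Q / (4 * (T - t))) * (inverse S / 2 * (- 4 * pi))) / (S * S)
  = exp (- Q / (4 * (T - t))) / S * ((- (2 * kp t u * M) * (4 * (T - t)) - - Q * - 4) / (4 * (T - t) * (4 * (T - t))) + 2 * pi / (S * S))"
  using S(1) by (simp add: field_simps)
 also have "\<dots> = rho x0 T t u * (1 / (2 * (T - t)) - Q * (1 / (2 * (T - t)))\<^sup>2 - kp t u * M * (1 / (2 * (T - t))))"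
 proof -
  have "(- (2 * kp t u * M) * (4 * (T - t)) - - Q * - 4) / (4 * (T - t) * (4 * (T - t))) + 2 * pi / (S * S)
   = 1 / (2 * (T - t)) - Q * (1 / (2 * (T - t)))\<^sup>2 - kp t u * M * (1 / (2 * (T - t)))"
  proof -
   define s where "s = T - t"
   have "s \<noteq> 0" using t by (simp add: s_def)
   thus ?thesis unfolding S(2) s_def[symmetric] by (simp add: field_simps power2_eq_square)
  qed
  thus ?thesis by (simp add: rho_def Q_def S_def)
 qed
 finally show "((\<lambda>s. rho x0 T s u) has_real_derivative rho x0 T t u * (1 / (2 * (T - t)) - (norm (z t u - x0))\<^sup>2 * (1 / (2 * (T - t)))\<^sup>2
   - kp t u * inner (z t u - x0) (\<i> * cis (ag t u)) * (1 / (2 * (T - t))))) (at t within {..0})"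
  by (simp add: Q_def M_def)
 have "((\<lambda>v. exp (- (norm (z t v - x0))\<^sup>2 / (4 * (T - t))) / S) has_real_derivative
  exp (- (norm (z t u - x0))\<^sup>2 / (4 * (T - t))) * (- (2 * inner (z t u - x0) (cis (ag t u)) * J t u) / (4 * (T - t))) / S) (at u)"
  by (intro DERIV_cdivide DERIV_chain2[OF DERIV_exp] DERIV_minus sq_dist_deriv(2)[OF t(1)])
 thus "(rho x0 T t has_real_derivative - rho x0 T t u * inner (z t u - x0) (cis (ag t u)) * (1 / (2 * (T - t))) * J t u) (at u)"
  unfolding rho_def[abs_def] S_def[symmetric]
 proof (rule DERIV_cong)
  define s where "s = T - t"
  have "s \<noteq> 0" using t by (simp add: s_def)
  thus "exp (- (norm (z t u - x0))\<^sup>2 / (4 * (T - t))) * (- (2 * inner (z t u - x0) (cis (ag t u)) * J t u) / (4 * (T - t))) / S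
   = - (exp (- (norm (z t u - x0))\<^sup>2 / (4 * (T - t))) / S) * inner (z t u - x0) (cis (ag t u)) * (1 / (2 * (T - t))) * J t u"
   unfolding s_def[symmetric] using S(1) by (simp add: field_simps)
 qed
qed

lemma cont_rho_Vel:
 assumes "continuous_on S f" "continuous_on S g" "\<And>x. x \<in> S \<Longrightarrow> f x < T"
 shows "continuous_on S (\<lambda>x. rho x0 T (f x) (g x))" "continuous_on S (\<lambda>x. Vel x0 T (f x) (g x))"
proof -
 have ne: "4 * (T - f x) \<noteq> 0" "sqrt (4 * pi * (T - f x)) \<noteq> 0" "2 * (T - f x) \<noteq> 0" if "x \<in> S" for x using assms(3)[OF that] by auto
 show "continuous_on S (\<lambda>x. rho x0 T (f x) (g x))" unfolding rho_def
  by (intro continuous_intros cont2 assms(1,2)) (use ne in auto)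
 show "continuous_on S (\<lambda>x. Vel x0 T (f x) (g x))" unfolding Vel_def
  by (intro continuous_intros cont2 assms(1,2)) (use ne in auto)
qed

text \<open>Huisken's monotonicity formula with a weight \<open>f(ag)\<close>. The cutoff is \<open>(1 - |x|\<^sup>2/R\<^sup>2)\<^sub>+\<^sup>3\<close>; the
 condition \<open>f'\<^sup>2 \<le> 8 f f''\<close> lets the curvature term absorb the gradient of the cutoff.\<close>
lemma gaussian_monotonicity:
 fixes f f' f'' :: "real \<Rightarrow> real"
 assumes t: "t1 \<le> t2" "t2 \<le> 0" "t2 < T"
  and f: "\<And>x. (f has_real_derivative f' x) (at x)" "\<And>x. (f' has_real_derivative f'' x) (at x)" "continuous_on UNIV f''"
  and fpos: "\<And>x. 0 \<le> f x" "\<And>x. 0 \<le> f'' x" "\<And>x. (f' x)\<^sup>2 \<le> 8 * f x * f'' x"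
  and fin: "(NN t. (NE u. f (ag t u) * rho x0 T t u * J t u) * indicator {t1..t2} t) < \<infinity>"
 shows "(NE u. f (ag t2 u) * rho x0 T t2 u * J t2 u)
   + (NN t. (NE u. (f'' (ag t u) / 2 * (kp t u)\<^sup>2 + f (ag t u) * (Vel x0 T t u)\<^sup>2) * rho x0 T t u * J t u) * indicator {t1..t2} t)
  \<le> (NE u. f (ag t1 u) * rho x0 T t1 u * J t1 u)"
proof -
 have cf: "continuous_on UNIV f" "continuous_on UNIV f'"
  using f by (auto intro: DERIV_isCont continuous_at_imp_continuous_on)
 have [measurable]: "f \<in> borel_measurable borel" "f'' \<in> borel_measurable borel"
  using cf f(3) by (auto intro: borel_measurable_continuous_onI)
 define Q where "Q = (\<lambda>t u. (norm (z t u - x0))\<^sup>2)"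
 define w where "w = (\<lambda>R t u. max 0 (1 - Q t u * (1 / R\<^sup>2)))"
 define D where "D = (\<lambda>t u. (f'' (ag t u) / 2 * (kp t u)\<^sup>2 + f (ag t u) * (Vel x0 T t u)\<^sup>2) * rho x0 T t u * J t u)"
 define F where "F = (\<lambda>t u. f (ag t u) * rho x0 T t u * J t u)"
 define FI where "FI = (NN t. (NE u. F t u) * indicator {t1..t2} t)"
 have rJ: "rho x0 T t u \<ge> 0" "J t u \<ge> 0" if "t \<in> {t1..t2}" for t u
  using that t J_pos[of t u] rho_nonneg[of t T x0 u] by auto
 have FD: "F t u \<ge> 0" "D t u \<ge> 0" if "t \<in> {t1..t2}" for t u
  using rJ[OF that] fpos by (auto simp: F_def D_def intro!: mult_nonneg_nonneg add_nonneg_nonneg)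
 have w01: "0 \<le> w R t u" "w R t u \<le> 1" for R t u by (auto simp: w_def Q_def)
 \<comment> \<open>The localized inequality: the cutoff costs 582 / R^2 times the space-time
   integral \<open>FI\<close>, which is finite by hypothesis, so the error disappears as
   \<open>R\<close> grows.\<close>
 have cut: "(NE u. (w R t2 u)^3 * F t2 u)
   + (NN t. (NE u. (w R t u)^3 * D t u) * indicator {t1..t2} t)
  \<le> (NE u. F t1 u) + ennreal (582 / R\<^sup>2) * FI" if R: "R > 0" for R
 proof -
  define b where "b = 1 / R\<^sup>2"
  have b: "b > 0" using R by (simp add: b_def)
  define p where "p = (\<lambda>t u. inner (z t u - x0) (cis (ag t u)))"
  define m where "m = (\<lambda>t u. inner (z t u - x0) (\<i> * cis (ag t u)))"
  define a where "a = (\<lambda>t::real. 1 / (2 * (T - t)))"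
  define r where "r = rho x0 T"
  define W where "W = w R"
  have Qpm: "Q t u = (p t u)\<^sup>2 + (m t u)\<^sup>2" for t u unfolding Q_def p_def m_def by (rule sq_dist_split)
  obtain U where U: "U > 0" "\<And>t u. t \<in> {t1..t2} \<Longrightarrow> \<bar>u\<bar> \<ge> U \<Longrightarrow> norm (z t u) \<ge> R + norm x0"
   by (rule proper[OF t(1,2)]) blast
  have W0: "W t u = 0" if "t \<in> {t1..t2}" "\<bar>u\<bar> \<ge> U" for t u
  proof -
   have "R \<le> norm (z t u - x0)" using U(2)[OF that] norm_triangle_sub[of "z t u" x0] by linarith
   hence "R\<^sup>2 \<le> Q t u" unfolding Q_def using R by (intro power_mono) auto
   thus ?thesis using R by (simp add: W_def w_def field_simps)
  qed
  define A where "A = (\<lambda>t u. (W t u)^3 * r t u)"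
  define At where "At = (\<lambda>t u. (W t u)^3 * (r t u * (a t - Q t u * (a t)\<^sup>2 - kp t u * m t u * a t)) + r t u * ((- 3 * (W t u)\<^sup>2) * (2 * kp t u * m t u * b)))"
  define Au where "Au = (\<lambda>t u. r t u * p t u * J t u * (2 * (- 3 * (W t u)\<^sup>2) * b - (W t u)^3 * a t))"
  \<comment> \<open>The divergence of this tangential field cancels the tangential part of
    \<open>Q\<close> and completes the square of \<open>Vel\<close>. The second power of
    \<open>W\<close> that occurs in it is still differentiable; this is what the cube in the cutoff
    is for.\<close>
  define B where "B = (\<lambda>t u. - (r t u * p t u) * ((W t u)^3 * a t + 2 * (- 3 * (W t u)\<^sup>2) * b))"
  define Bu where "Bu = (\<lambda>t u. (r t u * (p t u)\<^sup>2 * a t * ((W t u)^3 * a t + 2 * (- 3 * (W t u)\<^sup>2) * b)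
    - r t u * (1 + kp t u * m t u) * ((W t u)^3 * a t + 2 * (- 3 * (W t u)\<^sup>2) * b)
    - r t u * p t u * (2 * (- 3 * (W t u)\<^sup>2) * p t u * b * a t + 4 * (6 * W t u) * p t u * b\<^sup>2)) * J t u)"
  define G where "G = (\<lambda>t u. r t u * J t u * (- f (ag t u) * (kp t u + m t u * a t)\<^sup>2 * (W t u)^3 - f'' (ag t u) * (kp t u)\<^sup>2 * (W t u)^3
    - f (ag t u) * (2 * (- 3 * (W t u)\<^sup>2) * b + 4 * (p t u)\<^sup>2 * (6 * W t u) * b\<^sup>2) - 4 * f' (ag t u) * kp t u * p t u * (- 3 * (W t u)\<^sup>2) * b))"
  have Wpow_t: "((\<lambda>s. (W s u)^n) has_real_derivative real n * (W t u)^(n - 1) * (- (2 * kp t u * m t u) * b)) (at t within {..0})"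
   if "n \<ge> 2" "t \<le> 0" for n t u
  proof -
   have "((\<lambda>s. 1 - Q s u * b) has_real_derivative - (2 * kp t u * m t u) * b) (at t within {..0})"
    unfolding Q_def m_def by (rule derivative_eq_intros sq_dist_deriv(1)[OF that(2)] refl)+ simp
   from DERIV_chain2[OF pos_part_power_deriv[OF that(1)] this] show ?thesis by (simp add: W_def w_def b_def)
  qed
  have Wpow_u: "((\<lambda>v. (W t v)^n) has_real_derivative real n * (W t u)^(n - 1) * (- (2 * p t u * J t u) * b)) (at u)"
   if "n \<ge> 2" "t \<le> 0" for n t u
  proof -
   have "((\<lambda>v. 1 - Q t v * b) has_real_derivative - (2 * p t u * J t u) * b) (at u)"
    unfolding Q_def p_def by (rule derivative_eq_intros sq_dist_deriv(2)[OF that(2)] refl)+ simp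
   from DERIV_chain2[OF pos_part_power_deriv[OF that(1)] this] show ?thesis by (simp add: W_def w_def b_def)
  qed
  have Err: "f (ag t u) * At t u * J t u - f (ag t u) * (kp t u)\<^sup>2 * A t u * J t u - f'' (ag t u) * (kp t u)\<^sup>2 * A t u * J t u
    - f' (ag t u) * kp t u * Au t u + f' (ag t u) * kp t u * J t u * B t u + f (ag t u) * Bu t u = G t u" for t u
   unfolding At_def A_def Au_def B_def Bu_def G_def by (rule monotonicity_error_identity[OF Qpm])
  have cQ: "continuous_on S (\<lambda>x. Q (fst x) (snd x))" "continuous_on S (\<lambda>x. p (fst x) (snd x))" "continuous_on S (\<lambda>x. m (fst x) (snd x))"
   "continuous_on S (\<lambda>x. W (fst x) (snd x))" for S
   unfolding Q_def p_def m_def W_def w_def by (intro continuous_intros cont2)+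
  have ca: "continuous_on ({t1..t2} \<times> S) (\<lambda>x. a (fst x))" "continuous_on ({t1..t2} \<times> S) (\<lambda>x. r (fst x) (snd x))"
   "continuous_on ({t1..t2} \<times> S) (\<lambda>x. Vel x0 T (fst x) (snd x))" for S :: "real set"
   unfolding a_def r_def using t(3) by (intro continuous_intros cont_rho_Vel; force)+
  note cthf = continuous_on_compose2[OF cf(1)] continuous_on_compose2[OF cf(2)] continuous_on_compose2[OF f(3)] cont2
  have contA: "continuous_on ({t1..t2} \<times> UNIV) (\<lambda>x. A (fst x) (snd x))" "continuous_on ({t1..t2} \<times> UNIV) (\<lambda>x. At (fst x) (snd x))"
   unfolding A_def At_def by (intro continuous_intros ca cQ cont2)+
  have contG: "continuous_on ({t1..t2} \<times> {-U..U}) (\<lambda>x. G (fst x) (snd x))"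
   unfolding G_def by (intro continuous_intros ca cQ cthf) auto
  have contF: "continuous_on ({t1..t2} \<times> {-U..U}) (\<lambda>x. F (fst x) (snd x))"
   unfolding F_def r_def[symmetric] by (intro continuous_intros ca cQ cthf) auto
  have contWD: "continuous_on ({t1..t2} \<times> {-U..U}) (\<lambda>x. (W (fst x) (snd x))^3 * D (fst x) (snd x))"
   unfolding D_def r_def[symmetric] by (intro continuous_intros ca cQ cthf) auto
  have ev: "((\<lambda>t. integral {-U..U} (G t)) has_integral (integral {-U..U} (\<lambda>u. (W t2 u)^3 * F t2 u) - integral {-U..U} (\<lambda>u. (W t1 u)^3 * F t1 u))) {t1..t2}"
  proof -
   have "((\<lambda>t. integral {-U..U} (\<lambda>u. f (ag t u) * At t u * J t u - f (ag t u) * (kp t u)\<^sup>2 * A t u * J t u - f'' (ag t u) * (kp t u)\<^sup>2 * A t u * J t u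
    - f' (ag t u) * kp t u * Au t u + f' (ag t u) * kp t u * J t u * B t u + f (ag t u) * Bu t u))
     has_integral (integral {-U..U} (\<lambda>u. f (ag t2 u) * A t2 u * J t2 u) - integral {-U..U} (\<lambda>u. f (ag t1 u) * A t1 u * J t1 u))) {t1..t2}"
   proof (rule weighted_integral_evolution[OF t(1,2) U(1) f _ _ _ contA])
    fix t u assume t': "t \<in> {t1..t2}"
    have t0: "t \<le> 0" "t < T" "{t1..t2} \<subseteq> {..0}" using t t' by auto
    show "((\<lambda>s. A s u) has_real_derivative At t u) (at t within {t1..t2})"
     unfolding A_def r_def
     by (rule DERIV_subset[OF DERIV_cong[OF DERIV_mult'[OF Wpow_t[of 3, OF _ t0(1)] rho_deriv(1)[OF t0(1,2)]]] t0(3)])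
      (simp_all add: At_def r_def Q_def m_def a_def algebra_simps)
    show "(A t has_real_derivative Au t u) (at u)"
     unfolding A_def r_def
     by (rule DERIV_cong[OF DERIV_mult'[OF Wpow_u[of 3, OF _ t0(1)] rho_deriv(2)[OF t0(1,2)]]])
      (simp_all add: Au_def r_def p_def a_def algebra_simps)
    have c: "((\<lambda>v. (W t v)^3 * a t + 2 * (- 3 * (W t v)\<^sup>2) * b) has_real_derivative
      (3 * (W t u)\<^sup>2 * (- (2 * p t u * J t u) * b)) * a t + 2 * (- 3 * (2 * W t u * (- (2 * p t u * J t u) * b))) * b) (at u)"
     using Wpow_u[of 3, OF _ t0(1), of u] Wpow_u[of 2, OF _ t0(1), of u]
     by (intro DERIV_add DERIV_cmult_right DERIV_cmult) simp_all
    have pu: "(p t has_real_derivative (1 + kp t u * m t u) * J t u) (at u)"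
     unfolding p_def m_def by (rule sq_dist_deriv(3)[OF t0(1)])
    have ru: "(r t has_real_derivative - r t u * p t u * a t * J t u) (at u)"
     unfolding p_def r_def a_def by (rule rho_deriv(2)[OF t0(1,2)])
    show "(B t has_real_derivative Bu t u) (at u)"
     unfolding B_def
     by (rule DERIV_cong[OF DERIV_mult'[OF DERIV_minus[OF DERIV_mult'[OF ru pu]] c]])
      (simp add: Bu_def power2_eq_square algebra_simps)
   next
    fix t u assume "t \<in> {t1..t2}" "\<bar>u\<bar> = U"
    thus "A t u = 0 \<and> B t u = 0" using W0[of t u] by (simp add: A_def B_def)
   qed
   thus ?thesis unfolding Err by (simp add: A_def F_def r_def mult_ac)
  qed
  have Gle: "G t u \<le> 582 * b * F t u - (W t u)^3 * D t u" if t': "t \<in> {t1..t2}" for t u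
  proof -
   \<comment> \<open>Where the cutoff is positive the point is within distance \<open>R\<close> of
     \<open>x0\<close>, which bounds the tangential component.\<close>
   have pb: "(p t u)\<^sup>2 * b \<le> 1" if "W t u > 0"
   proof -
    have "Q t u * b < 1" using that by (auto simp: W_def w_def b_def max_def split: if_splits)
    moreover have "(p t u)\<^sup>2 * b \<le> Q t u * b" unfolding Qpm using b by (intro mult_right_mono) auto
    ultimately show ?thesis by simp
   qed
   have "G t u \<le> 582 * b * (f (ag t u) * r t u * J t u) - (f'' (ag t u) / 2 * (kp t u)\<^sup>2 + f (ag t u) * (kp t u + m t u * a t)\<^sup>2) * (W t u)^3 * r t u * J t u"
    unfolding G_def by (rule monotonicity_error_bound) (use fpos w01 b pb rJ[OF t'] in \<open>auto simp: W_def r_def\<close>)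
   thus ?thesis by (simp add: F_def D_def Vel_def m_def a_def r_def mult_ac)
  qed
  define IF where "IF = integral {t1..t2} (\<lambda>t. integral {-U..U} (F t))"
  define ID where "ID = integral {t1..t2} (\<lambda>t. integral {-U..U} (\<lambda>u. (W t u)^3 * D t u))"
  define I where "I = (\<lambda>t. integral {-U..U} (\<lambda>u. (W t u)^3 * F t u))"
  note slice = continuous_on_slice[OF contG] continuous_on_slice[OF contF] continuous_on_slice[OF contWD]
  have rF: "(NN t. (NN u. ennreal (F t u) * indicator {-U..U} u) * indicator {t1..t2} t) = ennreal IF"
   "continuous_on {t1..t2} (\<lambda>t. integral {-U..U} (F t))"
   unfolding IF_def using nn_integral_continuous_rectangle[OF contF FD(1)] by auto
  have rD: "(NN t. (NN u. ennreal ((W t u)^3 * D t u) * indicator {-U..U} u) * indicator {t1..t2} t) = ennreal ID"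
   "continuous_on {t1..t2} (\<lambda>t. integral {-U..U} (\<lambda>u. (W t u)^3 * D t u))"
   unfolding ID_def using nn_integral_continuous_rectangle[OF contWD] FD(2) w01 by (auto simp: W_def)
  have IFD0: "IF \<ge> 0" "ID \<ge> 0" unfolding IF_def ID_def
   by (intro integral_nonneg integrable_continuous_interval rF(2) rD(2) slice; use FD w01 in \<open>auto simp: W_def\<close>)+
  have "I t2 - I t1 = integral {t1..t2} (\<lambda>t. integral {-U..U} (G t))" using ev by (simp add: has_integral_iff I_def)
  also have "\<dots> \<le> integral {t1..t2} (\<lambda>t. 582 * b * integral {-U..U} (F t) - integral {-U..U} (\<lambda>u. (W t u)^3 * D t u))"
  proof (rule integral_le)
   show "(\<lambda>t. integral {-U..U} (G t)) integrable_on {t1..t2}" using ev by (simp add: has_integral_iff)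
   show "(\<lambda>t. 582 * b * integral {-U..U} (F t) - integral {-U..U} (\<lambda>u. (W t u)^3 * D t u)) integrable_on {t1..t2}"
    by (intro integrable_continuous_interval continuous_intros rF(2) rD(2))
   fix t assume t': "t \<in> {t1..t2}"
   have "integral {-U..U} (G t) \<le> integral {-U..U} (\<lambda>u. 582 * b * F t u - (W t u)^3 * D t u)"
    by (intro integral_le integrable_continuous_interval continuous_intros slice[OF t'] Gle[OF t'])
   also have "\<dots> = 582 * b * integral {-U..U} (F t) - integral {-U..U} (\<lambda>u. (W t u)^3 * D t u)"
    by (subst Henstock_Kurzweil_Integration.integral_diff)
     (auto intro!: integrable_continuous_interval continuous_intros slice[OF t'])
   finally show "integral {-U..U} (G t) \<le> 582 * b * integral {-U..U} (F t) - integral {-U..U} (\<lambda>u. (W t u)^3 * D t u)" .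
  qed
  also have "\<dots> = 582 * b * IF - ID" unfolding IF_def ID_def
   by (subst Henstock_Kurzweil_Integration.integral_diff)
    (auto intro!: integrable_continuous_interval continuous_intros rF(2) rD(2))
  finally have main: "I t2 + ID \<le> I t1 + 582 * b * IF" by simp
  have In: "ennreal (I t) = (NE u. (W t u)^3 * F t u)" "I t \<ge> 0" if t': "t \<in> {t1..t2}" for t
  proof -
   have c: "continuous_on {-U..U} (\<lambda>u. (W t u)^3 * F t u)"
    by (intro continuous_intros slice(2)[OF t'] continuous_on_slice[of UNIV _ W, OF continuous_on_subset[OF cQ(4)[of UNIV]]]) auto
   have "ennreal (I t) = (NN u. ennreal ((W t u)^3 * F t u) * indicator {-U..U} u)"
    unfolding I_def by (rule nn_integral_continuous_interval[symmetric, OF c]) (use FD(1)[OF t'] w01 in \<open>auto simp: W_def\<close>)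
   also have "\<dots> = (NE u. (W t u)^3 * F t u)"
    using W0[OF t'] by (intro nn_integral_cong) (auto simp: indicator_def)
   finally show "ennreal (I t) = (NE u. (W t u)^3 * F t u)" .
   show "I t \<ge> 0" unfolding I_def using FD(1)[OF t'] w01 by (intro integral_nonneg integrable_continuous_interval c) (auto simp: W_def)
  qed
  have Dn: "(NN t. (NE u. (W t u)^3 * D t u) * indicator {t1..t2} t) = ennreal ID"
   unfolding rD(1)[symmetric]
  proof (intro nn_integral_cong)
   fix t
   have "(NE u. (W t u)^3 * D t u) = (NN u. ennreal ((W t u)^3 * D t u) * indicator {-U..U} u)" if "t \<in> {t1..t2}"
    using W0[OF that] by (intro nn_integral_cong) (auto simp: indicator_def)
   thus "(NE u. (W t u)^3 * D t u) * indicator {t1..t2} t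
    = (NN u. ennreal ((W t u)^3 * D t u) * indicator {-U..U} u) * indicator {t1..t2} t"
    by (cases "t \<in> {t1..t2}") auto
  qed
  have "ennreal (I t2) + ennreal ID = ennreal (I t2 + ID)" using In(2)[of t2] IFD0 t by simp
  also have "\<dots> \<le> ennreal (I t1 + 582 * b * IF)" by (rule ennreal_leI[OF main])
  also have "\<dots> = ennreal (I t1) + ennreal (582 / R\<^sup>2) * ennreal IF"
   using In(2)[of t1] IFD0 t b by (simp add: ennreal_mult'[symmetric] b_def)
  also have "\<dots> \<le> (NE u. F t1 u) + ennreal (582 / R\<^sup>2) * FI"
  proof (intro add_mono mult_left_mono)
   show "ennreal (I t1) \<le> (NE u. F t1 u)"
    using In(1)[of t1] t FD(1)[of t1] w01 power_le_one[OF w01]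
    by (auto intro!: nn_integral_mono ennreal_leI simp: W_def mult_left_le_one_le)
   show "ennreal IF \<le> FI" unfolding rF(1)[symmetric] FI_def
    by (intro nn_integral_mono mult_right_mono) (auto simp: indicator_def)
  qed auto
  finally show ?thesis using In(1)[of t2] t Dn by (simp add: W_def)
 qed
 \<comment> \<open>The cutoffs increase to 1 with the radius, so both integrals on the left are
   recovered by monotone convergence; the right-hand side is already free of the cutoff.\<close>
 have mono_w: "(w (real (Suc n)) t u)^3 \<le> (w (real (Suc k)) t u)^3" if "n \<le> k" for n k t u
 proof -
  have "1 / (real (Suc k))\<^sup>2 \<le> 1 / (real (Suc n))\<^sup>2" using that by (intro divide_left_mono power_mono) auto
  hence "Q t u * (1 / (real (Suc k))\<^sup>2) \<le> Q t u * (1 / (real (Suc n))\<^sup>2)" by (intro mult_left_mono) (auto simp: Q_def)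
  thus ?thesis unfolding w_def by (intro power_mono) auto
 qed
 have lim_w: "(\<lambda>n. (w (real (Suc n)) t u)^3) \<longlonglongrightarrow> 1" for t u
 proof -
  have "(\<lambda>n. 1 / (real (Suc n))\<^sup>2) \<longlonglongrightarrow> 0"
   using tendsto_power[OF LIMSEQ_inverse_real_of_nat, of 2] by (simp add: inverse_eq_divide power_divide)
  hence "(\<lambda>n. (max 0 (1 - Q t u * (1 / (real (Suc n))\<^sup>2)))^3) \<longlonglongrightarrow> (max 0 (1 - Q t u * 0))^3"
   by (intro tendsto_intros)
  thus ?thesis by (simp add: w_def)
 qed
 have sup: "(SUP n. ennreal ((w (real (Suc n)) t u)^3 * x)) = ennreal x" if "x \<ge> 0" for t u x
 proof (rule LIMSEQ_unique[OF LIMSEQ_SUP])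
  show "incseq (\<lambda>n. ennreal ((w (real (Suc n)) t u)^3 * x))"
   using mono_w that by (auto simp: incseq_def intro!: ennreal_leI mult_right_mono)
  show "(\<lambda>n. ennreal ((w (real (Suc n)) t u)^3 * x)) \<longlonglongrightarrow> ennreal x"
   using tendsto_ennrealI[OF tendsto_mult[OF lim_w[of t u] tendsto_const[of x]]] by simp
 qed
 define a where "a = (\<lambda>n. NE u. (w (real (Suc n)) t2 u)^3 * F t2 u)"
 define d where "d = (\<lambda>n. NN t. (NE u. (w (real (Suc n)) t u)^3 * D t u) * indicator {t1..t2} t)"
 have inc: "incseq a" "incseq d"
 proof -
  show "incseq a" unfolding a_def incseq_def using FD(1)[of t2] t(1)
   by (intro allI impI nn_integral_mono ennreal_leI mult_right_mono mono_w) auto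
  show "incseq d" unfolding d_def incseq_def
  proof (intro allI impI nn_integral_mono)
   fix n k :: nat and t assume "n \<le> k"
   show "(NE u. (w (real (Suc n)) t u)^3 * D t u) * indicator {t1..t2} t
    \<le> (NE u. (w (real (Suc k)) t u)^3 * D t u) * indicator {t1..t2} t"
   proof (cases "t \<in> {t1..t2}")
    case True
    thus ?thesis using FD(2)[OF True] by (intro mult_right_mono nn_integral_mono ennreal_leI mono_w \<open>n \<le> k\<close>) auto
   qed simp
  qed
 qed
 \<comment> \<open>The cutoff on the left stays fixed while the radius in the error term tends to
   infinity.\<close>
 have bound: "a n + d n \<le> (NE u. F t1 u)" for n
 proof (rule LIMSEQ_le_const)
  have "(\<lambda>k. ennreal (582 / (real (Suc k))\<^sup>2)) \<longlonglongrightarrow> ennreal (582 * 0)"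
   using tendsto_ennrealI[OF tendsto_mult[OF tendsto_const[of "582::real"] tendsto_power[OF LIMSEQ_inverse_real_of_nat, of 2]]]
   by (simp add: inverse_eq_divide power_divide)
  hence "(\<lambda>k. ennreal (582 / (real (Suc k))\<^sup>2) * FI) \<longlonglongrightarrow> 0 * FI"
   using fin by (intro tendsto_mult_ennreal tendsto_const) (auto simp: FI_def F_def)
  thus "(\<lambda>k. (NE u. F t1 u) + ennreal (582 / (real (Suc k))\<^sup>2) * FI) \<longlonglongrightarrow> (NE u. F t1 u)"
   using tendsto_add[OF tendsto_const] by fastforce
  show "\<exists>N. \<forall>k\<ge>N. a n + d n \<le> (NE u. F t1 u) + ennreal (582 / (real (Suc k))\<^sup>2) * FI"
  proof (intro exI[of _ n] allI impI)
   fix k assume "n \<le> k"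
   hence "a n + d n \<le> a k + d k" using inc by (auto simp: incseq_def intro!: add_mono)
   also have "\<dots> \<le> (NE u. F t1 u) + ennreal (582 / (real (Suc k))\<^sup>2) * FI"
    unfolding a_def d_def by (rule cut) simp
   finally show "a n + d n \<le> (NE u. F t1 u) + ennreal (582 / (real (Suc k))\<^sup>2) * FI" .
  qed
 qed
 have "(SUP n. a n) = (NN u. (SUP n. ennreal ((w (real (Suc n)) t2 u)^3 * F t2 u)))"
  unfolding a_def
 proof (rule nn_integral_monotone_convergence_SUP[symmetric])
  show "incseq (\<lambda>n u. ennreal ((w (real (Suc n)) t2 u)^3 * F t2 u))"
   unfolding incseq_def le_fun_def using FD(1)[of t2] t(1) by (intro allI impI ennreal_leI mult_right_mono mono_w) auto
  show "(\<lambda>u. ennreal ((w (real (Suc n)) t2 u)^3 * F t2 u)) \<in> borel_measurable lborel" for n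
   unfolding w_def Q_def F_def by measurable
 qed
 also have "\<dots> = (NE u. F t2 u)" using sup FD(1)[of t2] t by (intro nn_integral_cong) auto
 finally have Sa: "(SUP n. a n) = (NE u. F t2 u)" .
 have "(SUP n. d n) = (NN t. (SUP n. (NE u. (w (real (Suc n)) t u)^3 * D t u) * indicator {t1..t2} t))"
  unfolding d_def
 proof (intro nn_integral_monotone_convergence_SUP[symmetric])
  show "incseq (\<lambda>n t. (NE u. (w (real (Suc n)) t u)^3 * D t u) * indicator {t1..t2} t)"
   unfolding incseq_def le_fun_def
  proof (intro allI impI)
   fix n k :: nat and t assume "n \<le> k"
   show "(NE u. (w (real (Suc n)) t u)^3 * D t u) * indicator {t1..t2} t
    \<le> (NE u. (w (real (Suc k)) t u)^3 * D t u) * indicator {t1..t2} t"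
   proof (cases "t \<in> {t1..t2}")
    case True
    thus ?thesis using FD(2)[OF True] by (intro mult_right_mono nn_integral_mono ennreal_leI mono_w \<open>n \<le> k\<close>) auto
   qed simp
  qed
  show "(\<lambda>t. (NE u. (w (real (Suc n)) t u)^3 * D t u) * indicator {t1..t2} t) \<in> borel_measurable lborel" for n
   unfolding w_def Q_def D_def by measurable
 qed
 also have "\<dots> = (NN t. (NE u. D t u) * indicator {t1..t2} t)"
 proof (rule nn_integral_cong)
  fix t
  show "(SUP n. (NE u. (w (real (Suc n)) t u)^3 * D t u) * indicator {t1..t2} t)
    = (NE u. D t u) * indicator {t1..t2} t"
  proof (cases "t \<in> {t1..t2}")
   case True
   have "(SUP n. (NE u. (w (real (Suc n)) t u)^3 * D t u))
     = (NN u. (SUP n. ennreal ((w (real (Suc n)) t u)^3 * D t u)))"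
   proof (rule nn_integral_monotone_convergence_SUP[symmetric])
    show "incseq (\<lambda>n u. ennreal ((w (real (Suc n)) t u)^3 * D t u))"
     unfolding incseq_def le_fun_def using FD(2)[OF True] by (intro allI impI ennreal_leI mult_right_mono mono_w) auto
    show "(\<lambda>u. ennreal ((w (real (Suc n)) t u)^3 * D t u)) \<in> borel_measurable lborel" for n
     unfolding w_def Q_def D_def by measurable
   qed
   also have "\<dots> = (NE u. D t u)" using sup FD(2)[OF True] by (intro nn_integral_cong) auto
   finally show ?thesis using True by simp
  qed simp
 qed
 finally have Sd: "(SUP n. d n) = (NN t. (NE u. D t u) * indicator {t1..t2} t)" .
 have "(SUP n. a n) + (SUP n. d n) = (SUP n. a n + d n)" using inc by (intro ennreal_SUP_add[symmetric])
 also have "\<dots> \<le> (NE u. F t1 u)" using bound by (intro SUP_least)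
 finally show ?thesis unfolding Sa Sd unfolding F_def D_def .
qed

end

section \<open>Parabolic rescaling and curvature energy on bounded time intervals\<close>

text \<open>The curvature scales like 1/l and its arc length derivative like 1/l^2, while the angle
  and the entropy bound \<open>E\<close> are unchanged.\<close>

lemma csf_rescale:
 assumes "csf z J ag kp kps E" and l: "l > 0"
 shows "csf (\<lambda>t u. of_real l * z (t / l\<^sup>2) u) (\<lambda>t u. l * J (t / l\<^sup>2) u) (\<lambda>t u. ag (t / l\<^sup>2) u)
  (\<lambda>t u. kp (t / l\<^sup>2) u / l) (\<lambda>t u. kps (t / l\<^sup>2) u / l\<^sup>2) E"
proof -
 interpret csf z J ag kp kps E by fact
 have l2: "l\<^sup>2 > 0" using l by simp
 have neg: "t / l\<^sup>2 \<le> 0" if "t \<le> 0" for t using that l2 by (simp add: divide_nonpos_pos)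
 have img: "(\<lambda>s. s / l\<^sup>2) ` {..0} \<subseteq> {..0}" using neg by auto
 have dl: "((\<lambda>s. s / l\<^sup>2) has_real_derivative 1 / l\<^sup>2) (at t within {..0})" for t
  by (rule DERIV_cdivide[OF DERIV_ident])
 have ch: "((\<lambda>s. f (s / l\<^sup>2)) has_real_derivative D / l\<^sup>2) (at t within {..0})"
  if "(f has_real_derivative D) (at (t / l\<^sup>2) within {..0})" for f D t
  using DERIV_image_chain[OF DERIV_subset[OF that img] dl] by (simp add: o_def)
 show ?thesis
 proof
  fix t u :: real assume t: "t \<le> 0"
  note t' = neg[OF t]
  show "0 < l * J (t / l\<^sup>2) u" using J_pos[OF t'] l by simp
  show "((\<lambda>u. of_real l * z (t / l\<^sup>2) u) has_vector_derivative (l * J (t / l\<^sup>2) u) *\<^sub>R cis (ag (t / l\<^sup>2) u)) (at u)"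
   using has_vector_derivative_mult_right[OF z_u[OF t'], of "of_real l" u] by (simp add: scaleR_conv_of_real mult.assoc)
  have "((\<lambda>s. z s u) has_vector_derivative (kp (t / l\<^sup>2) u *\<^sub>R (\<i> * cis (ag (t / l\<^sup>2) u)))) (at (t / l\<^sup>2) within (\<lambda>s. s / l\<^sup>2) ` {..0})"
   by (rule has_vector_derivative_within_subset[OF z_t[OF t'] img])
  hence "((\<lambda>s. z s u) \<circ> (\<lambda>s. s / l\<^sup>2) has_vector_derivative (1 / l\<^sup>2) *\<^sub>R (kp (t / l\<^sup>2) u *\<^sub>R (\<i> * cis (ag (t / l\<^sup>2) u)))) (at t within {..0})"
   using dl by (intro vector_diff_chain_within) (auto simp: has_real_derivative_iff_has_vector_derivative)
  from has_vector_derivative_mult_right[OF this, of "of_real l"]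
  show "((\<lambda>s. of_real l * z (s / l\<^sup>2) u) has_vector_derivative (kp (t / l\<^sup>2) u / l) *\<^sub>R (\<i> * cis (ag (t / l\<^sup>2) u))) (at t within {..0})"
   using l by (simp add: o_def scaleR_conv_of_real power2_eq_square field_simps)
  show "((\<lambda>u. ag (t / l\<^sup>2) u) has_real_derivative kp (t / l\<^sup>2) u / l * (l * J (t / l\<^sup>2) u)) (at u)"
   using th_u[OF t', of u] l by simp
  show "((\<lambda>s. ag (s / l\<^sup>2) u) has_real_derivative kps (t / l\<^sup>2) u / l\<^sup>2) (at t within {..0})"
   by (rule ch[OF th_t[OF t']])
  show "((\<lambda>u. kp (t / l\<^sup>2) u / l) has_real_derivative kps (t / l\<^sup>2) u / l\<^sup>2 * (l * J (t / l\<^sup>2) u)) (at u)"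
   using DERIV_cdivide[OF kap_u[OF t'], of l u] l by (simp add: power2_eq_square)
  show "((\<lambda>s. l * J (s / l\<^sup>2) u) has_real_derivative - (kp (t / l\<^sup>2) u / l)\<^sup>2 * (l * J (t / l\<^sup>2) u)) (at t within {..0})"
   using DERIV_cmult[OF ch[OF J_t[OF t']], of l u] by (rule DERIV_cong) (simp add: power_divide)
 next
  show "continuous_on UNIV (\<lambda>p. of_real l * z (fst p / l\<^sup>2) (snd p))" "continuous_on UNIV (\<lambda>p. l * J (fst p / l\<^sup>2) (snd p))"
   "continuous_on UNIV (\<lambda>p. ag (fst p / l\<^sup>2) (snd p))" "continuous_on UNIV (\<lambda>p. kp (fst p / l\<^sup>2) (snd p) / l)"
   "continuous_on UNIV (\<lambda>p. kps (fst p / l\<^sup>2) (snd p) / l\<^sup>2)"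
   using l by (intro continuous_intros cont2; simp)+
 next
  fix t :: real assume t: "t \<le> 0"
  note t' = neg[OF t]
  show "inj (\<lambda>u. of_real l * z (t / l\<^sup>2) u)" using inj[OF t'] l by (auto simp: inj_def)
  fix u r
  show "\<exists>v\<ge>u. r \<le> integral {u..v} (\<lambda>u. l * J (t / l\<^sup>2) u)" using len_right[OF t', of u "r / l"] l by (auto simp: field_simps)
  show "\<exists>v\<le>u. r \<le> integral {v..u} (\<lambda>u. l * J (t / l\<^sup>2) u)" using len_left[OF t', of u "r / l"] l by (auto simp: field_simps)
 next
  fix t :: real and x and r :: real assume t: "t \<le> 0" and r: "r > 0"
  note t' = neg[OF t]
  have eq: "exp (- (norm (of_real l * z (t / l\<^sup>2) u - x))\<^sup>2 / (4 * r)) = exp (- (norm (z (t / l\<^sup>2) u - x / of_real l))\<^sup>2 / (4 * (r / l\<^sup>2)))" for u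
  proof -
   have "of_real l * z (t / l\<^sup>2) u - x = of_real l * (z (t / l\<^sup>2) u - x / of_real l)" using l by (simp add: right_diff_distrib)
   hence "norm (of_real l * z (t / l\<^sup>2) u - x) = l * norm (z (t / l\<^sup>2) u - x / of_real l)" using l by (simp only: norm_mult) simp
   thus ?thesis using l by (simp add: power_mult_distrib field_simps)
  qed
  have "(NE u. exp (- (norm (of_real l * z (t / l\<^sup>2) u - x))\<^sup>2 / (4 * r)) * (l * J (t / l\<^sup>2) u))
   = (NN u. ennreal l * ennreal (exp (- (norm (z (t / l\<^sup>2) u - x / of_real l))\<^sup>2 / (4 * (r / l\<^sup>2))) * J (t / l\<^sup>2) u))"
   unfolding eq using l by (intro nn_integral_cong) (simp add: ennreal_mult'[symmetric] mult_ac)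
  also have "\<dots> = ennreal l * (NE u. exp (- (norm (z (t / l\<^sup>2) u - x / of_real l))\<^sup>2 / (4 * (r / l\<^sup>2))) * J (t / l\<^sup>2) u)"
   by (rule nn_integral_cmult) measurable
  also have "\<dots> \<le> ennreal l * ennreal (E * sqrt (4 * pi * (r / l\<^sup>2)))"
   using gauss[OF t', of "r / l\<^sup>2" "x / of_real l"] r l by (intro mult_left_mono) auto
  also have "\<dots> = ennreal (E * sqrt (4 * pi * r))"
   using l by (simp add: ennreal_mult'[symmetric] real_sqrt_divide)
  finally show "(NE u. exp (- (norm (of_real l * z (t / l\<^sup>2) u - x))\<^sup>2 / (4 * r)) * (l * J (t / l\<^sup>2) u)) \<le> ennreal (E * sqrt (4 * pi * r))" .
 qed (rule E)
qed

context csf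
begin

lemma gauss_rho_le:
 assumes "t \<le> 0" "t < T"
 shows "(gmass x0 T t) \<le> ennreal E"
proof -
 have s: "sqrt (4 * pi * (T - t)) > 0" using assms by simp
 have "(gmass x0 T t)
  = (NN u. ennreal (1 / sqrt (4 * pi * (T - t))) * ennreal (exp (- (norm (z t u - x0))\<^sup>2 / (4 * (T - t))) * J t u))"
  using s by (intro nn_integral_cong) (simp add: rho_def ennreal_mult'[symmetric])
 also have "\<dots> = ennreal (1 / sqrt (4 * pi * (T - t))) * (NE u. exp (- (norm (z t u - x0))\<^sup>2 / (4 * (T - t))) * J t u)"
  by (rule nn_integral_cmult) measurable
 also have "\<dots> \<le> ennreal (1 / sqrt (4 * pi * (T - t))) * ennreal (E * sqrt (4 * pi * (T - t)))"
  using assms by (intro mult_left_mono gauss) auto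
 also have "\<dots> = ennreal E" using s assms by (simp add: ennreal_mult'[symmetric])
 finally show ?thesis .
qed

text \<open>The weight 1, for which the entropy bound makes the space-time integral finite.\<close>

lemma huisken:
 assumes t: "t1 \<le> t2" "t2 \<le> 0" "t2 < T"
 shows "(gmass x0 T t2)
  + (NN t. (NE u. (Vel x0 T t u)\<^sup>2 * rho x0 T t u * J t u) * indicator {t1..t2} t)
  \<le> (gmass x0 T t1)"
proof -
 have "(NN t. (NE u. 1 * rho x0 T t u * J t u) * indicator {t1..t2} t)
   \<le> (NN t. ennreal E * indicator {t1..t2} t)"
  using gauss_rho_le t by (intro nn_integral_mono) (auto simp: indicator_def)
 also have "\<dots> < \<infinity>" using t by (simp add: nn_integral_cmult_indicator ennreal_mult_less_top)
 finally have fin: "(NN t. (NE u. 1 * rho x0 T t u * J t u) * indicator {t1..t2} t) < \<infinity>" .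
 show ?thesis
  using gaussian_monotonicity[OF t, of "\<lambda>_. 1" "\<lambda>_. 0" "\<lambda>_. 0", OF _ _ _ _ _ _ fin] by simp
qed

text \<open>The curvature is \<open>Vel\<close> minus a position term. The square of that term times
  the kernel is bounded by a Gaussian of twice the scale, because x exp(-x) <= exp(-x/2), and the
  entropy bound takes care of it.\<close>

lemma curvature_energy_le:
 assumes t: "t \<le> 0" "t < T"
 shows "(NE u. (kp t u)\<^sup>2 * rho 0 T t u * J t u)
  \<le> 2 * (NE u. (Vel 0 T t u)\<^sup>2 * rho 0 T t u * J t u) + ennreal (4 * E / (T - t))"
proof -
 define s where "s = T - t"
 have s: "s > 0" using t by (simp add: s_def)
 define n where "n = (\<lambda>u. inner (z t u) (\<i> * cis (ag t u)))"
 have J0: "J t u \<ge> 0" for u using J_pos[OF t(1), of u] by simp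
 have pt: "(kp t u)\<^sup>2 * rho 0 T t u * J t u \<le> 2 * ((Vel 0 T t u)\<^sup>2 * rho 0 T t u * J t u)
  + 2 / s / sqrt (4 * pi * s) * (exp (- (norm (z t u - 0))\<^sup>2 / (4 * (2 * s))) * J t u)" for u
 proof -
  define x where "x = (norm (z t u))\<^sup>2 / (4 * s)"
  have "\<bar>n u\<bar> \<le> norm (z t u) * norm (\<i> * cis (ag t u))" unfolding n_def by (rule Cauchy_Schwarz_ineq2)
  hence "\<bar>n u\<bar> \<le> norm (z t u)" by (simp add: norm_mult)
  hence n2: "(n u)\<^sup>2 \<le> (norm (z t u))\<^sup>2" by (metis abs_ge_zero power2_abs power_mono)
  have "(kp t u)\<^sup>2 = (Vel 0 T t u - n u / (2 * s))\<^sup>2" by (simp add: Vel_def n_def s_def)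
  also have "\<dots> \<le> 2 * (Vel 0 T t u)\<^sup>2 + 2 * (n u / (2 * s))\<^sup>2"
   using zero_le_power2[of "Vel 0 T t u + n u / (2 * s)"] by (simp add: power2_eq_square algebra_simps)
  also have "2 * (n u / (2 * s))\<^sup>2 \<le> 2 / s * x"
  proof -
   have "2 * (n u / (2 * s))\<^sup>2 = (n u)\<^sup>2 / (2 * s\<^sup>2)" by (simp add: power_divide power_mult_distrib)
   also have "\<dots> \<le> (norm (z t u))\<^sup>2 / (2 * s\<^sup>2)" using n2 by (intro divide_right_mono) auto
   also have "\<dots> = 2 / s * x" using s by (simp add: x_def power2_eq_square field_simps)
   finally show ?thesis .
  qed
  finally have k: "(kp t u)\<^sup>2 \<le> 2 * (Vel 0 T t u)\<^sup>2 + 2 / s * x" by simp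
  have xe: "x * exp (- x) \<le> exp (- (x / 2))"
  proof -
   have x0: "x \<ge> 0" using s by (simp add: x_def)
   have "x \<le> (1 + x / 2 / 2) ^ 2" using zero_le_power2[of "x / 4 - 1"] by (simp add: power2_eq_square algebra_simps)
   also have "\<dots> \<le> (exp (x / 2 / 2)) ^ 2" using x0 by (intro power_mono exp_ge_add_one_self) auto
   also have "\<dots> = exp (x / 2)" by (simp flip: exp_double)
   finally have "x * exp (- x) \<le> exp (x / 2) * exp (- x)" by (intro mult_right_mono) auto
   thus ?thesis by (simp flip: exp_add)
  qed
  have r: "rho 0 T t u = exp (- x) / sqrt (4 * pi * s)" by (simp add: rho_def x_def s_def)
  have "(kp t u)\<^sup>2 * (rho 0 T t u * J t u) \<le> (2 * (Vel 0 T t u)\<^sup>2 + 2 / s * x) * (rho 0 T t u * J t u)"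
   using k J0 rho_nonneg[OF t(2)] by (intro mult_right_mono) auto
  also have "\<dots> = 2 * ((Vel 0 T t u)\<^sup>2 * rho 0 T t u * J t u) + 2 / s / sqrt (4 * pi * s) * ((x * exp (- x)) * J t u)"
   unfolding r by (simp add: algebra_simps)
  also have "\<dots> \<le> 2 * ((Vel 0 T t u)\<^sup>2 * rho 0 T t u * J t u) + 2 / s / sqrt (4 * pi * s) * (exp (- (x / 2)) * J t u)"
   using xe J0 s by (intro add_left_mono mult_left_mono mult_right_mono) auto
  also have "- (x / 2) = - (norm (z t u - 0))\<^sup>2 / (4 * (2 * s))" by (simp add: x_def)
  finally show ?thesis by (simp add: mult.assoc)
 qed
 have "(NE u. (kp t u)\<^sup>2 * rho 0 T t u * J t u)
  \<le> (NN u. 2 * ennreal ((Vel 0 T t u)\<^sup>2 * rho 0 T t u * J t u)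
    + ennreal (2 / s / sqrt (4 * pi * s)) * ennreal (exp (- (norm (z t u - 0))\<^sup>2 / (4 * (2 * s))) * J t u))"
 proof (rule nn_integral_mono)
  fix u
  have nn: "0 \<le> (Vel 0 T t u)\<^sup>2 * rho 0 T t u * J t u" using J0 rho_nonneg[OF t(2)] by auto
  have "2 * ennreal ((Vel 0 T t u)\<^sup>2 * rho 0 T t u * J t u) + ennreal (2 / s / sqrt (4 * pi * s)) * ennreal (exp (- (norm (z t u - 0))\<^sup>2 / (4 * (2 * s))) * J t u)
   = ennreal (2 * ((Vel 0 T t u)\<^sup>2 * rho 0 T t u * J t u) + 2 / s / sqrt (4 * pi * s) * (exp (- (norm (z t u - 0))\<^sup>2 / (4 * (2 * s))) * J t u))"
  proof -
   have 2: "2 * ennreal x = ennreal (2 * x)" for x by (simp add: ennreal_mult')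
   have 3: "ennreal (2 / s / sqrt (4 * pi * s)) * ennreal x = ennreal (2 / s / sqrt (4 * pi * s) * x)" for x
    by (rule ennreal_mult'[symmetric]) (use s in auto)
   show ?thesis unfolding 2 3 by (rule ennreal_plus[symmetric]) (use nn s J0 in auto)
  qed
  thus "ennreal ((kp t u)\<^sup>2 * rho 0 T t u * J t u) \<le> 2 * ennreal ((Vel 0 T t u)\<^sup>2 * rho 0 T t u * J t u)
    + ennreal (2 / s / sqrt (4 * pi * s)) * ennreal (exp (- (norm (z t u - 0))\<^sup>2 / (4 * (2 * s))) * J t u)"
   using ennreal_leI[OF pt] by simp
 qed
 also have "\<dots> = 2 * (NE u. (Vel 0 T t u)\<^sup>2 * rho 0 T t u * J t u)
   + ennreal (2 / s / sqrt (4 * pi * s)) * (NE u. exp (- (norm (z t u - 0))\<^sup>2 / (4 * (2 * s))) * J t u)"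
  by (subst nn_integral_add) (auto simp: nn_integral_cmult)
 also have "\<dots> \<le> 2 * (NE u. (Vel 0 T t u)\<^sup>2 * rho 0 T t u * J t u)
   + ennreal (2 / s / sqrt (4 * pi * s)) * ennreal (E * sqrt (4 * pi * (2 * s)))"
  using s by (intro add_left_mono mult_left_mono gauss t) auto
 also have "ennreal (2 / s / sqrt (4 * pi * s)) * ennreal (E * sqrt (4 * pi * (2 * s))) = ennreal (2 / s / sqrt (4 * pi * s) * (E * sqrt (4 * pi * (2 * s))))"
  using s by (intro ennreal_mult'[symmetric]) auto
 also have "\<dots> \<le> ennreal (4 * E / s)"
 proof (rule ennreal_leI)
  have "sqrt (4 * pi * (2 * s)) = sqrt 2 * sqrt (4 * pi * s)" by (simp flip: real_sqrt_mult)
  hence "2 / s / sqrt (4 * pi * s) * (E * sqrt (4 * pi * (2 * s))) = 2 * E * sqrt 2 / s" using s by simp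
  also have "\<dots> \<le> 2 * E * 2 / s" using E s by (intro divide_right_mono mult_left_mono) (auto intro: real_le_lsqrt)
  finally show "2 / s / sqrt (4 * pi * s) * (E * sqrt (4 * pi * (2 * s))) \<le> 4 * E / s" by simp
 qed
 finally show ?thesis by (simp add: s_def add_left_mono)
qed

text \<open>For a kernel whose singular time lies beyond the interval the position term is harmless,
  and Huisken's formula bounds the \<open>Vel\<close> part by \<open>E\<close>. The bound grows with
  the length of the interval for fixed \<open>T\<close>, so by itself it says nothing about the
  whole past.\<close>

lemma curvature_energy_interval_le:
 assumes t: "t1 \<le> t2" "t2 \<le> 0" "t2 < T"
 shows "(NN t. (NE u. (kp t u)\<^sup>2 * rho 0 T t u * J t u) * indicator {t1..t2} t)
  \<le> ennreal (2 * E + 4 * E * (t2 - t1) / (T - t2))"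
proof -
 have "(NN t. (NE u. (kp t u)\<^sup>2 * rho 0 T t u * J t u) * indicator {t1..t2} t)
  \<le> (NN t. 2 * ((NE u. (Vel 0 T t u)\<^sup>2 * rho 0 T t u * J t u) * indicator {t1..t2} t) + ennreal (4 * E / (T - t2)) * indicator {t1..t2} t)"
 proof (rule nn_integral_mono)
  fix t
  show "(NE u. (kp t u)\<^sup>2 * rho 0 T t u * J t u) * indicator {t1..t2} t
   \<le> 2 * ((NE u. (Vel 0 T t u)\<^sup>2 * rho 0 T t u * J t u) * indicator {t1..t2} t) + ennreal (4 * E / (T - t2)) * indicator {t1..t2} t"
  proof (cases "t \<in> {t1..t2}")
   case True
   have "4 * E / (T - t) \<le> 4 * E / (T - t2)" using True t E by (intro divide_left_mono mult_pos_pos) auto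
   thus ?thesis using True t curvature_energy_le[of t T]
    by (auto intro: order_trans add_left_mono ennreal_leI)
  qed simp
 qed
 also have "\<dots> = 2 * (NN t. (NE u. (Vel 0 T t u)\<^sup>2 * rho 0 T t u * J t u) * indicator {t1..t2} t)
  + ennreal (4 * E / (T - t2)) * ennreal (t2 - t1)"
  using t by (subst nn_integral_add) (auto simp: nn_integral_cmult nn_integral_cmult_indicator)
 also have "\<dots> \<le> 2 * ennreal E + ennreal (4 * E / (T - t2)) * ennreal (t2 - t1)"
 proof (intro add_right_mono mult_left_mono)
  have "(NN t. (NE u. (Vel 0 T t u)\<^sup>2 * rho 0 T t u * J t u) * indicator {t1..t2} t)
   \<le> (gmass 0 T t1)"
   using huisken[OF t, of 0] by (meson le_iff_add order_trans add.commute add_increasing order_refl zero_le)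
  also have "\<dots> \<le> ennreal E" using t by (intro gauss_rho_le) auto
  finally show "(NN t. (NE u. (Vel 0 T t u)\<^sup>2 * rho 0 T t u * J t u) * indicator {t1..t2} t) \<le> ennreal E" .
 qed auto
 also have "\<dots> = ennreal (2 * E + 4 * E * (t2 - t1) / (T - t2))"
  using t E by (subst ennreal_plus) (auto simp: ennreal_mult'[symmetric] ennreal_mult)
 finally show ?thesis .
qed

end

section \<open>Variance of the angle along the flow\<close>

lemma ennreal_add_leD:
 fixes a b c :: ennreal
 assumes "a + b \<le> c"
 shows "a \<le> c" "b \<le> c"
 using assms by (meson add_increasing add_increasing2 order_refl order_trans zero_le)+

text \<open>\<open>gaussian_angle_variance_le\<close> in the original parameter. One constant serves
  all flows with entropy bound \<open>E\<close>, as the rescaling argument requires.\<close>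

lemma flow_angle_variance_le:
 assumes E: "E > 0" and r: "r > 0" and R0: "R0 \<ge> 0"
 shows "\<exists>C>0. \<forall>z J ag kp kps t u0. csf z J ag kp kps E \<longrightarrow> t \<le> 0 \<longrightarrow> norm (z t u0) \<le> R0 \<longrightarrow>
  (NE u. (ag t u - ag t u0)\<^sup>2 * exp (- (norm (z t u))\<^sup>2 / (4 * r)) * J t u)
  \<le> ennreal C * (1 + (NE u. (kp t u)\<^sup>2 * exp (- (norm (z t u))\<^sup>2 / (12 * r)) * J t u))"
proof -
 obtain C where C: "C > 0" "\<And>c ag k s0. ucurve c ag k E \<Longrightarrow> norm (c s0) \<le> R0 \<Longrightarrow>
  (NE s. (ag s - ag s0)\<^sup>2 * exp (- (norm (c s))\<^sup>2 / (4 * r)))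
  \<le> ennreal C * (1 + (NE s. (k s)\<^sup>2 * exp (- (norm (c s))\<^sup>2 / (12 * r))))"
  using gaussian_angle_variance_le[OF assms] by blast
 show ?thesis
 proof (intro exI[of _ C] conjI allI impI C(1))
  fix z J ag kp kps t u0 assume "csf z J ag kp kps E" and t: "t \<le> 0" and u0: "norm (z t u0) \<le> R0"
  then interpret csf z J ag kp kps E by blast
  obtain sg where sg: "surj sg" "ucurve (\<lambda>s. z t (sg s)) (\<lambda>s. ag t (sg s)) (\<lambda>s. kp t (sg s)) E"
   "\<And>F. F \<in> borel_measurable borel \<Longrightarrow> (NN s. F (sg s)) = (NN u. F u * ennreal (J t u))"
   by (rule arclength[OF t]) blast
  obtain s0 where s0: "u0 = sg s0" using sg(1) by (metis surjD)
  have conv: "(NE u. g u * J t u) = (NE s. g (sg s))"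
   if [measurable]: "g \<in> borel_measurable borel" for g
   using sg(3)[of "\<lambda>u. ennreal (g u)"] J_pos[OF t] by (simp add: ennreal_mult'' less_imp_le)
  have m1: "(\<lambda>u. (ag t u - ag t u0)\<^sup>2 * exp (- (norm (z t u))\<^sup>2 / (4 * r))) \<in> borel_measurable borel"
   "(\<lambda>u. (kp t u)\<^sup>2 * exp (- (norm (z t u))\<^sup>2 / (12 * r))) \<in> borel_measurable borel" by measurable
  show "(NE u. (ag t u - ag t u0)\<^sup>2 * exp (- (norm (z t u))\<^sup>2 / (4 * r)) * J t u)
  \<le> ennreal C * (1 + (NE u. (kp t u)\<^sup>2 * exp (- (norm (z t u))\<^sup>2 / (12 * r)) * J t u))"
   unfolding conv[OF m1(1)] conv[OF m1(2)] using C(2)[OF sg(2), of s0] u0 unfolding s0 by simp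
 qed
qed

context csf
begin

text \<open>When \<open>T - t\<close> is at least \<open>3 * r\<close>, the kernel decays no faster
  than the weight left over in \<open>gaussian_angle_variance_le\<close>.\<close>

lemma curvature_kernel_le:
 assumes t: "t \<le> 0" "3 * r \<le> T - t" "T - t \<le> 4 * r" and r: "r > 0"
 shows "(NE u. (kp t u)\<^sup>2 * exp (- (norm (z t u))\<^sup>2 / (12 * r)) * J t u)
  \<le> ennreal (sqrt (16 * pi * r)) * (NE u. (kp t u)\<^sup>2 * rho 0 T t u * J t u)"
proof -
 have "(NE u. (kp t u)\<^sup>2 * exp (- (norm (z t u))\<^sup>2 / (12 * r)) * J t u)
  \<le> (NN u. ennreal (sqrt (16 * pi * r)) * ennreal ((kp t u)\<^sup>2 * rho 0 T t u * J t u))"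
 proof (rule nn_integral_mono)
  fix u
  have "(norm (z t u))\<^sup>2 / (4 * (T - t)) \<le> (norm (z t u))\<^sup>2 / (12 * r)" using t r by (intro divide_left_mono) auto
  hence "exp (- (norm (z t u))\<^sup>2 / (12 * r)) \<le> exp (- (norm (z t u))\<^sup>2 / (4 * (T - t)))" by simp
  also have "\<dots> = sqrt (4 * pi * (T - t)) * rho 0 T t u" using t r by (simp add: rho_def)
  also have "\<dots> \<le> sqrt (16 * pi * r) * rho 0 T t u"
   using t r by (intro mult_right_mono rho_nonneg) auto
  finally have "exp (- (norm (z t u))\<^sup>2 / (12 * r)) \<le> sqrt (16 * pi * r) * rho 0 T t u" .
  from mult_left_mono[OF this, of "(kp t u)\<^sup>2 * J t u"] J_pos[OF t(1), of u]
  have "(kp t u)\<^sup>2 * exp (- (norm (z t u))\<^sup>2 / (12 * r)) * J t u \<le> sqrt (16 * pi * r) * ((kp t u)\<^sup>2 * rho 0 T t u * J t u)"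
   by (simp add: mult_ac)
  thus "ennreal ((kp t u)\<^sup>2 * exp (- (norm (z t u))\<^sup>2 / (12 * r)) * J t u) \<le> ennreal (sqrt (16 * pi * r)) * ennreal ((kp t u)\<^sup>2 * rho 0 T t u * J t u)"
   using r by (subst ennreal_mult'[symmetric]) (auto intro: ennreal_leI)
 qed
 also have "\<dots> = ennreal (sqrt (16 * pi * r)) * (NE u. (kp t u)\<^sup>2 * rho 0 T t u * J t u)"
  by (rule nn_integral_cmult) measurable
 finally show ?thesis .
qed

text \<open>Supplies the finiteness hypothesis of \<open>gaussian_monotonicity\<close> for weights
  of quadratic growth. The reference point is the particle with parameter 0, whose position and
  angle are bounded on the compact time interval; no control of the constants is needed, only
  finiteness.\<close>

lemma finite_weighted_time_integral:
 fixes f :: "real \<Rightarrow> real"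
 assumes t: "t1 \<le> t2" "t2 < 0" and f: "f \<in> borel_measurable borel" "\<And>x. f x \<le> B * (1 + x\<^sup>2)" "B \<ge> 0"
 shows "(NN t. (NE u. f (ag t u) * rho 0 0 t u * J t u) * indicator {t1..t2} t) < \<infinity>"
proof -
 note [measurable] = f(1)
 \<comment> \<open>With this \<open>r\<close> the kernel with singular time \<open>3 * r\<close> is
   comparable on the whole interval, because 3 r <= 3 r - t <= 4 r.\<close>
 define r where "r = - t1"
 have r: "r > 0" using t by (simp add: r_def)
 have c0: "continuous_on {t1..t2} (\<lambda>t. norm (z t 0))" "continuous_on {t1..t2} (\<lambda>t. \<bar>ag t 0\<bar>)"
  by (intro continuous_intros cont2)+
 obtain R0 where R0: "\<And>t. t \<in> {t1..t2} \<Longrightarrow> norm (z t 0) \<le> R0"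
  using continuous_attains_sup[OF compact_Icc _ c0(1)] t by fastforce
 obtain D where D: "\<And>t. t \<in> {t1..t2} \<Longrightarrow> \<bar>ag t 0\<bar> \<le> D"
  using continuous_attains_sup[OF compact_Icc _ c0(2)] t by fastforce
 have R0': "R0 \<ge> 0" using R0[of t1] t by (auto intro: order_trans[OF norm_ge_zero])
 obtain C where C: "C > 0" "\<And>t. t \<le> 0 \<Longrightarrow> norm (z t 0) \<le> R0 \<Longrightarrow>
  (NE u. (ag t u - ag t 0)\<^sup>2 * exp (- (norm (z t u))\<^sup>2 / (4 * r)) * J t u)
  \<le> ennreal C * (1 + (NE u. (kp t u)\<^sup>2 * exp (- (norm (z t u))\<^sup>2 / (12 * r)) * J t u))"
  using flow_angle_variance_le[OF E r R0'] csf_axioms by blast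
 define c1 where "c1 = B * (1 + 2 * D\<^sup>2)"
 define c2 where "c2 = 2 * B / sqrt (4 * pi * (- t2))"
 have c12: "c1 \<ge> 0" "c2 \<ge> 0" unfolding c1_def c2_def
  using f(3) t by (intro divide_nonneg_nonneg mult_nonneg_nonneg real_sqrt_ge_zero add_nonneg_nonneg; simp)+
 define K where "K = (\<lambda>t. NE u. (kp t u)\<^sup>2 * rho 0 (3 * r) t u * J t u)"
 have [measurable]: "K \<in> borel_measurable borel" unfolding K_def by measurable
 have slice: "(NE u. f (ag t u) * rho 0 0 t u * J t u)
  \<le> ennreal (c1 * E) + ennreal (c2 * C) * (1 + ennreal (sqrt (16 * pi * r)) * K t)" if t': "t \<in> {t1..t2}" for t
 proof -
  have t0: "t \<le> 0" "t < 0" using t' t by auto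
  have pt: "f (ag t u) * rho 0 0 t u * J t u \<le> c1 * (rho 0 0 t u * J t u) + c2 * ((ag t u - ag t 0)\<^sup>2 * exp (- (norm (z t u))\<^sup>2 / (4 * r)) * J t u)" for u
  proof -
   have Ju: "J t u \<ge> 0" "rho 0 0 t u \<ge> 0" using J_pos[OF t0(1), of u] rho_nonneg[OF t0(2)] by auto
   have "(ag t u)\<^sup>2 \<le> 2 * (ag t 0)\<^sup>2 + 2 * (ag t u - ag t 0)\<^sup>2"
    using zero_le_power2[of "ag t u - 2 * ag t 0"] by (simp add: power2_eq_square algebra_simps)
   moreover have "(ag t 0)\<^sup>2 \<le> D\<^sup>2" using D[OF t'] by (metis abs_ge_zero power2_abs power_mono)
   ultimately have "1 + (ag t u)\<^sup>2 \<le> (1 + 2 * D\<^sup>2) + 2 * (ag t u - ag t 0)\<^sup>2" by simp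
   hence "f (ag t u) \<le> B * ((1 + 2 * D\<^sup>2) + 2 * (ag t u - ag t 0)\<^sup>2)"
    using f(2)[of "ag t u"] f(3) by (meson mult_left_mono order_trans)
   hence "f (ag t u) * (rho 0 0 t u * J t u) \<le> B * ((1 + 2 * D\<^sup>2) + 2 * (ag t u - ag t 0)\<^sup>2) * (rho 0 0 t u * J t u)"
    using Ju by (intro mult_right_mono) auto
   also have "\<dots> = c1 * (rho 0 0 t u * J t u) + 2 * B * ((ag t u - ag t 0)\<^sup>2 * J t u) * rho 0 0 t u"
    by (simp add: c1_def algebra_simps)
   also have "2 * B * ((ag t u - ag t 0)\<^sup>2 * J t u) * rho 0 0 t u \<le> 2 * B * ((ag t u - ag t 0)\<^sup>2 * J t u) * (exp (- (norm (z t u))\<^sup>2 / (4 * r)) / sqrt (4 * pi * (- t2)))"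
   proof (rule mult_left_mono)
    have "(norm (z t u))\<^sup>2 / (4 * r) \<le> (norm (z t u))\<^sup>2 / (4 * (0 - t))" using t' t0 by (intro divide_left_mono mult_pos_pos) (auto simp: r_def)
    thus "rho 0 0 t u \<le> exp (- (norm (z t u))\<^sup>2 / (4 * r)) / sqrt (4 * pi * (- t2))"
     unfolding rho_def using t' t by (intro frac_le) (auto simp: mult_pos_neg)
   qed (use f(3) Ju in auto)
   finally show ?thesis by (simp add: c2_def mult_ac)
  qed
  have "(NE u. f (ag t u) * rho 0 0 t u * J t u)
   \<le> (NN u. ennreal c1 * ennreal (rho 0 0 t u * J t u) + ennreal c2 * ennreal ((ag t u - ag t 0)\<^sup>2 * exp (- (norm (z t u))\<^sup>2 / (4 * r)) * J t u))"
  proof (rule nn_integral_mono)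
   fix u
   have "0 \<le> rho 0 0 t u * J t u" "0 \<le> (ag t u - ag t 0)\<^sup>2 * exp (- (norm (z t u))\<^sup>2 / (4 * r)) * J t u"
    using J_pos[OF t0(1), of u] rho_nonneg[OF t0(2)] by auto
   thus "ennreal (f (ag t u) * rho 0 0 t u * J t u) \<le> ennreal c1 * ennreal (rho 0 0 t u * J t u) + ennreal c2 * ennreal ((ag t u - ag t 0)\<^sup>2 * exp (- (norm (z t u))\<^sup>2 / (4 * r)) * J t u)"
    using ennreal_leI[OF pt[of u]] c12 by (simp only: ennreal_mult'[symmetric] ennreal_plus[symmetric] mult_nonneg_nonneg)
  qed
  also have "\<dots> = ennreal c1 * (gmass 0 0 t)
    + ennreal c2 * (NE u. (ag t u - ag t 0)\<^sup>2 * exp (- (norm (z t u))\<^sup>2 / (4 * r)) * J t u)"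
   by (subst nn_integral_add) (auto simp: nn_integral_cmult)
  also have "\<dots> \<le> ennreal c1 * ennreal E + ennreal c2 * (ennreal C * (1 + (NE u. (kp t u)\<^sup>2 * exp (- (norm (z t u))\<^sup>2 / (12 * r)) * J t u)))"
   using t0 R0[OF t'] by (intro add_mono mult_left_mono gauss_rho_le C(2)) auto
  also have "\<dots> \<le> ennreal c1 * ennreal E + ennreal c2 * (ennreal C * (1 + ennreal (sqrt (16 * pi * r)) * K t))"
   unfolding K_def using t0 t' r by (intro add_left_mono mult_left_mono curvature_kernel_le) (auto simp: r_def)
  finally show ?thesis using c12 C(1) by (simp add: ennreal_mult' mult.assoc)
 qed
 have "(NN t. (NE u. f (ag t u) * rho 0 0 t u * J t u) * indicator {t1..t2} t)
  \<le> (NN t. ennreal (c1 * E + c2 * C) * indicator {t1..t2} t + ennreal (c2 * C * sqrt (16 * pi * r)) * (K t * indicator {t1..t2} t))"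
 proof (rule nn_integral_mono)
  fix t
  show "(NE u. f (ag t u) * rho 0 0 t u * J t u) * indicator {t1..t2} t
   \<le> ennreal (c1 * E + c2 * C) * indicator {t1..t2} t + ennreal (c2 * C * sqrt (16 * pi * r)) * (K t * indicator {t1..t2} t)"
  proof (cases "t \<in> {t1..t2}")
   case True
   have "ennreal (c1 * E) + ennreal (c2 * C) * (1 + ennreal (sqrt (16 * pi * r)) * K t) = ennreal (c1 * E + c2 * C) + ennreal (c2 * C * sqrt (16 * pi * r)) * K t"
    using c12 C(1) E r by (simp add: distrib_left ennreal_plus ennreal_mult mult.assoc add.assoc)
   thus ?thesis using slice[OF True] True by simp
  qed simp
 qed
 also have "\<dots> = ennreal (c1 * E + c2 * C) * ennreal (t2 - t1) + ennreal (c2 * C * sqrt (16 * pi * r)) * (NN t. K t * indicator {t1..t2} t)"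
  using t by (subst nn_integral_add) (auto simp: nn_integral_cmult nn_integral_cmult_indicator)
 also have "\<dots> \<le> ennreal (c1 * E + c2 * C) * ennreal (t2 - t1) + ennreal (c2 * C * sqrt (16 * pi * r)) * ennreal (2 * E + 4 * E * (t2 - t1) / (3 * r - t2))"
  unfolding K_def using t r by (intro add_left_mono mult_left_mono curvature_energy_interval_le) auto
 also have "\<dots> < \<infinity>" by (simp add: ennreal_mult_less_top)
 finally show ?thesis .
qed

text \<open>The Gaussian density centred at the curve point \<open>z 0 0\<close> is at least 1 at
  time 0, hence also at earlier times. If the curve avoided the ball at time \<open>t\<close>, the
  density would be at most sqrt(2) E exp(-2 E), which is below 1. The radius sqrt(32 E) makes the
  squared distance over 8 s at least 2 E for all \<open>s\<close> up to 2.\<close>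

lemma point_in_ball:
 assumes p: "norm (z 0 0) \<le> 1" and t: "-1 \<le> t" "t \<le> 0"
 shows "\<exists>u. norm (z t u) \<le> 1 + sqrt (32 * E)"
proof (rule ccontr)
 assume "\<not> ?thesis"
 hence far: "norm (z t u) > 1 + sqrt (32 * E)" for u by (simp add: not_le)
 define p where "p = z 0 0"
 define s where "s = 1 - t"
 have s: "1 \<le> s" "s \<le> 2" using t by (auto simp: s_def)
 have "1 = ennreal (1 / sqrt (4 * pi)) * ennreal (sqrt (4 * pi * 1))" by (simp add: ennreal_mult'[symmetric])
 also have "\<dots> \<le> ennreal (1 / sqrt (4 * pi)) * (NE u. exp (- (norm (z 0 u - z 0 0))\<^sup>2 / (4 * 1)) * J 0 u)"
  by (intro mult_left_mono gauss_at_point_ge) auto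
 also have "\<dots> = (gmass p 1 0)"
  by (subst nn_integral_cmult[symmetric]) (auto simp: rho_def p_def ennreal_mult'[symmetric] intro!: nn_integral_cong)
 also have "\<dots> \<le> (gmass p 1 t)"
  by (rule ennreal_add_leD(1)[OF huisken]) (use t in auto)
 also have "\<dots> \<le> (NN u. ennreal (exp (- (2 * E)) / sqrt (4 * pi * s)) * ennreal (exp (- (norm (z t u - p))\<^sup>2 / (4 * (2 * s))) * J t u))"
 proof (rule nn_integral_mono)
  fix u
  have "norm (z t u) \<le> norm p + norm (z t u - p)" by (rule norm_triangle_sub)
  hence "sqrt (32 * E) \<le> norm (z t u - p)" using far[of u] p by (simp add: p_def)
  hence "(sqrt (32 * E))\<^sup>2 \<le> (norm (z t u - p))\<^sup>2" using E by (intro power_mono) auto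
  hence "32 * E \<le> (norm (z t u - p))\<^sup>2" using E by simp
  moreover have "E * (16 * s) \<le> E * 32" using s E by (intro mult_left_mono) auto
  ultimately have "2 * E \<le> (norm (z t u - p))\<^sup>2 / (8 * s)" using s by (simp add: pos_le_divide_eq mult_ac)
  hence "- (norm (z t u - p))\<^sup>2 / (4 * s) \<le> - (2 * E) + - (norm (z t u - p))\<^sup>2 / (4 * (2 * s))" by simp
  hence "exp (- (norm (z t u - p))\<^sup>2 / (4 * s)) \<le> exp (- (2 * E)) * exp (- (norm (z t u - p))\<^sup>2 / (4 * (2 * s)))"
   by (simp only: exp_add[symmetric] exp_le_cancel_iff)
  hence "exp (- (norm (z t u - p))\<^sup>2 / (4 * s)) * (J t u / sqrt (4 * pi * s)) \<le> exp (- (2 * E)) * exp (- (norm (z t u - p))\<^sup>2 / (4 * (2 * s))) * (J t u / sqrt (4 * pi * s))"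
   using J_pos[of t u] t s by (intro mult_right_mono) auto
  hence "rho p 1 t u * J t u \<le> exp (- (2 * E)) / sqrt (4 * pi * s) * (exp (- (norm (z t u - p))\<^sup>2 / (4 * (2 * s))) * J t u)"
   by (simp add: rho_def s_def mult_ac)
  thus "ennreal (rho p 1 t u * J t u) \<le> ennreal (exp (- (2 * E)) / sqrt (4 * pi * s)) * ennreal (exp (- (norm (z t u - p))\<^sup>2 / (4 * (2 * s))) * J t u)"
   using s by (subst ennreal_mult'[symmetric]) (auto intro: ennreal_leI)
 qed
 also have "\<dots> = ennreal (exp (- (2 * E)) / sqrt (4 * pi * s)) * (NE u. exp (- (norm (z t u - p))\<^sup>2 / (4 * (2 * s))) * J t u)"
  by (rule nn_integral_cmult) measurable
 also have "\<dots> \<le> ennreal (exp (- (2 * E)) / sqrt (4 * pi * s)) * ennreal (E * sqrt (4 * pi * (2 * s)))"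
  using s t by (intro mult_left_mono gauss) auto
 also have "\<dots> = ennreal (exp (- (2 * E)) / sqrt (4 * pi * s) * (E * sqrt (4 * pi * (2 * s))))"
  using s by (intro ennreal_mult'[symmetric]) auto
 also have "exp (- (2 * E)) / sqrt (4 * pi * s) * (E * sqrt (4 * pi * (2 * s))) = exp (- (2 * E)) * (E * sqrt 2)"
 proof -
  have "sqrt (4 * pi * (2 * s)) = sqrt 2 * sqrt (4 * pi * s)" by (simp flip: real_sqrt_mult)
  thus ?thesis using s by simp
 qed
 also have "ennreal (exp (- (2 * E)) * (E * sqrt 2)) < 1"
 proof -
  have "1 + 2 * E \<le> exp (2 * E)" by (rule exp_ge_add_one_self)
  moreover have "E * sqrt 2 \<le> E * 2" using E by (intro mult_left_mono) (auto intro: real_le_lsqrt)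
  ultimately have "E * sqrt 2 < exp (2 * E)" by linarith
  hence "exp (- (2 * E)) * (E * sqrt 2) < exp (- (2 * E)) * exp (2 * E)" by (intro mult_strict_left_mono) auto
  thus ?thesis by (simp add: exp_add[symmetric] ennreal_less_one_iff)
 qed
 finally show False by simp
qed

end

text \<open>Averaging over the time interval finds a slice of bounded curvature energy, to which the
  angle variance bound applies with a reference point from \<open>point_in_ball\<close>. The
  constant depends on \<open>E\<close> only, so the result may be applied to every rescaling of one
  flow.\<close>

lemma uniform_variance_time:
 assumes E: "E > 0"
 shows "\<exists>C>0. \<forall>z J ag kp kps. csf z J ag kp kps E \<longrightarrow> norm (z 0 0) \<le> 1 \<longrightarrow>
  (\<exists>t\<in>{-1..-1/2}. \<exists>c. (NE u. (ag t u - c)\<^sup>2 * csf.rho z 0 0 t u * J t u) \<le> ennreal C)"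
proof -
 have R0: "1 + sqrt (32 * E) \<ge> 0" using E by (simp add: add_nonneg_nonneg)
 have "(1::real) > 0" by simp
 from flow_angle_variance_le[OF E this R0] obtain C where C: "C > 0"
  "\<And>z J ag kp kps t u0. csf z J ag kp kps E \<Longrightarrow> t \<le> 0 \<Longrightarrow> norm (z t u0) \<le> 1 + sqrt (32 * E) \<Longrightarrow>
  (NE u. (ag t u - ag t u0)\<^sup>2 * exp (- (norm (z t u))\<^sup>2 / (4 * 1)) * J t u)
  \<le> ennreal C * (1 + (NE u. (kp t u)\<^sup>2 * exp (- (norm (z t u))\<^sup>2 / (12 * 1)) * J t u))"
  by blast
 define C' where "C' = C * (1 + sqrt (16 * pi * 1) * (7 * E))"
 have "C' > 0" unfolding C'_def using C(1) E by (intro mult_pos_pos add_pos_nonneg) auto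
 show ?thesis
 proof (intro exI[of _ C'] conjI allI impI \<open>C' > 0\<close>)
  fix z J ag kp kps assume csf: "csf z J ag kp kps E" and z0: "norm (z 0 0) \<le> 1"
  interpret csf z J ag kp kps E by (rule csf)
  define K where "K = (\<lambda>t. NE u. (kp t u)\<^sup>2 * rho 0 3 t u * J t u)"
  \<comment> \<open>Energy of at least 7 E throughout would integrate to at least 7/2 E over this
    half unit of time, but the integral is at most 2 E + 4/7 E.\<close>
  have "\<exists>t\<in>{-1..-1/2}. K t \<le> ennreal (7 * E)"
  proof (rule ccontr)
   assume "\<not> ?thesis"
   hence big: "ennreal (7 * E) \<le> K t" if "t \<in> {-1..-1/2}" for t using that by (meson le_cases)
   have em: "emeasure lborel {-1..-1/2::real} = ennreal (1/2)" by (subst emeasure_lborel_Icc) auto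
   have "ennreal (7 / 2 * E) = ennreal (7 * E) * ennreal (1/2)" using E by (subst ennreal_mult'[symmetric]) (auto simp: mult_ac)
   also have "\<dots> = (NN t. ennreal (7 * E) * indicator {-1..-1/2::real} t)"
    by (subst nn_integral_cmult_indicator) (simp, simp only: em)
   also have "\<dots> \<le> (NN t. K t * indicator {-1..-1/2} t)"
    using big by (intro nn_integral_mono) (auto simp: indicator_def)
   also have "\<dots> \<le> ennreal (2 * E + 4 * E * (-1/2 - -1) / (3 - -1/2))"
    unfolding K_def by (rule curvature_energy_interval_le) auto
   finally show False using E by (simp add: ennreal_le_iff)
  qed
  then obtain t where t: "t \<in> {-1..-1/2}" "K t \<le> ennreal (7 * E)" by blast
  have t0: "t \<le> 0" "-1 \<le> t" using t by auto
  obtain u0 where u0: "norm (z t u0) \<le> 1 + sqrt (32 * E)" using point_in_ball[OF z0 t0(2,1)] by blast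
  have "(NE u. (ag t u - ag t u0)\<^sup>2 * rho 0 0 t u * J t u)
   \<le> (NE u. (ag t u - ag t u0)\<^sup>2 * exp (- (norm (z t u))\<^sup>2 / (4 * 1)) * J t u)"
  proof (intro nn_integral_mono ennreal_leI mult_right_mono mult_left_mono)
   fix u
   have "(norm (z t u))\<^sup>2 / (4 * 1) \<le> (norm (z t u))\<^sup>2 / (4 * (0 - t))" using t by (intro divide_left_mono) auto
   moreover have "1 \<le> sqrt (4 * pi * (0 - t))"
   proof -
    have "1 \<le> 4 * (0 - t) * pi" using t pi_gt3 mult_mono[of 1 "4 * (0 - t)" 1 pi] by auto
    thus ?thesis by (simp add: mult_ac)
   qed
   ultimately have "rho 0 0 t u \<le> exp (- (norm (z t u))\<^sup>2 / (4 * 1)) / 1"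
    unfolding rho_def by (intro frac_le) auto
   thus "rho 0 0 t u \<le> exp (- (norm (z t u))\<^sup>2 / (4 * 1))" by simp
  qed (use J_pos[OF t0(1)] in \<open>auto intro: less_imp_le\<close>)
  also have "\<dots> \<le> ennreal C * (1 + (NE u. (kp t u)\<^sup>2 * exp (- (norm (z t u))\<^sup>2 / (12 * 1)) * J t u))"
   by (rule C(2)[OF csf t0(1) u0])
  also have "\<dots> \<le> ennreal C * (1 + ennreal (sqrt (16 * pi * 1)) * K t)"
   unfolding K_def using t by (intro mult_left_mono add_left_mono curvature_kernel_le) auto
  also have "\<dots> \<le> ennreal C * (1 + ennreal (sqrt (16 * pi * 1)) * ennreal (7 * E))"
   by (intro mult_left_mono add_left_mono t(2)) auto
  also have "\<dots> = ennreal C'"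
  proof -
   have "1 + ennreal (sqrt (16 * pi * 1)) * ennreal (7 * E) = ennreal (1 + sqrt (16 * pi * 1) * (7 * E))"
    using E by (subst ennreal_mult'[symmetric]) (auto simp: ennreal_plus[symmetric] ennreal_1[symmetric] simp del: ennreal_plus ennreal_1)
   thus ?thesis unfolding C'_def using C(1) by (simp add: ennreal_mult')
  qed
  finally show "\<exists>t\<in>{-1..-1/2}. \<exists>c. (NE u. (ag t u - c)\<^sup>2 * rho 0 0 t u * J t u) \<le> ennreal C'"
   using t(1) by blast
 qed
qed

section \<open>Squared curvature integrated over the whole past\<close>

context csf
begin

text \<open>The extra \<open>l\<close> is the factor by which the speed is rescaled, so the product
  of kernel and speed is invariant.\<close>

lemma rho_rescale:
 assumes "l > 0" "t < 0"
 shows "csf.rho (\<lambda>t u. of_real l * z (t / l\<^sup>2) u) 0 0 t u * l = rho 0 0 (t / l\<^sup>2) u"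
proof -
 interpret L: csf "\<lambda>t u. of_real l * z (t / l\<^sup>2) u" "\<lambda>t u. l * J (t / l\<^sup>2) u" "\<lambda>t u. ag (t / l\<^sup>2) u"
   "\<lambda>t u. kp (t / l\<^sup>2) u / l" "\<lambda>t u. kps (t / l\<^sup>2) u / l\<^sup>2" E
  by (rule csf_rescale[OF csf_axioms assms(1)])
 have "sqrt (4 * pi * (0 - t / l\<^sup>2)) = sqrt (4 * pi * (0 - t)) / l"
 proof -
  have "4 * pi * (0 - t / l\<^sup>2) = 4 * pi * (0 - t) / l\<^sup>2" using assms by (simp add: field_simps)
  thus ?thesis by (simp only: real_sqrt_divide) (use assms in simp)
 qed
 moreover have "- (norm (of_real l * z (t / l\<^sup>2) u - 0))\<^sup>2 / (4 * (0 - t)) = - (norm (z (t / l\<^sup>2) u - 0))\<^sup>2 / (4 * (0 - t / l\<^sup>2))"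
  using assms by (simp add: norm_mult power_mult_distrib field_simps)
 ultimately show ?thesis unfolding L.rho_def rho_def by simp
qed

text \<open>The variance of the angle is scale invariant, so the uniform bound for a rescaled flow
  at a time in [-1, -1/2] is the same bound for the flow itself at that time divided by
  \<open>l^2\<close>.\<close>

lemma good_variance_times:
 obtains C where "C > 0" "\<And>a. \<exists>t\<le>a. \<exists>c. (NE u. (ag t u - c)\<^sup>2 * rho 0 0 t u * J t u) \<le> ennreal C"
proof -
 obtain C where C: "C > 0" "\<And>z J ag kp kps. csf z J ag kp kps E \<Longrightarrow> norm (z 0 0) \<le> 1 \<Longrightarrow>
  (\<exists>t\<in>{-1..-1/2}. \<exists>c. (NE u. (ag t u - c)\<^sup>2 * csf.rho z 0 0 t u * J t u) \<le> ennreal C)"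
  using uniform_variance_time[OF E] by blast
 have "\<exists>t\<le>a. \<exists>c. (NE u. (ag t u - c)\<^sup>2 * rho 0 0 t u * J t u) \<le> ennreal C" for a
 proof -
  \<comment> \<open>The first bound moves \<open>z 0 0\<close> into the unit ball; the second sends
    every time in [-1, -1/2] to a time before \<open>a\<close>.\<close>
  define l where "l = min (1 / (norm (z 0 0) + 1)) (1 / sqrt (2 * (\<bar>a\<bar> + 1)))"
  have n0: "norm (z 0 0) + 1 > 0" by (simp add: add_nonneg_pos)
  have l: "l > 0" "l \<le> 1 / (norm (z 0 0) + 1)" "l \<le> 1 / sqrt (2 * (\<bar>a\<bar> + 1))" using n0 by (auto simp: l_def)
  have l1: "norm (of_real l * z (0 / l\<^sup>2) 0) \<le> 1"
  proof -
   have "l * norm (z 0 0) \<le> 1 / (norm (z 0 0) + 1) * norm (z 0 0)" using l by (intro mult_right_mono) auto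
   also have "\<dots> \<le> 1" using n0 by (simp add: divide_le_eq)
   finally show ?thesis using l by (simp add: norm_mult)
  qed
  have "l\<^sup>2 \<le> (1 / sqrt (2 * (\<bar>a\<bar> + 1)))\<^sup>2" using l by (intro power_mono) auto
  also have "\<dots> = 1 / (2 * (\<bar>a\<bar> + 1))" by (simp add: power_divide)
  finally have l2: "l\<^sup>2 * (\<bar>a\<bar> + 1) \<le> 1 / 2" by (simp add: field_simps)
  obtain t c where tc: "t \<in> {-1..-1/2}" "(NE u. (ag (t / l\<^sup>2) u - c)\<^sup>2 * csf.rho (\<lambda>t u. of_real l * z (t / l\<^sup>2) u) 0 0 t u * (l * J (t / l\<^sup>2) u)) \<le> ennreal C"
   using C(2)[OF csf_rescale[OF csf_axioms l(1)] l1] by blast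
  have tneg: "t < 0" using tc by auto
  have eq: "(ag (t / l\<^sup>2) u - c)\<^sup>2 * csf.rho (\<lambda>t u. of_real l * z (t / l\<^sup>2) u) 0 0 t u * (l * J (t / l\<^sup>2) u)
   = (ag (t / l\<^sup>2) u - c)\<^sup>2 * rho 0 0 (t / l\<^sup>2) u * J (t / l\<^sup>2) u" for u
   using rho_rescale[OF l(1) tneg, of u] by (simp add: mult_ac)
  have "(NE u. (ag (t / l\<^sup>2) u - c)\<^sup>2 * rho 0 0 (t / l\<^sup>2) u * J (t / l\<^sup>2) u) \<le> ennreal C"
   using tc(2) unfolding eq .
  moreover have "t / l\<^sup>2 \<le> a"
  proof -
   have "t \<le> - (l\<^sup>2 * (\<bar>a\<bar> + 1))" using tc(1) l2 by auto
   also have "\<dots> \<le> l\<^sup>2 * a" unfolding mult_minus_right[symmetric] by (intro mult_left_mono) auto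
   finally show ?thesis using l(1) by (simp add: pos_divide_le_eq mult.commute)
  qed
  ultimately show ?thesis by blast
 qed
 thus ?thesis using that C(1) by blast
qed

text \<open>The weight (x - c)^2 has second derivative 2, so the gain f''/2 times the squared
  curvature is exactly the squared curvature, and f'^2 = 4 f lies below 8 f f'' = 16 f.\<close>

lemma variance_monotonicity:
 assumes t: "t1 \<le> t2" "t2 < 0"
 shows "(NE u. (ag t2 u - c)\<^sup>2 * rho 0 0 t2 u * J t2 u)
  + (NN t. (NE u. (kp t u)\<^sup>2 * rho 0 0 t u * J t u) * indicator {t1..t2} t)
  \<le> (NE u. (ag t1 u - c)\<^sup>2 * rho 0 0 t1 u * J t1 u)"
proof -
 have fin: "(NN t. (NE u. (ag t u - c)\<^sup>2 * rho 0 0 t u * J t u) * indicator {t1..t2} t) < \<infinity>"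
 proof (rule finite_weighted_time_integral[OF t, where B="2 + 2 * c\<^sup>2" and f="\<lambda>x. (x - c)\<^sup>2"])
  show "(x - c)\<^sup>2 \<le> (2 + 2 * c\<^sup>2) * (1 + x\<^sup>2)" for x
  proof -
   have "(x - c)\<^sup>2 \<le> 2 * x\<^sup>2 + 2 * c\<^sup>2" using zero_le_power2[of "x + c"] by (simp add: power2_eq_square algebra_simps)
   moreover have "(2 + 2 * c\<^sup>2) * (1 + x\<^sup>2) = 2 + 2 * x\<^sup>2 + 2 * c\<^sup>2 + 2 * (c\<^sup>2 * x\<^sup>2)" by (simp add: algebra_simps)
   moreover have "0 \<le> c\<^sup>2 * x\<^sup>2" by simp
   ultimately show ?thesis by linarith
  qed
 qed auto
 have key: "(2 * (x - c))\<^sup>2 \<le> 8 * (x - c)\<^sup>2 * 2" for x by (simp only: power_mult_distrib) simp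
 have "(NE u. (ag t2 u - c)\<^sup>2 * rho 0 0 t2 u * J t2 u)
  + (NN t. (NE u. (2 / 2 * (kp t u)\<^sup>2 + (ag t u - c)\<^sup>2 * (Vel 0 0 t u)\<^sup>2) * rho 0 0 t u * J t u) * indicator {t1..t2} t)
  \<le> (NE u. (ag t1 u - c)\<^sup>2 * rho 0 0 t1 u * J t1 u)"
  by (rule gaussian_monotonicity[where f="\<lambda>x. (x - c)\<^sup>2" and f'="\<lambda>x. 2 * (x - c)" and f''="\<lambda>_. 2", OF t(1) _ t(2) _ _ _ _ _ key fin])
   (use t in \<open>auto intro!: derivative_eq_intros\<close>)
 moreover have "(NN t. (NE u. (kp t u)\<^sup>2 * rho 0 0 t u * J t u) * indicator {t1..t2} t)
  \<le> (NN t. (NE u. (2 / 2 * (kp t u)\<^sup>2 + (ag t u - c)\<^sup>2 * (Vel 0 0 t u)\<^sup>2) * rho 0 0 t u * J t u) * indicator {t1..t2} t)"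
 proof (rule nn_integral_mono)
  fix t
  show "(NE u. (kp t u)\<^sup>2 * rho 0 0 t u * J t u) * indicator {t1..t2} t
   \<le> (NE u. (2 / 2 * (kp t u)\<^sup>2 + (ag t u - c)\<^sup>2 * (Vel 0 0 t u)\<^sup>2) * rho 0 0 t u * J t u) * indicator {t1..t2} t"
  proof (cases "t \<in> {t1..t2}")
   case True
   hence "t < 0" "t \<le> 0" using t by auto
   thus ?thesis using J_pos[of t] rho_nonneg[of t 0 0]
    by (intro mult_right_mono nn_integral_mono ennreal_leI) (auto intro: less_imp_le)
  qed simp
 qed
 ultimately show ?thesis by (meson add_left_mono order_trans)
qed

text \<open>Starting from good times arbitrarily far in the past,
  \<open>variance_monotonicity\<close> bounds the curvature integral over every interval by the same
  \<open>C\<close>. The centre of the variance depends on the starting time, but it cannot drift: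
  two centres with variance at most \<open>C\<close> at time -1 differ in square by at most 4 C over
  the Gaussian mass at that time. Hence the second moment about the fixed centre 0 is bounded as
  well.\<close>

lemma energy_bounded:
 obtains C where "C > 0"
  "\<And>a. (NN t. (energy t) * indicator {a..-1} t) \<le> ennreal C"
  "\<And>t. t \<le> -1 \<Longrightarrow> (NE u. (ag t u)\<^sup>2 * rho 0 0 t u * J t u) \<le> ennreal C"
proof -
 define Q where "Q = (\<lambda>t c. NE u. (ag t u - c)\<^sup>2 * rho 0 0 t u * J t u)"
 define K where "K = (\<lambda>a. NN t. (NE u. (kp t u)\<^sup>2 * rho 0 0 t u * J t u) * indicator {a..-1} t)"
 define V where "V = (\<lambda>a. NN t. (NE u. (Vel 0 0 t u)\<^sup>2 * rho 0 0 t u * J t u) * indicator {a..-1} t)"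
 have rJ: "0 \<le> rho 0 0 t u" "0 \<le> J t u" if "t \<le> -1" for t u using that J_pos[of t u] rho_nonneg[of t 0 0 u] by auto
 obtain C where C: "C > 0" "\<And>a. \<exists>t\<le>a. \<exists>c. Q t c \<le> ennreal C"
  unfolding Q_def by (rule good_variance_times) blast
 \<comment> \<open>The variance about a fixed centre decreases in time, so one earlier good time
   gives the bound at \<open>s\<close> and at -1 with the same \<open>c\<close>.\<close>
 have 1: "\<exists>c. Q s c \<le> ennreal C \<and> Q (-1) c \<le> ennreal C" if "s \<le> -1" for s
 proof -
  obtain t c where tc: "t \<le> s" "Q t c \<le> ennreal C" using C(2) by blast
  have "Q s c \<le> Q t c" "Q (-1) c \<le> Q t c" unfolding Q_def
   using tc(1) that by (intro ennreal_add_leD(1)[OF variance_monotonicity]; simp)+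
  thus ?thesis using tc(2) by (meson order_trans)
 qed
 have Kle: "K a \<le> ennreal C" for a
 proof -
  obtain t c where tc: "t \<le> min a (-1)" "Q t c \<le> ennreal C" using C(2) by blast
  have "K a \<le> K t" unfolding K_def
   using tc(1) by (intro nn_integral_mono mult_left_mono) (auto simp: indicator_def)
  also have "\<dots> \<le> Q t c" unfolding K_def Q_def
   using tc(1) by (intro ennreal_add_leD(2)[OF variance_monotonicity]) auto
  finally show ?thesis using tc(2) by (meson order_trans)
 qed
 have Vle: "V a \<le> ennreal E" for a
 proof (cases "a \<le> -1")
  case True
  have "V a \<le> (gmass 0 0 a)"
   unfolding V_def using True by (intro ennreal_add_leD(2)[OF huisken]) auto
  also have "\<dots> \<le> ennreal E" using True by (intro gauss_rho_le) auto
  finally show ?thesis .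
 qed (simp add: V_def)
 obtain c1 where c1: "Q (-1) c1 \<le> ennreal C" using 1[of "-1"] by auto
 have Qshift: "Q t c \<le> 2 * Q t d + ennreal (2 * (c - d)\<^sup>2) * (gmass 0 0 t)" if "t \<le> -1" for t c d
 proof -
  have "Q t c \<le> (NN u. 2 * ennreal ((ag t u - d)\<^sup>2 * rho 0 0 t u * J t u) + ennreal (2 * (c - d)\<^sup>2) * ennreal (rho 0 0 t u * J t u))"
   unfolding Q_def
  proof (rule nn_integral_mono)
   fix u
   have "(ag t u - c)\<^sup>2 \<le> 2 * (ag t u - d)\<^sup>2 + 2 * (c - d)\<^sup>2"
    using zero_le_power2[of "ag t u - d + (c - d)"] by (simp add: power2_eq_square algebra_simps)
   hence "(ag t u - c)\<^sup>2 * (rho 0 0 t u * J t u) \<le> (2 * (ag t u - d)\<^sup>2 + 2 * (c - d)\<^sup>2) * (rho 0 0 t u * J t u)"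
    using rJ[OF that] by (intro mult_right_mono) auto
   hence "ennreal ((ag t u - c)\<^sup>2 * rho 0 0 t u * J t u) \<le> ennreal (2 * ((ag t u - d)\<^sup>2 * rho 0 0 t u * J t u) + 2 * (c - d)\<^sup>2 * (rho 0 0 t u * J t u))"
    by (intro ennreal_leI) (simp add: algebra_simps)
   also have "\<dots> = 2 * ennreal ((ag t u - d)\<^sup>2 * rho 0 0 t u * J t u) + ennreal (2 * (c - d)\<^sup>2) * ennreal (rho 0 0 t u * J t u)"
   proof -
    have 2: "2 * ennreal x = ennreal (2 * x)" for x by (simp add: ennreal_mult')
    have 3: "ennreal (2 * (c - d)\<^sup>2) * ennreal x = ennreal (2 * (c - d)\<^sup>2 * x)" for x by (rule ennreal_mult'[symmetric]) auto
    show ?thesis unfolding 2 3 by (rule ennreal_plus) (use rJ[OF that] in auto)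
   qed
   finally show "ennreal ((ag t u - c)\<^sup>2 * rho 0 0 t u * J t u) \<le> 2 * ennreal ((ag t u - d)\<^sup>2 * rho 0 0 t u * J t u) + ennreal (2 * (c - d)\<^sup>2) * ennreal (rho 0 0 t u * J t u)" .
  qed
  also have "\<dots> = 2 * Q t d + ennreal (2 * (c - d)\<^sup>2) * (gmass 0 0 t)"
   unfolding Q_def by (subst nn_integral_add) (auto simp: nn_integral_cmult)
  finally show ?thesis .
 qed
 define P where "P = (NE u. rho 0 0 (-1) u * J (-1) u)"
 have P: "P \<le> ennreal E" unfolding P_def by (intro gauss_rho_le) auto
 have "P \<noteq> 0"
 proof
  assume "P = 0"
  hence "AE u in lborel. ennreal (rho 0 0 (-1) u * J (-1) u) = 0" unfolding P_def by (subst (asm) nn_integral_0_iff_AE) auto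
  moreover have "ennreal (rho 0 0 (-1) u * J (-1) u) \<noteq> 0" for u
   using J_pos[of "-1" u] by (simp add: rho_def ennreal_eq_0_iff not_le)
  ultimately have "AE u in (lborel :: real measure). False" by simp
  thus False by (simp add: AE_iff_measurable[OF _ refl])
 qed
 then obtain p where p: "P = ennreal p" "p > 0" using P by (cases P) (auto simp: top_unique less_le)
 define D where "D = 4 * C / p"
 have shift_bound: "(c - c1)\<^sup>2 \<le> D" if "Q (-1) c \<le> ennreal C" for c
 proof -
  have "ennreal ((c - c1)\<^sup>2 * p) = (NN u. ennreal ((c - c1)\<^sup>2) * ennreal (rho 0 0 (-1) u * J (-1) u))"
   using p by (subst nn_integral_cmult) (auto simp: P_def[symmetric] ennreal_mult')
  also have "\<dots> \<le> (NN u. 2 * ennreal ((ag (-1) u - c)\<^sup>2 * rho 0 0 (-1) u * J (-1) u) + 2 * ennreal ((ag (-1) u - c1)\<^sup>2 * rho 0 0 (-1) u * J (-1) u))"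
  proof (rule nn_integral_mono)
   fix u
   have "(c - c1)\<^sup>2 \<le> 2 * (ag (-1) u - c)\<^sup>2 + 2 * (ag (-1) u - c1)\<^sup>2"
    using zero_le_power2[of "(ag (-1) u - c) + (ag (-1) u - c1)"] by (simp add: power2_eq_square algebra_simps)
   hence "(c - c1)\<^sup>2 * (rho 0 0 (-1) u * J (-1) u) \<le> (2 * (ag (-1) u - c)\<^sup>2 + 2 * (ag (-1) u - c1)\<^sup>2) * (rho 0 0 (-1) u * J (-1) u)"
    using rJ[of "-1"] by (intro mult_right_mono) auto
   hence "ennreal ((c - c1)\<^sup>2 * (rho 0 0 (-1) u * J (-1) u)) \<le> ennreal (2 * ((ag (-1) u - c)\<^sup>2 * rho 0 0 (-1) u * J (-1) u) + 2 * ((ag (-1) u - c1)\<^sup>2 * rho 0 0 (-1) u * J (-1) u))"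
    by (intro ennreal_leI) (simp add: algebra_simps)
   also have "\<dots> = 2 * ennreal ((ag (-1) u - c)\<^sup>2 * rho 0 0 (-1) u * J (-1) u) + 2 * ennreal ((ag (-1) u - c1)\<^sup>2 * rho 0 0 (-1) u * J (-1) u)"
   proof -
    have 2: "2 * ennreal x = ennreal (2 * x)" for x by (simp add: ennreal_mult')
    show ?thesis unfolding 2 by (rule ennreal_plus) (use rJ[of "-1"] in auto)
   qed
   finally show "ennreal ((c - c1)\<^sup>2) * ennreal (rho 0 0 (-1) u * J (-1) u)
    \<le> 2 * ennreal ((ag (-1) u - c)\<^sup>2 * rho 0 0 (-1) u * J (-1) u) + 2 * ennreal ((ag (-1) u - c1)\<^sup>2 * rho 0 0 (-1) u * J (-1) u)"
    by (subst ennreal_mult'[symmetric]) auto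
  qed
  also have "\<dots> = 2 * Q (-1) c + 2 * Q (-1) c1"
   unfolding Q_def by (subst nn_integral_add) (auto simp: nn_integral_cmult)
  also have "\<dots> \<le> 2 * ennreal C + 2 * ennreal C" by (intro add_mono mult_left_mono that c1) auto
  also have "\<dots> = ennreal (4 * C)"
  proof -
   have 2: "2 * ennreal x = ennreal (2 * x)" for x by (simp add: ennreal_mult')
   show ?thesis unfolding 2 using C(1) by (subst ennreal_plus[symmetric]) auto
  qed
  finally have "(c - c1)\<^sup>2 * p \<le> 4 * C" using C(1) by (simp add: ennreal_le_iff)
  thus ?thesis using p(2) by (simp add: D_def field_simps)
 qed
 define D' where "D' = 2 * c1\<^sup>2 + 2 * D"
 have D'0: "D' \<ge> 0" using C(1) p(2) by (simp add: D'_def D_def)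
 have th2: "Q t 0 \<le> ennreal (2 * C + 2 * D' * E)" if t: "t \<le> -1" for t
 proof -
  obtain c where c: "Q t c \<le> ennreal C" "Q (-1) c \<le> ennreal C" using 1[OF t] by blast
  have "c\<^sup>2 \<le> 2 * c1\<^sup>2 + 2 * (c - c1)\<^sup>2" using zero_le_power2[of "c - 2 * c1"] by (simp add: power2_eq_square algebra_simps)
  hence cD: "c\<^sup>2 \<le> D'" using shift_bound[OF c(2)] by (simp add: D'_def)
  have "Q t 0 \<le> 2 * Q t c + ennreal (2 * (0 - c)\<^sup>2) * (gmass 0 0 t)"
   by (rule Qshift[OF t])
  also have "\<dots> \<le> 2 * ennreal C + ennreal (2 * D') * ennreal E"
   using cD t by (intro add_mono mult_mono c(1) gauss_rho_le ennreal_leI) auto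
  also have "\<dots> = ennreal (2 * C + 2 * D' * E)"
   using C(1) E D'0 by (simp add: ennreal_mult' ennreal_plus mult.assoc)
  finally show ?thesis .
 qed
 define Ct where "Ct = max (C + E) (2 * C + 2 * D' * E)"
 show ?thesis
 proof (rule that[of Ct])
  show "Ct > 0" using C(1) E by (simp add: Ct_def max_def)
  fix a
  have "(NN t. (energy t) * indicator {a..-1} t)
   = (NN t. (NE u. (kp t u)\<^sup>2 * rho 0 0 t u * J t u) * indicator {a..-1} t
     + (NE u. (Vel 0 0 t u)\<^sup>2 * rho 0 0 t u * J t u) * indicator {a..-1} t)"
  proof (rule nn_integral_cong)
   fix t
   show "(energy t) * indicator {a..-1} t
    = (NE u. (kp t u)\<^sup>2 * rho 0 0 t u * J t u) * indicator {a..-1} t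
     + (NE u. (Vel 0 0 t u)\<^sup>2 * rho 0 0 t u * J t u) * indicator {a..-1} t"
   proof (cases "t \<in> {a..-1}")
    case True
    hence t: "t \<le> -1" by simp
    have "(energy t)
     = (NN u. ennreal ((kp t u)\<^sup>2 * rho 0 0 t u * J t u) + ennreal ((Vel 0 0 t u)\<^sup>2 * rho 0 0 t u * J t u))"
     using rJ[OF t] by (intro nn_integral_cong) (auto simp: distrib_right ennreal_plus[symmetric] simp del: ennreal_plus)
    thus ?thesis using True by (simp add: nn_integral_add)
   qed simp
  qed
  also have "\<dots> = K a + V a" unfolding K_def V_def by (rule nn_integral_add) measurable
  also have "\<dots> \<le> ennreal C + ennreal E" by (intro add_mono Kle Vle)
  also have "\<dots> = ennreal (C + E)" using C(1) E by simp
  also have "\<dots> \<le> ennreal Ct" by (intro ennreal_leI) (simp add: Ct_def)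
  finally show "(NN t. (energy t) * indicator {a..-1} t) \<le> ennreal Ct" .
 next
  fix t :: real assume "t \<le> -1"
  from th2[OF this] have "Q t 0 \<le> ennreal Ct" by (rule order_trans) (auto simp: Ct_def intro!: ennreal_leI)
  thus "(NE u. (ag t u)\<^sup>2 * rho 0 0 t u * J t u) \<le> ennreal Ct" by (simp add: Q_def)
 qed
qed

end

section \<open>Gaussian integrals converge in the past\<close>

lemma antimono_bounded_at_bot:
 fixes g :: "real \<Rightarrow> real"
 assumes mono: "\<And>s t. s \<le> t \<Longrightarrow> t \<le> a \<Longrightarrow> g t \<le> g s" and bd: "\<And>t. t \<le> a \<Longrightarrow> g t \<le> B"
 shows "\<exists>L. (g \<longlongrightarrow> L) at_bot"
proof -
 define L where "L = (SUP t\<in>{..a}. g t)"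
 have bdd: "bdd_above (g ` {..a})" using bd by (auto intro!: bdd_aboveI[of _ B])
 have "(g \<longlongrightarrow> L) at_bot"
 proof (rule order_tendstoI)
  fix x assume "x < L"
  then obtain s where s: "s \<le> a" "x < g s" unfolding L_def using less_cSUP_iff[OF _ bdd] by auto
  show "eventually (\<lambda>t. x < g t) at_bot"
   using eventually_le_at_bot[of s] by eventually_elim (use s mono in \<open>force intro: less_le_trans\<close>)
 next
  fix x assume "L < x"
  show "eventually (\<lambda>t. g t < x) at_bot"
   using eventually_le_at_bot[of a]
  proof eventually_elim
   case (elim t)
   have "g t \<le> L" unfolding L_def using elim by (intro cSUP_upper bdd) auto
   thus ?case using \<open>L < x\<close> by simp
  qed
 qed
 thus ?thesis by blast
qed

lemma lborel_integral_eq_integral: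
 fixes f :: "real \<Rightarrow> real"
 assumes c: "continuous_on {a..b} f" and z: "\<And>x. x \<notin> {a..b} \<Longrightarrow> f x = 0"
 shows "(LBINT x. f x) = integral {a..b} f"
proof -
 have si: "set_integrable lborel {a..b} f" by (rule borel_integrable_atLeastAtMost'[OF c])
 have "(\<lambda>x. indicator {a..b} x *\<^sub>R f x) = f" using z by (auto simp: fun_eq_iff indicator_def)
 thus ?thesis using set_borel_integral_eq_integral(2)[OF si] by (simp add: set_lebesgue_integral_def)
qed

context csf
begin

text \<open>The monotonicity formula makes the integral nonincreasing in time, and quadratic growth
  of the weight together with the second moment bound keeps it bounded.\<close>

lemma weighted_limit:
 fixes f f' f'' :: "real \<Rightarrow> real"
 assumes f: "\<And>x. (f has_real_derivative f' x) (at x)" "\<And>x. (f' has_real_derivative f'' x) (at x)" "continuous_on UNIV f''"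
  and fpos: "\<And>x. 0 \<le> f x" "\<And>x. 0 \<le> f'' x" "\<And>x. (f' x)\<^sup>2 \<le> 8 * f x * f'' x"
  and B: "\<And>x. f x \<le> B * (1 + x\<^sup>2)" "B \<ge> 0"
 shows "\<exists>L. ((\<lambda>t. LBINT u. f (ag t u) * rho 0 0 t u * J t u) \<longlongrightarrow> L) at_bot"
  and "\<And>t. t \<le> -1 \<Longrightarrow> integrable lborel (\<lambda>u. f (ag t u) * rho 0 0 t u * J t u)"
  and "\<And>s t. s \<le> t \<Longrightarrow> t \<le> -1 \<Longrightarrow> (LBINT u. f (ag t u) * rho 0 0 t u * J t u) \<le> (LBINT u. f (ag s u) * rho 0 0 s u * J s u)"
proof -
 have cf: "continuous_on UNIV f" using f(1) by (auto intro: DERIV_isCont continuous_at_imp_continuous_on)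
 have [measurable]: "f \<in> borel_measurable borel" by (rule borel_measurable_continuous_onI[OF cf])
 obtain C where C: "C > 0" "\<And>t. t \<le> -1 \<Longrightarrow> (NE u. (ag t u)\<^sup>2 * rho 0 0 t u * J t u) \<le> ennreal C"
  by (rule energy_bounded) blast
 have rJ: "0 \<le> rho 0 0 t u" "0 \<le> J t u" if "t \<le> -1" for t u using that J_pos[of t u] rho_nonneg[of t 0 0 u] by auto
 define F where "F = (\<lambda>t. NE u. f (ag t u) * rho 0 0 t u * J t u)"
 have Fb: "F t \<le> ennreal (B * (E + C))" if t: "t \<le> -1" for t
 proof -
  have "F t \<le> (NN u. ennreal B * (ennreal (rho 0 0 t u * J t u) + ennreal ((ag t u)\<^sup>2 * rho 0 0 t u * J t u)))"
   unfolding F_def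
  proof (rule nn_integral_mono)
   fix u
   have "f (ag t u) * (rho 0 0 t u * J t u) \<le> B * (1 + (ag t u)\<^sup>2) * (rho 0 0 t u * J t u)"
    using rJ[OF t] by (intro mult_right_mono B(1)) auto
   hence "ennreal (f (ag t u) * rho 0 0 t u * J t u) \<le> ennreal (B * (rho 0 0 t u * J t u + (ag t u)\<^sup>2 * rho 0 0 t u * J t u))"
    by (intro ennreal_leI) (simp add: algebra_simps)
   also have "\<dots> = ennreal B * (ennreal (rho 0 0 t u * J t u) + ennreal ((ag t u)\<^sup>2 * rho 0 0 t u * J t u))"
    using B(2) rJ[OF t] by (subst ennreal_plus[symmetric]) (auto simp: ennreal_mult')
   finally show "ennreal (f (ag t u) * rho 0 0 t u * J t u) \<le> ennreal B * (ennreal (rho 0 0 t u * J t u) + ennreal ((ag t u)\<^sup>2 * rho 0 0 t u * J t u))" .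
  qed
  also have "\<dots> = ennreal B * ((gmass 0 0 t) + (NE u. (ag t u)\<^sup>2 * rho 0 0 t u * J t u))"
   by (subst nn_integral_cmult) (auto simp: nn_integral_add)
  also have "\<dots> \<le> ennreal B * (ennreal E + ennreal C)"
   using t by (intro mult_left_mono add_mono C(2) gauss_rho_le) auto
  also have "\<dots> = ennreal (B * (E + C))" using B(2) E C(1) by (simp add: ennreal_mult' ennreal_plus)
  finally show ?thesis .
 qed
 have Fint: "integrable lborel (\<lambda>u. f (ag t u) * rho 0 0 t u * J t u)" "ennreal (LBINT u. f (ag t u) * rho 0 0 t u * J t u) = F t"
  if t: "t \<le> -1" for t
 proof -
  have nn: "0 \<le> f (ag t u) * rho 0 0 t u * J t u" for u using fpos rJ[OF t] by auto
  show i: "integrable lborel (\<lambda>u. f (ag t u) * rho 0 0 t u * J t u)"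
   by (rule integrableI_nonneg) (use Fb[OF t] nn in \<open>auto simp: F_def intro: le_less_trans\<close>)
  show "ennreal (LBINT u. f (ag t u) * rho 0 0 t u * J t u) = F t"
   unfolding F_def by (rule nn_integral_eq_integral[symmetric, OF i]) (use nn in auto)
 qed
 show "\<And>t. t \<le> -1 \<Longrightarrow> integrable lborel (\<lambda>u. f (ag t u) * rho 0 0 t u * J t u)" by (rule Fint)
 have nn: "0 \<le> (LBINT u. f (ag t u) * rho 0 0 t u * J t u)" if "t \<le> -1" for t
  using fpos rJ[OF that] by (intro integral_nonneg_AE AE_I2) auto
 have mono: "(LBINT u. f (ag t u) * rho 0 0 t u * J t u) \<le> (LBINT u. f (ag s u) * rho 0 0 s u * J s u)" if st: "s \<le> t" "t \<le> -1" for s t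
 proof -
  have "F t \<le> F s" unfolding F_def
   by (rule ennreal_add_leD(1)[OF gaussian_monotonicity[OF st(1) _ _ f fpos]])
    (use st finite_weighted_time_integral[of s t f B] B in auto)
  hence "ennreal (LBINT u. f (ag t u) * rho 0 0 t u * J t u) \<le> ennreal (LBINT u. f (ag s u) * rho 0 0 s u * J s u)"
   using Fint(2)[of s] Fint(2)[of t] st by simp
  thus ?thesis using nn[of s] st by (simp add: ennreal_le_iff)
 qed
 show "\<And>s t. s \<le> t \<Longrightarrow> t \<le> -1 \<Longrightarrow> (LBINT u. f (ag t u) * rho 0 0 t u * J t u) \<le> (LBINT u. f (ag s u) * rho 0 0 s u * J s u)"
  by (rule mono)
 have bd: "(LBINT u. f (ag t u) * rho 0 0 t u * J t u) \<le> B * (E + C)" if t: "t \<le> -1" for t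
  using Fb[OF t] Fint(2)[OF t] B(2) E C(1) by (simp add: ennreal_le_iff[symmetric] del: ennreal_le_iff) 
 show "\<exists>L. ((\<lambda>t. LBINT u. f (ag t u) * rho 0 0 t u * J t u) \<longlongrightarrow> L) at_bot"
  by (rule antimono_bounded_at_bot[where a="-1", OF mono bd])
qed

lemma gaussian_limit:
 "\<exists>L. ((\<lambda>t. mass t) \<longlongrightarrow> L) at_bot"
 "\<And>t. t \<le> -1 \<Longrightarrow> integrable lborel (\<lambda>u. rho 0 0 t u * J t u)"
 using weighted_limit(1,2)[of "\<lambda>_. 1" "\<lambda>_. 0" "\<lambda>_. 0" 1] by (auto simp: add_nonneg_nonneg)

text \<open>The cosine is not convex, but adding 4 x^2 + 2 makes it so and leaves room for f'^2 <= 8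
  f f''. Both 4 x^2 + 2 and the sum have limits, and their difference is the cosine. The phase
  \<open>d\<close> gives the sine as well.\<close>

lemma direction_limit:
 "\<exists>L. ((\<lambda>t. LBINT u. cos (2 * ag t u + d) * rho 0 0 t u * J t u) \<longlongrightarrow> L) at_bot"
proof -
 define f0 where "f0 = (\<lambda>x::real. 4 * x\<^sup>2 + 2)"
 define f1 where "f1 = (\<lambda>x::real. 4 * x\<^sup>2 + 2 + cos (2 * x + d))"
 have a0: "(f0 has_real_derivative 8 * x) (at x)" "((\<lambda>x. 8 * x) has_real_derivative 8) (at x)" for x
  unfolding f0_def by (auto intro!: derivative_eq_intros)
 have a1: "(f1 has_real_derivative 8 * x - 2 * sin (2 * x + d)) (at x)"
  "((\<lambda>x. 8 * x - 2 * sin (2 * x + d)) has_real_derivative 8 - 4 * cos (2 * x + d)) (at x)" for x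
  unfolding f1_def by (auto intro!: derivative_eq_intros)
 have b0: "(8 * x)\<^sup>2 \<le> 8 * f0 x * 8" for x unfolding f0_def by (simp add: power_mult_distrib)
 have c: "f1 x \<ge> 4 * x\<^sup>2 + 1" "8 - 4 * cos (2 * x + d) \<ge> 4" for x
  using cos_ge_minus_one[of "2 * x + d"] cos_le_one[of "2 * x + d"] unfolding f1_def by linarith+
 have b1: "(8 * x - 2 * sin (2 * x + d))\<^sup>2 \<le> 8 * f1 x * (8 - 4 * cos (2 * x + d))" for x
 proof -
  have "(8 * x - 2 * sin (2 * x + d))\<^sup>2 \<le> 2 * (8 * x)\<^sup>2 + 2 * (2 * sin (2 * x + d))\<^sup>2"
   using zero_le_power2[of "8 * x + 2 * sin (2 * x + d)"] by (simp add: power2_eq_square algebra_simps)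
  also have "\<dots> = 128 * x\<^sup>2 + 8 * (sin (2 * x + d))\<^sup>2" by (simp add: power_mult_distrib)
  also have "\<dots> \<le> 128 * x\<^sup>2 + 8 * 1" by (intro add_left_mono mult_left_mono) (auto simp: abs_square_le_1)
  also have "\<dots> \<le> 8 * (4 * x\<^sup>2 + 1) * 4" by simp
  also have "\<dots> \<le> 8 * f1 x * (8 - 4 * cos (2 * x + d))"
   using c[of x] by (intro mult_mono) (auto intro: order_trans[OF _ c(1)])
  finally show ?thesis .
 qed
 have le: "f0 x \<le> 4 * (1 + x\<^sup>2)" "f1 x \<le> 4 * (1 + x\<^sup>2)" "0 \<le> f0 x" "0 \<le> f1 x" "0 \<le> 8 - 4 * cos (2 * x + d)" for x
 proof -
  show "f0 x \<le> 4 * (1 + x\<^sup>2)" "0 \<le> f0 x" by (simp_all add: f0_def)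
  show "0 \<le> 8 - 4 * cos (2 * x + d)" using cos_le_one[of "2 * x + d"] by linarith
  show "f1 x \<le> 4 * (1 + x\<^sup>2)" "0 \<le> f1 x"
   unfolding f1_def using cos_le_one[of "2 * x + d"] cos_ge_minus_one[of "2 * x + d"] zero_le_power2[of x]
   unfolding distrib_left by linarith+
 qed
 have cont: "continuous_on UNIV (\<lambda>x. 8 - 4 * cos (2 * x + d))" by (intro continuous_intros)
 note w0 = weighted_limit[OF a0 continuous_on_const le(3) _ b0 le(1)]
 note w1 = weighted_limit[OF a1 cont le(4) le(5) b1 le(2)]
 obtain L0 where L0: "((\<lambda>t. LBINT u. f0 (ag t u) * rho 0 0 t u * J t u) \<longlongrightarrow> L0) at_bot" using w0(1) by auto
 obtain L1 where L1: "((\<lambda>t. LBINT u. f1 (ag t u) * rho 0 0 t u * J t u) \<longlongrightarrow> L1) at_bot" using w1(1) by auto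
 have "((\<lambda>t. LBINT u. cos (2 * ag t u + d) * rho 0 0 t u * J t u) \<longlongrightarrow> L1 - L0) at_bot"
 proof (rule Lim_transform_eventually[OF tendsto_diff[OF L1 L0]])
  show "eventually (\<lambda>t. (LBINT u. f1 (ag t u) * rho 0 0 t u * J t u) - (LBINT u. f0 (ag t u) * rho 0 0 t u * J t u)
   = (LBINT u. cos (2 * ag t u + d) * rho 0 0 t u * J t u)) at_bot"
   using eventually_le_at_bot[of "-1"]
  proof eventually_elim
   case (elim t)
   have "(LBINT u. f1 (ag t u) * rho 0 0 t u * J t u) - (LBINT u. f0 (ag t u) * rho 0 0 t u * J t u)
    = (LBINT u. f1 (ag t u) * rho 0 0 t u * J t u - f0 (ag t u) * rho 0 0 t u * J t u)"
    using w0(2) w1(2) elim by (intro Bochner_Integration.integral_diff[symmetric]) auto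
   also have "\<dots> = (LBINT u. cos (2 * ag t u + d) * rho 0 0 t u * J t u)"
    by (intro Bochner_Integration.integral_cong) (auto simp: f0_def f1_def algebra_simps)
   finally show ?case .
  qed
 qed
 thus ?thesis by blast
qed

section \<open>Test integrals over the rescaled curve\<close>

text \<open>The integral of \<open>ph\<close> over the slice rescaled by 1/sqrt(-t), with its own
  length measure; under this normalization curves shrinking to the origin at time 0 are
  stationary.\<close>

definition Ntest :: "(complex \<Rightarrow> real) \<Rightarrow> real \<Rightarrow> real" where
 "Ntest ph t = (LBINT u. ph (of_real (1 / sqrt (- t)) * z t u) * (1 / sqrt (- t)) * J t u)"

text \<open>The time derivative of the rescaled test integral is an integral against
  \<open>Vel\<close>, hence small where the energy is small. As \<open>Vel\<close> enters linearly
  and the energy is quadratic, the inequality 2 v <= v^2/mu + mu with a free \<open>mu\<close> is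
  used, and the mass bound \<open>E\<close> pays for the second term.\<close>

lemma test_evolution:
 fixes ph :: "complex \<Rightarrow> real" and Dph :: "complex \<Rightarrow> complex"
 assumes s: "-1 \<le> s" "s \<le> -1/2"
  and ph: "\<And>x. (ph has_derivative (\<lambda>h. inner (Dph x) h)) (at x)" "continuous_on UNIV Dph"
  and R: "\<And>x. norm x \<ge> R \<Longrightarrow> ph x = 0 \<and> Dph x = 0"
  and M: "M \<ge> 0" "\<And>x. \<bar>ph x\<bar> \<le> M" "\<And>x. norm (Dph x) \<le> M" and mu: "mu > 0" and de: "de \<ge> 0"
  and en: "(NN t. (energy t) * indicator {-1..s} t) \<le> ennreal de"
 shows "\<bar>Ntest ph s - Ntest ph (-1)\<bar> \<le> M * sqrt (4 * pi) * exp (R\<^sup>2 / 2) * ((1 / mu + 1) * de + mu * E)"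
proof -
 define a where "a = (\<lambda>t::real. 1 / sqrt (- t))"
 define p where "p = (\<lambda>t u. inner (z t u) (cis (ag t u)))"
 define m where "m = (\<lambda>t u. inner (z t u) (\<i> * cis (ag t u)))"
 define f where "f = (\<lambda>t u. ph (of_real (a t) * z t u))"
 define D where "D = (\<lambda>t u. Dph (of_real (a t) * z t u))"
 have cf: "continuous_on UNIV ph" using ph(1) by (meson continuous_at_imp_continuous_on has_derivative_continuous)
 have a: "1 \<le> a t" "(a t)\<^sup>2 = 1 / (- t)" "(a t)\<^sup>2 \<le> 2" if "t \<in> {-1..s}" for t
 proof -
  have t: "1/2 \<le> - t" "- t \<le> 1" using that s by auto
  have "sqrt (- t) \<le> 1" "sqrt (- t) > 0" using t by auto
  thus "1 \<le> a t" by (simp add: a_def)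
  show a2: "(a t)\<^sup>2 = 1 / (- t)" using t by (simp add: a_def power_divide)
  have "1 / (- t) \<le> 1 / (1/2)" using t by (intro divide_left_mono) auto
  thus "(a t)\<^sup>2 \<le> 2" using a2 by simp
 qed
 have ad: "(a has_real_derivative (a t)^3 / 2) (at t within {-1..s})" if "t \<in> {-1..s}" for t
 proof -
  have t: "- t > 0" using that s by auto
  have "((\<lambda>t. - t) has_real_derivative - 1) (at t within {-1..s})" by (rule DERIV_minus[OF DERIV_ident])
  hence d: "((\<lambda>t. sqrt (- t)) has_real_derivative inverse (sqrt (- t)) / 2 * (- 1)) (at t within {-1..s})"
   by (rule DERIV_chain2[where f=sqrt and g="\<lambda>t. - t", rotated]) (rule DERIV_real_sqrt[OF t])
  have ne: "sqrt (- t) \<noteq> 0" using t by simp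
  have "- (inverse S * (inverse S / 2 * - 1) * inverse S) = (inverse S)^3 / 2" for S :: real by (simp add: power3_eq_cube)
  thus ?thesis using DERIV_inverse'[OF d ne] unfolding a_def inverse_eq_divide[symmetric] by (simp only:)
 qed
 define A where "A = (\<lambda>t u. a t * f t u)"
 define At where "At = (\<lambda>t u. (a t)^3 / 2 * f t u + a t * inner (D t u) (of_real ((a t)^3 / 2) * z t u + of_real (a t * kp t u) * (\<i> * cis (ag t u))))"
 define Au where "Au = (\<lambda>t u. a t * (inner (D t u) (cis (ag t u)) * (a t * J t u)))"
 \<comment> \<open>Accounts for the tangential part of the dilation field: with it all terms of the
   derivative combine into the multiple \<open>G\<close> of \<open>Vel\<close>.\<close>
 define B where "B = (\<lambda>t u. - ((a t)^3 / 2) * (f t u * p t u))"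
 define Bu where "Bu = (\<lambda>t u. - ((a t)^3 / 2) * (f t u * ((1 + kp t u * m t u) * J t u) + (inner (D t u) (cis (ag t u)) * (a t * J t u)) * p t u))"
 define G where "G = (\<lambda>t u. (inner (D t u) (\<i> * cis (ag t u)) * (a t)\<^sup>2 - a t * f t u * kp t u) * Vel 0 0 t u * J t u)"
 have s0: "s \<le> 0" "s < 0" using s by auto
 obtain U where U: "U > 0" "\<And>t u. t \<in> {-1..s} \<Longrightarrow> \<bar>u\<bar> \<ge> U \<Longrightarrow> norm (z t u) \<ge> R"
  by (rule proper[OF s(1) s0(1)]) blast
 have far: "f t u = 0 \<and> D t u = 0" if "t \<in> {-1..s}" "norm (z t u) \<ge> R" for t u
 proof -
  have "norm (z t u) \<le> a t * norm (z t u)" using a(1)[OF that(1)] mult_right_mono[of 1 "a t" "norm (z t u)"] by simp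
  hence "R \<le> norm (of_real (a t) * z t u)" using that(2) a(1)[OF that(1)] by (simp add: norm_mult)
  thus ?thesis using R by (simp add: f_def D_def)
 qed
 have f_u: "(f t has_real_derivative inner (D t u) (cis (ag t u)) * (a t * J t u)) (at u)" if "t \<le> 0" for t u
 proof -
  have "((\<lambda>v. of_real (a t) * z t v) has_derivative (\<lambda>h. of_real (a t) * (h *\<^sub>R (J t u *\<^sub>R cis (ag t u))))) (at u)"
   using z_u[OF that, of u] unfolding has_vector_derivative_def by (intro has_derivative_mult_right)
  from has_derivative_compose[OF this ph(1)]
  have "(f t has_derivative (\<lambda>h. inner (D t u) (of_real (a t) * (h *\<^sub>R (J t u *\<^sub>R cis (ag t u)))))) (at u)" by (simp add: f_def D_def)
  moreover have "inner (D t u) (of_real (a t) * (h *\<^sub>R (J t u *\<^sub>R cis (ag t u)))) = h *\<^sub>R (inner (D t u) (cis (ag t u)) * (a t * J t u))" for h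
  proof -
   have "of_real (a t) * (h *\<^sub>R (J t u *\<^sub>R cis (ag t u))) = (h * (a t * J t u)) *\<^sub>R cis (ag t u)" by (simp add: scaleR_conv_of_real)
   thus ?thesis by simp
  qed
  ultimately have "(f t has_derivative (\<lambda>h. h *\<^sub>R (inner (D t u) (cis (ag t u)) * (a t * J t u)))) (at u)" by (simp only:)
  thus ?thesis by (simp only: has_real_derivative_iff_has_vector_derivative has_vector_derivative_def)
 qed
 have f_t: "((\<lambda>t. f t u) has_real_derivative inner (D t u) (of_real ((a t)^3 / 2) * z t u + of_real (a t * kp t u) * (\<i> * cis (ag t u)))) (at t within {-1..s})"
  if t: "t \<in> {-1..s}" for t u
 proof -
  have t0: "t \<le> 0" "{-1..s} \<subseteq> {..0}" using t s by auto
  have zt: "((\<lambda>s. z s u) has_vector_derivative (kp t u *\<^sub>R (\<i> * cis (ag t u)))) (at t within {-1..s})"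
   by (rule has_vector_derivative_within_subset[OF z_t[OF t0(1)] t0(2)])
  have "((\<lambda>t. a t *\<^sub>R z t u) has_vector_derivative (a t *\<^sub>R (kp t u *\<^sub>R (\<i> * cis (ag t u))) + ((a t)^3 / 2) *\<^sub>R z t u)) (at t within {-1..s})"
   by (rule has_vector_derivative_scaleR[OF ad[OF t] zt])
  hence "((\<lambda>t. of_real (a t) * z t u) has_derivative (\<lambda>h. h *\<^sub>R (a t *\<^sub>R (kp t u *\<^sub>R (\<i> * cis (ag t u))) + ((a t)^3 / 2) *\<^sub>R z t u))) (at t within {-1..s})"
   by (simp add: has_vector_derivative_def scaleR_conv_of_real)
  from has_derivative_compose[OF this ph(1)]
  have "((\<lambda>t. f t u) has_derivative (\<lambda>h. inner (D t u) (h *\<^sub>R (a t *\<^sub>R (kp t u *\<^sub>R (\<i> * cis (ag t u))) + ((a t)^3 / 2) *\<^sub>R z t u)))) (at t within {-1..s})"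
   by (simp add: f_def D_def)
  moreover have "a t *\<^sub>R (kp t u *\<^sub>R (\<i> * cis (ag t u))) + ((a t)^3 / 2) *\<^sub>R z t u = of_real ((a t)^3 / 2) * z t u + of_real (a t * kp t u) * (\<i> * cis (ag t u))"
   by (simp add: scaleR_conv_of_real)
  ultimately have "((\<lambda>t. f t u) has_derivative (\<lambda>h. inner (D t u) (h *\<^sub>R (of_real ((a t)^3 / 2) * z t u + of_real (a t * kp t u) * (\<i> * cis (ag t u)))))) (at t within {-1..s})"
   by (simp only:)
  thus ?thesis by (simp only: has_real_derivative_iff_has_vector_derivative has_vector_derivative_def inner_scaleR_right real_scaleR_def)
 qed
 have ca: "continuous_on ({-1..s} \<times> S) (\<lambda>x. a (fst x))" for S :: "real set"
  unfolding a_def using s by (intro continuous_intros) auto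
 have cD: "continuous_on ({-1..s} \<times> S) (\<lambda>x. f (fst x) (snd x))" "continuous_on ({-1..s} \<times> S) (\<lambda>x. D (fst x) (snd x))" for S
  unfolding f_def D_def
  by (intro continuous_on_compose2[OF cf] continuous_on_compose2[OF ph(2)] continuous_intros cont2 ca; simp)+
 have cV: "continuous_on ({-1..s} \<times> S) (\<lambda>x. Vel 0 0 (fst x) (snd x))" "continuous_on ({-1..s} \<times> S) (\<lambda>x. rho 0 0 (fst x) (snd x))" for S :: "real set"
  by (intro cont_rho_Vel continuous_intros; use s in auto)+
 have contA: "continuous_on ({-1..s} \<times> UNIV) (\<lambda>x. A (fst x) (snd x))" "continuous_on ({-1..s} \<times> UNIV) (\<lambda>x. At (fst x) (snd x))"
  unfolding A_def At_def by (intro continuous_intros ca cD cont2; simp)+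
 have contG: "continuous_on ({-1..s} \<times> {-U..U}) (\<lambda>x. G (fst x) (snd x))"
  unfolding G_def by (intro continuous_intros ca cD cV cont2)
 have Err: "1 * At t u * J t u - 1 * (kp t u)\<^sup>2 * A t u * J t u - 0 * (kp t u)\<^sup>2 * A t u * J t u - 0 * kp t u * Au t u + 0 * kp t u * J t u * B t u + 1 * Bu t u = G t u"
  if t: "t \<in> {-1..s}" for t u
 proof -
  define d1 d2 where "d1 = inner (D t u) (cis (ag t u))" and "d2 = inner (D t u) (\<i> * cis (ag t u))"
  have dz: "inner (D t u) (z t u) = d1 * p t u + d2 * m t u"
  proof -
   have "((sin (ag t u))\<^sup>2 + (cos (ag t u))\<^sup>2) * (Re (D t u) * Re (z t u) + Im (D t u) * Im (z t u))
    = (Re (D t u) * cos (ag t u) + Im (D t u) * sin (ag t u)) * (Re (z t u) * cos (ag t u) + Im (z t u) * sin (ag t u))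
    + (Im (D t u) * cos (ag t u) - Re (D t u) * sin (ag t u)) * (Im (z t u) * cos (ag t u) - Re (z t u) * sin (ag t u))"
    by algebra
   thus ?thesis by (simp add: d1_def d2_def p_def m_def inner_complex_def)
  qed
  have ex: "inner (D t u) (of_real ((a t)^3 / 2) * z t u + of_real (a t * kp t u) * (\<i> * cis (ag t u)))
   = (a t)^3 / 2 * (d1 * p t u + d2 * m t u) + a t * kp t u * d2"
  proof -
   have "inner (D t u) (of_real x * w) = x * inner (D t u) w" for x w by (simp flip: scaleR_conv_of_real)
   thus ?thesis by (simp only: inner_add_right dz d2_def[symmetric])
  qed
  have V: "Vel 0 0 t u = kp t u + m t u * (a t)\<^sup>2 / 2" using a(2)[OF t] by (simp add: Vel_def m_def)
  show ?thesis unfolding At_def A_def Bu_def G_def ex V d1_def[symmetric] d2_def[symmetric]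
   by (simp add: algebra_simps power2_eq_square power3_eq_cube)
 qed
 have hh: "((\<lambda>t. integral {-U..U} (\<lambda>u. 1 * At t u * J t u - 1 * (kp t u)\<^sup>2 * A t u * J t u - 0 * (kp t u)\<^sup>2 * A t u * J t u - 0 * kp t u * Au t u + 0 * kp t u * J t u * B t u + 1 * Bu t u))
   has_integral (integral {-U..U} (\<lambda>u. 1 * A s u * J s u) - integral {-U..U} (\<lambda>u. 1 * A (-1) u * J (-1) u))) {-1..s}"
 proof (rule weighted_integral_evolution[OF s(1) s0(1) U(1), where f="\<lambda>_. 1" and f'="\<lambda>_. 0" and f''="\<lambda>_. 0", OF _ _ _ _ _ _ contA])
  fix t u assume t: "t \<in> {-1..s}"
  have t0: "t \<le> 0" using t s by auto
  show "((\<lambda>s. A s u) has_real_derivative At t u) (at t within {-1..s})"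
   unfolding A_def by (rule DERIV_cong[OF DERIV_mult'[OF ad[OF t] f_t[OF t]]]) (simp add: At_def)
  show "(A t has_real_derivative Au t u) (at u)"
   unfolding A_def Au_def by (rule DERIV_cmult[OF f_u[OF t0]])
  have pu: "(p t has_real_derivative (1 + kp t u * m t u) * J t u) (at u)"
   using sq_dist_deriv(3)[OF t0, of 0 u] by (simp add: p_def m_def)
  show "(B t has_real_derivative Bu t u) (at u)"
   unfolding B_def Bu_def by (rule DERIV_cmult[OF DERIV_mult'[OF f_u[OF t0] pu]])
  show "A t u = 0 \<and> B t u = 0" if "\<bar>u\<bar> = U" using far[OF t, of u] U(2)[OF t, of u] that by (simp add: A_def B_def)
 qed auto
 have "((\<lambda>t. integral {-U..U} (G t)) has_integral (integral {-U..U} (\<lambda>u. 1 * A s u * J s u) - integral {-U..U} (\<lambda>u. 1 * A (-1) u * J (-1) u))) {-1..s}"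
  by (rule has_integral_eq[OF _ hh]) (simp only: Err)
 hence ev: "((\<lambda>t. integral {-U..U} (G t)) has_integral (integral {-U..U} (\<lambda>u. A s u * J s u) - integral {-U..U} (\<lambda>u. A (-1) u * J (-1) u))) {-1..s}"
  by simp
 have NA: "Ntest ph t = integral {-U..U} (\<lambda>u. A t u * J t u)" if t: "t \<in> {-1..s}" for t
 proof -
  have "continuous_on {-U..U} (\<lambda>u. A t u * J t u)"
   by (intro continuous_intros cont2 continuous_on_subset[OF continuous_on_slice[OF contA(1) t]]) auto
  from lborel_integral_eq_integral[OF this] far[OF t] U(2)[OF t]
  have "(LBINT u. A t u * J t u) = integral {-U..U} (\<lambda>u. A t u * J t u)"
   by (force simp: A_def)
  thus ?thesis by (simp add: Ntest_def A_def f_def a_def mult_ac)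
 qed
 define c where "c = M * sqrt (4 * pi) * exp (R\<^sup>2 / 2)"
 have c0: "c \<ge> 0" using M by (simp add: c_def)
 define H where "H = (\<lambda>t u. (1 / mu + 1) * (((kp t u)\<^sup>2 + (Vel 0 0 t u)\<^sup>2) * rho 0 0 t u * J t u) + mu * (rho 0 0 t u * J t u))"
 have GH: "\<bar>G t u\<bar> \<le> c * H t u" if t: "t \<in> {-1..s}" for t u
 proof (cases "norm (z t u) \<ge> R")
  case True
  hence "G t u = 0" using far[OF t] by (simp add: G_def)
  moreover have "0 \<le> H t u" using J_pos[of t u] rho_nonneg[of t 0 0 u] t s mu unfolding H_def
   by (intro add_nonneg_nonneg mult_nonneg_nonneg) auto
  ultimately show ?thesis using c0 by simp
 next
  case False
  have t0: "t \<le> 0" "t < 0" using t s by auto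
  define v k where "v = \<bar>Vel 0 0 t u\<bar>" and "k = \<bar>kp t u\<bar>"
  have a2: "a t \<le> 2" using a[OF t] self_le_power[of "a t" 2] by linarith
  have "\<bar>inner (D t u) (\<i> * cis (ag t u)) * (a t)\<^sup>2 - a t * f t u * kp t u\<bar> \<le> \<bar>inner (D t u) (\<i> * cis (ag t u))\<bar> * (a t)\<^sup>2 + a t * \<bar>f t u\<bar> * k"
   using a(1)[OF t] by (intro order_trans[OF abs_triangle_ineq4]) (simp add: abs_mult k_def)
  also have "\<dots> \<le> M * 2 + 2 * M * k"
  proof (intro add_mono mult_mono)
   have "\<bar>inner (D t u) (\<i> * cis (ag t u))\<bar> \<le> norm (D t u) * norm (\<i> * cis (ag t u))" by (rule Cauchy_Schwarz_ineq2)
   thus "\<bar>inner (D t u) (\<i> * cis (ag t u))\<bar> \<le> M" using M(3)[of "of_real (a t) * z t u"] by (simp add: norm_mult D_def)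
  qed (use a[OF t] a2 M t0 in \<open>auto simp: f_def k_def\<close>)
  finally have "\<bar>G t u\<bar> \<le> (M * 2 + 2 * M * k) * v * J t u"
   unfolding G_def v_def abs_mult using J_pos[OF t0(1), of u] by (intro mult_mono) auto
  also have "\<dots> = M * (2 * v + 2 * k * v) * J t u" by (simp add: algebra_simps)
  also have "\<dots> \<le> M * ((1 / mu + 1) * (k\<^sup>2 + v\<^sup>2) + mu) * J t u"
  proof (intro mult_right_mono mult_left_mono)
   have "2 * v \<le> v\<^sup>2 / mu + mu"
    using zero_le_power2[of "v - mu"] mu by (simp add: field_simps power2_eq_square)
   moreover have "2 * k * v \<le> k\<^sup>2 + v\<^sup>2" using zero_le_power2[of "k - v"] by (simp add: power2_eq_square algebra_simps)
   moreover have "(1 / mu + 1) * (k\<^sup>2 + v\<^sup>2) = k\<^sup>2 / mu + v\<^sup>2 / mu + k\<^sup>2 + v\<^sup>2" by (simp add: algebra_simps)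
   moreover have "0 \<le> k\<^sup>2 / mu" using mu by simp
   ultimately show "2 * v + 2 * k * v \<le> (1 / mu + 1) * (k\<^sup>2 + v\<^sup>2) + mu" by linarith
  qed (use M J_pos[OF t0(1), of u] in auto)
  \<comment> \<open>On the support the norm is below \<open>R\<close> and -t is between 1/2 and 1,
    so the kernel is bounded below and may be inserted at the cost of sqrt(4 pi) exp(R^2/2).\<close>
  also have "\<dots> \<le> M * ((1 / mu + 1) * (k\<^sup>2 + v\<^sup>2) + mu) * J t u * (sqrt (4 * pi) * exp (R\<^sup>2 / 2) * rho 0 0 t u)"
  proof -
   have "1 \<le> sqrt (4 * pi) * exp (R\<^sup>2 / 2) * rho 0 0 t u"
   proof -
    have "(norm (z t u))\<^sup>2 / (4 * (0 - t)) \<le> R\<^sup>2 / 2"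
    proof -
     have "(norm (z t u))\<^sup>2 / (4 * (0 - t)) \<le> (norm (z t u))\<^sup>2 / 2" using t s by (intro divide_left_mono) auto
     also have "\<dots> \<le> R\<^sup>2 / 2" using False by (intro divide_right_mono power_mono) auto
     finally show ?thesis .
    qed
    hence "1 \<le> exp (R\<^sup>2 / 2) * exp (- (norm (z t u - 0))\<^sup>2 / (4 * (0 - t)))"
     by (simp add: exp_add[symmetric])
    moreover have "sqrt (4 * pi * (0 - t)) \<le> sqrt (4 * pi)" "sqrt (4 * pi * (0 - t)) > 0" using t t0 mult_left_mono[of "0 - t" 1 "4 * pi"] by (auto simp: mult_pos_neg)
    ultimately have "sqrt (4 * pi * (0 - t)) * 1 \<le> sqrt (4 * pi) * (exp (R\<^sup>2 / 2) * exp (- (norm (z t u - 0))\<^sup>2 / (4 * (0 - t))))"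
     by (intro mult_mono) auto
    thus ?thesis unfolding rho_def using \<open>sqrt (4 * pi * (0 - t)) > 0\<close> by (simp add: field_simps)
   qed
   from mult_left_mono[OF this, of "M * ((1 / mu + 1) * (k\<^sup>2 + v\<^sup>2) + mu) * J t u"] show ?thesis
    using M mu J_pos[OF t0(1), of u] by simp
  qed
  also have "\<dots> = c * H t u" by (simp add: c_def H_def k_def v_def algebra_simps)
  finally show ?thesis .
 qed
 have contH: "continuous_on ({-1..s} \<times> {-U..U}) (\<lambda>x. c * H (fst x) (snd x))"
  unfolding H_def by (intro continuous_intros cV cont2)
 have H0: "0 \<le> c * H t u" if "t \<in> {-1..s}" for t u using GH[OF that, of u] by linarith
 note rH = nn_integral_continuous_rectangle[OF contH H0]
 have "\<bar>Ntest ph s - Ntest ph (-1)\<bar> = \<bar>integral {-1..s} (\<lambda>t. integral {-U..U} (G t))\<bar>"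
  using ev NA[of s] NA[of "-1"] s by (simp add: has_integral_iff)
 also have "\<dots> \<le> integral {-1..s} (\<lambda>t. integral {-U..U} (\<lambda>u. c * H t u))"
 proof (rule order_trans[OF eq_refl[OF real_norm_def[symmetric]] integral_norm_bound_integral])
  show "(\<lambda>t. integral {-U..U} (G t)) integrable_on {-1..s}" using ev by (simp add: has_integral_iff)
  show "(\<lambda>t. integral {-U..U} (\<lambda>u. c * H t u)) integrable_on {-1..s}" by (intro integrable_continuous_interval rH(2))
  show "norm (integral {-U..U} (G t)) \<le> integral {-U..U} (\<lambda>u. c * H t u)" if t: "t \<in> {-1..s}" for t
   by (rule integral_norm_bound_integral)
    (use GH[OF t] continuous_on_slice[OF contG t] continuous_on_slice[OF contH t] in \<open>auto intro!: integrable_continuous_interval\<close>)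
 qed
 finally have main: "\<bar>Ntest ph s - Ntest ph (-1)\<bar> \<le> integral {-1..s} (\<lambda>t. integral {-U..U} (\<lambda>u. c * H t u))" .
 have "ennreal (integral {-1..s} (\<lambda>t. integral {-U..U} (\<lambda>u. c * H t u)))
  = (NN t. (NN u. ennreal (c * H t u) * indicator {-U..U} u) * indicator {-1..s} t)" by (rule rH(1)[symmetric])
 also have "\<dots> \<le> (NN t. ennreal (c * (1 / mu + 1)) * ((energy t) * indicator {-1..s} t)
   + ennreal (c * mu) * (ennreal E * indicator {-1..s} t))"
 proof (rule nn_integral_mono)
  fix t
  show "(NN u. ennreal (c * H t u) * indicator {-U..U} u) * indicator {-1..s} t
   \<le> ennreal (c * (1 / mu + 1)) * ((energy t) * indicator {-1..s} t)
   + ennreal (c * mu) * (ennreal E * indicator {-1..s} t)"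
  proof (cases "t \<in> {-1..s}")
   case True
   hence t0: "t \<le> 0" "t < 0" using s by auto
   have "(NN u. ennreal (c * H t u) * indicator {-U..U} u)
    \<le> (NN u. ennreal (c * (1 / mu + 1)) * ennreal (((kp t u)\<^sup>2 + (Vel 0 0 t u)\<^sup>2) * rho 0 0 t u * J t u) + ennreal (c * mu) * ennreal (rho 0 0 t u * J t u))"
   proof (rule nn_integral_mono)
    fix u
    have nn: "0 \<le> ((kp t u)\<^sup>2 + (Vel 0 0 t u)\<^sup>2) * rho 0 0 t u * J t u" "0 \<le> rho 0 0 t u * J t u"
     using J_pos[OF t0(1), of u] rho_nonneg[OF t0(2)] by auto
    have e: "ennreal (c * (1 / mu + 1)) * ennreal x = ennreal (c * (1 / mu + 1) * x)" "ennreal (c * mu) * ennreal x = ennreal (c * mu * x)" for x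
     using c0 mu by (auto intro!: ennreal_mult'[symmetric])
    have "c * H t u = c * (1 / mu + 1) * (((kp t u)\<^sup>2 + (Vel 0 0 t u)\<^sup>2) * rho 0 0 t u * J t u) + c * mu * (rho 0 0 t u * J t u)"
     unfolding H_def by (simp add: distrib_left mult.assoc)
    hence "ennreal (c * H t u) = ennreal (c * (1 / mu + 1)) * ennreal (((kp t u)\<^sup>2 + (Vel 0 0 t u)\<^sup>2) * rho 0 0 t u * J t u) + ennreal (c * mu) * ennreal (rho 0 0 t u * J t u)"
     unfolding e by (simp only:) (rule ennreal_plus; rule mult_nonneg_nonneg; use nn c0 mu in \<open>(assumption | simp)\<close>)
    thus "ennreal (c * H t u) * indicator {-U..U} u \<le> ennreal (c * (1 / mu + 1)) * ennreal (((kp t u)\<^sup>2 + (Vel 0 0 t u)\<^sup>2) * rho 0 0 t u * J t u) + ennreal (c * mu) * ennreal (rho 0 0 t u * J t u)"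
     by (simp add: indicator_def)
   qed
   also have "\<dots> = ennreal (c * (1 / mu + 1)) * (energy t)
    + ennreal (c * mu) * (gmass 0 0 t)"
    by (subst nn_integral_add) (auto simp: nn_integral_cmult)
   also have "\<dots> \<le> ennreal (c * (1 / mu + 1)) * (energy t) + ennreal (c * mu) * ennreal E"
    using t0 by (intro add_left_mono mult_left_mono gauss_rho_le) auto
   finally show ?thesis using True by simp
  qed simp
 qed
 also have "\<dots> = ennreal (c * (1 / mu + 1)) * (NN t. (energy t) * indicator {-1..s} t)
   + ennreal (c * mu) * (ennreal E * ennreal (s + 1))"
  using s by (subst nn_integral_add) (auto simp: nn_integral_cmult nn_integral_cmult_indicator)
 also have "\<dots> \<le> ennreal (c * (1 / mu + 1)) * ennreal de + ennreal (c * mu) * (ennreal E * 1)"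
  using s by (intro add_mono mult_left_mono en) (auto simp: ennreal_1[symmetric] simp del: ennreal_1 intro!: ennreal_leI)
 also have "\<dots> = ennreal (c * ((1 / mu + 1) * de + mu * E))"
  using c0 mu de E by (simp add: ennreal_mult[symmetric] ennreal_plus[symmetric] distrib_left mult.assoc del: ennreal_plus)
 finally have "integral {-1..s} (\<lambda>t. integral {-U..U} (\<lambda>u. c * H t u)) \<le> c * ((1 / mu + 1) * de + mu * E)"
  using c0 mu de E by (subst (asm) ennreal_le_iff) (auto intro!: mult_nonneg_nonneg add_nonneg_nonneg)
 with main show ?thesis by (simp add: c_def)
qed

end

section \<open>Closeness to a multiple line at all early times\<close>

text \<open>Small energy at time -1 gives closeness to a line with multiplicity there, and
  \<open>test_evolution\<close> carries the test integral on to the times up to -1/2. The Gaussian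
  integrals are compared at time -1 only, since their convergence is known independently.\<close>

lemma normalized_step:
 fixes ph :: "complex \<Rightarrow> real" and Dph :: "complex \<Rightarrow> complex"
 assumes E: "E > 0" and ph: "\<And>x. (ph has_derivative (\<lambda>h. inner (Dph x) h)) (at x)" "continuous_on UNIV Dph"
  and R: "\<And>x. norm x \<ge> R \<Longrightarrow> ph x = 0 \<and> Dph x = 0" and ep: "ep > 0"
 shows "\<exists>de>0. \<forall>z J ag kp kps. csf z J ag kp kps E \<longrightarrow>
  (NN t. (NE u. ((kp t u)\<^sup>2 + (csf.Vel z ag kp 0 0 t u)\<^sup>2) * csf.rho z 0 0 t u * J t u) * indicator {-1..-1/2} t) \<le> ennreal de \<longrightarrow>
  (NE u. ((kp (-1) u)\<^sup>2 + (csf.Vel z ag kp 0 0 (-1) u)\<^sup>2) * csf.rho z 0 0 (-1) u * J (-1) u) \<le> ennreal de \<longrightarrow>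
  (\<forall>s\<in>{-1..-1/2}. \<exists>(N::nat) al. \<bar>csf.Ntest z J ph s - N * (LBINT r. ph (of_real r * cis al))\<bar> \<le> ep
    \<and> \<bar>(LBINT u. csf.rho z 0 0 (-1) u * J (-1) u) - N\<bar> \<le> ep
    \<and> \<bar>(LBINT u. cos (2 * ag (-1) u) * csf.rho z 0 0 (-1) u * J (-1) u) - N * cos (2 * al)\<bar> \<le> ep
    \<and> \<bar>(LBINT u. sin (2 * ag (-1) u) * csf.rho z 0 0 (-1) u * J (-1) u) - N * sin (2 * al)\<bar> \<le> ep)"
proof -
 have cf: "continuous_on UNIV ph" using ph(1) by (meson continuous_at_imp_continuous_on has_derivative_continuous)
 have bdd: "\<exists>M\<ge>0. \<forall>x. norm (g x) \<le> M" if "continuous_on UNIV g" "\<And>x. norm x \<ge> R \<Longrightarrow> g x = 0" for g :: "complex \<Rightarrow> 'b::real_normed_vector"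
 proof -
  have "bounded (g ` cball 0 R)" by (intro compact_imp_bounded compact_continuous_image continuous_on_subset[OF that(1)]) auto
  then obtain M where "\<And>x. x \<in> cball 0 R \<Longrightarrow> norm (g x) \<le> M" unfolding bounded_iff by (metis imageI)
  hence "norm (g x) \<le> max 0 M" for x using that(2)[of x] by (cases "norm x \<le> R") (auto simp: le_max_iff_disj)
  thus ?thesis by (intro exI[of _ "max 0 M"]) auto
 qed
 obtain M1 where M1: "M1 \<ge> 0" "\<And>x. norm (ph x) \<le> M1" using bdd[OF cf] R by auto
 obtain M2 where M2: "M2 \<ge> 0" "\<And>x. norm (Dph x) \<le> M2" using bdd[OF ph(2)] R by auto
 define M where "M = max M1 M2"
 have M: "M \<ge> 0" "\<And>x. \<bar>ph x\<bar> \<le> M" "\<And>x. norm (Dph x) \<le> M"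
  using M1 M2 by (auto simp: M_def le_max_iff_disj)
 define c where "c = M * sqrt (4 * pi) * exp (R\<^sup>2 / 2) + 1"
 have c: "c > 0" "M * sqrt (4 * pi) * exp (R\<^sup>2 / 2) \<le> c" using M unfolding c_def by (auto intro: add_nonneg_pos)
 \<comment> \<open>\<open>mu\<close> and \<open>de2\<close> use up ep / 4 each in the estimate of
   \<open>test_evolution\<close>; the remaining ep / 2 is left to
   \<open>straight_approx\<close>.\<close>
 define mu where "mu = ep / (4 * c * E)"
 have mu: "mu > 0" "c * (mu * E) = ep / 4" using ep c E by (auto simp: mu_def)
 define de2 where "de2 = ep / (4 * c * (1 / mu + 1))"
 have q: "1 / mu + 1 > 0" using mu by (simp add: add_pos_pos)
 have de2: "de2 > 0" "c * ((1 / mu + 1) * de2) = ep / 4"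
 proof -
  have "0 < ep / (4 * c * Q)" "c * (Q * (ep / (4 * c * Q))) = ep / 4" if "Q > 0" for Q using ep c that by (auto simp: field_simps)
  from this[OF q] show "de2 > 0" "c * ((1 / mu + 1) * de2) = ep / 4" unfolding de2_def by auto
 qed
 have "ep / 2 > 0" using ep by simp
 from straight_approx[OF E cf _ this, of R] R obtain de1 where de1: "de1 > 0" and sa: "\<And>c ag k. ucurve c ag k E \<Longrightarrow>
  (NE s. ((k s)\<^sup>2 + (Im (c s * cis (- ag s)))\<^sup>2) * exp (- (norm (c s))\<^sup>2 / 4)) \<le> ennreal de1 \<Longrightarrow>
  (\<exists>(N::nat) al. \<bar>(LBINT s. ph (c s)) - N * (LBINT r. ph (of_real r * cis al))\<bar> \<le> ep / 2
   \<and> \<bar>(LBINT s. exp (- (norm (c s))\<^sup>2 / 4)) - N * sqrt (4 * pi)\<bar> \<le> ep / 2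
   \<and> \<bar>(LBINT s. cos (2 * ag s) * exp (- (norm (c s))\<^sup>2 / 4)) - N * cos (2 * al) * sqrt (4 * pi)\<bar> \<le> ep / 2
   \<and> \<bar>(LBINT s. sin (2 * ag s) * exp (- (norm (c s))\<^sup>2 / 4)) - N * sin (2 * al) * sqrt (4 * pi)\<bar> \<le> ep / 2)"
  by blast
 define S where "S = sqrt (4 * pi)"
 have S: "S \<ge> 1" unfolding S_def using pi_gt3 by simp
 hence S9: "0 \<le> 9 * S" by simp
 define de where "de = min de2 (de1 / (9 * S))"
 have de: "de > 0" "de \<le> de2" "9 * S * de \<le> de1" using de1 de2 S by (auto simp: de_def min_def field_simps)
 show ?thesis
 proof (intro exI[of _ de] conjI allI impI ballI de(1))
  fix z J ag kp kps and s :: real assume "csf z J ag kp kps E"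
  then interpret csf z J ag kp kps E .
  assume en: "(NN t. (energy t) * indicator {-1..-1/2} t) \<le> ennreal de"
   and en1: "(energy (-1)) \<le> ennreal de"
   and s: "s \<in> {-1..-1/2}"
  have "(NN t. (energy t) * indicator {-1..s} t) \<le> ennreal de"
   by (rule order_trans[OF nn_integral_mono en]) (use s in \<open>auto simp: indicator_def\<close>)
  hence "\<bar>Ntest ph s - Ntest ph (-1)\<bar> \<le> M * sqrt (4 * pi) * exp (R\<^sup>2 / 2) * ((1 / mu + 1) * de + mu * E)"
   using s by (intro test_evolution[OF _ _ ph R M mu(1)]) (use de in auto)
  also have "\<dots> \<le> c * ((1 / mu + 1) * de2 + mu * E)"
   using c de q mu E by (intro mult_mono add_mono) auto
  also have "\<dots> = ep / 2" unfolding distrib_left[of c] mu(2) de2(2) by simp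
  finally have step: "\<bar>Ntest ph s - Ntest ph (-1)\<bar> \<le> ep / 2" .
  have m1: "(-1::real) \<le> 0" by simp
  obtain sg where sg: "ucurve (\<lambda>s. z (-1) (sg s)) (\<lambda>s. ag (-1) (sg s)) (\<lambda>s. kp (-1) (sg s)) E"
   "\<And>F. F \<in> borel_measurable borel \<Longrightarrow> (NN s. F (sg s)) = (NN u. F u * ennreal (J (-1) u))"
   "\<And>F::real \<Rightarrow> real. F \<in> borel_measurable borel \<Longrightarrow> (LBINT s. F (sg s)) = (LBINT u. F u * J (-1) u)"
   by (rule arclength[OF m1]) blast
  have ex: "exp (- (norm (z (-1) u))\<^sup>2 / 4) = S * rho 0 0 (-1) u" for u using S by (simp add: rho_def S_def)
  have [measurable]: "ph \<in> borel_measurable borel" by (rule borel_measurable_continuous_onI[OF cf])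
  have "(NE s. ((kp (-1) (sg s))\<^sup>2 + (Im (z (-1) (sg s) * cis (- ag (-1) (sg s))))\<^sup>2) * exp (- (norm (z (-1) (sg s)))\<^sup>2 / 4))
   = (NN u. ennreal (((kp (-1) u)\<^sup>2 + (Im (z (-1) u * cis (- ag (-1) u)))\<^sup>2) * exp (- (norm (z (-1) u))\<^sup>2 / 4)) * ennreal (J (-1) u))"
   by (rule sg(2)) (unfold cis_conv_exp, measurable)
  also have "\<dots> \<le> (NN u. ennreal (9 * S) * ennreal (((kp (-1) u)\<^sup>2 + (Vel 0 0 (-1) u)\<^sup>2) * rho 0 0 (-1) u * J (-1) u))"
  proof (rule nn_integral_mono)
   fix u
   \<comment> \<open>At time -1, \<open>Vel\<close> is the curvature plus m / 2, so m^2 <= 8 kp^2 +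
     8 Vel^2; this explains the factor 9, while \<open>S\<close> converts the exponential into
     \<open>rho\<close>.\<close>
   define m where "m = Im (z (-1) u * cis (- ag (-1) u))"
   have V: "Vel 0 0 (-1) u = kp (-1) u + m / 2" by (simp add: Vel_def m_def inner_complex_def)
   have "m\<^sup>2 = 4 * (Vel 0 0 (-1) u - kp (-1) u)\<^sup>2" unfolding V by (simp add: power_divide)
   also have "\<dots> \<le> 8 * (kp (-1) u)\<^sup>2 + 8 * (Vel 0 0 (-1) u)\<^sup>2"
    using zero_le_power2[of "Vel 0 0 (-1) u + kp (-1) u"] by (simp add: power2_eq_square algebra_simps)
   finally have "(kp (-1) u)\<^sup>2 + m\<^sup>2 \<le> 9 * ((kp (-1) u)\<^sup>2 + (Vel 0 0 (-1) u)\<^sup>2)" by (smt (verit) zero_le_power2)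
   hence "((kp (-1) u)\<^sup>2 + m\<^sup>2) * (S * rho 0 0 (-1) u * J (-1) u) \<le> 9 * ((kp (-1) u)\<^sup>2 + (Vel 0 0 (-1) u)\<^sup>2) * (S * rho 0 0 (-1) u * J (-1) u)"
    using S J_pos[OF m1, of u] rho_nonneg[of "-1" 0 0 u] by (intro mult_right_mono) auto
   hence "((kp (-1) u)\<^sup>2 + m\<^sup>2) * exp (- (norm (z (-1) u))\<^sup>2 / 4) * J (-1) u \<le> 9 * S * (((kp (-1) u)\<^sup>2 + (Vel 0 0 (-1) u)\<^sup>2) * rho 0 0 (-1) u * J (-1) u)"
    unfolding ex by (simp only: mult_ac)
   thus "ennreal (((kp (-1) u)\<^sup>2 + (Im (z (-1) u * cis (- ag (-1) u)))\<^sup>2) * exp (- (norm (z (-1) u))\<^sup>2 / 4)) * ennreal (J (-1) u)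
    \<le> ennreal (9 * S) * ennreal (((kp (-1) u)\<^sup>2 + (Vel 0 0 (-1) u)\<^sup>2) * rho 0 0 (-1) u * J (-1) u)"
    unfolding m_def[symmetric] ennreal_mult''[OF less_imp_le[OF J_pos[OF m1]], symmetric] ennreal_mult'[OF S9, symmetric] by (rule ennreal_leI)
  qed
  also have "\<dots> = ennreal (9 * S) * (energy (-1))"
   by (rule nn_integral_cmult) measurable
  also have "\<dots> \<le> ennreal (9 * S) * ennreal de" by (intro mult_left_mono en1) auto
  also have "\<dots> \<le> ennreal de1" using S de by (subst ennreal_mult'[symmetric]) (auto intro!: ennreal_leI)
  finally obtain N :: nat and al where N:
   "\<bar>(LBINT s. ph (z (-1) (sg s))) - N * (LBINT r. ph (of_real r * cis al))\<bar> \<le> ep / 2"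
   "\<bar>(LBINT s. exp (- (norm (z (-1) (sg s)))\<^sup>2 / 4)) - N * sqrt (4 * pi)\<bar> \<le> ep / 2"
   "\<bar>(LBINT s. cos (2 * ag (-1) (sg s)) * exp (- (norm (z (-1) (sg s)))\<^sup>2 / 4)) - N * cos (2 * al) * sqrt (4 * pi)\<bar> \<le> ep / 2"
   "\<bar>(LBINT s. sin (2 * ag (-1) (sg s)) * exp (- (norm (z (-1) (sg s)))\<^sup>2 / 4)) - N * sin (2 * al) * sqrt (4 * pi)\<bar> \<le> ep / 2"
   using sa[OF sg(1)] by blast
  have i0: "(LBINT s. ph (z (-1) (sg s))) = Ntest ph (-1)"
   using sg(3)[of "\<lambda>u. ph (z (-1) u)"] by (simp add: Ntest_def)
  have i: "(LBINT s. g (ag (-1) (sg s)) * exp (- (norm (z (-1) (sg s)))\<^sup>2 / 4)) = S * (LBINT u. g (ag (-1) u) * rho 0 0 (-1) u * J (-1) u)"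
   if [measurable]: "g \<in> borel_measurable borel" for g :: "real \<Rightarrow> real"
  proof -
   have "(LBINT s. g (ag (-1) (sg s)) * exp (- (norm (z (-1) (sg s)))\<^sup>2 / 4)) = (LBINT u. g (ag (-1) u) * exp (- (norm (z (-1) u))\<^sup>2 / 4) * J (-1) u)"
    by (rule sg(3)) measurable
   also have "\<dots> = (LBINT u. S * (g (ag (-1) u) * rho 0 0 (-1) u * J (-1) u))" unfolding ex by (simp add: mult_ac)
   finally show ?thesis by simp
  qed
  have div: "\<bar>x - y\<bar> \<le> ep" if "\<bar>S * x - y * S\<bar> \<le> ep / 2" for x y
  proof -
   have "1 * \<bar>x - y\<bar> \<le> S * \<bar>x - y\<bar>" using S by (intro mult_right_mono) auto
   also have "\<dots> = \<bar>S * x - y * S\<bar>" 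
   proof -
    have "S * x - y * S = S * (x - y)" by (simp add: right_diff_distrib mult.commute)
    thus ?thesis using S by (simp add: abs_mult)
   qed
   finally show ?thesis using that ep by simp
  qed
  show "\<exists>(N::nat) al. \<bar>Ntest ph s - N * (LBINT r. ph (of_real r * cis al))\<bar> \<le> ep
    \<and> \<bar>(mass (-1)) - N\<bar> \<le> ep
    \<and> \<bar>(cmass (-1)) - N * cos (2 * al)\<bar> \<le> ep
    \<and> \<bar>(smass (-1)) - N * sin (2 * al)\<bar> \<le> ep"
  proof (intro exI[of _ N] exI[of _ al] conjI)
   show "\<bar>Ntest ph s - N * (LBINT r. ph (of_real r * cis al))\<bar> \<le> ep" using N(1) step unfolding i0 by linarith
   show "\<bar>(mass (-1)) - N\<bar> \<le> ep"
    using N(2) i[of "\<lambda>_. 1"] by (intro div) (simp add: S_def)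
   show "\<bar>(cmass (-1)) - N * cos (2 * al)\<bar> \<le> ep"
    using N(3) i[of "\<lambda>x. cos (2 * x)"] by (intro div) (simp add: S_def)
   show "\<bar>(smass (-1)) - N * sin (2 * al)\<bar> \<le> ep"
    using N(4) i[of "\<lambda>x. sin (2 * x)"] by (intro div) (simp add: S_def)
  qed
 qed
qed

lemma line_integral_close:
 fixes ph :: "complex \<Rightarrow> real"
 assumes ph: "continuous_on UNIV ph" "\<And>x. norm x \<ge> R \<Longrightarrow> ph x = 0" and e: "e > 0" and R: "R > 0"
 shows "\<exists>et>0. \<forall>al be. \<bar>sin (al - be)\<bar> \<le> 2 * et \<longrightarrow> \<bar>(LBINT r. ph (of_real r * cis al)) - (LBINT r. ph (of_real r * cis be))\<bar> \<le> e"
proof -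
 define om where "om = e / (2 * R)"
 have om: "om > 0" "2 * R * om = e" using e R by (auto simp: om_def)
 obtain d where d: "d > 0" "\<And>x y. norm (x - y) \<le> d \<Longrightarrow> \<bar>ph x - ph y\<bar> \<le> om"
  using uniform_modulus_compact_support[OF ph om(1)] by blast
 define et where "et = d / (3 * R)"
 have et: "et > 0" "R * (3 * et) = d" using d R by (auto simp: et_def)
 show ?thesis
 proof (intro exI[of _ et] conjI allI impI et(1))
  fix al be assume "\<bar>sin (al - be)\<bar> \<le> 2 * et"
  then obtain g where g: "g \<in> {1,-1::real}" "norm (cis al - of_real g * cis be) \<le> 3 * et" using cis_sign_close by blast
  have il: "integrable lborel (\<lambda>r. ph (of_real r * w))" if "norm w = 1" for w
   by (rule integrable_compact_support[of _ "-R" R])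
    (use ph(2) R that in \<open>auto intro!: continuous_on_compose2[OF ph(1)] continuous_intros simp: norm_mult\<close>)
  have "(LBINT r. ph (of_real r * cis be)) = (LBINT r. ph (of_real r * (of_real g * cis be)))"
   using lborel_integral_real_affine[of "-1" "\<lambda>r. ph (of_real r * cis be)" 0] g(1) by auto
  moreover have "\<bar>(LBINT r. ph (of_real r * cis al)) - (LBINT r. ph (of_real r * (of_real g * cis be)))\<bar>
    \<le> (LBINT r. indicator {-R..R} r *\<^sub>R om)"
  proof (rule abs_integral_diff_le)
   show "integrable lborel (\<lambda>r. indicator {-R..R} r *\<^sub>R om)" by (intro borel_integrable_compact) auto
   show "\<bar>ph (of_real r * cis al) - ph (of_real r * (of_real g * cis be))\<bar> \<le> indicator {-R..R} r *\<^sub>R om" for r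
   proof (cases "r \<in> {-R..R}")
    case True
    have "norm (of_real r * cis al - of_real r * (of_real g * cis be)) = \<bar>r\<bar> * norm (cis al - of_real g * cis be)"
     by (simp add: norm_mult flip: right_diff_distrib)
    also have "\<dots> \<le> R * (3 * et)" using True g(2) R by (intro mult_mono) auto
    finally show ?thesis using True d(2) et(2) by simp
   next
    case False
    thus ?thesis using ph(2)[of "of_real r * cis al"] ph(2)[of "of_real r * (of_real g * cis be)"] R g(1)
     by (auto simp: norm_mult)
   qed
  qed (rule il; use g(1) in \<open>auto simp: norm_mult\<close>)+
  moreover have "(LBINT r. indicator {-R..R} r *\<^sub>R om) = 2 * R * om" using R by simp
  ultimately show "\<bar>(LBINT r. ph (of_real r * cis al)) - (LBINT r. ph (of_real r * cis be))\<bar> \<le> e"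
   using om(2) by linarith
 qed
qed

context csf
begin

lemma Vel_rescale:
 assumes l: "l > 0" and t: "t < 0"
 shows "csf.Vel (\<lambda>t u. of_real l * z (t / l\<^sup>2) u) (\<lambda>t u. ag (t / l\<^sup>2) u) (\<lambda>t u. kp (t / l\<^sup>2) u / l) 0 0 t u = Vel 0 0 (t / l\<^sup>2) u / l"
proof -
 interpret L: csf "\<lambda>t u. of_real l * z (t / l\<^sup>2) u" "\<lambda>t u. l * J (t / l\<^sup>2) u" "\<lambda>t u. ag (t / l\<^sup>2) u"
   "\<lambda>t u. kp (t / l\<^sup>2) u / l" "\<lambda>t u. kps (t / l\<^sup>2) u / l\<^sup>2" E
  by (rule csf_rescale[OF csf_axioms l])
 have "inner (of_real l * z (t / l\<^sup>2) u) w = l * inner (z (t / l\<^sup>2) u) w" for w by (simp flip: scaleR_conv_of_real)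
 hence "L.Vel 0 0 t u = kp (t / l\<^sup>2) u / l + l * inner (z (t / l\<^sup>2) u) (\<i> * cis (ag (t / l\<^sup>2) u)) / (2 * (0 - t))"
  by (simp add: L.Vel_def)
 also have "\<dots> = Vel 0 0 (t / l\<^sup>2) u / l" unfolding Vel_def using l t by (simp add: add_divide_distrib field_simps power2_eq_square)
 finally show ?thesis .
qed

lemma Ntest_rescale:
 assumes l: "l > 0" and t: "t < 0"
 shows "csf.Ntest (\<lambda>t u. of_real l * z (t / l\<^sup>2) u) (\<lambda>t u. l * J (t / l\<^sup>2) u) ph t = Ntest ph (t / l\<^sup>2)"
proof -
 interpret L: csf "\<lambda>t u. of_real l * z (t / l\<^sup>2) u" "\<lambda>t u. l * J (t / l\<^sup>2) u" "\<lambda>t u. ag (t / l\<^sup>2) u"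
   "\<lambda>t u. kp (t / l\<^sup>2) u / l" "\<lambda>t u. kps (t / l\<^sup>2) u / l\<^sup>2" E
  by (rule csf_rescale[OF csf_axioms l])
 have "sqrt (- (t / l\<^sup>2)) = sqrt (- t) / l"
 proof -
  have "- (t / l\<^sup>2) = (- t) / l\<^sup>2" by simp
  thus ?thesis by (simp only: real_sqrt_divide) (use l in simp)
 qed
 hence r: "1 / sqrt (- (t / l\<^sup>2)) = l * (1 / sqrt (- t))" using l by simp
 show ?thesis unfolding L.Ntest_def Ntest_def r
  by (intro Bochner_Integration.integral_cong refl) (simp add: mult_ac)
qed

text \<open>Energy scales like inverse squared length, that is, like inverse time; its integrals
  over corresponding time intervals are therefore equal.\<close>

lemma energy_slice_rescale:
 assumes l: "l > 0" and t: "t < 0"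
 shows "(NE u. ((kp (t / l\<^sup>2) u / l)\<^sup>2 + (csf.Vel (\<lambda>t u. of_real l * z (t / l\<^sup>2) u) (\<lambda>t u. ag (t / l\<^sup>2) u) (\<lambda>t u. kp (t / l\<^sup>2) u / l) 0 0 t u)\<^sup>2)
   * csf.rho (\<lambda>t u. of_real l * z (t / l\<^sup>2) u) 0 0 t u * (l * J (t / l\<^sup>2) u))
  = ennreal (1 / l\<^sup>2) * (NE u. ((kp (t / l\<^sup>2) u)\<^sup>2 + (Vel 0 0 (t / l\<^sup>2) u)\<^sup>2) * rho 0 0 (t / l\<^sup>2) u * J (t / l\<^sup>2) u)"
proof -
 have "((kp (t / l\<^sup>2) u / l)\<^sup>2 + (csf.Vel (\<lambda>t u. of_real l * z (t / l\<^sup>2) u) (\<lambda>t u. ag (t / l\<^sup>2) u) (\<lambda>t u. kp (t / l\<^sup>2) u / l) 0 0 t u)\<^sup>2)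
   * csf.rho (\<lambda>t u. of_real l * z (t / l\<^sup>2) u) 0 0 t u * (l * J (t / l\<^sup>2) u)
  = 1 / l\<^sup>2 * (((kp (t / l\<^sup>2) u)\<^sup>2 + (Vel 0 0 (t / l\<^sup>2) u)\<^sup>2) * rho 0 0 (t / l\<^sup>2) u * J (t / l\<^sup>2) u)" for u
  unfolding Vel_rescale[OF l t] rho_rescale[OF l t, symmetric] by (simp add: power_divide add_divide_distrib mult_ac distrib_left distrib_right)
 thus ?thesis by (simp only: ennreal_mult'[of "1 / l\<^sup>2"] zero_le_divide_1_iff zero_le_power2) (rule nn_integral_cmult, measurable)
qed

text \<open>Once \<open>H a\<close> comes within \<open>de\<close> of the finite supremum, all
  earlier intervals together contribute at most \<open>de\<close>.\<close>

lemma energy_tail: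
 assumes "de > 0"
 obtains T where "T \<le> -1" "\<And>t1 t2. t2 \<le> T \<Longrightarrow>
  (NN t. (energy t) * indicator {t1..t2} t) \<le> ennreal de"
proof -
 define W where "W = (\<lambda>t. energy t)"
 have [measurable]: "W \<in> borel_measurable borel" unfolding W_def by measurable
 define H where "H = (\<lambda>a. NN t. W t * indicator {a..-1} t)"
 obtain C where C: "C > 0" "\<And>a. H a \<le> ennreal C" unfolding H_def W_def by (rule energy_bounded) blast
 define S where "S = (SUP a. H a)"
 have S: "S \<le> ennreal C" unfolding S_def by (rule SUP_least) (rule C(2))
 have "\<exists>a. S < H a + ennreal de"
 proof (cases "S = 0")
  case False
  have "S - ennreal de < S" using False assms le_less_trans[OF S ennreal_less_top] by (intro ennreal_between) (auto simp: zero_less_iff_neq_zero)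
  then obtain a where "S - ennreal de < H a" unfolding S_def by (auto simp: less_SUP_iff)
  hence "S < H a + ennreal de" by (auto simp: ennreal_le_minus_iff simp flip: not_le)
  thus ?thesis by blast
 qed (use assms in \<open>auto intro: add_pos_pos simp: add_nonneg_pos\<close>)
 then obtain a where a: "S < H a + ennreal de" by blast
 show ?thesis
 proof (rule that[of "min a (-1) - 1"])
  fix t1 t2 assume t: "t2 \<le> min a (-1) - 1"
  define X where "X = (NN t. W t * indicator {t1..t2} t)"
  have "X + H a = (NN t. W t * indicator {t1..t2} t + W t * indicator {a..-1} t)"
   unfolding X_def H_def by (rule nn_integral_add[symmetric]) measurable
  also have "\<dots> \<le> H (min t1 a)" unfolding H_def
   using t by (intro nn_integral_mono) (auto simp: indicator_def)
  also have "\<dots> \<le> S" unfolding S_def by (rule SUP_upper) simp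
  finally have "X + H a \<le> H a + ennreal de" using a by (rule order_trans[OF _ less_imp_le])
  moreover have "H a \<noteq> \<top>" using C(2)[of a] by (auto simp: top_unique)
  ultimately have "X \<le> ennreal de" using ennreal_add_left_cancel_le[of "H a" X] by (simp add: add.commute)
  thus "(NN t. (energy t) * indicator {t1..t2} t) \<le> ennreal de"
   unfolding X_def W_def .
 qed simp
qed

text \<open>For very early \<open>t\<close>, averaging over [2t, t] finds a slice \<open>tg\<close>
  of small scale-invariant energy. Rescaling \<open>tg\<close> to -1 moves \<open>t\<close> to a
  time in [-1, -1/2], the range of \<open>normalized_step\<close>. The Gaussian integrals are taken
  at \<open>tg\<close> instead of \<open>t\<close>, which is as good once their limits are
  known.\<close>

lemma approx_all_times:
 fixes ph :: "complex \<Rightarrow> real" and Dph :: "complex \<Rightarrow> complex"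
 assumes ph: "\<And>x. (ph has_derivative (\<lambda>h. inner (Dph x) h)) (at x)" "continuous_on UNIV Dph"
  and R: "\<And>x. norm x \<ge> R \<Longrightarrow> ph x = 0 \<and> Dph x = 0" and ep: "ep > 0"
 obtains T where "\<And>t. t \<le> T \<Longrightarrow> \<exists>(N::nat) al. \<exists>tg\<le>t. \<bar>Ntest ph t - N * (LBINT r. ph (of_real r * cis al))\<bar> \<le> ep
    \<and> \<bar>(mass tg) - N\<bar> \<le> ep
    \<and> \<bar>(cmass tg) - N * cos (2 * al)\<bar> \<le> ep
    \<and> \<bar>(smass tg) - N * sin (2 * al)\<bar> \<le> ep"
proof -
 obtain de where de: "de > 0" and step: "\<forall>z J ag kp kps. csf z J ag kp kps E \<longrightarrow>
  (NN t. (NE u. ((kp t u)\<^sup>2 + (csf.Vel z ag kp 0 0 t u)\<^sup>2) * csf.rho z 0 0 t u * J t u) * indicator {-1..-1/2} t) \<le> ennreal de \<longrightarrow>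
  (NE u. ((kp (-1) u)\<^sup>2 + (csf.Vel z ag kp 0 0 (-1) u)\<^sup>2) * csf.rho z 0 0 (-1) u * J (-1) u) \<le> ennreal de \<longrightarrow>
  (\<forall>s\<in>{-1..-1/2}. \<exists>(N::nat) al. \<bar>csf.Ntest z J ph s - N * (LBINT r. ph (of_real r * cis al))\<bar> \<le> ep
    \<and> \<bar>(LBINT u. csf.rho z 0 0 (-1) u * J (-1) u) - N\<bar> \<le> ep
    \<and> \<bar>(LBINT u. cos (2 * ag (-1) u) * csf.rho z 0 0 (-1) u * J (-1) u) - N * cos (2 * al)\<bar> \<le> ep
    \<and> \<bar>(LBINT u. sin (2 * ag (-1) u) * csf.rho z 0 0 (-1) u * J (-1) u) - N * sin (2 * al)\<bar> \<le> ep)"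
  using normalized_step[where R = R, OF E ph R ep] by - (drule meta_mp, assumption, erule exE, erule conjE, rule that)
 define W where "W = (\<lambda>t. energy t)"
 have [measurable]: "W \<in> borel_measurable borel" unfolding W_def by measurable
 have "de / 4 > 0" using de by simp
 from energy_tail[OF this] obtain T where T: "T \<le> -1" "\<And>t1 t2. t2 \<le> T \<Longrightarrow> (NN t. W t * indicator {t1..t2} t) \<le> ennreal (de / 4)"
  unfolding W_def by blast
 show ?thesis
 proof (rule that[of "2 * T"])
  fix t assume t: "t \<le> 2 * T"
  have tneg: "t < 0" "t \<le> T" "t / 2 \<le> T" using t T(1) by auto
  \<comment> \<open>The interval has length -t, so otherwise the energy integral would be at least
    de / 2, against the tail bound de / 4.\<close>
  have "\<exists>tg\<in>{2*t..t}. ennreal (- t) * W tg \<le> ennreal (de / 2)"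
  proof (rule ccontr)
   assume "\<not> ?thesis"
   hence big: "ennreal (de / 2) \<le> ennreal (- t) * W tg" if "tg \<in> {2*t..t}" for tg using that by (meson le_cases)
   have "ennreal (de / 2) * ennreal (- t) = (NN x. ennreal (de / 2) * indicator {2*t..t} x)"
    using tneg by (subst nn_integral_cmult_indicator) auto
   also have "\<dots> \<le> (NN x. ennreal (- t) * (W x * indicator {2*t..t} x))"
    using big by (intro nn_integral_mono) (auto simp: indicator_def)
   also have "\<dots> = ennreal (- t) * (NN x. W x * indicator {2*t..t} x)" by (rule nn_integral_cmult) measurable
   also have "\<dots> \<le> ennreal (- t) * ennreal (de / 4)" using tneg by (intro mult_left_mono T(2)) auto
   finally have le: "ennreal (de / 2) * ennreal (- t) \<le> ennreal (de / 4) * ennreal (- t)" by (simp only: mult.commute)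
   have d: "0 \<le> de / 2" "0 \<le> de / 4" using de by auto
   have p: "de * (- t) > 0" using de tneg by (intro mult_pos_pos) auto
   have "de / 2 * (- t) \<le> de / 4 * (- t)"
    using le p unfolding ennreal_mult'[OF d(1), symmetric] ennreal_mult'[OF d(2), symmetric] by (subst (asm) ennreal_le_iff) linarith+
   thus False using p by linarith
  qed
  then obtain tg where tg: "2 * t \<le> tg" "tg \<le> t" "ennreal (- t) * W tg \<le> ennreal (de / 2)" by auto
  have tgneg: "tg < 0" using tg tneg by simp
  \<comment> \<open>The scale for which the rescaled time of \<open>tg\<close> is -1.\<close>
  define l where "l = 1 / sqrt (- tg)"
  have l: "l > 0" using tgneg by (simp add: l_def)
  have l2: "l\<^sup>2 = 1 / (- tg)" using tgneg by (simp add: l_def power_divide)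
  have dl: "x / l\<^sup>2 = x * (- tg)" for x unfolding l2 by simp
  have tg1: "(- 1) / l\<^sup>2 = tg" "- 1 / l\<^sup>2 = tg" unfolding dl by simp_all
  define s where "s = t / (- tg)"
  have s: "s \<in> {-1..-1/2}" "s / l\<^sup>2 = t" "s < 0"
   using tg tgneg tneg unfolding s_def dl by (auto simp: field_simps)
  have WL: "(NE u. ((kp (x / l\<^sup>2) u / l)\<^sup>2 + (csf.Vel (\<lambda>t u. of_real l * z (t / l\<^sup>2) u) (\<lambda>t u. ag (t / l\<^sup>2) u) (\<lambda>t u. kp (t / l\<^sup>2) u / l) 0 0 x u)\<^sup>2)
   * csf.rho (\<lambda>t u. of_real l * z (t / l\<^sup>2) u) 0 0 x u * (l * J (x / l\<^sup>2) u)) = ennreal (1 / l\<^sup>2) * W (x / l\<^sup>2)" if "x < 0" for x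
   unfolding W_def by (rule energy_slice_rescale[OF l that])
  have e1: "(NN x. (NE u. ((kp (x / l\<^sup>2) u / l)\<^sup>2 + (csf.Vel (\<lambda>t u. of_real l * z (t / l\<^sup>2) u) (\<lambda>t u. ag (t / l\<^sup>2) u) (\<lambda>t u. kp (t / l\<^sup>2) u / l) 0 0 x u)\<^sup>2)
   * csf.rho (\<lambda>t u. of_real l * z (t / l\<^sup>2) u) 0 0 x u * (l * J (x / l\<^sup>2) u)) * indicator {-1..-1/2} x) \<le> ennreal de" (is "?L \<le> _")
  proof -
   have "?L = (NN x. ennreal (1 / l\<^sup>2) * (W (0 + 1 / l\<^sup>2 * x) * indicator {tg..tg/2} (0 + 1 / l\<^sup>2 * x)))"
   proof (rule nn_integral_cong)
    fix x :: real
    have "x \<in> {-1..-1/2} \<longleftrightarrow> 0 + 1 / l\<^sup>2 * x \<in> {tg..tg/2}"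
     using mult_le_cancel_left_pos[of "- tg" "-1" x] mult_le_cancel_left_pos[of "- tg" x "-1/2"] tgneg unfolding l2 by simp
    thus "(NE u. ((kp (x / l\<^sup>2) u / l)\<^sup>2 + (csf.Vel (\<lambda>t u. of_real l * z (t / l\<^sup>2) u) (\<lambda>t u. ag (t / l\<^sup>2) u) (\<lambda>t u. kp (t / l\<^sup>2) u / l) 0 0 x u)\<^sup>2)
     * csf.rho (\<lambda>t u. of_real l * z (t / l\<^sup>2) u) 0 0 x u * (l * J (x / l\<^sup>2) u)) * indicator {-1..-1/2} x
     = ennreal (1 / l\<^sup>2) * (W (0 + 1 / l\<^sup>2 * x) * indicator {tg..tg/2} (0 + 1 / l\<^sup>2 * x))"
     using WL[of x] by (cases "x \<in> {-1..-1/2}") (auto simp: mult.assoc)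
   qed
   also have "\<dots> = ennreal \<bar>1 / l\<^sup>2\<bar> * (NN x. W (0 + 1 / l\<^sup>2 * x) * indicator {tg..tg/2} (0 + 1 / l\<^sup>2 * x))"
    using l by (subst nn_integral_cmult) auto
   also have "\<dots> = (NN x. W x * indicator {tg..tg/2} x)"
    using l by (subst nn_integral_real_affine[of "\<lambda>x. W x * indicator {tg..tg/2} x" "1 / l\<^sup>2" 0]) auto
   also have "\<dots> \<le> ennreal (de / 4)" using tg tneg by (intro T(2)) auto
   also have "\<dots> \<le> ennreal de" using de by (intro ennreal_leI) auto
   finally show ?thesis .
  qed
  have e2: "(NE u. ((kp (-1 / l\<^sup>2) u / l)\<^sup>2 + (csf.Vel (\<lambda>t u. of_real l * z (t / l\<^sup>2) u) (\<lambda>t u. ag (t / l\<^sup>2) u) (\<lambda>t u. kp (t / l\<^sup>2) u / l) 0 0 (-1) u)\<^sup>2)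
   * csf.rho (\<lambda>t u. of_real l * z (t / l\<^sup>2) u) 0 0 (-1) u * (l * J (-1 / l\<^sup>2) u)) \<le> ennreal de" (is "?L \<le> _")
  proof -
   have "?L = ennreal (1 / l\<^sup>2) * W (-1 / l\<^sup>2)" by (rule WL) simp
   also have "\<dots> = ennreal (- tg) * W tg" unfolding tg1 unfolding l2 by simp
   also have "\<dots> \<le> ennreal (2 * (- t)) * W tg" using tg by (intro mult_right_mono ennreal_leI) auto
   also have "\<dots> = 2 * (ennreal (- t) * W tg)"
    using tneg by (subst ennreal_mult) (auto simp: mult.assoc)
   also have "\<dots> \<le> 2 * ennreal (de / 2)" by (intro mult_left_mono tg(3)) auto
   also have "\<dots> = ennreal de"
   proof -
    have 2: "2 * ennreal x = ennreal (2 * x)" for x by (simp add: ennreal_mult')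
    show ?thesis unfolding 2 by simp
   qed
   finally show ?thesis .
  qed
  have rr: "csf.rho (\<lambda>t u. of_real l * z (t / l\<^sup>2) u) 0 0 (-1) u * (l * J (-1 / l\<^sup>2) u) = rho 0 0 tg u * J tg u" for u
   using rho_rescale[OF l, of "-1" u] unfolding tg1 by (simp add: mult_ac)
  have rr': "x * csf.rho (\<lambda>t u. of_real l * z (t / l\<^sup>2) u) 0 0 (-1) u * (l * J (-1 / l\<^sup>2) u) = x * rho 0 0 tg u * J tg u" for u x
   unfolding mult.assoc rr ..
  from step[rule_format, OF csf_rescale[OF csf_axioms l] e1 e2 s(1)]
  show "\<exists>(N::nat) al. \<exists>tg\<le>t. \<bar>Ntest ph t - N * (LBINT r. ph (of_real r * cis al))\<bar> \<le> ep
    \<and> \<bar>(mass tg) - N\<bar> \<le> ep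
    \<and> \<bar>(cmass tg) - N * cos (2 * al)\<bar> \<le> ep
    \<and> \<bar>(smass tg) - N * sin (2 * al)\<bar> \<le> ep"
   unfolding rr rr' Ntest_rescale[OF l s(3)] s(2) unfolding tg1 using tg(2) by blast
 qed
qed

end

section \<open>Asymptotics as time tends to minus infinity\<close>

text \<open>Here q stands for sqrt(-t) with t very early: moving the singular point of the kernel
  from (0, 0) to (x0, T) changes it by O(1/q) times a wider Gaussian. From exp(-a) <= exp(-b) + (b -
  a) exp(-a), where b - a is at most (|y|^2/q^2 + |x0|^2/2)/q; widening the Gaussian to scale 8 q^2
  absorbs the factor |y|^2/q^2.\<close>

lemma gaussian_shift_le:
 fixes y x0 :: complex
 assumes q: "q \<ge> 1" "\<bar>T\<bar> \<le> q" "2 * \<bar>T\<bar> \<le> q\<^sup>2"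
 shows "exp (- (norm (y - x0))\<^sup>2 / (4 * (T + q\<^sup>2))) \<le> exp (- (norm y)\<^sup>2 / (4 * q\<^sup>2))
  + 32 * (1 + (norm x0)\<^sup>2) * exp ((norm x0)\<^sup>2) / q * exp (- (norm y)\<^sup>2 / (4 * (8 * q\<^sup>2)))"
proof -
 define ta r n d X where "ta = T + q\<^sup>2" and "r = norm y" and "n = norm x0" and "d = norm (y - x0)" and "X = n\<^sup>2"
 have q0: "q > 0" "q\<^sup>2 > 0" "q\<^sup>2 \<ge> 1" using q by (auto intro: one_le_power)
 have ta: "ta \<ge> q\<^sup>2 / 2" "ta \<le> 2 * q\<^sup>2" "ta > 0" unfolding ta_def using q(3) q0 by linarith+
 have X: "X \<ge> 0" "r \<ge> 0" "n \<ge> 0" by (auto simp: X_def r_def n_def)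
 have "\<bar>r - n\<bar> \<le> d" unfolding r_def n_def d_def by (rule norm_triangle_ineq3)
 hence d: "(r - n)\<^sup>2 \<le> d\<^sup>2" by (metis abs_ge_zero power2_abs power_mono)
 define a b v where "a = d\<^sup>2 / (4 * ta)" and "b = r\<^sup>2 / (4 * q\<^sup>2)" and "v = r\<^sup>2 / (32 * q\<^sup>2)"
 have v: "v \<ge> 0" by (simp add: v_def)
 have rn: "2 * r * n \<le> r\<^sup>2 / q + q * X"
 proof -
  have "0 \<le> (r - q * n)\<^sup>2 / q" using q0 by simp
  also have "\<dots> = r\<^sup>2 / q + q * X - 2 * r * n" using q0 by (simp add: X_def field_simps power2_eq_square)
  finally show ?thesis by simp
 qed
 have ba: "b - a \<le> (r\<^sup>2 / q\<^sup>2 + X / 2) / q"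
 proof -
  have "(r\<^sup>2 - 2 * r * n) / (4 * ta) \<le> a" unfolding a_def
   using d ta zero_le_power2[of n] unfolding power2_diff by (intro divide_right_mono) linarith+
  hence "b - a \<le> b - (r\<^sup>2 - 2 * r * n) / (4 * ta)" by simp
  also have "\<dots> = (r\<^sup>2 * T + q\<^sup>2 * (2 * r * n)) / (4 * q\<^sup>2 * ta)"
  proof -
   have T: "T = ta - q\<^sup>2" by (simp add: ta_def)
   show ?thesis unfolding T b_def using ta(3) q0 by (simp add: field_simps)
  qed
  also have "\<dots> \<le> (r\<^sup>2 * q + q\<^sup>2 * (r\<^sup>2 / q + q * X)) / (4 * q\<^sup>2 * ta)"
   using rn q q0 ta by (intro divide_right_mono add_mono mult_left_mono) auto
  also have "\<dots> \<le> (r\<^sup>2 * q + q\<^sup>2 * (r\<^sup>2 / q + q * X)) / (4 * q\<^sup>2 * (q\<^sup>2 / 2))"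
   using X q0 ta by (intro divide_left_mono mult_left_mono mult_pos_pos add_nonneg_nonneg mult_nonneg_nonneg) auto
  also have "\<dots> = (r\<^sup>2 / q\<^sup>2 + X / 2) / q" using q0 by (simp add: field_simps power2_eq_square)
  finally show ?thesis .
 qed
 have av: "2 * v - X \<le> a"
 proof -
  have "r\<^sup>2 / 2 - X \<le> (r - n)\<^sup>2"
  proof -
   have "(r - n)\<^sup>2 - (r\<^sup>2 / 2 - X) = (r - 2 * n)\<^sup>2 / 2" by (simp add: X_def power2_eq_square field_simps)
   thus ?thesis using zero_le_power2[of "r - 2 * n"] by linarith
  qed
  hence "(r\<^sup>2 / 2 - X) / (4 * ta) \<le> a" unfolding a_def using d ta by (intro divide_right_mono) auto
  moreover have "X / (4 * ta) \<le> X / 1" using X q0 ta by (intro divide_left_mono) auto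
  moreover have "2 * v \<le> r\<^sup>2 / 2 / (4 * ta)"
  proof -
   have "r\<^sup>2 / (16 * q\<^sup>2) \<le> r\<^sup>2 / (8 * ta)" using q0 ta by (intro divide_left_mono) auto
   thus ?thesis by (simp add: v_def)
  qed
  ultimately show ?thesis by (simp add: diff_divide_distrib)
 qed
 have "exp (- a) * (1 - (b - a)) \<le> exp (- a) * exp (a - b)"
  using exp_ge_add_one_self[of "a - b"] by (intro mult_left_mono, linarith, simp)
 also have "\<dots> = exp (- b)" by (simp flip: exp_add)
 finally have "exp (- a) \<le> exp (- b) + exp (- a) * (b - a)" by (simp add: algebra_simps)
 also have "exp (- a) * (b - a) \<le> exp (- a) * ((r\<^sup>2 / q\<^sup>2 + X / 2) / q)" by (intro mult_left_mono ba) auto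
 also have "\<dots> \<le> exp (X - 2 * v) * (32 * (1 + X) * exp v / q)"
 proof (intro mult_mono divide_right_mono)
  have "r\<^sup>2 / q\<^sup>2 = 32 * v" by (simp add: v_def)
  hence "r\<^sup>2 / q\<^sup>2 + X / 2 \<le> 32 * ((1 + X) * (1 + v))" using X v mult_nonneg_nonneg[OF X(1) v] by (simp add: algebra_simps)
  also have "\<dots> \<le> 32 * ((1 + X) * exp v)" using X exp_ge_add_one_self[of v] by (intro mult_left_mono) auto
  finally show "r\<^sup>2 / q\<^sup>2 + X / 2 \<le> 32 * (1 + X) * exp v" by (simp only: mult.assoc)
 qed (use av X q0 in auto)
 also have "\<dots> = 32 * (1 + X) * (exp (X - 2 * v) * exp v) / q" by (simp only: times_divide_eq_right mult_ac)
 also have "exp (X - 2 * v) * exp v = exp X * exp (- v)" by (simp flip: exp_add)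
 also have "32 * (1 + X) * (exp X * exp (- v)) / q = 32 * (1 + X) * exp X / q * exp (- v)" by simp
 finally show ?thesis unfolding a_def b_def v_def X_def r_def n_def d_def ta_def by (simp add: mult.assoc)
qed

section \<open>Approximation of continuous test functions\<close>

lemma real_polynomial_gradient:
 fixes p :: "complex \<Rightarrow> real"
 assumes "real_polynomial_function p"
 shows "\<exists>Dp. (\<forall>x. (p has_derivative (\<lambda>h. inner (Dp x) h)) (at x)) \<and> continuous_on UNIV Dp"
 using assms
proof induction
 case (linear f)
 have "inner (adjoint f 1) h = f h" for h using adjoint_works[OF bounded_linear.linear[OF linear], of h 1] by (simp add: inner_commute)
 thus ?case using bounded_linear_imp_has_derivative[OF linear] by (intro exI[of _ "\<lambda>_. adjoint f 1"]) simp
next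
 case (const c)
 show ?case by (intro exI[of _ "\<lambda>_. 0"]) simp
next
 case (add f g)
 then obtain Df Dg where "\<And>x. (f has_derivative (\<lambda>h. inner (Df x) h)) (at x)" "continuous_on UNIV Df"
  "\<And>x. (g has_derivative (\<lambda>h. inner (Dg x) h)) (at x)" "continuous_on UNIV Dg" by blast
 thus ?case by (intro exI[of _ "\<lambda>x. Df x + Dg x"]) (auto intro!: derivative_eq_intros continuous_intros simp: inner_add_left)
next
 case (mult f g)
 then obtain Df Dg where D: "\<And>x. (f has_derivative (\<lambda>h. inner (Df x) h)) (at x)" "continuous_on UNIV Df"
  "\<And>x. (g has_derivative (\<lambda>h. inner (Dg x) h)) (at x)" "continuous_on UNIV Dg" by blast
 have c: "continuous_on UNIV f" "continuous_on UNIV g"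
  using D by (auto intro!: continuous_at_imp_continuous_on has_derivative_continuous)
 show ?case
 proof (intro exI[of _ "\<lambda>x. f x *\<^sub>R Dg x + g x *\<^sub>R Df x"] conjI allI)
  show "((\<lambda>x. f x * g x) has_derivative (\<lambda>h. inner (f x *\<^sub>R Dg x + g x *\<^sub>R Df x) h)) (at x)" for x
   by (rule has_derivative_eq_rhs[OF has_derivative_mult[OF D(1,3)]]) (auto simp: inner_add_left mult.commute)
  show "continuous_on UNIV (\<lambda>x. f x *\<^sub>R Dg x + g x *\<^sub>R Df x)" by (intro continuous_intros c D)
 qed
qed

text \<open>\<open>test_evolution\<close> needs a continuously differentiable test function.
  Stone-Weierstrass supplies a polynomial on a ball and the cutoff \<open>ze\<close> makes it
  compactly supported; \<open>ph\<close> is divided by \<open>ze\<close> beforehand, so that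
  multiplying back is exact. The error is measured against a Gaussian because Gaussian integrals
  along the curve are bounded uniformly in time.\<close>

lemma smooth_approximation:
 fixes ph :: "complex \<Rightarrow> real"
 assumes ph: "continuous_on UNIV ph" "\<And>x. norm x \<ge> R \<Longrightarrow> ph x = 0" and R: "R > 0" and e: "e > 0"
 obtains ps Dps where "\<And>x. (ps has_derivative (\<lambda>h. inner (Dps x) h)) (at x)" "continuous_on UNIV Dps"
  "\<And>x. norm x \<ge> 2 * R \<Longrightarrow> ps x = 0 \<and> Dps x = 0" "\<And>x. \<bar>ph x - ps x\<bar> \<le> e * exp (- (norm x)\<^sup>2 / 4)"
proof -
 define w where "w = (\<lambda>x::complex. 1 - (norm x)\<^sup>2 / (2 * R)\<^sup>2)"
 define ze where "ze = (\<lambda>x. (max 0 (w x)) ^ 3)"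
 define Dze where "Dze = (\<lambda>x. (- 6 * (max 0 (w x))\<^sup>2 / (2 * R)\<^sup>2) *\<^sub>R x)"
 have contw: "continuous_on S w" for S unfolding w_def using R by (intro continuous_intros) auto
 have dze: "(ze has_derivative (\<lambda>h. inner (Dze x) h)) (at x)" for x
 proof -
  define c where "c = 1 / (2 * R)\<^sup>2"
  have "w = (\<lambda>x. 1 - c * inner x x)" unfolding w_def c_def by (simp add: power2_norm_eq_inner)
  hence dw: "(w has_derivative (\<lambda>h. - (2 * c * inner x h))) (at x)"
   by (auto intro!: derivative_eq_intros simp: inner_commute)
  have "((\<lambda>y. (max 0 y) ^ 3) has_real_derivative 3 * (max 0 (w x))\<^sup>2) (at (w x))"
   using pos_part_power_deriv[of 3 "w x"] by simp
  from has_derivative_compose[OF dw this[unfolded has_field_derivative_def]]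
  show ?thesis unfolding ze_def Dze_def by (rule has_derivative_eq_rhs) (auto simp: fun_eq_iff c_def)
 qed
 have w0: "max 0 (w x) = 0" if "norm x \<ge> 2 * R" for x
 proof -
  have "(2 * R)\<^sup>2 \<le> (norm x)\<^sup>2" using that R by (intro power_mono) auto
  thus ?thesis using R by (simp add: w_def)
 qed
 have w1: "w x \<ge> 3/4" if "norm x \<le> R" for x
 proof -
  have "(norm x)\<^sup>2 \<le> R\<^sup>2" using that by (intro power_mono) auto
  thus ?thesis using R by (simp add: w_def field_simps)
 qed
 have ze01: "0 \<le> ze x" "ze x \<le> 1" for x unfolding ze_def by (auto intro!: power_le_one simp: w_def)
 \<comment> \<open>The floor is a lower bound of \<open>ze\<close> on the ball of radius
   \<open>R\<close>, so it changes nothing where \<open>ph\<close> is nonzero and makes the quotient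
   continuous everywhere.\<close>
 define f where "f = (\<lambda>x. ph x / max ((3/4) ^ 3) (ze x))"
 have contze: "continuous_on S ze" for S unfolding ze_def by (intro continuous_intros contw)
 have "0 < max ((3/4) ^ 3) (ze x)" for x by (rule less_le_trans[OF _ max.cobounded1]) simp
 hence "max ((3/4) ^ 3) (ze x) \<noteq> 0" for x by (simp add: less_imp_neq[symmetric])
 hence cf: "continuous_on S f" for S unfolding f_def
  by (intro continuous_intros continuous_on_subset[OF ph(1)] contze) auto
 have fze: "ph x = f x * ze x" for x
 proof (cases "norm x \<le> R")
  case True
  have "(3/4) ^ 3 \<le> ze x" unfolding ze_def using w1[OF True] by (intro power_mono) auto
  hence "max ((3/4) ^ 3) (ze x) = ze x" "ze x > 0" by (auto simp: max_def power3_eq_cube)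
  thus ?thesis by (simp add: f_def)
 qed (use ph(2)[of x] in \<open>simp add: f_def\<close>)
 \<comment> \<open>exp(-R^2) is the value of exp(-|x|^2/4) at radius \<open>2 * R\<close>, its
   minimum over the ball on which the polynomial is compared.\<close>
 have e': "e * exp (- R\<^sup>2) > 0" using e by simp
 obtain p where p: "real_polynomial_function p" "\<And>x. x \<in> cball 0 (2 * R) \<Longrightarrow> \<bar>f x - p x\<bar> < e * exp (- R\<^sup>2)"
  using Stone_Weierstrass_real_polynomial_function[OF compact_cball cf e', of 0 "2 * R"] by blast
 obtain Dp where Dp: "\<And>x. (p has_derivative (\<lambda>h. inner (Dp x) h)) (at x)" "continuous_on UNIV Dp"
  using real_polynomial_gradient[OF p(1)] by blast
 have cp: "continuous_on S p" for S using Dp(1) by (auto intro!: continuous_at_imp_continuous_on has_derivative_continuous)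
 show ?thesis
 proof (rule that[of "\<lambda>x. p x * ze x" "\<lambda>x. p x *\<^sub>R Dze x + ze x *\<^sub>R Dp x"])
  show "((\<lambda>x. p x * ze x) has_derivative (\<lambda>h. inner (p x *\<^sub>R Dze x + ze x *\<^sub>R Dp x) h)) (at x)" for x
   by (rule has_derivative_eq_rhs[OF has_derivative_mult[OF Dp(1) dze]]) (auto simp: inner_add_left mult.commute)
  show "continuous_on UNIV (\<lambda>x. p x *\<^sub>R Dze x + ze x *\<^sub>R Dp x)"
   unfolding Dze_def using R by (intro continuous_intros cp contze contw Dp) auto
  show "p x * ze x = 0 \<and> p x *\<^sub>R Dze x + ze x *\<^sub>R Dp x = 0" if "norm x \<ge> 2 * R" for x
   using w0[OF that] by (simp add: ze_def Dze_def)
  show "\<bar>ph x - p x * ze x\<bar> \<le> e * exp (- (norm x)\<^sup>2 / 4)" for x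
  proof (cases "norm x \<le> 2 * R")
   case True
   have "\<bar>ph x - p x * ze x\<bar> = \<bar>f x - p x\<bar> * ze x" unfolding fze[of x] using ze01(1)[of x] by (simp add: abs_mult flip: left_diff_distrib)
   also have "\<dots> \<le> e * exp (- R\<^sup>2) * 1" using p(2)[of x] True ze01[of x] e by (intro mult_mono) (auto simp: less_imp_le)
   also have "\<dots> \<le> e * exp (- (norm x)\<^sup>2 / 4)"
   proof -
    have "(norm x)\<^sup>2 \<le> (2 * R)\<^sup>2" using True by (intro power_mono) auto
    thus ?thesis using e by simp
   qed
   finally show ?thesis .
  next
   case False
   hence "ph x = 0" "ze x = 0" using R w0[of x] ph(2)[of x] by (auto simp: ze_def)
   thus ?thesis using e by simp
  qed
 qed
qed

section \<open>Density bound and multiplicity\<close>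

context csf
begin

text \<open>Huisken's formula pushes the density back in time, and far in the past the kernel
  centred at (x0, T) differs negligibly from the one centred at the origin. So the limit at the
  origin dominates the Gaussian densities at all centres, times and scales.\<close>

lemma gauss_le_limit:
 assumes lim: "((\<lambda>t. mass t) \<longlongrightarrow> L) at_bot" and t1: "t1 \<le> 0" "t1 < T"
 shows "(gmass x0 T t1) \<le> ennreal L"
proof -
 define K where "K = 32 * (1 + (norm x0)\<^sup>2) * exp ((norm x0)\<^sup>2)"
 have K: "K > 0" unfolding K_def by (intro mult_pos_pos) (auto simp: add_pos_nonneg)
 define G where "G = (\<lambda>t. mass t)"
 \<comment> \<open>The upper bound that \<open>gaussian_shift_le\<close> yields at time
   \<open>t\<close>: the first factor corrects the normalization of the two kernels, the last
   summand is the error of the shift.\<close>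
 define h where "h = (\<lambda>t. sqrt (- t) / sqrt (T - t) * (G t + K * E * sqrt 8 / sqrt (- t)))"
 have "((\<lambda>t. sqrt (- t) / sqrt (T - t)) \<longlongrightarrow> 1) at_bot"
 proof -
  have "filterlim (\<lambda>t::real. T - t) at_top at_bot"
   using filterlim_tendsto_add_at_top[OF tendsto_const[of T] filterlim_uminus_at_top_at_bot] by simp
  hence "((\<lambda>t. T / (T - t)) \<longlongrightarrow> 0) at_bot" by (rule real_tendsto_divide_at_top[OF tendsto_const])
  hence "((\<lambda>t. sqrt (1 - T / (T - t))) \<longlongrightarrow> sqrt (1 - 0)) at_bot" by (intro tendsto_intros)
  moreover have "\<forall>\<^sub>F t in at_bot. sqrt (1 - T / (T - t)) = sqrt (- t) / sqrt (T - t)"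
   by (rule eventually_mono[OF eventually_le_at_bot[of "T - 1"]]) (simp add: real_sqrt_divide[symmetric] field_simps)
  ultimately show ?thesis by (simp add: tendsto_cong)
 qed
 moreover have "((\<lambda>t. K * E * sqrt 8 / sqrt (- t)) \<longlongrightarrow> 0) at_bot"
  by (rule real_tendsto_divide_at_top[OF tendsto_const filterlim_compose[OF sqrt_at_top filterlim_uminus_at_top_at_bot]])
 ultimately have hl: "(h \<longlongrightarrow> 1 * (L + 0)) at_bot" unfolding h_def using lim unfolding G_def by (intro tendsto_intros)
 have "\<forall>\<^sub>F t in at_bot. t \<le> -1 \<and> t \<le> t1 \<and> \<bar>T\<bar> \<le> sqrt (- t) \<and> 2 * \<bar>T\<bar> \<le> - t"
 proof (intro eventually_conj)
  show "\<forall>\<^sub>F t in at_bot. \<bar>T\<bar> \<le> sqrt (- t)"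
   by (rule eventually_mono[OF eventually_le_at_bot[of "- T\<^sup>2"]]) (simp add: real_le_rsqrt)
  show "\<forall>\<^sub>F t in at_bot. 2 * \<bar>T\<bar> \<le> - t"
   by (rule eventually_mono[OF eventually_le_at_bot[of "- 2 * \<bar>T\<bar>"]]) simp
 qed (rule eventually_le_at_bot)+
 hence "\<forall>\<^sub>F t in at_bot. (gmass x0 T t1) \<le> ennreal (h t)"
 proof eventually_elim
  case (elim t)
  define q where "q = sqrt (- t)"
  have q: "q \<ge> 1" "\<bar>T\<bar> \<le> q" "2 * \<bar>T\<bar> \<le> q\<^sup>2" "q\<^sup>2 = - t" using elim by (auto simp: q_def)
  have t: "t \<le> 0" "t < 0" "T - t > 0" using elim t1 by auto
  have lt: "0 < - t" "0 < 8 * - t" using t by auto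
  have G0: "G t \<ge> 0" unfolding G_def using rho_nonneg[of t 0 0] J_pos[OF t(1)] t by (intro Bochner_Integration.integral_nonneg) (simp add: less_imp_le)
  define S where "S = sqrt (4 * pi * (T - t))"
  have S: "S > 0" using t by (simp add: S_def)
  have lin: "ennreal (a * X + b * Y) = ennreal a * ennreal X + ennreal b * ennreal Y" if "0 \<le> a" "0 \<le> X" "0 \<le> b" "0 \<le> Y" for a b X Y
   using that by (simp add: ennreal_mult)
  have "(gmass x0 T t1) \<le> (gmass x0 T t)"
   using order_trans[OF _ huisken[of t t1 T x0]] elim t1 by (simp add: add_increasing2)
  also have "\<dots> \<le> (NN u. ennreal (sqrt (4 * pi * - t) / S) * ennreal (rho 0 0 t u * J t u)
   + ennreal (K / q / S) * ennreal (exp (- (norm (z t u - 0))\<^sup>2 / (4 * (8 * - t))) * J t u))"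
  proof (intro nn_integral_mono)
   fix u
   have alg: "(A + K / q * B) * (j / S) = c / S * (A / c * j) + K / q / S * (B * j)" if "c \<noteq> 0" for A B j c
    using that S q by (simp add: field_simps)
   have "rho x0 T t u * J t u = exp (- (norm (z t u - x0))\<^sup>2 / (4 * (T + q\<^sup>2))) * (J t u / S)" unfolding q(4) by (simp add: rho_def S_def)
   also have "\<dots> \<le> (exp (- (norm (z t u))\<^sup>2 / (4 * q\<^sup>2)) + K / q * exp (- (norm (z t u))\<^sup>2 / (4 * (8 * q\<^sup>2)))) * (J t u / S)"
    using gaussian_shift_le[OF q(1-3), of "z t u" x0] J_pos[OF t(1), of u] S unfolding K_def by (intro mult_right_mono) auto
   also have "\<dots> = sqrt (4 * pi * - t) / S * (rho 0 0 t u * J t u) + K / q / S * (exp (- (norm (z t u - 0))\<^sup>2 / (4 * (8 * - t))) * J t u)"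
    unfolding q(4) rho_def diff_0 diff_0_right by (rule alg) (use t in simp)
   finally have le: "rho x0 T t u * J t u \<le> sqrt (4 * pi * - t) / S * (rho 0 0 t u * J t u) + K / q / S * (exp (- (norm (z t u - 0))\<^sup>2 / (4 * (8 * - t))) * J t u)" .
   show "ennreal (rho x0 T t u * J t u) \<le> ennreal (sqrt (4 * pi * - t) / S) * ennreal (rho 0 0 t u * J t u)
    + ennreal (K / q / S) * ennreal (exp (- (norm (z t u - 0))\<^sup>2 / (4 * (8 * - t))) * J t u)"
    by (rule order_trans[OF ennreal_leI[OF le] eq_refl[OF lin]])
     (use S K q J_pos[OF t(1), of u] rho_nonneg[OF t(2), of 0 u] t in \<open>auto simp: zero_le_mult_iff zero_le_divide_iff mult_le_0_iff\<close>)
  qed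
  also have "\<dots> = ennreal (sqrt (4 * pi * - t) / S) * (gmass 0 0 t)
   + ennreal (K / q / S) * (NE u. exp (- (norm (z t u - 0))\<^sup>2 / (4 * (8 * - t))) * J t u)"
   by (subst nn_integral_add) (auto simp: nn_integral_cmult)
  also have "\<dots> \<le> ennreal (sqrt (4 * pi * - t) / S) * ennreal (G t) + ennreal (K / q / S) * ennreal (E * sqrt (4 * pi * (8 * - t)))"
  proof (intro add_mono mult_left_mono gauss[OF t(1) lt(2)])
   show "(gmass 0 0 t) \<le> ennreal (G t)" unfolding G_def
    using gaussian_limit(2)[of t] elim rho_nonneg[OF t(2)] J_pos[OF t(1)]
    by (subst nn_integral_eq_integral) (auto simp: less_imp_le)
  qed auto
  also have "\<dots> = ennreal (sqrt (4 * pi * - t) / S * G t + K / q / S * (E * sqrt (4 * pi * (8 * - t))))"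
   by (rule lin[symmetric]) (use G0 K q S E t in \<open>auto simp: zero_le_mult_iff zero_le_divide_iff mult_le_0_iff\<close>)
  also have "sqrt (4 * pi * - t) / S * G t + K / q / S * (E * sqrt (4 * pi * (8 * - t))) = h t"
  proof -
   have a: "S = sqrt (4 * pi) * sqrt (T - t)" "sqrt (4 * pi * - t) = sqrt (4 * pi) * q" "sqrt (4 * pi * (8 * - t)) = sqrt (4 * pi) * (sqrt 8 * q)"
    unfolding S_def q_def by (simp_all only: real_sqrt_mult)
   have "sqrt (4 * pi) > 0" "sqrt (T - t) > 0" using t by auto
   thus ?thesis unfolding a h_def q_def[symmetric] using q(1) by (simp add: field_simps)
  qed
  finally show ?case .
 qed
 moreover have "((\<lambda>t. ennreal (h t)) \<longlongrightarrow> ennreal L) at_bot" using tendsto_ennrealI[OF hl] by simp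
 ultimately show ?thesis by - (rule tendsto_lowerbound[where f = "\<lambda>t. ennreal (h t)"], assumption+, rule trivial_limit_at_bot_linorder)
qed

text \<open>The slice on which the Gaussian integrals are approximated varies with \<open>t\<close>
  but lies before it, so there these integrals are already near their limits.\<close>

lemma approx_limits:
 fixes ph :: "complex \<Rightarrow> real" and Dph :: "complex \<Rightarrow> complex"
 assumes ph: "\<And>x. (ph has_derivative (\<lambda>h. inner (Dph x) h)) (at x)" "continuous_on UNIV Dph"
  and R: "\<And>x. norm x \<ge> R \<Longrightarrow> ph x = 0 \<and> Dph x = 0" and ep: "ep > 0"
  and lim: "((\<lambda>t. mass t) \<longlongrightarrow> L) at_bot"
   "((\<lambda>t. cmass t) \<longlongrightarrow> Lc) at_bot"
   "((\<lambda>t. smass t) \<longlongrightarrow> Ls) at_bot"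
 shows "\<forall>\<^sub>F t in at_bot. \<exists>(N::nat) al. \<bar>Ntest ph t - N * (LBINT r. ph (of_real r * cis al))\<bar> \<le> ep
  \<and> \<bar>L - N\<bar> \<le> ep \<and> \<bar>Lc - N * cos (2 * al)\<bar> \<le> ep \<and> \<bar>Ls - N * sin (2 * al)\<bar> \<le> ep"
proof -
 have e2: "ep / 2 > 0" using ep by simp
 obtain T where T: "\<And>t. t \<le> T \<Longrightarrow> \<exists>(N::nat) al. \<exists>tg\<le>t. \<bar>Ntest ph t - N * (LBINT r. ph (of_real r * cis al))\<bar> \<le> ep / 2
    \<and> \<bar>(mass tg) - N\<bar> \<le> ep / 2
    \<and> \<bar>(cmass tg) - N * cos (2 * al)\<bar> \<le> ep / 2
    \<and> \<bar>(smass tg) - N * sin (2 * al)\<bar> \<le> ep / 2"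
  using approx_all_times[OF ph R e2] by blast
 have "\<forall>\<^sub>F t in at_bot. \<bar>(mass t) - L\<bar> < ep / 2
   \<and> \<bar>(cmass t) - Lc\<bar> < ep / 2
   \<and> \<bar>(smass t) - Ls\<bar> < ep / 2"
  using tendstoD[OF lim(1) e2] tendstoD[OF lim(2) e2] tendstoD[OF lim(3) e2] by eventually_elim (auto simp: dist_real_def)
 then obtain T' where T': "\<And>t. t \<le> T' \<Longrightarrow> \<bar>(mass t) - L\<bar> < ep / 2
   \<and> \<bar>(cmass t) - Lc\<bar> < ep / 2
   \<and> \<bar>(smass t) - Ls\<bar> < ep / 2"
  unfolding eventually_at_bot_linorder by blast
 show ?thesis
 proof (rule eventually_mono[OF eventually_conj[OF eventually_le_at_bot[of T] eventually_le_at_bot[of T']]])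
  fix t assume "t \<le> T \<and> t \<le> T'"
  then obtain N :: nat and al tg where N: "tg \<le> t" "tg \<le> T'" "\<bar>Ntest ph t - N * (LBINT r. ph (of_real r * cis al))\<bar> \<le> ep / 2"
    "\<bar>(mass tg) - N\<bar> \<le> ep / 2"
    "\<bar>(cmass tg) - N * cos (2 * al)\<bar> \<le> ep / 2"
    "\<bar>(smass tg) - N * sin (2 * al)\<bar> \<le> ep / 2"
   using T[of t] by (meson order_trans)
  show "\<exists>(N::nat) al. \<bar>Ntest ph t - N * (LBINT r. ph (of_real r * cis al))\<bar> \<le> ep
   \<and> \<bar>L - N\<bar> \<le> ep \<and> \<bar>Lc - N * cos (2 * al)\<bar> \<le> ep \<and> \<bar>Ls - N * sin (2 * al)\<bar> \<le> ep"
   using T'[OF N(2)] N ep by (intro exI[of _ N] exI[of _ al] conjI) linarith+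
 qed
qed

text \<open>Only the Gaussian integrals matter here, so the zero test function is inserted. The
  integer \<open>N\<close> could depend on the accuracy, but integers within 1/4 of \<open>L\<close>
  coincide; letting the accuracy tend to 0 shows that \<open>L\<close> is an integer
  \<open>m\<close> and that Lc + i Ls has modulus \<open>m\<close>, so its argument defines
  \<open>2 * al\<close>. Positivity comes from the density at a point of the curve, which is at
  least 1.\<close>

lemma multiplicity:
 obtains m :: nat and al where "m \<ge> 1"
  "((\<lambda>t. mass t) \<longlongrightarrow> m) at_bot"
  "((\<lambda>t. cmass t) \<longlongrightarrow> m * cos (2 * al)) at_bot"
  "((\<lambda>t. smass t) \<longlongrightarrow> m * sin (2 * al)) at_bot"
proof -
 obtain L where L: "((\<lambda>t. mass t) \<longlongrightarrow> L) at_bot" using gaussian_limit(1) by blast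
 obtain Lc where Lc: "((\<lambda>t. cmass t) \<longlongrightarrow> Lc) at_bot" using direction_limit[of 0] by auto
 have cosq: "cos (x - pi / 2) = sin x" for x by (simp add: cos_diff)
 obtain Ls where Ls: "((\<lambda>t. smass t) \<longlongrightarrow> Ls) at_bot"
  using direction_limit[of "- (pi / 2)"] by (auto simp: cosq)
 have ap: "\<exists>(N::nat) al. \<bar>L - N\<bar> \<le> ep \<and> \<bar>Lc - N * cos (2 * al)\<bar> \<le> ep \<and> \<bar>Ls - N * sin (2 * al)\<bar> \<le> ep" if "ep > 0" for ep
 proof -
  have "\<forall>\<^sub>F t::real in at_bot. \<exists>(N::nat) al. \<bar>L - N\<bar> \<le> ep \<and> \<bar>Lc - N * cos (2 * al)\<bar> \<le> ep \<and> \<bar>Ls - N * sin (2 * al)\<bar> \<le> ep"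
   by (rule eventually_mono[OF approx_limits[of "\<lambda>_. 0" "\<lambda>_. 0" 0, OF _ _ _ that L Lc Ls]]) auto
  thus ?thesis by (simp add: eventually_const)
 qed
 obtain m :: nat where m: "\<bar>L - m\<bar> \<le> 1/4" using ap[of "1/4"] by auto
 have eqm: "N = m" if "\<bar>L - real N\<bar> \<le> ep" "ep \<le> 1/4" for N ep
 proof -
  have "\<bar>real N - real m\<bar> < 1" using that m by linarith
  thus ?thesis by linarith
 qed
 have ap': "\<exists>al. \<bar>L - m\<bar> \<le> ep \<and> \<bar>Lc - m * cos (2 * al)\<bar> \<le> ep \<and> \<bar>Ls - m * sin (2 * al)\<bar> \<le> ep" if "ep > 0" "ep \<le> 1/4" for ep
  using ap[OF that(1)] eqm[OF _ that(2)] by blast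
 have Lm: "L = m"
 proof (rule ccontr)
  assume "L \<noteq> m"
  hence "\<bar>L - m\<bar> / 2 > 0" "\<bar>L - m\<bar> / 2 \<le> 1/4" using m by auto
  from ap'[OF this] this(1) show False by auto
 qed
 have nm: "norm (Complex Lc Ls) = m"
 proof (rule ccontr)
  assume ne: "norm (Complex Lc Ls) \<noteq> m"
  define ep where "ep = min (1/4) (\<bar>norm (Complex Lc Ls) - m\<bar> / 3)"
  have ep: "ep > 0" "ep \<le> 1/4" using ne by (auto simp: ep_def)
  have ep3: "ep \<le> \<bar>norm (Complex Lc Ls) - m\<bar> / 3" unfolding ep_def by (rule min.cobounded2)
  obtain al where al: "\<bar>Lc - m * cos (2 * al)\<bar> \<le> ep" "\<bar>Ls - m * sin (2 * al)\<bar> \<le> ep" using ap'[OF ep(1,2)] by blast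
  have "norm (of_real m * cis (2 * al)) = m" by (simp add: norm_mult)
  hence "\<bar>norm (Complex Lc Ls) - m\<bar> \<le> norm (Complex Lc Ls - of_real m * cis (2 * al))" using norm_triangle_ineq3 by metis
  also have "\<dots> \<le> \<bar>Lc - m * cos (2 * al)\<bar> + \<bar>Ls - m * sin (2 * al)\<bar>"
   using cmod_le[of "Complex Lc Ls - of_real m * cis (2 * al)"] by simp
  finally have d: "\<bar>norm (Complex Lc Ls) - m\<bar> \<le> \<bar>Lc - m * cos (2 * al)\<bar> + \<bar>Ls - m * sin (2 * al)\<bar>" .
  have "False" if "d \<le> x + y" "x \<le> ep" "y \<le> ep" "ep \<le> d / 3" for d x y using that ep(1) by linarith
  from this[OF d al ep3] show False .
 qed
 define al where "al = Arg (Complex Lc Ls) / 2"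
 have "Complex Lc Ls = rcis m (2 * al)" using rcis_cmod_Arg[of "Complex Lc Ls"] nm by (simp add: al_def)
 hence cs: "Lc = m * cos (2 * al)" "Ls = m * sin (2 * al)" by (auto simp: rcis_def complex_eq_iff)
 have "m \<ge> 1"
 proof -
  have "ennreal (sqrt (4 * pi)) \<le> (NE u. exp (- (norm (z 0 u - z 0 0))\<^sup>2 / 4) * J 0 u)"
   using gauss_at_point_ge[of 0 1 0] by simp
  also have "\<dots> = (NN u. ennreal (sqrt (4 * pi)) * ennreal (rho (z 0 0) 1 0 u * J 0 u))"
   by (intro nn_integral_cong) (simp add: rho_def ennreal_mult'[symmetric])
  also have "\<dots> = ennreal (sqrt (4 * pi)) * (gmass (z 0 0) 1 0)"
   by (rule nn_integral_cmult) measurable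
  also have "\<dots> \<le> ennreal (sqrt (4 * pi)) * ennreal m"
   by (intro mult_left_mono gauss_le_limit[OF L[unfolded Lm]]) auto
  finally have "sqrt (4 * pi) \<le> sqrt (4 * pi) * m" by (simp add: ennreal_mult'[symmetric] del: ennreal_of_nat_eq_real_of_nat)
  thus ?thesis using pi_gt_zero by (cases "m = 0") auto
 qed
 thus ?thesis using that[of m al] L Lc Ls unfolding Lm cs by blast
qed

end

section \<open>Unit density and convergence of test integrals\<close>

text \<open>The squared distance on the unit circle between the points with the doubled angles is
  four times the squared sine of the difference.\<close>

lemma sin_diff_le_double_angle:
 fixes a b e :: real
 assumes "\<bar>cos (2 * a) - cos (2 * b)\<bar> \<le> e" "\<bar>sin (2 * a) - sin (2 * b)\<bar> \<le> e"
 shows "\<bar>sin (a - b)\<bar> \<le> e"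
proof -
 have e: "0 \<le> e" using assms(1) by linarith
 have "(cos (2 * a) - cos (2 * b))\<^sup>2 + (sin (2 * a) - sin (2 * b))\<^sup>2 = 2 - 2 * cos (2 * a - 2 * b)"
  using sin_cos_squared_add[of "2 * a"] sin_cos_squared_add[of "2 * b"] unfolding power2_diff cos_diff by algebra
 also have "cos (2 * a - 2 * b) = 1 - 2 * (sin (a - b))\<^sup>2" using cos_double_sin[of "a - b"] by (simp add: right_diff_distrib)
 finally have "4 * (sin (a - b))\<^sup>2 = (cos (2 * a) - cos (2 * b))\<^sup>2 + (sin (2 * a) - sin (2 * b))\<^sup>2" by simp
 also have "\<dots> \<le> e\<^sup>2 + e\<^sup>2" using assms by (intro add_mono) (auto intro: abs_le_square_iff[THEN iffD1] simp: e)
 finally have "(sin (a - b))\<^sup>2 \<le> e\<^sup>2" using zero_le_power2[of e] by linarith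
 thus ?thesis using e abs_le_square_iff[of "sin (a - b)" e] by simp
qed

text \<open>The functions agree almost everywhere, and the set where two continuous functions differ
  is open; an open null set is empty.\<close>

lemma continuous_eq_of_nn_integral_le:
 fixes f g :: "real \<Rightarrow> real"
 assumes c: "continuous_on UNIV f" "continuous_on UNIV g" and fg: "\<And>x. 0 \<le> f x" "\<And>x. f x \<le> g x"
  and le: "(NE x. g x) \<le> (NE x. f x)" and fin: "(NE x. f x) < \<infinity>"
 shows "f x = g x"
proof -
 have [measurable]: "f \<in> borel_measurable borel" "g \<in> borel_measurable borel" using c by (auto intro: borel_measurable_continuous_onI)
 have "(NE x. f x) + (NE x. g x - f x) = (NN x. ennreal (f x) + ennreal (g x - f x))"
  by (rule nn_integral_add[symmetric]) auto
 also have "\<dots> = (NE x. g x)" using fg by (intro nn_integral_cong) (simp add: ennreal_plus[symmetric] del: ennreal_plus)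
 finally have "(NE x. f x) + (NE x. g x - f x) \<le> (NE x. f x) + 0"
  using le by simp
 hence "(NE x. g x - f x) = 0" using fin ennreal_add_left_cancel_le by (metis le_zero_eq less_irrefl infinity_ennreal_def)
 hence "AE x in lborel. ennreal (g x - f x) = 0" by (subst (asm) nn_integral_0_iff_AE) auto
 hence "AE x in lborel. x \<notin> {x. f x \<noteq> g x}" using fg by (auto elim!: eventually_mono simp: ennreal_eq_0_iff order_antisym)
 hence "{x. f x \<noteq> g x} \<in> null_sets lborel" by (subst (asm) AE_iff_null_sets[symmetric]) auto
 hence "negligible {x. f x \<noteq> g x}" by (simp add: negligible_iff_null_sets null_sets_completionI)
 moreover have "open {x. f x \<noteq> g x}" by (rule open_Collect_neq[OF c])
 ultimately have "{x. f x \<noteq> g x} = {}" using open_not_negligible by blast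
 thus ?thesis by auto
qed

context ucurve
begin

text \<open>Differentiating the squared length of a chord shows that its inner product with the unit
  tangent attains its length in absolute value. This is equality in Cauchy-Schwarz, so the chord is
  a multiple of the tangent.\<close>

lemma straight_of_isometric:
 assumes iso: "\<And>s t. norm (c s - c t) = \<bar>s - t\<bar>"
 shows "c s = c 0 + s *\<^sub>R cis (ag 0)" "k s = 0"
proof -
 have tangent: "c t = c s + (t - s) *\<^sub>R cis (ag s)" for s t
 proof -
  have "((\<lambda>x. inner (c x - c t) (c x - c t)) has_vector_derivative inner (c s - c t) (cis (ag s)) + inner (cis (ag s)) (c s - c t)) (at s)"
   by (intro bounded_bilinear.has_vector_derivative[OF bounded_bilinear_inner]) (auto intro!: derivative_eq_intros c')
  moreover have "(\<lambda>x. inner (c x - c t) (c x - c t)) = (\<lambda>x. (x - t)\<^sup>2)" using iso[of _ t] by (simp add: power2_norm_eq_inner[symmetric])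
  ultimately have "((\<lambda>x. (x - t)\<^sup>2) has_real_derivative 2 * inner (c s - c t) (cis (ag s))) (at s)"
   by (simp add: has_real_derivative_iff_has_vector_derivative inner_commute)
  moreover have "((\<lambda>x. (x - t)\<^sup>2) has_real_derivative 2 * (s - t)) (at s)" by (auto intro!: derivative_eq_intros)
  ultimately have i: "inner (c s - c t) (cis (ag s)) = s - t" using DERIV_unique by fastforce
  have "(norm (x - y))\<^sup>2 = (norm x)\<^sup>2 - 2 * inner x y + (norm y)\<^sup>2" for x y :: complex
   by (simp add: power2_norm_eq_inner inner_diff_left inner_diff_right inner_commute)
  hence "(norm ((c s - c t) - (s - t) *\<^sub>R cis (ag s)))\<^sup>2 = (norm (c s - c t))\<^sup>2 - 2 * inner (c s - c t) ((s - t) *\<^sub>R cis (ag s)) + (norm ((s - t) *\<^sub>R cis (ag s)))\<^sup>2" .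
  also have "\<dots> = 0" using i by (simp add: iso power2_eq_square)
  finally show ?thesis by (simp add: algebra_simps)
 qed
 show line: "c s = c 0 + s *\<^sub>R cis (ag 0)" for s using tangent[of s 0] by simp
 have "cis (ag s) = cis (ag 0)" for s
 proof -
  have "(c has_vector_derivative cis (ag 0)) (at s)"
   by (subst ext[of c "\<lambda>s. c 0 + s *\<^sub>R cis (ag 0)", OF line]) (auto intro!: derivative_eq_intros)
  thus ?thesis using c' vector_derivative_unique_at by blast
 qed
 hence cs: "(\<lambda>s. cos (ag s)) = (\<lambda>s. cos (ag 0))" "(\<lambda>s. sin (ag s)) = (\<lambda>s. sin (ag 0))" by (auto simp: complex_eq_iff)
 have "((\<lambda>s. cos (ag s)) has_real_derivative - sin (ag s) * k s) (at s)" "((\<lambda>s. sin (ag s)) has_real_derivative cos (ag s) * k s) (at s)"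
  by (auto intro!: derivative_eq_intros th')
 hence "- sin (ag s) * k s = 0" "cos (ag s) * k s = 0" unfolding cs using DERIV_unique DERIV_const by blast+
 moreover have "k s = k s * ((sin (ag s))\<^sup>2 + (cos (ag s))\<^sup>2)" by simp
 ultimately show "k s = 0" by (auto simp: power2_eq_square)
qed

end

context csf
begin

text \<open>The density bound 1 and the comparison of chord with arc length squeeze two continuous
  Gaussians to equality, so chords are as long as arcs. Zero curvature then makes every particle
  stationary, so the same line occurs at all times.\<close>

lemma static_line_of_unit_density:
 assumes lim: "((\<lambda>t. mass t) \<longlongrightarrow> 1) at_bot"
 shows "\<exists>p e. e \<noteq> 0 \<and> (\<forall>t\<le>0. range (z t) = {p + s *\<^sub>R e |s. True})"
proof -
 have ln: "(\<exists>p al. range (z t) = {p + s *\<^sub>R cis al |s. True}) \<and> (\<forall>u. kp t u = 0)" if t: "t \<le> 0" for t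
 proof -
  obtain sg where sg: "surj sg" "ucurve (\<lambda>s. z t (sg s)) (\<lambda>s. ag t (sg s)) (\<lambda>s. kp t (sg s)) E"
   "\<And>F. F \<in> borel_measurable borel \<Longrightarrow> (NN s. F (sg s)) = (NN u. F u * ennreal (J t u))"
   by (rule arclength[OF t]) blast
  interpret u: ucurve "\<lambda>s. z t (sg s)" "\<lambda>s. ag t (sg s)" "\<lambda>s. kp t (sg s)" E by (rule sg(2))
  have iso: "norm (z t (sg s) - z t (sg s0)) = \<bar>s - s0\<bar>" for s s0
  proof -
   have "(NE s. exp (- (norm (z t (sg s) - z t (sg s0)))\<^sup>2 / (4 * 1)))
     = (NN u. ennreal (exp (- (norm (z t u - z t (sg s0)))\<^sup>2 / (4 * 1))) * ennreal (J t u))"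
    by (rule sg(3)) measurable
   also have "\<dots> = (NN u. ennreal (sqrt (4 * pi)) * ennreal (rho (z t (sg s0)) (t + 1) t u * J t u))"
    using J_pos[OF t] by (intro nn_integral_cong) (simp add: rho_def ennreal_mult'[symmetric] ennreal_mult''[symmetric] less_imp_le)
   also have "\<dots> = ennreal (sqrt (4 * pi)) * (NE u. rho (z t (sg s0)) (t + 1) t u * J t u)"
    by (rule nn_integral_cmult) measurable
   also have "\<dots> \<le> ennreal (sqrt (4 * pi)) * ennreal 1"
    using t by (intro mult_left_mono gauss_le_limit[OF lim]) auto
   finally have le: "(NE s. exp (- (norm (z t (sg s) - z t (sg s0)))\<^sup>2 / (4 * 1)))
    \<le> (NE s. exp (- (s - s0)\<^sup>2 / (4 * 1)))"
    using nn_integral_gaussian[of 1 s0] by simp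
   have "exp (- (s - s0)\<^sup>2 / (4 * 1)) = exp (- (norm (z t (sg s) - z t (sg s0)))\<^sup>2 / (4 * 1))"
   proof (rule continuous_eq_of_nn_integral_le[OF _ _ _ _ le])
    show "continuous_on UNIV (\<lambda>s. exp (- (s - s0)\<^sup>2 / (4 * 1)))" by (intro continuous_intros) auto
    show "continuous_on UNIV (\<lambda>s. exp (- (norm (z t (sg s) - z t (sg s0)))\<^sup>2 / (4 * 1)))" by (intro continuous_intros u.cont) auto
    show "exp (- (s - s0)\<^sup>2 / (4 * 1)) \<le> exp (- (norm (z t (sg s) - z t (sg s0)))\<^sup>2 / (4 * 1))" for s
     using power_mono[OF u.chord_le[of s s0] norm_ge_zero, of 2] by simp
    show "(NE s. exp (- (s - s0)\<^sup>2 / (4 * 1))) < \<infinity>" using nn_integral_gaussian[of 1 s0] by simp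
   qed auto
   hence "(norm (z t (sg s) - z t (sg s0)))\<^sup>2 = \<bar>s - s0\<bar>\<^sup>2" by simp
   thus ?thesis by (simp only: power2_eq_iff_nonneg norm_ge_zero abs_ge_zero)
  qed
  have "range (z t) = range (\<lambda>s. z t (sg s))" using sg(1) by (metis image_image)
  also have "\<dots> = range (\<lambda>s. z t (sg 0) + s *\<^sub>R cis (ag t (sg 0)))" by (intro image_cong refl u.straight_of_isometric(1)[OF iso])
  also have "\<dots> = {z t (sg 0) + s *\<^sub>R cis (ag t (sg 0)) |s. True}" by auto
  finally show ?thesis using u.straight_of_isometric(2)[OF iso] sg(1) by (metis surjD)
 qed
 obtain p al where p: "range (z 0) = {p + s *\<^sub>R cis al |s. True}" using ln[of 0] by auto
 have "z t u = z 0 u" if "t \<le> 0" for t u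
 proof -
  have "\<exists>c. \<forall>t\<in>{..0}. z t u = c"
  proof (rule has_vector_derivative_zero_constant)
   show "((\<lambda>t. z t u) has_vector_derivative 0) (at t within {..0})" if "t \<in> {..0}" for t
    using z_t[of t u] ln[of t] that by simp
  qed auto
  thus ?thesis using that by auto
 qed
 hence "range (z t) = {p + s *\<^sub>R cis al |s. True}" if "t \<le> 0" for t using p that by (metis ext)
 thus ?thesis by (intro exI[of _ p] exI[of _ "cis al"]) simp
qed

text \<open>Below accuracy 1/4 the integer \<open>N\<close> must be \<open>m\<close>, and closeness
  of the doubled angles puts \<open>be\<close> near \<open>al\<close> modulo pi, which is all that
  an integral over a line depends on.\<close>

lemma test_limit_smooth:
 fixes ph :: "complex \<Rightarrow> real" and Dph :: "complex \<Rightarrow> complex" and m :: nat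
 assumes ph: "\<And>x. (ph has_derivative (\<lambda>h. inner (Dph x) h)) (at x)" "continuous_on UNIV Dph"
  and R: "R > 0" "\<And>x. norm x \<ge> R \<Longrightarrow> ph x = 0 \<and> Dph x = 0" and m: "m \<ge> 1"
  and lim: "((\<lambda>t. mass t) \<longlongrightarrow> m) at_bot"
   "((\<lambda>t. cmass t) \<longlongrightarrow> m * cos (2 * al)) at_bot"
   "((\<lambda>t. smass t) \<longlongrightarrow> m * sin (2 * al)) at_bot"
 shows "(Ntest ph \<longlongrightarrow> m * (LBINT r. ph (of_real r * cis al))) at_bot"
proof (rule tendstoI)
 fix e :: real assume e: "e > 0"
 define I where "I = (\<lambda>be. LBINT r. ph (of_real r * cis be))"
 have cf: "continuous_on UNIV ph" using ph(1) by (meson continuous_at_imp_continuous_on has_derivative_continuous)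
 have e': "e / (4 * m) > 0" using e m by simp
 obtain et where et: "et > 0" "\<And>a b. \<bar>sin (a - b)\<bar> \<le> 2 * et \<Longrightarrow> \<bar>I a - I b\<bar> \<le> e / (4 * m)"
  unfolding I_def using line_integral_close[OF cf _ e' R(1)] R(2) by blast
 define ep where "ep = min (e / 4) (min (1/4) et)"
 have ep: "ep > 0" "ep \<le> e / 4" "ep \<le> 1/4" "ep \<le> et" using e et by (auto simp: ep_def min_def)
 have "\<forall>\<^sub>F t in at_bot. \<exists>(N::nat) be. \<bar>Ntest ph t - N * I be\<bar> \<le> ep
  \<and> \<bar>real m - real N\<bar> \<le> ep \<and> \<bar>m * cos (2 * al) - N * cos (2 * be)\<bar> \<le> ep \<and> \<bar>m * sin (2 * al) - N * sin (2 * be)\<bar> \<le> ep"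
  unfolding I_def by (rule approx_limits[OF ph R(2) ep(1) lim])
 thus "\<forall>\<^sub>F t in at_bot. dist (Ntest ph t) (m * (LBINT r. ph (of_real r * cis al))) < e"
 proof eventually_elim
  case (elim t)
  then obtain N :: nat and be where N: "\<bar>Ntest ph t - N * I be\<bar> \<le> ep" "\<bar>real m - real N\<bar> \<le> ep"
   "\<bar>m * cos (2 * al) - N * cos (2 * be)\<bar> \<le> ep" "\<bar>m * sin (2 * al) - N * sin (2 * be)\<bar> \<le> ep" by blast
  have "\<bar>real m - real N\<bar> < 1" using N(2) ep(3) by linarith
  hence Nm: "N = m" by linarith
  have red: "\<bar>x - y\<bar> \<le> ep" if "\<bar>m * x - m * y\<bar> \<le> ep" for x y :: real
  proof -
   have "1 * \<bar>x - y\<bar> \<le> real m * \<bar>x - y\<bar>" using m by (intro mult_right_mono) auto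
   also have "\<dots> = \<bar>m * x - m * y\<bar>" by (simp add: abs_mult flip: right_diff_distrib)
   finally show ?thesis using that by simp
  qed
  have "\<bar>sin (al - be)\<bar> \<le> ep" by (rule sin_diff_le_double_angle) (use N(3,4) in \<open>auto simp: Nm intro!: red\<close>)
  hence "\<bar>I al - I be\<bar> \<le> e / (4 * m)" using ep(1,4) by (intro et(2)) linarith
  hence "m * \<bar>I al - I be\<bar> \<le> m * (e / (4 * m))" by (intro mult_left_mono) auto
  also have "\<dots> = e / 4" using m by simp
  finally have "\<bar>m * I al - m * I be\<bar> \<le> e / 4" by (simp add: abs_mult flip: right_diff_distrib)
  thus ?case using N(1) ep(2) e unfolding Nm dist_real_def I_def by linarith
 qed
qed

lemma test_integrable:
 fixes ph :: "complex \<Rightarrow> real"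
 assumes ph: "continuous_on UNIV ph" "\<And>x. norm x \<ge> R \<Longrightarrow> ph x = 0" and t: "t < 0"
 shows "integrable lborel (\<lambda>u. ph (of_real (1 / sqrt (- t)) * z t u) * (1 / sqrt (- t)) * J t u)"
proof -
 have t0: "t \<le> t" "t \<le> 0" using t by auto
 obtain U where U: "U > 0" "\<And>s u. s \<in> {t..t} \<Longrightarrow> \<bar>u\<bar> \<ge> U \<Longrightarrow> norm (z s u) \<ge> R * sqrt (- t)" by (rule proper[OF t0]) blast
 show ?thesis
 proof (rule integrable_compact_support[of _ "- U" U])
  show "continuous_on UNIV (\<lambda>u. ph (of_real (1 / sqrt (- t)) * z t u) * (1 / sqrt (- t)) * J t u)"
   by (intro continuous_intros continuous_on_compose2[OF ph(1)] cont2) auto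
  fix u assume "u \<notin> {- U..U}"
  hence "R * sqrt (- t) \<le> norm (z t u)" using U(2)[of t u] by auto
  hence "R \<le> norm (of_real (1 / sqrt (- t)) * z t u)" using t by (simp add: norm_divide pos_le_divide_eq)
  thus "ph (of_real (1 / sqrt (- t)) * z t u) * (1 / sqrt (- t)) * J t u = 0" using ph(2) by simp
 qed
qed

text \<open>The Gaussian error of a smooth approximation is controlled on the rescaled curve by
  \<open>E\<close>, uniformly in time, and on the limiting line by \<open>m\<close>; this is why
  \<open>d\<close> contains \<open>E + m\<close>.\<close>

lemma test_limit:
 fixes ph :: "complex \<Rightarrow> real" and m :: nat
 assumes ph: "continuous_on UNIV ph" "\<And>x. norm x \<ge> R \<Longrightarrow> ph x = 0" and R: "R > 0" and m: "m \<ge> 1"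
  and lim: "((\<lambda>t. mass t) \<longlongrightarrow> m) at_bot"
   "((\<lambda>t. cmass t) \<longlongrightarrow> m * cos (2 * al)) at_bot"
   "((\<lambda>t. smass t) \<longlongrightarrow> m * sin (2 * al)) at_bot"
 shows "(Ntest ph \<longlongrightarrow> m * (LBINT r. ph (of_real r * cis al))) at_bot"
proof (rule tendstoI)
 fix e :: real assume e: "e > 0"
 define S where "S = sqrt (4 * pi)"
 have S: "S > 0" by (simp add: S_def)
 define d where "d = e / (4 * (S * (E + m)))"
 have Em: "S * (E + m) > 0" using S E by (intro mult_pos_pos) auto
 have d: "d > 0" "d * S * (E + m) = e / 4" using e Em by (auto simp: d_def field_simps)
 obtain ps Dps where ps: "\<And>x. (ps has_derivative (\<lambda>h. inner (Dps x) h)) (at x)" "continuous_on UNIV Dps"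
  "\<And>x. norm x \<ge> 2 * R \<Longrightarrow> ps x = 0 \<and> Dps x = 0" and close: "\<And>x. \<bar>ph x - ps x\<bar> \<le> d * exp (- (norm x)\<^sup>2 / 4)"
  apply (rule smooth_approximation[OF ph(1) _ R d(1)], erule ph(2))
  subgoal for ps Dps by (rule that[of ps Dps]) simp_all
  done
 have cps: "continuous_on UNIV ps" using ps(1) by (meson continuous_at_imp_continuous_on has_derivative_continuous)
 have R2: "2 * R > 0" using R by simp
 have L: "\<bar>(LBINT r. ph (of_real r * cis al)) - (LBINT r. ps (of_real r * cis al))\<bar> \<le> d * S"
 proof -
  have int: "integrable lborel (\<lambda>r. f (of_real r * cis al))" if "continuous_on UNIV f" "\<And>x. norm x \<ge> 2 * R \<Longrightarrow> f x = 0" for f :: "complex \<Rightarrow> real"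
   by (rule integrable_compact_support[of _ "- (2 * R)" "2 * R"])
    (use that in \<open>auto intro!: continuous_on_compose2[OF that(1)] continuous_intros simp: norm_mult\<close>)
  have "\<bar>(LBINT r. ph (of_real r * cis al)) - (LBINT r. ps (of_real r * cis al))\<bar> \<le> (LBINT r. d * exp (- r\<^sup>2 / (4 * 1)))"
  proof (rule abs_integral_diff_le)
   show "integrable lborel (\<lambda>r. ph (of_real r * cis al))" using ph R by (intro int) auto
   show "integrable lborel (\<lambda>r. ps (of_real r * cis al))" using ps(3) by (intro int cps) auto
   show "integrable lborel (\<lambda>r. d * exp (- r\<^sup>2 / (4 * 1)))" using gaussian_integral(1)[of 1] by simp
   show "\<bar>ph (of_real r * cis al) - ps (of_real r * cis al)\<bar> \<le> d * exp (- r\<^sup>2 / (4 * 1))" for r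
    using close[of "of_real r * cis al"] by (simp add: norm_mult)
  qed
  thus ?thesis using gaussian_integral(2)[of 1] by (simp add: S_def)
 qed
 have N: "\<bar>Ntest ph t - Ntest ps t\<bar> \<le> d * S * E" if t: "t \<le> -1" for t
 proof -
  have t0: "t < 0" "t \<le> 0" using t by auto
  have "\<bar>Ntest ph t - Ntest ps t\<bar> \<le> (LBINT u. d * S * (rho 0 0 t u * J t u))" unfolding Ntest_def
  proof (rule abs_integral_diff_le[OF test_integrable[OF ph t0(1)] test_integrable[OF cps _ t0(1)]])
   show "integrable lborel (\<lambda>u. d * S * (rho 0 0 t u * J t u))" using gaussian_limit(2)[OF t] by simp
   fix u
   define a where "a = 1 / sqrt (- t)"
   have a: "a > 0" "a\<^sup>2 = 1 / (- t)" using t0 by (auto simp: a_def power_divide)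
   have "\<bar>ph (of_real a * z t u) * a * J t u - ps (of_real a * z t u) * a * J t u\<bar> = \<bar>ph (of_real a * z t u) - ps (of_real a * z t u)\<bar> * (a * J t u)"
    using a J_pos[OF t0(2), of u] by (simp add: abs_mult mult.assoc flip: left_diff_distrib)
   also have "\<dots> \<le> d * exp (- (norm (of_real a * z t u))\<^sup>2 / 4) * (a * J t u)"
    using close a J_pos[OF t0(2), of u] by (intro mult_right_mono) auto
   also have "\<dots> = d * S * (rho 0 0 t u * J t u)"
   proof -
    have "(norm (of_real a * z t u))\<^sup>2 = (norm (z t u))\<^sup>2 / (- t)" using a by (simp add: norm_mult power_mult_distrib)
    hence "exp (- (norm (of_real a * z t u))\<^sup>2 / 4) = exp (- (norm (z t u - 0))\<^sup>2 / (4 * (0 - t)))" by (simp add: mult.commute)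
    moreover have "sqrt (4 * pi * (0 - t)) = S * sqrt (- t)" by (simp only: S_def real_sqrt_mult diff_0)
    ultimately show ?thesis unfolding rho_def using S by (simp add: a_def)
   qed
   finally show "\<bar>ph (of_real (1 / sqrt (- t)) * z t u) * (1 / sqrt (- t)) * J t u - ps (of_real (1 / sqrt (- t)) * z t u) * (1 / sqrt (- t)) * J t u\<bar>
    \<le> d * S * (rho 0 0 t u * J t u)" unfolding a_def .
  qed (use ps(3) in auto)
  also have "\<dots> = d * S * (mass t)" by simp
  also have "\<dots> \<le> d * S * E"
  proof (intro mult_left_mono)
   have "ennreal (mass t) = (gmass 0 0 t)"
    using gaussian_limit(2)[OF t] rho_nonneg[OF t0(1)] J_pos[OF t0(2)] by (subst nn_integral_eq_integral) (auto simp: less_imp_le)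
   also have "\<dots> \<le> ennreal E" using t0 by (intro gauss_rho_le) auto
   finally show "(mass t) \<le> E" using E by (simp add: ennreal_le_iff)
  qed (use d S in auto)
  finally show ?thesis .
 qed
 have "e / 2 > 0" using e by simp
 from tendstoD[OF test_limit_smooth[OF ps(1,2) R2 ps(3) m lim] this]
 have "\<forall>\<^sub>F t in at_bot. dist (Ntest ps t) (m * (LBINT r. ps (of_real r * cis al))) < e / 2" .
 thus "\<forall>\<^sub>F t in at_bot. dist (Ntest ph t) (m * (LBINT r. ph (of_real r * cis al))) < e"
  using eventually_le_at_bot[of "-1"]
 proof eventually_elim
  case (elim t)
  have "m * \<bar>(LBINT r. ph (of_real r * cis al)) - (LBINT r. ps (of_real r * cis al))\<bar> \<le> m * (d * S)"
   by (intro mult_left_mono L) auto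
  hence "\<bar>m * (LBINT r. ph (of_real r * cis al)) - m * (LBINT r. ps (of_real r * cis al))\<bar> \<le> m * (d * S)"
   by (simp add: abs_mult flip: right_diff_distrib)
  moreover have "m * (d * S) + d * S * E = e / 4" using d(2) by (simp add: distrib_left mult.commute)
  ultimately show ?case using elim(1) N[OF elim(2)] unfolding dist_real_def by linarith
 qed
qed

end

section \<open>Flows in the Euclidean plane\<close>

definition to_complex :: "pt \<Rightarrow> complex" where "to_complex v = Complex (v $ 1) (v $ 2)"
definition to_plane :: "complex \<Rightarrow> pt" where "to_plane w = vector [Re w, Im w]"

lemma to_complex_to_plane [simp]: "to_complex (to_plane w) = w"
 by (simp add: to_complex_def to_plane_def)

lemma to_plane_to_complex [simp]: "to_plane (to_complex v) = v"
 by (simp add: to_complex_def to_plane_def vec_eq_iff forall_2)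

lemma norm_to_complex [simp]: "norm (to_complex v) = norm v"
 by (simp add: to_complex_def cmod_def norm_vec_def L2_set_def sum_2)

lemma norm_to_plane [simp]: "norm (to_plane w) = norm w"
 using norm_to_complex[of "to_plane w"] by simp

lemma bounded_linear_to_complex: "bounded_linear to_complex"
 unfolding linear_conv_bounded_linear[symmetric] by (rule linearI) (auto simp: to_complex_def complex_eq_iff)

lemma bounded_linear_to_plane: "bounded_linear to_plane"
 unfolding linear_conv_bounded_linear[symmetric] by (rule linearI) (auto simp: to_plane_def vec_eq_iff forall_2)

section \<open>From a parametrized flow to angle, speed and curvature\<close>

text \<open>Near \<open>x\<close> a continuous logarithm is \<open>g x\<close> plus the principal
  logarithm of a quantity close to 1, since continuity excludes jumps by multiples of 2 pi
  i.\<close>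

lemma continuous_log_has_vector_derivative:
 fixes f g :: "real \<Rightarrow> complex"
 assumes f: "(f has_vector_derivative f') (at x within S)" and g: "continuous (at x within S) g"
  and fg: "\<And>y. y \<in> S \<Longrightarrow> f y = exp (g y)" and x: "x \<in> S"
 shows "(g has_vector_derivative f' * exp (- g x)) (at x within S)"
proof -
 have "((\<lambda>y. f y * exp (- g x)) has_vector_derivative f' * exp (- g x)) (at x within S)"
  by (rule has_vector_derivative_mult_left[OF f])
 moreover have "(Ln has_field_derivative inverse 1) (at (f x * exp (- g x)) within (\<lambda>y. f y * exp (- g x)) ` S)"
  using has_field_derivative_at_within[OF has_field_derivative_Ln[of 1]] fg[OF x] by (simp flip: exp_add)
 ultimately have "(Ln \<circ> (\<lambda>y. f y * exp (- g x)) has_vector_derivative f' * exp (- g x) * inverse 1) (at x within S)"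
  by (rule field_vector_diff_chain_within)
 hence L: "((\<lambda>y. g x + Ln (f y * exp (- g x))) has_vector_derivative 0 + f' * exp (- g x)) (at x within S)"
  by (intro has_vector_derivative_add has_vector_derivative_const) (simp add: o_def)
 obtain d where d: "d > 0" "\<And>y. y \<in> S \<Longrightarrow> dist y x < d \<Longrightarrow> dist (g y) (g x) < 1"
  using g unfolding continuous_within_eps_delta by (metis zero_less_one)
 have "((\<lambda>y. g y) has_vector_derivative 0 + f' * exp (- g x)) (at x within S)"
 proof (rule has_vector_derivative_transform_within[OF L d(1) x])
  fix y assume y: "y \<in> S" "dist y x < d"
  have "\<bar>Im (g y - g x)\<bar> < 1" using d(2)[OF y] abs_Im_le_cmod[of "g y - g x"] by (simp add: dist_norm)
  hence "Ln (exp (g y - g x)) = g y - g x" using pi_gt3 by (intro Ln_exp) auto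
  moreover have "f y * exp (- g x) = exp (g y - g x)" using fg[OF y(1)] by (simp flip: exp_add)
  ultimately show "g x + Ln (f y * exp (- g x)) = g y" by simp
 qed
 thus ?thesis by simp
qed

text \<open>Equality of mixed derivatives when the time derivative is one-sided at 0: integrating
  \<open>ft\<close> in time and differentiating under the integral in \<open>u\<close> writes
  \<open>fu\<close> as an integral of \<open>ftu\<close>, which can be differentiated in
  time.\<close>

lemma mixed_partials:
 fixes f ft fu fut ftu :: "real \<Rightarrow> real \<Rightarrow> complex"
 assumes ft: "\<And>t u. t \<le> 0 \<Longrightarrow> ((\<lambda>s. f s u) has_vector_derivative ft t u) (at t within {..0})"
  and fu: "\<And>t u. t \<le> 0 \<Longrightarrow> (f t has_vector_derivative fu t u) (at u)"
  and ftu: "\<And>t u. t \<le> 0 \<Longrightarrow> (ft t has_vector_derivative ftu t u) (at u)"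
  and fut: "\<And>t u. t \<le> 0 \<Longrightarrow> ((\<lambda>s. fu s u) has_vector_derivative fut t u) (at t within {..0})"
  and c: "continuous_on ({..0} \<times> UNIV) (\<lambda>p. ft (fst p) (snd p))" "continuous_on ({..0} \<times> UNIV) (\<lambda>p. ftu (fst p) (snd p))"
  and t: "t \<le> 0"
 shows "fut t u = ftu t u"
proof -
 define a where "a = t - 1"
 have cs: "continuous_on {a..s} (\<lambda>ta. ft ta v)" "continuous_on {a..s} (\<lambda>ta. ftu ta v)" if "s \<le> 0" for s v
  using that by (auto intro!: continuous_on_compose2[OF c(1), of _ "\<lambda>ta. (ta, v)", simplified]
   continuous_on_compose2[OF c(2), of _ "\<lambda>ta. (ta, v)", simplified] continuous_intros)
 have inc: "fu s u - fu a u = integral {a..s} (\<lambda>ta. ftu ta u)" if s: "s \<in> {a..0}" for s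
 proof -
  have s0: "s \<le> 0" "a \<le> s" "a \<le> 0" using s by auto
  have "integral {a..s} (\<lambda>ta. ft ta v) = f s v - f a v" for v
   by (intro integral_unique fundamental_theorem_of_calculus s0) (use s0 in \<open>auto intro: has_vector_derivative_within_subset[OF ft]\<close>)
  moreover have "((\<lambda>v. integral (cbox a s) (\<lambda>ta. ft ta v)) has_vector_derivative integral (cbox a s) (\<lambda>ta. ftu ta u)) (at u within UNIV)"
  proof (rule leibniz_rule_vector_derivative)
   have sw: "continuous_on (UNIV \<times> cbox a s) (\<lambda>p. (snd p, fst p))" "(\<lambda>p. (snd p, fst p)) ` (UNIV \<times> cbox a s) \<subseteq> {..0} \<times> UNIV"
    using s0 by (auto intro!: continuous_intros)
   show "((\<lambda>v. ft ta v) has_vector_derivative ftu ta v) (at v within UNIV)" if "ta \<in> cbox a s" for v ta using ftu[of ta v] that s0 by simp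
   show "(\<lambda>ta. ft ta v) integrable_on cbox a s" for v using integrable_continuous_interval[OF cs(1)[OF s0(1)]] by simp
   show "continuous_on (UNIV \<times> cbox a s) (\<lambda>(v, ta). ftu ta v)"
    using continuous_on_compose2[OF c(2) sw] by (simp add: split_beta)
  qed auto
  ultimately have "((\<lambda>v. f s v - f a v) has_vector_derivative integral {a..s} (\<lambda>ta. ftu ta u)) (at u)" by simp
  moreover have "((\<lambda>v. f s v - f a v) has_vector_derivative fu s u - fu a u) (at u)"
   using fu[OF s0(1)] fu[OF s0(3)] by (intro has_vector_derivative_diff) auto
  ultimately show ?thesis using vector_derivative_unique_at by blast
 qed
 have t0: "t \<in> {a..0}" "a < 0" using t by (auto simp: a_def)
 have D: "((\<lambda>s. fu a u + integral {a..s} (\<lambda>ta. ftu ta u)) has_vector_derivative 0 + ftu t u) (at t within {a..0})"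
  by (intro has_vector_derivative_add has_vector_derivative_const integral_has_vector_derivative cs t0) simp
 have "((\<lambda>s. fu s u) has_vector_derivative 0 + ftu t u) (at t within {a..0})"
  by (rule has_vector_derivative_transform[OF t0(1) _ D]) (simp flip: inc)
 moreover have "((\<lambda>s. fu s u) has_vector_derivative fut t u) (at t within {a..0})"
  by (rule has_vector_derivative_within_subset[OF fut[OF t]]) auto
 ultimately show ?thesis using vector_derivative_unique_within_closed_interval[of a 0 t "\<lambda>s. fu s u"] t0 by simp
qed

text \<open>The hypothesis concerns the half line from 0; passing to the one from \<open>u\<close>
  loses at most the integral over a bounded interval.\<close>

lemma infinite_length:
 fixes f :: "real \<Rightarrow> real"
 assumes f: "continuous_on UNIV f" "\<And>x. 0 \<le> f x" and inf: "(NN x. ennreal (f x) * indicator {0..} x) = \<infinity>"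
 shows "\<exists>v\<ge>u. l \<le> integral {u..v} f"
proof (rule ccontr)
 assume "\<not> ?thesis"
 hence b: "integral {u..v} f < l" if "v \<ge> u" for v using that by (meson not_le)
 have [measurable]: "f \<in> borel_measurable borel" by (rule borel_measurable_continuous_onI[OF f(1)])
 have c: "continuous_on S f" for S using f(1) continuous_on_subset by blast
 have "(NN x. ennreal (f x) * indicator {u..} x) = (SUP n::nat. NN x. ennreal (f x) * indicator {u..u + n} x)"
 proof (subst nn_integral_monotone_convergence_SUP[symmetric])
  show "incseq (\<lambda>n x. ennreal (f x) * indicator {u..u + real n} x)"
   by (auto simp: incseq_def le_fun_def indicator_def)
  show "(NN x. ennreal (f x) * indicator {u..} x) = (NN x. (SUP n. ennreal (f x) * indicator {u..u + real n} x))"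
  proof (rule nn_integral_cong)
   fix x
   obtain n :: nat where n: "x - u \<le> n" using real_arch_simple by blast
   show "ennreal (f x) * indicator {u..} x = (SUP n. ennreal (f x) * indicator {u..u + real n} x)"
   proof (rule antisym)
    have "ennreal (f x) * indicator {u..} x \<le> ennreal (f x) * indicator {u..u + real n} x" using n by (auto simp: indicator_def)
    thus "ennreal (f x) * indicator {u..} x \<le> (SUP n. ennreal (f x) * indicator {u..u + real n} x)" by (rule order_trans[OF _ SUP_upper]) simp
    show "(SUP n. ennreal (f x) * indicator {u..u + real n} x) \<le> ennreal (f x) * indicator {u..} x"
     by (rule SUP_least) (auto simp: indicator_def)
   qed
  qed
 qed auto
 also have "\<dots> \<le> ennreal l"
 proof (rule SUP_least)
  fix n :: nat
  have "(NN x. ennreal (f x) * indicator {u..u + n} x) = ennreal (integral {u..u + n} f)"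
   by (rule nn_integral_continuous_interval[OF c f(2)])
  thus "(NN x. ennreal (f x) * indicator {u..u + n} x) \<le> ennreal l" using b[of "u + n"] by (simp add: ennreal_leI less_imp_le)
 qed
 finally have 1: "(NN x. ennreal (f x) * indicator {u..} x) \<le> ennreal l" .
 have "(NN x. ennreal (f x) * indicator {0..} x)
  \<le> (NN x. ennreal (f x) * indicator {0..u} x + ennreal (f x) * indicator {u..} x)"
  by (intro nn_integral_mono) (auto simp: indicator_def)
 also have "\<dots> = (NN x. ennreal (f x) * indicator {0..u} x) + (NN x. ennreal (f x) * indicator {u..} x)"
  by (rule nn_integral_add) auto
 also have "\<dots> \<le> ennreal (integral {0..u} f) + ennreal l"
  using 1 nn_integral_continuous_interval[OF c f(2), of 0 u] by (intro add_mono) auto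
 finally show False using inf by (simp add: top_unique)
qed

text \<open>One continuous logarithm of the velocity on the contractible half plane of nonpositive
  times yields the logarithm of the speed as real part and a global tangent angle as imaginary part.
  Their evolution equations are the two parts of a single complex equation.\<close>

lemma csf_of_flow:
 fixes \<gamma> :: flow
 assumes csf: "ancient_csf \<gamma>" and emb: "embedded_flow \<gamma>" and compl: "complete_flow \<gamma>" and ent: "entropy \<gamma> < \<infinity>"
 obtains J ag kp kps E where "csf (\<lambda>t u. to_complex (\<gamma> (min t 0) u)) J ag kp kps E" "\<And>t u. t \<le> 0 \<Longrightarrow> J t u = norm (gu \<gamma> t u)"
proof -
 define D where "D = (\<lambda>w t u. to_complex (dword w (case_prod \<gamma>) (t, u)))"
 have sm: "continuous_on ({..0} \<times> UNIV) (dword w (case_prod \<gamma>))"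
  "t \<le> 0 \<Longrightarrow> (\<lambda>s. dword w (case_prod \<gamma>) (s, u)) differentiable (at t within {..0})"
  "t \<le> 0 \<Longrightarrow> (\<lambda>v. dword w (case_prod \<gamma>) (t, v)) differentiable (at u)" for w t u
  using csf unfolding ancient_csf_def smooth_flow_def by auto
 have Dt: "((\<lambda>s. D w s u) has_vector_derivative D (True # w) t u) (at t within {..0})" if "t \<le> 0" for w t u
  using bounded_linear.has_vector_derivative[OF bounded_linear_to_complex sm(2)[OF that, of w u, unfolded vector_derivative_works]]
  by (simp add: D_def dT_def)
 have Du: "(D w t has_vector_derivative D (False # w) t u) (at u)" if "t \<le> 0" for w t u
  using bounded_linear.has_vector_derivative[OF bounded_linear_to_complex sm(3)[OF that, of w u, unfolded vector_derivative_works]]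
  by (simp add: D_def dU_def)
 have Dc: "continuous_on ({..0} \<times> UNIV) (\<lambda>p. D w (fst p) (snd p))" for w
  unfolding D_def using sm(1)[of w] by (auto intro!: bounded_linear.continuous_on[OF bounded_linear_to_complex])
 have D0: "D [] t u = to_complex (\<gamma> t u)" and D1: "D [False] t u = to_complex (gu \<gamma> t u)"
  and D2: "D [True] t u = to_complex (vector_derivative (\<lambda>s. \<gamma> s u) (at t within {..0}))" for t u
  by (simp_all add: D_def dU_def dT_def gu_def)
 have gu0: "gu \<gamma> t u \<noteq> 0" "vector_derivative (\<lambda>s. \<gamma> s u) (at t within {..0}) = gss \<gamma> t u" if "t \<le> 0" for t u
  using csf that unfolding ancient_csf_def by auto
 obtain g where g: "continuous_on ({..0} \<times> UNIV) g" "\<And>p. p \<in> {..0} \<times> UNIV \<Longrightarrow> D [False] (fst p) (snd p) = exp (g p)"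
 proof (rule continuous_logarithm_on_contractible[OF Dc[of "[False]"]])
  show "contractible ({..0::real} \<times> (UNIV :: real set))" by (intro convex_imp_contractible convex_Times) auto
  show "D [False] (fst p) (snd p) \<noteq> 0" if "p \<in> {..0} \<times> UNIV" for p
   using gu0(1)[of "fst p" "snd p"] that unfolding D1 by (metis mem_Times_iff atMost_iff norm_to_complex norm_eq_zero)
 qed blast
 define G where "G = (\<lambda>t u. g (t, u))"
 have ex: "D [False] t u = exp (G t u)" if "t \<le> 0" for t u using g(2)[of "(t, u)"] that by (simp add: G_def)
 have Gc: "continuous_on ({..0} \<times> UNIV) (\<lambda>p. G (fst p) (snd p))" using g(1) by (simp add: G_def)
 \<comment> \<open>The derivative of the logarithm \<open>G\<close> in \<open>u\<close>; its
   imaginary part is curvature times speed.\<close>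
 define q where "q = (\<lambda>t u. D [False, False] t u * exp (- G t u))"
 have Gu: "(G t has_vector_derivative q t u) (at u)" if "t \<le> 0" for t u unfolding q_def
 proof (rule continuous_log_has_vector_derivative[where S = UNIV and f = "D [False] t"])
  have "continuous_on UNIV (\<lambda>u. g (t, u))" by (rule continuous_on_compose2[OF g(1)]) (use that in \<open>auto intro!: continuous_intros\<close>)
  thus "isCont (G t) u" by (simp add: G_def continuous_on_eq_continuous_at)
 qed (use Du[OF that] ex[OF that] in auto)
 have Gt: "((\<lambda>s. G s u) has_vector_derivative D [True, False] t u * exp (- G t u)) (at t within {..0})" if "t \<le> 0" for t u
 proof (rule continuous_log_has_vector_derivative[where f = "\<lambda>s. D [False] s u"])
  have "continuous_on {..0} (\<lambda>s. g (s, u))" by (rule continuous_on_compose2[OF g(1)]) (auto intro!: continuous_intros)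
  thus "continuous (at t within {..0}) (\<lambda>s. G s u)" using that by (simp add: G_def continuous_on_eq_continuous_within)
 qed (use Dt[OF that] ex that in auto)
 define J where "J = (\<lambda>t u. exp (Re (G t u)))"
 define ag where "ag = (\<lambda>t u. Im (G t u))"
 define kp where "kp = (\<lambda>t u. Im (q t u) * exp (- Re (G t u)))"
 define q' where "q' = (\<lambda>t u. D [False, False] t u * (- q t u * exp (- G t u)) + D [False, False, False] t u * exp (- G t u))"
 define kpu where "kpu = (\<lambda>t u. Im (q t u) * (- Re (q t u) * exp (- Re (G t u))) + Im (q' t u) * exp (- Re (G t u)))"
 define kps where "kps = (\<lambda>t u. kpu t u * exp (- Re (G t u)))"
 have kJ: "kp t u * J t u = Im (q t u)" "kps t u * J t u = kpu t u" for t u by (simp_all add: kp_def kps_def J_def mult.assoc flip: exp_add)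
 have J0: "J t u > 0" for t u by (simp add: J_def)
 have zu: "D [False] t u = J t u *\<^sub>R cis (ag t u)" if "t \<le> 0" for t u
  unfolding ex[OF that] J_def ag_def by (subst exp_eq_polar) (simp add: scaleR_conv_of_real)
 have Jgu: "J t u = norm (gu \<gamma> t u)" if "t \<le> 0" for t u
  using arg_cong[OF zu[OF that, of u], of norm] J0[of t u] unfolding D1 by simp
 have thu: "(ag t has_real_derivative kp t u * J t u) (at u)" if "t \<le> 0" for t u
  unfolding kJ ag_def has_real_derivative_iff_has_vector_derivative by (rule bounded_linear.has_vector_derivative[OF bounded_linear_Im Gu[OF that]])
 have ReGu: "((\<lambda>u. Re (G t u)) has_real_derivative Re (q t u)) (at u)" if "t \<le> 0" for t u
  unfolding has_real_derivative_iff_has_vector_derivative by (rule bounded_linear.has_vector_derivative[OF bounded_linear_Re Gu[OF that]])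
 have qu: "(q t has_vector_derivative q' t u) (at u)" if "t \<le> 0" for t u
 proof -
  have "((\<lambda>u. - G t u) has_vector_derivative - q t u) (at u)" by (rule has_vector_derivative_minus[OF Gu[OF that]])
  from field_vector_diff_chain_at[OF this DERIV_exp]
  have "((\<lambda>u. exp (- G t u)) has_vector_derivative - q t u * exp (- G t u)) (at u)" by (simp add: o_def)
  from has_vector_derivative_mult[OF Du[OF that, of "[False, False]" u] this]
  show ?thesis unfolding q_def q'_def by simp
 qed
 have ku: "(kp t has_real_derivative kpu t u) (at u)" if "t \<le> 0" for t u
 proof -
  have "((\<lambda>u. Im (q t u)) has_real_derivative Im (q' t u)) (at u)"
   unfolding has_real_derivative_iff_has_vector_derivative by (rule bounded_linear.has_vector_derivative[OF bounded_linear_Im qu[OF that]])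
  moreover have "((\<lambda>u. exp (- Re (G t u))) has_real_derivative - Re (q t u) * exp (- Re (G t u))) (at u)"
   by (rule DERIV_cong[OF DERIV_chain2[OF DERIV_exp DERIV_minus[OF ReGu[OF that]]]]) simp
  ultimately show ?thesis unfolding kp_def kpu_def by (rule DERIV_mult')
 qed
 have cisu: "((\<lambda>u. cis (ag t u)) has_vector_derivative (kp t u * J t u) *\<^sub>R (\<i> * cis (ag t u))) (at u)" if "t \<le> 0" for t u
  using thu[OF that, of u] unfolding has_vector_derivative_def has_field_derivative_def
  by (auto intro!: derivative_eq_intros simp: mult_ac)
 have zt: "D [True] t u = kp t u *\<^sub>R (\<i> * cis (ag t u))" if "t \<le> 0" for t u
 proof -
  have "(1 / norm (gu \<gamma> t v)) *\<^sub>R gu \<gamma> t v = to_plane (cis (ag t v))" for v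
  proof -
   have "gu \<gamma> t v = to_plane (J t v *\<^sub>R cis (ag t v))" using zu[OF that, of v] unfolding D1 by (metis to_plane_to_complex)
   also have "\<dots> = J t v *\<^sub>R to_plane (cis (ag t v))" by (rule linear_scale[OF bounded_linear.linear[OF bounded_linear_to_plane]])
   finally show ?thesis using J0[of t v] unfolding Jgu[OF that, symmetric] by simp
  qed
  moreover have "((\<lambda>v. to_plane (cis (ag t v))) has_vector_derivative to_plane ((kp t u * J t u) *\<^sub>R (\<i> * cis (ag t u)))) (at u)"
   by (rule bounded_linear.has_vector_derivative[OF bounded_linear_to_plane cisu[OF that]])
  ultimately have "gss \<gamma> t u = (1 / J t u) *\<^sub>R to_plane ((kp t u * J t u) *\<^sub>R (\<i> * cis (ag t u)))"
   unfolding gss_def Jgu[OF that, symmetric] by (simp add: vector_derivative_at)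
  also have "\<dots> = to_plane (kp t u *\<^sub>R (\<i> * cis (ag t u)))"
   using J0[of t u] by (simp add: linear_scale[OF bounded_linear.linear[OF bounded_linear_to_plane]])
  finally show ?thesis unfolding D2 gu0(2)[OF that] by simp
 qed
 \<comment> \<open>By equality of mixed derivatives the velocity evolves by the derivative in
   \<open>u\<close> of the curvature vector. Dividing by the velocity gives the equation for
   \<open>G\<close>: its imaginary part is the evolution of the angle, its real part that of the
   logarithm of the speed.\<close>
 have evol: "D [True, False] t u * exp (- G t u) = kps t u *\<^sub>R \<i> - of_real ((kp t u)\<^sup>2)" if "t \<le> 0" for t u
 proof -
  have "D [True, False] t u = D [False, True] t u"
   by (rule mixed_partials[OF Dt Du Du Dt Dc Dc that])
  also have "\<dots> = kp t u *\<^sub>R (\<i> * ((kp t u * J t u) *\<^sub>R (\<i> * cis (ag t u)))) + kpu t u *\<^sub>R (\<i> * cis (ag t u))"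
  proof -
   have "((\<lambda>u. kp t u *\<^sub>R (\<i> * cis (ag t u))) has_vector_derivative
    kp t u *\<^sub>R (\<i> * ((kp t u * J t u) *\<^sub>R (\<i> * cis (ag t u)))) + kpu t u *\<^sub>R (\<i> * cis (ag t u))) (at u)"
    by (rule has_vector_derivative_scaleR[OF ku[OF that] has_vector_derivative_mult_right[OF cisu[OF that]]])
   moreover have "(\<lambda>u. kp t u *\<^sub>R (\<i> * cis (ag t u))) = D [True] t" using zt[OF that] by auto
   ultimately show ?thesis using Du[OF that, of "[True]" u] vector_derivative_unique_at by metis
  qed
  also have "\<dots> = D [False] t u * (kps t u *\<^sub>R \<i> - of_real ((kp t u)\<^sup>2))"
   unfolding zu[OF that] kJ(2)[symmetric] by (simp add: complex_eq_iff power2_eq_square algebra_simps)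
  finally show ?thesis unfolding ex[OF that] by (simp add: mult_ac flip: exp_add)
 qed
 have Rt: "((\<lambda>s. Re (G s u)) has_real_derivative - (kp t u)\<^sup>2) (at t within {..0})" and It: "((\<lambda>s. Im (G s u)) has_real_derivative kps t u) (at t within {..0})"
  if "t \<le> 0" for t u
  using bounded_linear.has_vector_derivative[OF bounded_linear_Re Gt[OF that, of u]] bounded_linear.has_vector_derivative[OF bounded_linear_Im Gt[OF that, of u]]
  unfolding evol[OF that] has_real_derivative_iff_has_vector_derivative by auto
 have cq: "continuous_on ({..0} \<times> UNIV) (\<lambda>p. q (fst p) (snd p))" unfolding q_def by (intro continuous_intros Dc Gc)
 have cq': "continuous_on ({..0} \<times> UNIV) (\<lambda>p. q' (fst p) (snd p))" unfolding q'_def by (intro continuous_intros Dc Gc cq)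
 have ck: "continuous_on ({..0} \<times> UNIV) (\<lambda>p. kp (fst p) (snd p))" "continuous_on ({..0} \<times> UNIV) (\<lambda>p. kps (fst p) (snd p))"
  unfolding kp_def kps_def kpu_def by (intro continuous_intros Gc cq cq')+
 \<comment> \<open>Positive times are given the values at time 0.\<close>
 have clamp: "continuous_on UNIV (\<lambda>p. f (min (fst p) 0) (snd p))" if "continuous_on ({..0} \<times> UNIV) (\<lambda>p. f (fst p) (snd p))"
  for f :: "real \<Rightarrow> real \<Rightarrow> 'b::topological_space"
 proof -
  have "continuous_on UNIV (\<lambda>p::real \<times> real. (min (fst p) 0, snd p))" "range (\<lambda>p::real \<times> real. (min (fst p) 0, snd p)) \<subseteq> {..0} \<times> UNIV"
   by (auto intro!: continuous_intros)
  from continuous_on_compose2[OF that this] show ?thesis by simp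
 qed
 have tr: "((\<lambda>s. f (min s 0)) has_vector_derivative f') (at t within {..0})" if "(f has_vector_derivative f') (at t within {..0})" "t \<le> 0"
  for f :: "real \<Rightarrow> 'b::real_normed_vector" and f' t
  by (rule has_vector_derivative_transform[OF _ _ that(1)]) (use that(2) in \<open>auto simp: min_def\<close>)
 have tr': "((\<lambda>s. f (min s 0)) has_real_derivative f') (at t within {..0})" if "(f has_real_derivative f') (at t within {..0})" "t \<le> 0" for f f' t
  using tr that unfolding has_real_derivative_iff_has_vector_derivative by blast
 \<comment> \<open>The added 1 ensures positivity.\<close>
 define E where "E = enn2real (entropy \<gamma>) + 1"
 have E: "E > 0" "entropy \<gamma> \<le> ennreal E" unfolding E_def using ent
  by (auto simp: add_nonneg_pos less_top ennreal_enn2real_if intro: order_trans[OF _ ennreal_leI[of "enn2real (entropy \<gamma>)"]])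
 have "csf (\<lambda>t u. to_complex (\<gamma> (min t 0) u)) (\<lambda>t. J (min t 0)) (\<lambda>t. ag (min t 0)) (\<lambda>t. kp (min t 0)) (\<lambda>t. kps (min t 0)) E"
 proof
  fix t u :: real assume t: "t \<le> 0"
  have mt: "min t 0 = t" using t by simp
  show "J (min t 0) u > 0" by (rule J0)
  show "((\<lambda>u. to_complex (\<gamma> (min t 0) u)) has_vector_derivative J (min t 0) u *\<^sub>R cis (ag (min t 0) u)) (at u)"
   using Du[OF t, of "[]" u] unfolding mt zu[OF t, symmetric] D0[abs_def] .
  show "((\<lambda>s. to_complex (\<gamma> (min s 0) u)) has_vector_derivative kp (min t 0) u *\<^sub>R (\<i> * cis (ag (min t 0) u))) (at t within {..0})"
   using tr[OF Dt[OF t, of "[]" u] t] unfolding mt zt[OF t, symmetric] D0 .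
  show "(ag (min t 0) has_real_derivative kp (min t 0) u * J (min t 0) u) (at u)" unfolding mt by (rule thu[OF t])
  show "((\<lambda>s. ag (min s 0) u) has_real_derivative kps (min t 0) u) (at t within {..0})"
   unfolding mt ag_def by (rule tr'[OF It[OF t] t])
  show "(kp (min t 0) has_real_derivative kps (min t 0) u * J (min t 0) u) (at u)" unfolding mt kJ by (rule ku[OF t])
  show "((\<lambda>s. J (min s 0) u) has_real_derivative - (kp (min t 0) u)\<^sup>2 * J (min t 0) u) (at t within {..0})"
  proof -
   have "((\<lambda>s. J s u) has_real_derivative - (kp t u)\<^sup>2 * J t u) (at t within {..0})"
    unfolding J_def by (rule DERIV_cong[OF DERIV_chain2[OF DERIV_exp Rt[OF t]]]) simp
   thus ?thesis unfolding mt by (rule tr'[OF _ t])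
  qed
  show "inj (\<lambda>u. to_complex (\<gamma> (min t 0) u))"
   using emb t unfolding embedded_flow_def mt inj_def by (metis to_plane_to_complex)
  have cJ: "continuous_on UNIV (J t)" unfolding J_def
   by (intro continuous_intros) (metis Gu[OF t] has_vector_derivative_continuous continuous_at_imp_continuous_on)
  have nJ: "0 \<le> J t x" for x using J0[of t x] by simp
  have inf: "(NN u. ennreal (J t u) * indicator {0..} u) = \<infinity>" "(NN u. ennreal (J t u) * indicator {..0} u) = \<infinity>"
   using compl t unfolding complete_flow_def by (auto simp: Jgu[OF t])
  show "\<exists>v\<ge>u. l \<le> integral {u..v} (J (min t 0))" for l unfolding mt by (rule infinite_length[OF cJ nJ inf(1)])
  \<comment> \<open>The left end is the right end for the reflected parameter.\<close>
  show "\<exists>v\<le>u. l \<le> integral {v..u} (J (min t 0))" for l unfolding mt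
  proof -
   have [measurable]: "J t \<in> borel_measurable borel" by (rule borel_measurable_continuous_onI[OF cJ])
   have cJ': "continuous_on UNIV (\<lambda>u. J t (- u))" by (rule continuous_on_compose2[OF cJ]) (auto intro!: continuous_intros)
   have "(NN u. ennreal (J t (- u)) * indicator {0..} u) = \<infinity>"
    using inf(2) nn_integral_real_affine[of "\<lambda>u. ennreal (J t u) * indicator {..0} u" "-1" 0] by (simp add: indicator_def)
   then obtain v where v: "v \<ge> - u" "l \<le> integral {- u..v} (\<lambda>u. J t (- u))"
    using infinite_length[of "\<lambda>u. J t (- u)", OF cJ' nJ] by blast
   have "integral {- u..v} (\<lambda>u. J t (- u)) = integral {- v..u} (J t)" using Henstock_Kurzweil_Integration.integral_reflect_real[where a = "- v" and b = u and f = "J t"] by simp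
   thus "\<exists>v\<le>u. l \<le> integral {v..u} (J t)" using v by (intro exI[of _ "- v"]) auto
  qed
  show "(NE u. exp (- (norm (to_complex (\<gamma> (min t 0) u) - x))\<^sup>2 / (4 * l)) * J (min t 0) u) \<le> ennreal (E * sqrt (4 * pi * l))"
   if l: "l > 0" for x l
  proof -
   define S where "S = sqrt (4 * pi * l)"
   have S: "S > 0" using l by (simp add: S_def)
   define X where "X = (NE u. exp (- (norm (\<gamma> t u - to_plane x))\<^sup>2 / (4 * l)) * norm (gu \<gamma> t u))"
   have n: "norm (to_complex (\<gamma> t u) - x) = norm (\<gamma> t u - to_plane x)" for u
    using norm_to_complex[of "\<gamma> t u - to_plane x"] by (simp add: linear_diff[OF bounded_linear.linear[OF bounded_linear_to_complex]])
   have "gauss_area \<gamma> t (to_plane x) l \<le> entropy_slice \<gamma> t" unfolding entropy_slice_def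
    using l by (intro SUP_upper2[of "(to_plane x, l)"]) auto
   also have "\<dots> \<le> entropy \<gamma>" unfolding entropy_def using t by (intro SUP_upper) auto
   also note E(2)
   finally have "ennreal (1 / S) * X \<le> ennreal E" by (simp add: gauss_area_def X_def S_def)
   hence "ennreal S * (ennreal (1 / S) * X) \<le> ennreal S * ennreal E" by (intro mult_left_mono) auto
   also have "ennreal S * (ennreal (1 / S) * X) = X" using S by (simp add: mult.assoc[symmetric] ennreal_mult'[symmetric])
   also have "ennreal S * ennreal E = ennreal (E * S)" using S E(1) by (simp add: ennreal_mult mult.commute)
   finally show ?thesis unfolding mt n Jgu[OF t] X_def S_def .
  qed
 next
  show "continuous_on UNIV (\<lambda>p. to_complex (\<gamma> (min (fst p) 0) (snd p)))" using clamp[OF Dc[of "[]"]] by (simp add: D0)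
  show "continuous_on UNIV (\<lambda>p. J (min (fst p) 0) (snd p))" by (rule clamp) (unfold J_def, intro continuous_intros Gc)
  show "continuous_on UNIV (\<lambda>p. ag (min (fst p) 0) (snd p))" by (rule clamp) (unfold ag_def, intro continuous_intros Gc)
  show "continuous_on UNIV (\<lambda>p. kp (min (fst p) 0) (snd p))" by (rule clamp[OF ck(1)])
  show "continuous_on UNIV (\<lambda>p. kps (min (fst p) 0) (snd p))" by (rule clamp[OF ck(2)])
 qed (rule E(1))
 thus ?thesis by (rule that) (simp add: Jgu)
qed

section \<open>Radon measures on the plane and the tangent flow\<close>

lemma integral_line_measure:
 assumes "continuous_on UNIV (ph :: pt \<Rightarrow> real)"
 shows "integral\<^sup>L (line_measure m e) ph = m * (LBINT s. ph (s *\<^sub>R e))"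
proof -
 have [measurable]: "ph \<in> borel_measurable borel" by (rule borel_measurable_continuous_onI[OF assms])
 have "line_measure m e = density (distr lborel borel (\<lambda>s. s *\<^sub>R e)) (\<lambda>_. ennreal (real m))"
  unfolding line_measure_def
  by (rule measure_eqI) (auto simp: emeasure_density nn_integral_cmult_indicator ennreal_of_nat_eq_real_of_nat)
 thus ?thesis by (simp add: integral_density integral_distr)
qed

lemma radon_line_measure:
 assumes "norm e = 1"
 shows "radon_measure (line_measure m e)"
 unfolding radon_measure_def
proof (intro conjI allI impI)
 show "sets (line_measure m e) = sets borel" by (simp add: line_measure_def)
 fix K :: "pt set" assume K: "compact K"
 then obtain B where B: "\<And>x. x \<in> K \<Longrightarrow> norm x \<le> B" using compact_imp_bounded bounded_iff by metis
 have [measurable]: "K \<in> sets borel" using K by (simp add: compact_imp_closed)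
 have "emeasure (distr lborel borel (\<lambda>s. s *\<^sub>R e)) K = emeasure lborel ((\<lambda>s. s *\<^sub>R e) -` K)"
  by (subst emeasure_distr) auto
 also have "\<dots> \<le> emeasure lborel {-B..B}"
  using B assms by (intro emeasure_mono) (force simp: abs_le_iff)+
 also have "\<dots> < \<infinity>" by (simp add: emeasure_lborel_Icc_eq)
 finally show "emeasure (line_measure m e) K < \<infinity>"
  by (simp add: line_measure_def ennreal_mult_less_top of_nat_less_top)
qed

text \<open>Open boxes generate the Borel sets and form an intersection-stable family. The indicator
  of a box is the increasing limit of compactly supported functions built from the distance to its
  complement, so test integrals determine the measure of every box.\<close>

lemma radon_measure_eqI:
 assumes mu: "radon_measure mu" and \<nu>: "radon_measure \<nu>"
  and eq: "\<And>ph. continuous_on UNIV ph \<Longrightarrow> compact (closure {x. ph x \<noteq> 0}) \<Longrightarrow> integral\<^sup>L mu ph = integral\<^sup>L \<nu> (ph :: pt \<Rightarrow> real)"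
 shows "mu = \<nu>"
proof -
 have fin: "emeasure M (box a b) < \<infinity>" if "radon_measure M" for M and a b :: pt
 proof -
  have "emeasure M (box a b) \<le> emeasure M (cbox a b)"
   by (rule emeasure_mono[OF box_subset_cbox]) (use that in \<open>simp add: radon_measure_def\<close>)
  also have "\<dots> < \<infinity>" using that compact_cbox unfolding radon_measure_def by blast
  finally show ?thesis .
 qed
 have box: "emeasure mu (box a b) = emeasure \<nu> (box a b)" for a b :: pt
 proof -
  define ph where "ph = (\<lambda>(n::nat) x. min 1 (n * infdist x (- box a b)))"
  have ne: "- box a b \<noteq> {}" using bounded_box[of a b] not_bounded_UNIV by (metis Compl_empty_eq double_complement)
  have c: "continuous_on UNIV (ph n)" for n unfolding ph_def by (intro continuous_intros)
  have out: "ph n x = 0" if "x \<notin> box a b" for n x using that by (simp add: ph_def)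
  have nn: "0 \<le> ph n x" "ph n x \<le> indicator (box a b) x" for n x
   using out[of x n] by (auto simp: ph_def indicator_def infdist_nonneg)
  have sup: "compact (closure {x. ph n x \<noteq> 0})" for n
  proof -
   have "{x. ph n x \<noteq> 0} \<subseteq> box a b" using out by blast
   thus ?thesis using bounded_box bounded_subset by (metis compact_closure)
  qed
  have inc: "incseq (\<lambda>n x. ennreal (ph n x))" unfolding ph_def incseq_def le_fun_def
   by (auto intro!: ennreal_leI min.mono mult_right_mono infdist_nonneg)
  have val: "emeasure M (box a b) = (SUP n. ennreal (integral\<^sup>L M (ph n)))" if M: "radon_measure M" for M
  proof -
   have sM [measurable_cong]: "sets M = sets borel" using M by (simp add: radon_measure_def)
   have [measurable]: "ph n \<in> borel_measurable M" for n using borel_measurable_continuous_onI[OF c] by (simp add: measurable_cong_sets[OF sM refl])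
   have "ennreal (integral\<^sup>L M (ph n)) = (\<integral>\<^sup>+ x. ennreal (ph n x) \<partial>M)" for n
   proof -
    have "(\<integral>\<^sup>+ x. ennreal (ph n x) \<partial>M) \<le> (\<integral>\<^sup>+ x. indicator (box a b) x \<partial>M)"
    proof (rule nn_integral_mono)
     show "ennreal (ph n x) \<le> indicator (box a b) x" for x
      using nn(2)[of n x] out[of x n] by (cases "x \<in> box a b") (auto simp: ennreal_le_1)
    qed
    also have "\<dots> = emeasure M (box a b)" by (intro nn_integral_indicator) (simp add: sM)
    finally have "(\<integral>\<^sup>+ x. ennreal (ph n x) \<partial>M) < \<top>" using fin[OF M, of a b] by simp
    thus ?thesis using nn(1) by (subst integral_eq_nn_integral) auto
   qed
   hence "(SUP n. ennreal (integral\<^sup>L M (ph n))) = (\<integral>\<^sup>+ x. (SUP n. ennreal (ph n x)) \<partial>M)"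
    by (subst nn_integral_monotone_convergence_SUP[OF inc]) auto
   also have "\<dots> = (\<integral>\<^sup>+ x. indicator (box a b) x \<partial>M)"
   proof (rule nn_integral_cong)
    fix x
    show "(SUP n. ennreal (ph n x)) = indicator (box a b) x"
    proof (cases "x \<in> box a b")
     case True
     have "infdist x (- box a b) > 0" using True ne by (intro infdist_pos_not_in_closed) auto
     then obtain n :: nat where "1 \<le> n * infdist x (- box a b)" using reals_Archimedean3 by (metis less_imp_le)
     hence "ennreal (ph n x) = 1" by (simp add: ph_def)
     hence "1 \<le> (SUP n. ennreal (ph n x))" by (metis SUP_upper UNIV_I)
     moreover have "(SUP n. ennreal (ph n x)) \<le> 1" by (rule SUP_least) (simp add: ph_def ennreal_le_1)
     ultimately show ?thesis using True by simp
    next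
     case False
     thus ?thesis by (simp add: out)
    qed
   qed
   also have "\<dots> = emeasure M (box a b)" by (intro nn_integral_indicator) (simp add: sM)
   finally show ?thesis ..
  qed
  show ?thesis unfolding val[OF mu] val[OF \<nu>] eq[OF c sup] ..
 qed
 show ?thesis
 proof (rule measure_eqI_generator_eq[where \<Omega> = UNIV and E = "range (\<lambda>(a, b). box a b :: pt set)" and A = "\<lambda>n::nat. box (- (real n *\<^sub>R One)) (real n *\<^sub>R One)"])
  show "Int_stable (range (\<lambda>(a, b). box a b :: pt set))" by (auto simp: Int_stable_def box_Int_box)
  show "sets mu = sigma_sets UNIV (range (\<lambda>(a, b). box a b))" "sets \<nu> = sigma_sets UNIV (range (\<lambda>(a, b). box a b))"
   using mu \<nu> by (simp_all add: radon_measure_def borel_eq_box)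
  show "(\<Union>n. box (- (real n *\<^sub>R One)) (real n *\<^sub>R One)) = (UNIV :: pt set)" by (rule UN_box_eq_UNIV)
  show "emeasure mu (box (- (real n *\<^sub>R One)) (real n *\<^sub>R One)) \<noteq> \<infinity>" for n
   using fin[OF mu] by (metis less_irrefl)
 qed (use box in auto)
qed

text \<open>A single statement, \<open>conv\<close>, convergence to one line measure for every
  sequence of scales, gives existence, uniqueness and shape of the limit; since test integrals
  determine Radon measures, a tangent flow cannot differ from it.\<close>

theorem theorem4p1:
  fixes \<gamma> :: "real \<Rightarrow> real \<Rightarrow> real ^ 2"
  assumes "ancient_csf \<gamma>"
    and "embedded_flow \<gamma>"
    and "complete_flow \<gamma>"
    and "noncompact_flow \<gamma>"
    and "entropy \<gamma> < \<infinity>"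
  shows "(\<exists>\<nu>. tangent_flow_at_infinity \<gamma> \<nu>) \<and>
         (\<forall>\<nu> \<nu>'. tangent_flow_at_infinity \<gamma> \<nu> \<longrightarrow> tangent_flow_at_infinity \<gamma> \<nu>' \<longrightarrow>
             (\<forall>t<0. \<nu> t = \<nu>' t)) \<and>
         (\<not> static_line \<gamma> \<longrightarrow>
            (\<exists>e m. norm e = 1 \<and> m \<ge> 2 \<and> entropy \<gamma> = of_nat m \<and>
               (\<forall>\<nu>. tangent_flow_at_infinity \<gamma> \<nu> \<longrightarrow> (\<forall>t<0. \<nu> t = line_measure m e))))"
proof -
 obtain J ag kp kps E where "csf (\<lambda>t u. to_complex (\<gamma> (min t 0) u)) J ag kp kps E" and J: "\<And>t u. t \<le> 0 \<Longrightarrow> J t u = norm (gu \<gamma> t u)"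
  by (rule csf_of_flow[OF assms(1-3,5)]) blast
 then interpret c: csf "\<lambda>t u. to_complex (\<gamma> (min t 0) u)" J ag kp kps E by blast
 obtain m :: nat and al where m: "m \<ge> 1" and lim: "((\<lambda>t. c.mass t) \<longlongrightarrow> m) at_bot"
  "((\<lambda>t. c.cmass t) \<longlongrightarrow> m * cos (2 * al)) at_bot"
  "((\<lambda>t. c.smass t) \<longlongrightarrow> m * sin (2 * al)) at_bot"
  by (rule c.multiplicity) blast
 define e where "e = to_plane (cis al)"
 have e: "norm e = 1" by (simp add: e_def)
 have lin: "linear to_plane" "linear to_complex" using bounded_linear_to_plane bounded_linear_to_complex by (simp_all add: bounded_linear.linear)
 have guD: "(\<gamma> t has_vector_derivative gu \<gamma> t u) (at u)" if "t \<le> 0" for t u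
 proof -
  have "((\<lambda>u. to_plane (to_complex (\<gamma> (min t 0) u))) has_vector_derivative to_plane (J t u *\<^sub>R cis (ag t u))) (at u)"
   by (rule bounded_linear.has_vector_derivative[OF bounded_linear_to_plane c.z_u[OF that]])
  moreover have "min t 0 = t" using that by simp
  ultimately show ?thesis unfolding gu_def by (simp add: vector_derivative_at[of "\<gamma> t"])
 qed
 have conv: "radon_converges (\<lambda>i. rescaled_measure \<gamma> (ls i) t) (line_measure m e)"
  if ls: "\<And>i. ls i > 0" "ls \<longlonglongrightarrow> 0" and t: "t < 0" for ls t
  unfolding radon_converges_def
 proof (intro allI impI)
  fix ph :: "pt \<Rightarrow> real" assume ph: "continuous_on UNIV ph" and "compact (closure {x. ph x \<noteq> 0})"
  then obtain B where B: "\<And>x. ph x \<noteq> 0 \<Longrightarrow> norm x \<le> B"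
   using compact_imp_bounded closure_subset by (metis (mono_tags, lifting) bounded_iff mem_Collect_eq subsetD)
  have [measurable]: "ph \<in> borel_measurable borel" by (rule borel_measurable_continuous_onI[OF ph])
  \<comment> \<open>\<open>Ntest\<close> normalizes the time to -1, while a tangent flow is tested
    at every negative \<open>t\<close>. The parabolic factor sqrt(-t) relates the two, and the line
    measure is invariant under the corresponding dilation.\<close>
  define b where "b = sqrt (- t)"
  have b: "b > 0" using t by (simp add: b_def)
  define ps where "ps = (\<lambda>w. b * ph (b *\<^sub>R to_plane w))"
  have "continuous_on UNIV ps" unfolding ps_def
   by (intro continuous_intros continuous_on_compose2[OF ph] bounded_linear.continuous_on[OF bounded_linear_to_plane]) auto
  moreover have "ps w = 0" if "norm w \<ge> (\<bar>B\<bar> + 1) / b" for w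
  proof -
   have "\<bar>B\<bar> + 1 \<le> norm (b *\<^sub>R to_plane w)" using that b by (simp add: pos_divide_le_eq mult.commute)
   thus ?thesis using B[of "b *\<^sub>R to_plane w"] by (force simp: ps_def)
  qed
  ultimately have L: "(c.Ntest ps \<longlongrightarrow> m * (LBINT r. ps (of_real r * cis al))) at_bot"
   using b by (intro c.test_limit[where R = "(\<bar>B\<bar> + 1) / b", OF _ _ _ m lim]) (auto intro: divide_pos_pos)
  have "(LBINT r. ps (of_real r * cis al)) = (LBINT s. ph (s *\<^sub>R e))"
   using lborel_integral_real_affine[of b "\<lambda>s. ph (s *\<^sub>R e)" 0] b
   by (simp add: ps_def e_def scaleR_conv_of_real[symmetric] linear_scale[OF lin(1)])
  hence lim': "m * (LBINT r. ps (of_real r * cis al)) = integral\<^sup>L (line_measure m e) ph" by (simp add: integral_line_measure[OF ph])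
  have int: "integral\<^sup>L (rescaled_measure \<gamma> l t) ph = c.Ntest ps (t / l\<^sup>2)" if l: "l > 0" for l
  proof -
   define ta where "ta = t / l\<^sup>2"
   have ta: "ta < 0" "ta \<le> 0" "min ta 0 = ta" using t l by (auto simp: ta_def divide_neg_pos less_imp_le)
   have vd: "vector_derivative (\<lambda>u. l *\<^sub>R \<gamma> ta u) (at u) = l *\<^sub>R gu \<gamma> ta u" for u
    by (rule vector_derivative_at) (rule bounded_linear.has_vector_derivative[OF bounded_linear_scaleR_right guD[OF ta(2)]])
   have nm: "norm (l *\<^sub>R gu \<gamma> ta u) = l * J ta u" for u using l J[OF ta(2)] by simp
   have "continuous_on UNIV (\<gamma> ta)" using guD[OF ta(2)] has_vector_derivative_continuous continuous_at_imp_continuous_on by blast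
   hence [measurable]: "\<gamma> ta \<in> borel_measurable borel" by (rule borel_measurable_continuous_onI)
   have "integral\<^sup>L (rescaled_measure \<gamma> l t) ph = (LBINT u. (l * J ta u) *\<^sub>R ph (l *\<^sub>R \<gamma> ta u))"
    unfolding rescaled_measure_def curve_measure_def ta_def[symmetric] vd nm
    using l c.J_pos[OF ta(2)] by (subst integral_distr, simp, simp, subst integral_density) (auto simp: less_imp_le)
   also have "\<dots> = c.Ntest ps ta" unfolding c.Ntest_def ta(3)
   proof (intro Bochner_Integration.integral_cong refl)
    fix u
    define a where "a = 1 / sqrt (- ta)"
    have "sqrt (- ta) = b / l" 
    proof -
     have "- ta = (- t) / l\<^sup>2" by (simp add: ta_def)
     thus ?thesis unfolding b_def by (simp only: real_sqrt_divide) (use l in simp)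
    qed
    hence a: "b * a = l" using b by (simp add: a_def)
    have "b *\<^sub>R to_plane (of_real a * to_complex (\<gamma> ta u)) = l *\<^sub>R \<gamma> ta u"
     using a by (simp add: scaleR_conv_of_real[symmetric] linear_scale[OF lin(1)])
    thus "(l * J ta u) *\<^sub>R ph (l *\<^sub>R \<gamma> ta u) = ps (of_real (1 / sqrt (- ta)) * to_complex (\<gamma> ta u)) * (1 / sqrt (- ta)) * J ta u"
     unfolding a_def[symmetric] ps_def a[symmetric] by (simp add: mult_ac)
   qed
   finally show ?thesis by (simp add: ta_def)
  qed
  have "filterlim (\<lambda>i. t / (ls i)\<^sup>2) at_bot sequentially"
  proof -
   have "(\<lambda>i. (ls i)\<^sup>2) \<longlonglongrightarrow> 0" using tendsto_power[OF ls(2), of 2] by simp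
   hence "filterlim (\<lambda>i. inverse ((ls i)\<^sup>2)) at_top sequentially" by (rule filterlim_inverse_at_top) (use ls(1) in \<open>simp add: less_imp_neq[symmetric]\<close>)
   from filterlim_tendsto_neg_mult_at_bot[OF tendsto_const t this] show ?thesis by (simp add: divide_inverse)
  qed
  from filterlim_compose[OF L this] show "(\<lambda>i. integral\<^sup>L (rescaled_measure \<gamma> (ls i) t) ph) \<longlonglongrightarrow> integral\<^sup>L (line_measure m e) ph"
   unfolding int[OF ls(1)] lim' .
 qed
 have uniq: "\<nu> t = line_measure m e" if tf: "tangent_flow_at_infinity \<gamma> \<nu>" and t: "t < 0" for \<nu> t
 proof -
  obtain ls where ls: "\<And>i. ls i > 0" "ls \<longlonglongrightarrow> 0" "radon_converges (\<lambda>i. rescaled_measure \<gamma> (ls i) t) (\<nu> t)" "radon_measure (\<nu> t)"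
   using tf t unfolding tangent_flow_at_infinity_def by blast
  show ?thesis
   by (rule radon_measure_eqI[OF ls(4) radon_line_measure[OF e]])
    (use ls(3) conv[OF ls(1,2) t] in \<open>auto simp: radon_converges_def intro: LIMSEQ_unique\<close>)
 qed
 \<comment> \<open>All sequences of scales converge, so any explicit one will do.\<close>
 have ex: "tangent_flow_at_infinity \<gamma> (\<lambda>_. line_measure m e)"
  unfolding tangent_flow_at_infinity_def
 proof (intro conjI allI impI exI[of _ "\<lambda>i. inverse (real (Suc i))"])
  show "(\<lambda>i. inverse (real (Suc i))) \<longlonglongrightarrow> 0" by (rule LIMSEQ_inverse_real_of_nat)
  show "radon_converges (\<lambda>i. rescaled_measure \<gamma> (inverse (real (Suc i))) t) (line_measure m e)" if "t < 0" for t
   by (rule conv[OF _ LIMSEQ_inverse_real_of_nat that]) simp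
 qed (auto intro: radon_line_measure[OF e])
 \<comment> \<open>The scale \<open>l\<close> at time \<open>t\<close> corresponds to the kernel
   with singular time \<open>t + l\<close>.\<close>
 have area: "gauss_area \<gamma> t x l = (c.gmass (to_complex x) (t + l) t)" if "t \<le> 0" "l > 0" for t x l
 proof -
  have mt: "min t 0 = t" using that by simp
  have n: "norm (\<gamma> t u - x) = norm (to_complex (\<gamma> t u) - to_complex x)" for u
   by (simp flip: linear_diff[OF lin(2)])
  have "(\<lambda>u. to_complex (\<gamma> (min t 0) u)) \<in> borel_measurable borel" by (rule c.meas2(1)) simp_all
  hence z: "(\<lambda>u. to_complex (\<gamma> t u)) \<in> borel_measurable borel" unfolding mt .
  have "J t \<in> borel_measurable borel" by (rule c.meas2(2)) simp_all
  with z have mes: "(\<lambda>u. ennreal (exp (- (norm (to_complex (\<gamma> t u) - to_complex x))\<^sup>2 / (4 * l)) * J t u)) \<in> borel_measurable lborel" by simp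
  have "gauss_area \<gamma> t x l = (NN u. ennreal (1 / sqrt (4 * pi * l)) * ennreal (exp (- (norm (to_complex (\<gamma> t u) - to_complex x))\<^sup>2 / (4 * l)) * J t u))"
   unfolding gauss_area_def n J[OF that(1), symmetric] by (rule nn_integral_cmult[OF mes, symmetric])
  also have "\<dots> = (c.gmass (to_complex x) (t + l) t)"
   unfolding c.rho_def mt using that(2) by (intro nn_integral_cong) (simp flip: ennreal_mult')
  finally show ?thesis .
 qed
 \<comment> \<open>The upper bound is \<open>gauss_le_limit\<close> at all centres and scales; for
   the lower one the densities centred at the origin with scale -t already tend to
   \<open>m\<close>.\<close>
 have ent: "entropy \<gamma> = of_nat m"
 proof (rule antisym)
  show "entropy \<gamma> \<le> of_nat m" unfolding entropy_def entropy_slice_def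
   by (intro SUP_least) (auto simp: area ennreal_of_nat_eq_real_of_nat intro!: c.gauss_le_limit[OF lim(1)])
  have "((\<lambda>t. ennreal (c.mass t)) \<longlongrightarrow> ennreal m) at_bot" by (intro tendsto_ennrealI lim)
  moreover have "\<forall>\<^sub>F t in at_bot. ennreal (c.mass t) \<le> entropy \<gamma>"
  proof (rule eventually_mono[OF eventually_le_at_bot[of "-1"]])
   fix t :: real assume t: "t \<le> -1"
   have "ennreal (c.mass t) = (c.gmass 0 0 t)"
    using t c.gaussian_limit(2)[OF t] c.rho_nonneg[of t 0 0] c.J_pos[of t] by (intro nn_integral_eq_integral[symmetric]) (auto simp: less_imp_le)
   also have "\<dots> = gauss_area \<gamma> t 0 (- t)" using t area[of t "- t" 0] linear_0[OF lin(2)] by simp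
   also have "\<dots> \<le> entropy_slice \<gamma> t" unfolding entropy_slice_def using t by (intro SUP_upper2[of "(0, - t)"]) auto
   also have "\<dots> \<le> entropy \<gamma>" unfolding entropy_def using t by (intro SUP_upper) auto
   finally show "ennreal (c.mass t) \<le> entropy \<gamma>" .
  qed
  ultimately have "ennreal m \<le> entropy \<gamma>"
   by - (rule tendsto_upperbound[where f = "\<lambda>t. ennreal (c.mass t)"], assumption+, rule trivial_limit_at_bot_linorder)
  thus "of_nat m \<le> entropy \<gamma>" by (simp add: ennreal_of_nat_eq_real_of_nat)
 qed
 have m2: "m \<ge> 2" if ns: "\<not> static_line \<gamma>"
 proof (rule ccontr)
  assume "\<not> m \<ge> 2"
  hence "real m = 1" using m by simp
  from c.static_line_of_unit_density[OF lim(1)[unfolded this]] obtain p d where d: "d \<noteq> 0"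
   "\<And>t. t \<le> 0 \<Longrightarrow> range (\<lambda>u. to_complex (\<gamma> (min t 0) u)) = {p + s *\<^sub>R d |s. True}" by blast
  have "range (\<gamma> t) = {to_plane p + s *\<^sub>R to_plane d |s. True}" if t: "t \<le> 0" for t
  proof -
   have "min t 0 = t" using t by simp
   hence "range (\<gamma> t) = to_plane ` range (\<lambda>u. to_complex (\<gamma> (min t 0) u))" by (simp add: image_image)
   also have "\<dots> = {to_plane (p + s *\<^sub>R d) |s. True}" unfolding d(2)[OF t] by auto
   finally show ?thesis by (simp add: linear_add[OF lin(1)] linear_scale[OF lin(1)])
  qed
  moreover have "to_plane d \<noteq> 0" using d(1) norm_to_plane[of d] by (metis norm_eq_zero)
  ultimately show False using ns unfolding static_line_def by blast
 qed
 show ?thesis using ex uniq e ent m2 by (metis (no_types, lifting))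
qed

end
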